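(* Let $\Omega\subset \mathrm{P}(V)$ be a properly convex open set and $\Gamma\subset\mathrm{Aut}(\Omega)$ a discrete subgroup which is strongly irreducible. Set $M=\Omega/\Gamma$, and suppose that the biproximal unit tangent bundle $T^1M_{bip}$ is non-empty. Then (1) the geodesic flow $(\phi_t)_{t\in\mathbb{R}}$ on $T^1M_{bip}$ is topologically mixing; (2) if $(\phi_t)_t$ is topologically transitive on a flow-invariant closed subset $A\subset T^1M$ which contains $T^1M_{bip}$, then $A=T^1M_{bip}$.
   Context: $V=\mathbb{R}^{d+1}$ and $\mathrm{P}(V)$ is its projective space. An open set $\Omega\subset\mathrm{P}(V)$ is properly convex if it is convex and bounded in some affine chart. $\mathrm{Aut}(\Omega)\subset\mathrm{PGL}(V)$ is the group of elements preserving $\Omega$. A subgroup $\Gamma\subset\mathrm{PGL}(V)$ is strongly irreducible if it preserves no finite union of proper projective subspaces. Hilbert metric: for $x,y\in\Omega$, $d_\Omega(x,y)=\frac12\log[a,x,y,b]$, where $a,x,y,b$ are aligned in this order, $a,b\in\partial\Omega$, and the cross-ratio is normalised by $[0,1,t,\infty]=t$. It is a proper $\mathrm{Aut}(\Omega)$-invariant metric, induced by a Finsler metric whose unit tangent bundle is $T^1\Omega$, with projection $\pi:T^1\Omega\to\Omega$. Geodesic flow: for $v\in T^1\Omega$, let $c:\mathbb{R}\to\Omega$ be the isometric parametrisation (for $d_\Omega$) of the intersection with $\Omega$ of the projective line generated by $v$, with $c'(0)=v$; then $\phi_t v=c'(t)$. Put $\phi_{\pm\infty}v=\lim_{t\to\pm\infty}\pi\phi_tv\in\partial\Omega$.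 A discrete subgroup $\Gamma\subset\mathrm{Aut}(\Omega)$ acts properly discontinuously on $\Omega$; $\Gamma$ is not assumed torsion-free, $M=\Omega/\Gamma$, $T^1M:=T^1\Omega/\Gamma$, and the geodesic flow descends to $T^1M$. An element of $\mathrm{PGL}(V)$ is proximal if a lift to $\mathrm{GL}(V)$ has exactly one complex eigenvalue of maximal modulus and this eigenvalue has multiplicity one; the corresponding eigenline is its attracting fixed point in $\mathrm{P}(V)$. The proximal limit set $\Lambda_\Gamma\subset\mathrm{P}(V)$ is the closure of the set of attracting fixed points of proximal elements of $\Gamma$. The biproximal unit tangent bundle is $T^1M_{bip}:=\{v\in T^1\Omega:\phi_{\infty}v\in\Lambda_\Gamma\text{ and }\phi_{-\infty}v\in\Lambda_\Gamma\}/\Gamma\subset T^1M$; it is closed and flow-invariant. A continuous flow $(f_t)_{t\in\mathbb{R}}$ on a topological space $X$ is topologically transitive if for all non-empty open $U,U'\subset X$ there exists $t>0$ with $f_t(U)\cap U'\neq\emptyset$; it is topologically mixing if for all non-empty open $U,U'\subset X$ one has $f_t(U)\cap U'\neq\emptyset$ for all large enough $t>0$. Invariant subsets carry the subspace topology. *)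

theory Defs
  imports
    "HOL-Analysis.Analysis"
    "HOL-Algebra.Coset"
    "HOL-Computational_Algebra.Polynomial"
begin

text \<open>
  Throughout, \<open>V = \<real>\<^sup>d\<^sup>+\<^sup>1\<close> is \<^typ>\<open>real^'n\<close> with \<open>CARD('n) = d + 1\<close>.
\<close>

definition proj_rel :: "real^'n \<Rightarrow> real^'n \<Rightarrow> bool" where
  "proj_rel x y \<longleftrightarrow> x \<noteq> 0 \<and> y \<noteq> 0 \<and> (\<exists>c. c \<noteq> 0 \<and> y = c *\<^sub>R x)"

lemma proj_rel_refl: "x \<noteq> 0 \<Longrightarrow> proj_rel x x"
  unfolding proj_rel_def by (auto intro: exI[of _ 1])

lemma part_equivp_proj_rel: "part_equivp (proj_rel :: real^'n \<Rightarrow> _)"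
proof (rule part_equivpI)
  show "\<exists>x::real^'n. proj_rel x x"
    using proj_rel_refl[of "axis undefined 1"] by (auto simp: axis_eq_0_iff)
  show "symp (proj_rel :: real^'n \<Rightarrow> _)"
  proof (rule sympI)
    fix x y :: "real^'n" assume "proj_rel x y"
    then obtain c where "x \<noteq> 0" "y \<noteq> 0" "c \<noteq> 0" "y = c *\<^sub>R x" by (auto simp: proj_rel_def)
    then show "proj_rel y x" by (auto simp: proj_rel_def intro!: exI[of _ "inverse c"])
  qed
  show "transp (proj_rel :: real^'n \<Rightarrow> _)"
  proof (rule transpI)
    fix x y z :: "real^'n" assume "proj_rel x y" "proj_rel y z"
    then obtain c d where "x \<noteq> 0" "z \<noteq> 0" "c \<noteq> 0" "y = c *\<^sub>R x" "d \<noteq> 0" "z = d *\<^sub>R y"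
      by (auto simp: proj_rel_def)
    then show "proj_rel x z" by (auto simp: proj_rel_def intro!: exI[of _ "d * c"])
  qed
qed

text \<open>\<open>proj_pt x\<close> is the point \<open>[x]\<close>; it is meaningful only for \<open>x \<noteq> 0\<close>.\<close>

quotient_type 'n proj = "real^'n" / partial: proj_rel
  morphisms rep_proj proj_pt
  by (rule part_equivp_proj_rel)

lemma proj_pt_eq_iff:
  "x \<noteq> 0 \<Longrightarrow> y \<noteq> 0 \<Longrightarrow> proj_pt x = proj_pt y \<longleftrightarrow> (\<exists>c. c \<noteq> 0 \<and> y = c *\<^sub>R x)"
  using Quotient3_rel[OF Quotient3_proj, of x y] proj_rel_refl by (auto simp: proj_rel_def)

lemma proj_cases: obtains x where "x \<noteq> 0" "p = proj_pt x"
  using Quotient3_abs_rep[OF Quotient3_proj, of p] Quotient3_rep_reflp[OF Quotient3_proj, of p]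
  by (metis proj_rel_def)

instantiation proj :: (finite) topological_space
begin

definition open_proj_def: "open U \<longleftrightarrow> open {x. x \<noteq> 0 \<and> proj_pt x \<in> U}"

instance
proof
  have "{x. x \<noteq> 0 \<and> proj_pt x \<in> UNIV} = - {0 :: real^'a}" by auto
  then show "open (UNIV :: 'a proj set)" by (simp add: open_proj_def open_Compl)
next
  fix S T :: "'a proj set" assume "open S" "open T"
  moreover have "{x. x \<noteq> 0 \<and> proj_pt x \<in> S \<inter> T}
      = {x. x \<noteq> 0 \<and> proj_pt x \<in> S} \<inter> {x. x \<noteq> 0 \<and> proj_pt x \<in> T}" by auto
  ultimately show "open (S \<inter> T)" by (simp add: open_proj_def open_Int)
next
  fix K :: "'a proj set set" assume "\<forall>S\<in>K. open S"
  moreover have "{x. x \<noteq> 0 \<and> proj_pt x \<in> \<Union>K} = (\<Union>S\<in>K. {x. x \<noteq> 0 \<and> proj_pt x \<in> S})" by auto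
  ultimately show "open (\<Union>K)" by (auto simp: open_proj_def)
qed

end

instance proj :: (finite) t2_space
proof
  fix p q :: "'a proj" assume "p \<noteq> q"
  obtain x where x: "x \<noteq> 0" "p = proj_pt x" by (rule proj_cases)
  obtain y where y: "y \<noteq> 0" "q = proj_pt y" by (rule proj_cases)
  define f where "f z = (z \<bullet> x)\<^sup>2 / (z \<bullet> z)" for z
  have f_scale: "f (c *\<^sub>R z) = f z" if "c \<noteq> 0" for c z
  proof -
    have "f (c *\<^sub>R z) = (c\<^sup>2 * (z \<bullet> x)\<^sup>2) / (c\<^sup>2 * (z \<bullet> z))"
      by (simp add: f_def power_mult_distrib power2_eq_square)
    then show ?thesis using that by (simp add: f_def)
  qed
  have f_proj: "f z = f w" if "z \<noteq> 0" "w \<noteq> 0" "proj_pt z = proj_pt w" for z w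
    using that proj_pt_eq_iff[OF that(1,2)] f_scale by metis
  have cont: "continuous_on (- {0}) f"
    unfolding f_def by (intro continuous_intros) auto
  have fx: "f x = x \<bullet> x" using x by (simp add: f_def power2_eq_square)
  have "f y < f x"
  proof (rule ccontr)
    assume "\<not> f y < f x"
    then have "x \<bullet> x \<le> (y \<bullet> x)\<^sup>2 / (y \<bullet> y)" unfolding fx f_def[of y] by simp
    then have "(x \<bullet> x) * (y \<bullet> y) \<le> (y \<bullet> x)\<^sup>2"
      using y by (simp add: pos_le_divide_eq)
    then have "(norm y * norm x)\<^sup>2 \<le> (y \<bullet> x)\<^sup>2"
      by (simp add: power_mult_distrib power2_norm_eq_inner mult.commute)
    then have "\<bar>norm y * norm x\<bar> \<le> \<bar>y \<bullet> x\<bar>"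
      by (simp only: abs_le_square_iff)
    then have "\<bar>y \<bullet> x\<bar> = norm y * norm x"
      using Cauchy_Schwarz_ineq2[of y x] by simp
    then have "norm y *\<^sub>R x = norm x *\<^sub>R y \<or> norm y *\<^sub>R x = - norm x *\<^sub>R y"
      by (rule norm_cauchy_schwarz_abs_eq[THEN iffD1])
    then obtain c where c: "y = c *\<^sub>R x"
    proof
      assume a: "norm y *\<^sub>R x = norm x *\<^sub>R y"
      have "y = inverse (norm x) *\<^sub>R (norm x *\<^sub>R y)" using x by simp
      also have "\<dots> = (inverse (norm x) * norm y) *\<^sub>R x" by (simp flip: a)
      finally show ?thesis by (rule that)
    next
      assume a: "norm y *\<^sub>R x = - norm x *\<^sub>R y"
      have "y = - inverse (norm x) *\<^sub>R (- norm x *\<^sub>R y)" using x by simp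
      also have "\<dots> = (- inverse (norm x) * norm y) *\<^sub>R x" by (simp only: a[symmetric] scaleR_scaleR)
      finally show ?thesis by (rule that)
    qed
    moreover have "c \<noteq> 0" using c y by auto
    ultimately have "p = q" using x y proj_pt_eq_iff by blast
    with \<open>p \<noteq> q\<close> show False by simp
  qed
  then obtain m where m: "f y < m" "m < f x" using dense by blast
  define U where "U = proj_pt ` {z. z \<noteq> 0 \<and> f z > m}"
  define W where "W = proj_pt ` {z. z \<noteq> 0 \<and> f z < m}"
  have pre: "{z. z \<noteq> 0 \<and> proj_pt z \<in> proj_pt ` {z. z \<noteq> 0 \<and> P (f z)}} = {z. z \<noteq> 0 \<and> P (f z)}" for P
  proof (intro equalityI subsetI CollectI conjI)
    fix z assume "z \<in> {z. z \<noteq> 0 \<and> proj_pt z \<in> proj_pt ` {z. z \<noteq> 0 \<and> P (f z)}}"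
    then obtain w where "z \<noteq> 0" "w \<noteq> 0" "P (f w)" "proj_pt z = proj_pt w" by auto
    then show "z \<noteq> 0" "P (f z)" using f_proj[of z w] by simp_all
  qed auto
  have op: "open {z. z \<noteq> 0 \<and> f z \<in> S}" if "open S" for S
  proof -
    have "open (- {0} \<inter> f -` S)"
      using cont that by (simp add: continuous_on_open_vimage open_Compl Int_commute)
    then show ?thesis by (simp add: Int_def vimage_def)
  qed
  have "open U" unfolding U_def open_proj_def
    using pre[of "\<lambda>t. m < t"] op[of "{m<..}"] by simp
  moreover have "open W" unfolding W_def open_proj_def
    using pre[of "\<lambda>t. t < m"] op[of "{..<m}"] by simp
  moreover have "p \<in> U" "q \<in> W" using x y m by (auto simp: U_def W_def)
  moreover have "U \<inter> W = {}"
  proof -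
    have False if "z \<noteq> 0" "w \<noteq> 0" "f z > m" "f w < m" "proj_pt z = proj_pt w" for z w
      using that f_proj[of z w] by simp
    then show ?thesis unfolding U_def W_def by blast
  qed
  ultimately show "\<exists>U V. open U \<and> open V \<and> p \<in> U \<and> q \<in> V \<and> U \<inter> V = {}" by blast
qed

definition proj_subspace :: "(real^'n) set \<Rightarrow> 'n proj set" where
  "proj_subspace S = proj_pt ` (S - {0})"

definition pgl_rel :: "real^'n^'n \<Rightarrow> real^'n^'n \<Rightarrow> bool" where
  "pgl_rel A B \<longleftrightarrow> invertible A \<and> invertible B \<and> (\<exists>c. c \<noteq> 0 \<and> B = c *\<^sub>R A)"

lemma pgl_rel_refl: "invertible A \<Longrightarrow> pgl_rel A A"
  unfolding pgl_rel_def by (auto intro: exI[of _ 1])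

lemma invertible_mat_1: "invertible (mat 1 :: real^'n^'n)"
  by (auto simp: invertible_def)

lemma part_equivp_pgl_rel: "part_equivp (pgl_rel :: real^'n^'n \<Rightarrow> _)"
proof (rule part_equivpI)
  show "\<exists>A::real^'n^'n. pgl_rel A A"
    using pgl_rel_refl[OF invertible_mat_1] by blast
  show "symp (pgl_rel :: real^'n^'n \<Rightarrow> _)"
  proof (rule sympI)
    fix A B :: "real^'n^'n" assume "pgl_rel A B"
    then obtain c where "invertible A" "invertible B" "c \<noteq> 0" "B = c *\<^sub>R A"
      by (auto simp: pgl_rel_def)
    then show "pgl_rel B A" by (auto simp: pgl_rel_def intro!: exI[of _ "inverse c"])
  qed
  show "transp (pgl_rel :: real^'n^'n \<Rightarrow> _)"
  proof (rule transpI)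
    fix A B C :: "real^'n^'n" assume "pgl_rel A B" "pgl_rel B C"
    then obtain c d where "invertible A" "invertible C" "c \<noteq> 0" "B = c *\<^sub>R A" "d \<noteq> 0" "C = d *\<^sub>R B"
      by (auto simp: pgl_rel_def)
    then show "pgl_rel A C" by (auto simp: pgl_rel_def intro!: exI[of _ "d * c"])
  qed
qed

text \<open>\<open>pgl A\<close> is the class of \<open>A\<close>; it is meaningful only for invertible \<open>A\<close>.\<close>

quotient_type 'n pgl = "real^'n^'n" / partial: pgl_rel
  morphisms rep_pgl pgl
  by (rule part_equivp_pgl_rel)

lemma pgl_cases: obtains A where "invertible A" "g = pgl A"
  using Quotient3_abs_rep[OF Quotient3_pgl, of g] Quotient3_rep_reflp[OF Quotient3_pgl, of g]
  by (metis pgl_rel_def)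

lemma open_invertible: "open {A :: real^'n^'n. invertible A}"
proof -
  have "continuous_on UNIV (det :: real^'n^'n \<Rightarrow> real)"
    unfolding det_def by (intro continuous_intros)
  then have "open (det -` (- {0}) :: (real^'n^'n) set)"
    by (rule open_vimage[rotated]) auto
  then show ?thesis by (simp add: vimage_def invertible_det_nz)
qed

instantiation pgl :: (finite) topological_space
begin

definition open_pgl_def: "open U \<longleftrightarrow> open {A. invertible A \<and> pgl A \<in> U}"

instance
proof
  show "open (UNIV :: 'a pgl set)" by (simp add: open_pgl_def open_invertible)
next
  fix S T :: "'a pgl set" assume "open S" "open T"
  moreover have "{A. invertible A \<and> pgl A \<in> S \<inter> T}
      = {A. invertible A \<and> pgl A \<in> S} \<inter> {A. invertible A \<and> pgl A \<in> T}" by auto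
  ultimately show "open (S \<inter> T)" by (simp add: open_pgl_def open_Int)
next
  fix K :: "'a pgl set set" assume "\<forall>S\<in>K. open S"
  moreover have "{A. invertible A \<and> pgl A \<in> \<Union>K} = (\<Union>S\<in>K. {A. invertible A \<and> pgl A \<in> S})"
    by auto
  ultimately show "open (\<Union>K)" by (auto simp: open_pgl_def)
qed

end

lift_definition pgl_mult :: "('n::finite) pgl \<Rightarrow> 'n pgl \<Rightarrow> 'n pgl" is "(**)"
proof -
  fix A A' B B' :: "real^'n^'n" assume "pgl_rel A A'" "pgl_rel B B'"
  then obtain c d where inv: "invertible A" "invertible A'" "invertible B" "invertible B'"
    and "c \<noteq> 0" "A' = c *\<^sub>R A" "d \<noteq> 0" "B' = d *\<^sub>R B" by (auto simp: pgl_rel_def)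
  then have "A' ** B' = (c * d) *\<^sub>R (A ** B)"
    by (simp add: scalar_matrix_assoc[symmetric] matrix_scalar_ac mult.commute)
  then show "pgl_rel (A ** B) (A' ** B')"
    using inv \<open>c \<noteq> 0\<close> \<open>d \<noteq> 0\<close>
    unfolding pgl_rel_def by (metis invertible_mult mult_eq_0_iff)
qed

lift_definition pgl_one :: "('n::finite) pgl" is "mat 1"
  by (simp add: pgl_rel_refl invertible_mat_1)

definition PGL :: "('n::finite) pgl monoid" where
  "PGL = \<lparr>carrier = UNIV, mult = pgl_mult, one = pgl_one\<rparr>"

lemma group_PGL: "group (PGL :: ('n::finite) pgl monoid)"
proof (rule groupI)
  fix x y z :: "'n pgl"
  show "x \<otimes>\<^bsub>PGL\<^esub> y \<otimes>\<^bsub>PGL\<^esub> z = x \<otimes>\<^bsub>PGL\<^esub> (y \<otimes>\<^bsub>PGL\<^esub> z)"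
    unfolding PGL_def monoid.simps
    by transfer (auto simp: pgl_rel_def matrix_mul_assoc intro!: pgl_rel_refl[unfolded pgl_rel_def] invertible_mult)
  show "\<one>\<^bsub>PGL\<^esub> \<otimes>\<^bsub>PGL\<^esub> x = x"
    unfolding PGL_def monoid.simps by transfer (auto simp: pgl_rel_def)
  obtain A where A: "invertible A" "x = pgl A" by (rule pgl_cases)
  then obtain B where B: "B ** A = mat 1" "A ** B = mat 1" by (auto simp: invertible_def)
  then have "invertible B" by (auto simp: invertible_def)
  have "pgl_mult (pgl B) (pgl A) = pgl_one"
    using pgl_mult.abs_eq[OF pgl_rel_refl[OF \<open>invertible B\<close>] pgl_rel_refl[OF A(1)]] B
    by (simp add: pgl_one.abs_eq)
  then show "\<exists>y\<in>carrier PGL. y \<otimes>\<^bsub>PGL\<^esub> x = \<one>\<^bsub>PGL\<^esub>"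
    using A by (auto simp: PGL_def)
qed (auto simp: PGL_def)

lemma matrix_vector_nz: "invertible (A :: real^'n^'n) \<Longrightarrow> x \<noteq> 0 \<Longrightarrow> A *v x \<noteq> 0"
  using inj_matrix_vector_mult[of A] by (metis injD matrix_vector_mult_0_right)

lift_definition pgl_act :: "('n::finite) pgl \<Rightarrow> 'n proj \<Rightarrow> 'n proj" is "(*v)"
proof -
  fix A B :: "real^'n^'n" and x y :: "real^'n" assume "pgl_rel A B" "proj_rel x y"
  then obtain c d where "invertible A" "invertible B" "x \<noteq> 0" "y \<noteq> 0"
    and "c \<noteq> 0" "B = c *\<^sub>R A" "d \<noteq> 0" "y = d *\<^sub>R x" by (auto simp: pgl_rel_def proj_rel_def)
  moreover from this have "B *v y = (c * d) *\<^sub>R (A *v x)"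
    by (simp add: scaleR_matrix_vector_assoc[symmetric] matrix_vector_mult_scaleR)
  ultimately show "proj_rel (A *v x) (B *v y)"
    unfolding proj_rel_def by (metis matrix_vector_nz mult_eq_0_iff)
qed

definition Aut :: "('n::finite) proj set \<Rightarrow> 'n pgl set" where
  "Aut \<Omega> = {g. pgl_act g ` \<Omega> = \<Omega>}"

text \<open>The union has to be non-empty: the empty union is preserved by every group.\<close>

definition strongly_irreducible :: "('n::finite) pgl set \<Rightarrow> bool" where
  "strongly_irreducible \<Gamma> \<longleftrightarrow>
     \<not> (\<exists>\<S>. finite \<S> \<and> \<S> \<noteq> {} \<and> (\<forall>S\<in>\<S>. subspace S \<and> S \<noteq> {0} \<and> S \<noteq> UNIV) \<and>
          (\<forall>g\<in>\<Gamma>. pgl_act g ` (\<Union>S\<in>\<S>. proj_subspace S) = (\<Union>S\<in>\<S>. proj_subspace S)))"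

definition complex_charpoly :: "real^'n^'n \<Rightarrow> complex poly" where
  "complex_charpoly A = det (mat [:0, 1:] - (\<chi> i j. [:complex_of_real (A $ i $ j):]))"

definition dominant_eigenvalue :: "real^'n^'n \<Rightarrow> complex \<Rightarrow> bool" where
  "dominant_eigenvalue A \<alpha> \<longleftrightarrow>
     poly (complex_charpoly A) \<alpha> = 0 \<and>
     (\<forall>\<mu>. poly (complex_charpoly A) \<mu> = 0 \<and> \<mu> \<noteq> \<alpha> \<longrightarrow> cmod \<mu> < cmod \<alpha>) \<and>
     Polynomial.order \<alpha> (complex_charpoly A) = 1"

definition proximal :: "('n::finite) pgl \<Rightarrow> bool" where
  "proximal g \<longleftrightarrow> (\<exists>A \<alpha>. invertible A \<and> g = pgl A \<and> dominant_eigenvalue A \<alpha>)"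

text \<open>A dominant eigenvalue of a real matrix is real, since its conjugate is also an eigenvalue.\<close>

definition attracting_fixed_point :: "('n::finite) pgl \<Rightarrow> 'n proj \<Rightarrow> bool" where
  "attracting_fixed_point g p \<longleftrightarrow>
     (\<exists>A \<alpha> x. invertible A \<and> g = pgl A \<and> dominant_eigenvalue A (complex_of_real \<alpha>) \<and>
        x \<noteq> 0 \<and> A *v x = \<alpha> *\<^sub>R x \<and> p = proj_pt x)"

definition proximal_limit_set :: "('n::finite) pgl set \<Rightarrow> 'n proj set" where
  "proximal_limit_set \<Gamma> = closure {p. \<exists>g\<in>\<Gamma>. proximal g \<and> attracting_fixed_point g p}"

text \<open>A nonzero \<open>f\<close> gives the affine chart \<open>{[x]. f \<bullet> x \<noteq> 0}\<close>, identified with the affine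
  hyperplane \<open>{x. f \<bullet> x = 1}\<close> of \<open>V\<close>.\<close>

definition properly_convex :: "('n::finite) proj set \<Rightarrow> bool" where
  "properly_convex \<Omega> \<longleftrightarrow>
     (\<exists>f. f \<noteq> 0 \<and> (\<forall>x. x \<noteq> 0 \<and> proj_pt x \<in> \<Omega> \<longrightarrow> f \<bullet> x \<noteq> 0) \<and>
        convex {x. f \<bullet> x = 1 \<and> proj_pt x \<in> \<Omega>} \<and> bounded {x. f \<bullet> x = 1 \<and> proj_pt x \<in> \<Omega>})"

text \<open>For \<open>a = [u] \<noteq> b = [w]\<close>, the map \<open>s \<mapsto> [u + s w]\<close> is a projective coordinate on the line
  \<open>ab\<close> sending \<open>0, \<infinity>\<close> to \<open>a, b\<close>. Rescaling \<open>w\<close> makes it send \<open>1\<close> to \<open>x\<close>, and the cross-ratio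
  \<open>[a, x, y, b]\<close> is then the coordinate of \<open>y\<close>.\<close>

definition cross_ratio ::
    "('n::finite) proj \<Rightarrow> 'n proj \<Rightarrow> 'n proj \<Rightarrow> 'n proj \<Rightarrow> real" where
  "cross_ratio a x y b =
     (THE t. \<exists>u w. u \<noteq> 0 \<and> w \<noteq> 0 \<and> a = proj_pt u \<and> b = proj_pt w \<and>
        x = proj_pt (u + w) \<and> y = proj_pt (u + t *\<^sub>R w))"

text \<open>\<open>a, x, y, b\<close> lie on a projective line in this order, i.e. \<open>x\<close> and \<open>y\<close> lie on one open arc
  of the line from \<open>a\<close> to \<open>b\<close>, with \<open>x\<close> not after \<open>y\<close>.\<close>

definition aligned_in_order ::
    "('n::finite) proj \<Rightarrow> 'n proj \<Rightarrow> 'n proj \<Rightarrow> 'n proj \<Rightarrow> bool" where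
  "aligned_in_order a x y b \<longleftrightarrow>
     a \<noteq> b \<and>
     (\<exists>u w s t. u \<noteq> 0 \<and> w \<noteq> 0 \<and> 0 < s \<and> s \<le> t \<and> a = proj_pt u \<and> b = proj_pt w \<and>
        x = proj_pt (u + s *\<^sub>R w) \<and> y = proj_pt (u + t *\<^sub>R w))"

definition hilbert_dist :: "('n::finite) proj set \<Rightarrow> 'n proj \<Rightarrow> 'n proj \<Rightarrow> real" where
  "hilbert_dist \<Omega> x y =
     (if x = y then 0
      else THE r. \<exists>a\<in>frontier \<Omega>. \<exists>b\<in>frontier \<Omega>.
             aligned_in_order a x y b \<and> r = 1 / 2 * ln (cross_ratio a x y b))"

text \<open>\<open>tvec (x, \<xi>)\<close>, for \<open>x \<noteq> 0\<close>, is the image of the vector \<open>\<xi>\<close> at \<open>x\<close> under the differential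
  of \<open>V - {0} \<rightarrow> P(V)\<close>; so \<open>tvec (x, \<xi>) = tvec (l x, l \<xi> + m x)\<close> for \<open>l \<noteq> 0\<close>. The type
  \<open>'n tproj\<close> is the whole tangent bundle of \<open>P(V)\<close>.\<close>

definition tproj_rel :: "(real^'n) \<times> (real^'n) \<Rightarrow> (real^'n) \<times> (real^'n) \<Rightarrow> bool" where
  "tproj_rel v w \<longleftrightarrow> fst v \<noteq> 0 \<and> fst w \<noteq> 0 \<and>
     (\<exists>l m. l \<noteq> 0 \<and> fst w = l *\<^sub>R fst v \<and> snd w = l *\<^sub>R snd v + m *\<^sub>R fst v)"

lemma tproj_rel_refl: "fst v \<noteq> 0 \<Longrightarrow> tproj_rel v v"
  unfolding tproj_rel_def
  by (intro conjI, assumption, assumption, rule exI[of _ 1], rule exI[of _ 0]) simp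

lemma part_equivp_tproj_rel: "part_equivp (tproj_rel :: (real^'n) \<times> (real^'n) \<Rightarrow> _)"
proof (rule part_equivpI)
  show "\<exists>v::(real^'n) \<times> (real^'n). tproj_rel v v"
    using tproj_rel_refl[of "(axis undefined 1, 0)"] by (auto simp: axis_eq_0_iff)
  show "symp (tproj_rel :: (real^'n) \<times> (real^'n) \<Rightarrow> _)"
  proof (rule sympI)
    fix v w :: "(real^'n) \<times> (real^'n)" assume "tproj_rel v w"
    then obtain l m where *: "fst v \<noteq> 0" "fst w \<noteq> 0" "l \<noteq> 0" "fst w = l *\<^sub>R fst v"
      "snd w = l *\<^sub>R snd v + m *\<^sub>R fst v" by (auto simp: tproj_rel_def)
    then have "fst v = inverse l *\<^sub>R fst w"
      "snd v = inverse l *\<^sub>R snd w + (- m / l / l) *\<^sub>R fst w"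
      by (auto simp: scaleR_add_right divide_inverse)
    with * show "tproj_rel w v"
      unfolding tproj_rel_def by (metis inverse_nonzero_iff_nonzero)
  qed
  show "transp (tproj_rel :: (real^'n) \<times> (real^'n) \<Rightarrow> _)"
  proof (rule transpI)
    fix v w z :: "(real^'n) \<times> (real^'n)" assume "tproj_rel v w" "tproj_rel w z"
    then obtain l m l' m' where *: "fst v \<noteq> 0" "fst z \<noteq> 0" "l \<noteq> 0" "l' \<noteq> 0"
      "fst w = l *\<^sub>R fst v" "snd w = l *\<^sub>R snd v + m *\<^sub>R fst v"
      "fst z = l' *\<^sub>R fst w" "snd z = l' *\<^sub>R snd w + m' *\<^sub>R fst w" by (auto simp: tproj_rel_def)
    then have "fst z = (l' * l) *\<^sub>R fst v" "snd z = (l' * l) *\<^sub>R snd v + (l' * m + m' * l) *\<^sub>R fst v"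
      by (auto simp: algebra_simps)
    with * show "tproj_rel v z"
      unfolding tproj_rel_def by (metis mult_eq_0_iff)
  qed
qed

quotient_type 'n tproj = "(real^'n) \<times> (real^'n)" / partial: tproj_rel
  morphisms rep_tproj tvec
  by (rule part_equivp_tproj_rel)

instantiation tproj :: (finite) topological_space
begin

definition open_tproj_def: "open U \<longleftrightarrow> open {v. fst v \<noteq> 0 \<and> tvec v \<in> U}"

instance
proof
  have "{v. fst v \<noteq> 0 \<and> tvec v \<in> UNIV} = (- {0 :: real^'a}) \<times> (UNIV :: (real^'a) set)" by auto
  then show "open (UNIV :: 'a tproj set)" by (simp add: open_tproj_def open_Times open_Compl)
next
  fix S T :: "'a tproj set" assume "open S" "open T"
  moreover have "{v. fst v \<noteq> 0 \<and> tvec v \<in> S \<inter> T}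
      = {v. fst v \<noteq> 0 \<and> tvec v \<in> S} \<inter> {v. fst v \<noteq> 0 \<and> tvec v \<in> T}" by auto
  ultimately show "open (S \<inter> T)" by (simp add: open_tproj_def open_Int)
next
  fix K :: "'a tproj set set" assume "\<forall>S\<in>K. open S"
  moreover have "{v. fst v \<noteq> 0 \<and> tvec v \<in> \<Union>K} = (\<Union>S\<in>K. {v. fst v \<noteq> 0 \<and> tvec v \<in> S})" by auto
  ultimately show "open (\<Union>K)" by (auto simp: open_tproj_def)
qed

end

lift_definition footpoint :: "('n::finite) tproj \<Rightarrow> 'n proj" is fst
  by (auto simp: tproj_rel_def proj_rel_def)

lift_definition pgl_tact :: "('n::finite) pgl \<Rightarrow> 'n tproj \<Rightarrow> 'n tproj"
  is "\<lambda>A v. (A *v fst v, A *v snd v)"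
proof -
  fix A B :: "real^'n^'n" and v w :: "(real^'n) \<times> (real^'n)" assume "pgl_rel A B" "tproj_rel v w"
  then obtain c l m where *: "invertible A" "invertible B" "fst v \<noteq> 0" "fst w \<noteq> 0"
    "c \<noteq> 0" "B = c *\<^sub>R A" "l \<noteq> 0" "fst w = l *\<^sub>R fst v" "snd w = l *\<^sub>R snd v + m *\<^sub>R fst v"
    by (auto simp: pgl_rel_def tproj_rel_def)
  then have "B *v fst w = (c * l) *\<^sub>R (A *v fst v)"
    "B *v snd w = (c * l) *\<^sub>R (A *v snd v) + (c * m) *\<^sub>R (A *v fst v)"
    by (simp_all add: scaleR_matrix_vector_assoc[symmetric] matrix_vector_mult_scaleR
        matrix_vector_right_distrib scaleR_add_right mult.commute)
  with * show "tproj_rel (A *v fst v, A *v snd v) (B *v fst w, B *v snd w)"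
    unfolding tproj_rel_def fst_conv snd_conv by (metis matrix_vector_nz mult_eq_0_iff)
qed

definition tangent_line :: "('n::finite) tproj \<Rightarrow> 'n proj set" where
  "tangent_line v = {p. \<exists>x \<xi>. x \<noteq> 0 \<and> v = tvec (x, \<xi>) \<and> p \<in> proj_subspace (span {x, \<xi>})}"

text \<open>\<open>v = c'(t)\<close>: the velocity is computed in a lift \<open>X\<close> of \<open>c\<close> to \<open>V\<close>, which has to be
  differentiable at \<open>t\<close> only; all such lifts give the same tangent vector.\<close>

definition has_velocity :: "(real \<Rightarrow> ('n::finite) proj) \<Rightarrow> 'n tproj \<Rightarrow> real \<Rightarrow> bool" where
  "has_velocity c v t \<longleftrightarrow>
     (\<exists>X \<xi>. (\<forall>s. X s \<noteq> 0 \<and> c s = proj_pt (X s)) \<and>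
        (X has_vector_derivative \<xi>) (at t) \<and> v = tvec (X t, \<xi>))"

text \<open>The Finsler norm inducing the Hilbert metric is its metric derivative: the rate at which
  the distance grows along a curve (here a straight one) with the given initial velocity.\<close>

definition hilbert_norm :: "('n::finite) proj set \<Rightarrow> 'n tproj \<Rightarrow> real" where
  "hilbert_norm \<Omega> v =
     (THE F. \<exists>x \<xi>. x \<noteq> 0 \<and> v = tvec (x, \<xi>) \<and>
        ((\<lambda>s. hilbert_dist \<Omega> (proj_pt x) (proj_pt (x + s *\<^sub>R \<xi>)) / s) \<longlongrightarrow> F) (at_right 0))"

definition unit_tangent :: "('n::finite) proj set \<Rightarrow> 'n tproj set" where
  "unit_tangent \<Omega> = {v. footpoint v \<in> \<Omega> \<and> hilbert_norm \<Omega> v = 1}"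

definition is_geodesic :: "('n::finite) proj set \<Rightarrow> 'n tproj \<Rightarrow> (real \<Rightarrow> 'n proj) \<Rightarrow> bool" where
  "is_geodesic \<Omega> v c \<longleftrightarrow>
     range c = \<Omega> \<inter> tangent_line v \<and>
     (\<forall>s t. hilbert_dist \<Omega> (c s) (c t) = \<bar>s - t\<bar>) \<and>
     has_velocity c v 0"

definition geodesic_flow :: "('n::finite) proj set \<Rightarrow> real \<Rightarrow> 'n tproj \<Rightarrow> 'n tproj" where
  "geodesic_flow \<Omega> t v = (THE w. \<exists>c. is_geodesic \<Omega> v c \<and> has_velocity c w t)"

definition flow_at_plus_infinity :: "('n::finite) proj set \<Rightarrow> 'n tproj \<Rightarrow> 'n proj" where
  "flow_at_plus_infinity \<Omega> v = Lim at_top (\<lambda>t. footpoint (geodesic_flow \<Omega> t v))"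

definition flow_at_minus_infinity :: "('n::finite) proj set \<Rightarrow> 'n tproj \<Rightarrow> 'n proj" where
  "flow_at_minus_infinity \<Omega> v = Lim at_bot (\<lambda>t. footpoint (geodesic_flow \<Omega> t v))"

definition quotient_topology :: "'a topology \<Rightarrow> ('a \<Rightarrow> 'b) \<Rightarrow> 'b topology" where
  "quotient_topology X f =
     topology (\<lambda>U. U \<subseteq> f ` topspace X \<and> openin X {x \<in> topspace X. f x \<in> U})"

lemma openin_quotient_topology:
  "openin (quotient_topology X f) U \<longleftrightarrow>
     U \<subseteq> f ` topspace X \<and> openin X {x \<in> topspace X. f x \<in> U}"
proof -
  have "istopology (\<lambda>U. U \<subseteq> f ` topspace X \<and> openin X {x \<in> topspace X. f x \<in> U})"
    unfolding istopology_def
  proof (intro conjI allI impI)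
    fix S T
    assume "S \<subseteq> f ` topspace X \<and> openin X {x \<in> topspace X. f x \<in> S}"
      "T \<subseteq> f ` topspace X \<and> openin X {x \<in> topspace X. f x \<in> T}"
    moreover have "{x \<in> topspace X. f x \<in> S \<inter> T}
        = {x \<in> topspace X. f x \<in> S} \<inter> {x \<in> topspace X. f x \<in> T}" by auto
    ultimately show "S \<inter> T \<subseteq> f ` topspace X" "openin X {x \<in> topspace X. f x \<in> S \<inter> T}"
      by auto
  next
    fix K assume K: "\<forall>S\<in>K. S \<subseteq> f ` topspace X \<and> openin X {x \<in> topspace X. f x \<in> S}"
    have "{x \<in> topspace X. f x \<in> \<Union>K} = (\<Union>S\<in>K. {x \<in> topspace X. f x \<in> S})" by auto
    with K show "\<Union>K \<subseteq> f ` topspace X" "openin X {x \<in> topspace X. f x \<in> \<Union>K}"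
      by auto
  qed
  then show ?thesis by (simp add: quotient_topology_def)
qed

lemma topspace_quotient_topology: "topspace (quotient_topology X f) = f ` topspace X"
proof -
  have "{x \<in> topspace X. f x \<in> f ` topspace X} = topspace X" by auto
  then have "openin (quotient_topology X f) (f ` topspace X)"
    by (simp add: openin_quotient_topology)
  then show ?thesis
    by (metis openin_quotient_topology openin_subset openin_topspace subset_antisym)
qed

lemma quotient_map_quotient_topology: "quotient_map X (quotient_topology X f) f"
  by (simp add: quotient_map_def topspace_quotient_topology openin_quotient_topology)

text \<open>Points of \<open>T\<^sup>1M\<close> are \<open>\<Gamma>\<close>-orbits of unit tangent vectors.\<close>

definition tangent_orbit :: "('n::finite) pgl set \<Rightarrow> 'n tproj \<Rightarrow> 'n tproj set" where
  "tangent_orbit \<Gamma> v = (\<lambda>g. pgl_tact g v) ` \<Gamma>"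

definition T1M :: "('n::finite) proj set \<Rightarrow> 'n pgl set \<Rightarrow> 'n tproj set topology" where
  "T1M \<Omega> \<Gamma> = quotient_topology (top_of_set (unit_tangent \<Omega>)) (tangent_orbit \<Gamma>)"

text \<open>The geodesic flow commutes with \<open>\<Gamma>\<close>, so it sends the orbit of \<open>v\<close> onto that of \<open>\<phi>\<^sub>t v\<close>.\<close>

definition quotient_flow :: "('n::finite) proj set \<Rightarrow> real \<Rightarrow> 'n tproj set \<Rightarrow> 'n tproj set" where
  "quotient_flow \<Omega> t q = geodesic_flow \<Omega> t ` q"

definition T1M_bip :: "('n::finite) proj set \<Rightarrow> 'n pgl set \<Rightarrow> 'n tproj set set" where
  "T1M_bip \<Omega> \<Gamma> = tangent_orbit \<Gamma> `
     {v \<in> unit_tangent \<Omega>. flow_at_plus_infinity \<Omega> v \<in> proximal_limit_set \<Gamma> \<and>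
                          flow_at_minus_infinity \<Omega> v \<in> proximal_limit_set \<Gamma>}"

definition topologically_transitive :: "'a topology \<Rightarrow> (real \<Rightarrow> 'a \<Rightarrow> 'a) \<Rightarrow> bool" where
  "topologically_transitive X f \<longleftrightarrow>
     (\<forall>U U'. openin X U \<and> U \<noteq> {} \<and> openin X U' \<and> U' \<noteq> {} \<longrightarrow>
        (\<exists>t>0. f t ` U \<inter> U' \<noteq> {}))"

definition topologically_mixing :: "'a topology \<Rightarrow> (real \<Rightarrow> 'a \<Rightarrow> 'a) \<Rightarrow> bool" where
  "topologically_mixing X f \<longleftrightarrow>
     (\<forall>U U'. openin X U \<and> U \<noteq> {} \<and> openin X U' \<and> U' \<noteq> {} \<longrightarrow>
        (\<forall>\<^sub>F t in at_top. f t ` U \<inter> U' \<noteq> {}))"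

definition flow_invariant :: "(real \<Rightarrow> 'a \<Rightarrow> 'a) \<Rightarrow> 'a set \<Rightarrow> bool" where
  "flow_invariant f A \<longleftrightarrow> (\<forall>t. f t ` A \<subseteq> A)"

end

theory Submission
  imports Defs "HOL-Computational_Algebra.Fundamental_Theorem_Algebra"
begin

text \<open>
  Let \<open>C \<subseteq> V\<close> be an open convex cone over \<open>\<Omega>\<close>. Unit tangent vectors correspond to pairs \<open>(u, w)\<close> of
  boundary vectors of \<open>C\<close> with \<open>u + w \<in> C\<close>, up to a common positive factor; the flow is
  \<open>(u, w) \<mapsto> (e\<^sup>-\<^sup>t u, e\<^sup>t w)\<close>, its endpoints are \<open>[u]\<close> and \<open>[w]\<close>, and \<open>\<Gamma>\<close> acts linearly through the lifts
  preserving \<open>C\<close>.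

  For the mixing property, take \<open>D\<close> in the lifted group such that \<open>l\<^sup>-\<^sup>n D\<^sup>n \<rightarrow> p \<otimes> \<xi>\<close> and
  \<open>m\<^sup>n D\<^sup>-\<^sup>n \<rightarrow> q \<otimes> \<eta>\<close> (it is found near \<open>A\<^sup>n Q A\<^sup>-\<^sup>n Q'\<close> with \<open>A\<close> proximal and \<open>Q, Q'\<close> generic). If \<open>H p\<close> is
  close to \<open>u\<^sub>1\<close> and \<open>E q\<close> to \<open>w\<^sub>0\<close>, the products \<open>H D\<^sup>n E\<^sup>-\<^sup>1\<close> map, after flowing for a time
  \<open>n ln (l / m) / 2 + const\<close>, a vector close to \<open>(u\<^sub>0, w\<^sub>0)\<close> to a vector close to \<open>(u\<^sub>1, w\<^sub>1)\<close>. Replacing \<open>D\<^sup>n\<close> by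
  \<open>D\<^sup>i K D\<^sup>j\<close> with \<open>i + j = n\<close> shifts this time by half the logarithm of \<open>\<xi>(K p) \<eta>(K\<^sup>-\<^sup>1 q)\<close>.
  These shifts and \<open>ln (l / m)\<close> generate a dense subgroup of \<open>\<real>\<close>: the numbers
  \<open>(m / l)\<^sup>n \<xi>(H D\<^sup>n H p) \<eta>(H\<^sup>-\<^sup>1 D\<^sup>-\<^sup>n H\<^sup>-\<^sup>1 q)\<close> converge, but are not eventually constant.

  For the second part, transitivity on \<open>A\<close> yields \<open>K\<^sub>n \<in> \<Gamma>\<close> and \<open>t\<^sub>n \<rightarrow> \<infinity>\<close> such that \<open>K\<^sub>n\<close> expands a vector near a
  limit point \<open>x\<close> by \<open>e\<close> to the power \<open>t\<^sub>n\<close> onto a vector near the given endpoint, and contracts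
  a transverse one. A limit of the normalised \<open>K\<^sub>n\<close> then maps \<open>x\<close> to that endpoint, which is therefore in
  the limit set.
\<close>

section \<open>Characteristic polynomials of real matrices over the complex numbers\<close>

text \<open>Nothing is assumed about the boundary of \<Omega>, which may contain segments and
  corners, so there are no stable leaves to follow. Two facts replace them:
  \<open>u + w \<in> C\<close> is an open condition, and maps of the cone with a rank one limit
  absorb all other directions. Generic elements must satisfy finitely many linear conditions on
  \<open>H\<close> and on its inverse at once. Strong irreducibility only speaks of subspaces and
  inversion is not linear; the group is therefore replaced by the graph of inversion in the space of
  pairs of matrices, where both kinds of conditions are linear. The halved times come from the ratio
  of the two components of a pair: the flow for time \<open>t\<close> changes it by
  \<open>exp (2 * t)\<close>, and \<open>D\<^sup>n\<close> by \<open>(l / m)\<^sup>n\<close>. The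
  shifts are only seen to form a semigroup, since inverting an element exchanges \<open>p\<close>
  and \<open>q\<close>. Both \<open>L\<close> and \<open>- L\<close> are shifts, however, because
  \<open>D\<^sup>n\<close> may be replaced by its two neighbours; together with Diophantine
  approximation this makes up for the missing negatives.\<close>

lemma poly_det: "poly (det (M :: 'a::comm_ring_1 poly^'n^'n)) x = det (\<chi> i j. poly (M $ i $ j) x)"
proof -
  have "poly (of_int k :: 'a poly) x = of_int k" for k
    by (simp add: of_int_poly)
  then show ?thesis
    by (simp add: det_def poly_sum poly_prod)
qed

definition const_mat :: "'a::zero^'n^'m \<Rightarrow> 'a poly^'n^'m" where
  "const_mat A = (\<chi> i j. [:A $ i $ j:])"

lemma const_poly_sum: "[:sum f S:] = (\<Sum>i\<in>S. [:f i:])"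
proof (induction S rule: infinite_finite_induct)
  case (insert x F)
  have "[:sum f (insert x F):] = [:f x:] + [:sum f F:]" using insert.hyps by simp
  also have "\<dots> = [:f x:] + (\<Sum>i\<in>F. [:f i:])" by (simp only: insert.IH)
  finally show ?case using insert.hyps by simp
qed auto

lemma const_mat_mult: "const_mat (A ** B) = const_mat A ** (const_mat B :: 'a::comm_ring_1 poly^_^_)"
  by (simp add: const_mat_def matrix_matrix_mult_def vec_eq_iff const_poly_sum mult.commute)

lemma const_mat_1: "const_mat (mat 1) = (mat 1 :: 'a::comm_ring_1 poly^'n^'n)"
  by (simp add: const_mat_def mat_def vec_eq_iff one_pCons)

lemma det_const_mat: "det (const_mat A :: 'a::comm_ring_1 poly^'n^'n) = [:det A:]"
proof -
  have 1: "[:prod f S:] = (\<Prod>i\<in>S. [:f i:])" for f :: "'n \<Rightarrow> 'a" and S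
  proof (induction S rule: infinite_finite_induct)
    case (insert x F)
    have "[:prod f (insert x F):] = [:f x:] * [:prod f F:]" using insert.hyps by simp
    also have "\<dots> = [:f x:] * (\<Prod>i\<in>F. [:f i:])" by (simp only: insert.IH)
    finally show ?case using insert.hyps by simp
  qed (auto simp: one_pCons)
  have 2: "[:of_int k * a:] = of_int k * [:a::'a:]" for k a
    by (simp add: of_int_poly)
  show ?thesis
    by (simp add: det_def const_poly_sum 1 2 const_mat_def)
qed

definition complexify :: "real^'n^'m \<Rightarrow> complex^'n^'m" where
  "complexify A = (\<chi> i j. complex_of_real (A $ i $ j))"

lemma complexify_mult: "complexify (A ** B) = complexify A ** complexify B"
  by (simp add: complexify_def matrix_matrix_mult_def vec_eq_iff)

lemma complexify_1: "complexify (mat 1) = mat 1"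
  by (simp add: complexify_def mat_def vec_eq_iff)

lemma complex_charpoly_alt: "complex_charpoly A = det (mat [:0, 1:] - const_mat (complexify A))"
  by (simp add: complex_charpoly_def const_mat_def complexify_def)

text \<open>A constant matrix commutes with the scalar matrix of the variable, so conjugation passes
  to the whole pencil. This transports proximality along conjugation in the group.\<close>

lemma complex_charpoly_conj:
  fixes A B C :: "real^'n^'n"
  assumes "B ** C = mat 1"
  shows "complex_charpoly (B ** A ** C) = complex_charpoly A"
proof -
  let ?c = "\<lambda>M. const_mat (complexify M)"
  have comm: "?c B ** mat [:0, 1:] = mat [:0, 1:] ** ?c B"
    by (simp add: matrix_matrix_mult_def mat_def vec_eq_iff if_distrib if_distribR mult.commute cong: if_cong)
  have BC: "?c B ** ?c C = mat 1"
    by (simp add: const_mat_mult[symmetric] complexify_mult[symmetric] assms complexify_1 const_mat_1)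
  have ldist: "L ** (M - N) = L ** M - L ** N" and rdist: "(M - N) ** L = M ** L - N ** L"
    for L M N :: "complex poly^'n^'n"
    by (simp_all add: matrix_matrix_mult_def vec_eq_iff algebra_simps sum_subtractf)
  have "mat [:0, 1:] - ?c (B ** A ** C) = ?c B ** (mat [:0, 1:] - ?c A) ** ?c C"
  proof -
    have "mat [:0, 1:] = mat [:0, 1:] ** (?c B ** ?c C)" by (simp add: BC)
    also have "\<dots> = ?c B ** mat [:0, 1:] ** ?c C" by (simp only: matrix_mul_assoc comm)
    finally show ?thesis by (simp add: ldist rdist const_mat_mult complexify_mult)
  qed
  then have "complex_charpoly (B ** A ** C) = det (?c B) * complex_charpoly A * det (?c C)"
    by (simp add: complex_charpoly_alt det_mul)
  also have "\<dots> = det (?c B ** ?c C) * complex_charpoly A" by (simp add: det_mul mult_ac)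
  finally show ?thesis by (simp add: BC)
qed

lemma eigenvalue_root_charpoly:
  assumes "complexify A *v z = \<mu> *s z" "z \<noteq> 0"
  shows "poly (complex_charpoly A) \<mu> = 0"
proof -
  let ?M = "mat \<mu> - complexify A"
  have "(\<chi> i j. poly ((mat [:0, 1:] - const_mat (complexify A)) $ i $ j) \<mu>) = ?M"
    by (simp add: mat_def const_mat_def vec_eq_iff)
  then have "poly (complex_charpoly A) \<mu> = det ?M"
    by (simp add: complex_charpoly_alt poly_det)
  moreover have "?M *v z = 0"
  proof -
    have "mat \<mu> *v z = \<mu> *s z"
      by (simp add: matrix_vector_mult_def mat_def vec_eq_iff if_distrib if_distribR cong: if_cong)
    then show ?thesis using assms(1) by (simp add: matrix_vector_mult_diff_rdistrib)
  qed
  then have "\<not> invertible ?M"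
    using assms(2) by (metis invertible_def matrix_left_invertible_ker)
  ultimately show ?thesis by (simp add: invertible_det_nz)
qed

text \<open>Both ways in which a root fails to be simple are covered: \<open>c = 0\<close> is a
  two-dimensional eigenspace, \<open>c \<noteq> 0\<close> a Jordan block. In a basis containing
  \<open>x\<close> and \<open>y\<close>, two columns of the pencil yield one linear factor
  each.\<close>

lemma order_ge_2_charpoly:
  fixes x y :: "complex^'n"
  assumes x: "complexify A *v x = \<alpha> *s x" "x \<noteq> 0"
    and y: "complexify A *v y = \<alpha> *s y + c *s x" "\<And>b. y \<noteq> b *s x"
  shows "[:-\<alpha>, 1:]\<^sup>2 dvd complex_charpoly A"
proof -
  obtain i where i: "x $ i \<noteq> 0" using x(2) by (auto simp: vec_eq_iff)
  \<comment> \<open>A non-zero minor of the columns \<open>x\<close> and \<open>y\<close>: putting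
    them in place of the basis vectors \<open>i\<close> and \<open>j\<close> leaves a basis.\<close>
  obtain j where j: "x $ i * y $ j \<noteq> x $ j * y $ i"
  proof (rule ccontr)
    assume "\<not> thesis"
    with that have *: "x $ i * y $ j = x $ j * y $ i" for j by blast
    have "y = (y $ i / x $ i) *s x"
      unfolding vec_eq_iff using i * by (simp add: field_simps)
    with y(2) show False by blast
  qed
  then have "i \<noteq> j" by (auto simp: mult.commute)
  define S :: "complex^'n^'n" where
    "S = (\<chi> k l. if l = i then x $ k else if l = j then y $ k else if k = l then 1 else 0)"
  have "z = 0" if "S *v z = 0" for z
  proof -
    have Sz: "(S *v z) $ k = x $ k * z $ i + y $ k * z $ j + (if k = i \<or> k = j then 0 else z $ k)" for k
    proof -
      have "(S *v z) $ k = (\<Sum>l\<in>UNIV. (if l = i then x $ k * z $ i else 0)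
          + (if l = j then y $ k * z $ j else 0) + (if l = k then (if k = i \<or> k = j then 0 else z $ k) else 0))"
        unfolding matrix_vector_mult_def S_def vec_lambda_beta
        by (intro sum.cong refl) (use \<open>i \<noteq> j\<close> in auto)
      then show ?thesis by (simp add: sum.distrib)
    qed
    have 0: "x $ k * z $ i + y $ k * z $ j + (if k = i \<or> k = j then 0 else z $ k) = 0" for k
      using Sz[of k] that by simp
    have 1: "x $ i * z $ i + y $ i * z $ j = 0" "x $ j * z $ i + y $ j * z $ j = 0"
      using 0[of i] 0[of j] by auto
    have "(x $ i * y $ j - x $ j * y $ i) * z $ i = y $ j * (x $ i * z $ i + y $ i * z $ j) - y $ i * (x $ j * z $ i + y $ j * z $ j)"
      by (simp add: algebra_simps)
    then have zi: "z $ i = 0" using j 1 by simp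
    have "(x $ i * y $ j - x $ j * y $ i) * z $ j = x $ i * (x $ j * z $ i + y $ j * z $ j) - x $ j * (x $ i * z $ i + y $ i * z $ j)"
      by (simp add: algebra_simps)
    then have zj: "z $ j = 0" using j 1 by simp
    show "z = 0" unfolding vec_eq_iff
    proof
      fix k show "z $ k = 0 $ k" using 0[of k] zi zj by (cases "k = i \<or> k = j") auto
    qed
  qed
  then have "det S \<noteq> 0"
    by (metis invertible_det_nz invertible_left_inverse matrix_left_invertible_ker)
  define M where "M = mat [:0, 1:] - const_mat (complexify A)"
  \<comment> \<open>Transposed, because the determinant rules act on rows: row \<open>i\<close>
    comes from \<open>x\<close>, row \<open>j\<close> from \<open>y\<close>.\<close>
  define N where "N = transpose (M ** const_mat S)"
  define X where "X = (\<chi> k. [:x $ k:])"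
  define Y where "Y = (\<chi> k. [:y $ k:])"
  have col: "transpose (const_mat S) $ i = X" "transpose (const_mat S) $ j = Y"
    using \<open>i \<noteq> j\<close> by (auto simp: transpose_def const_mat_def S_def X_def Y_def vec_eq_iff)
  have Nrow: "N $ k = M *v (transpose (const_mat S) $ k)" for k
    by (simp add: N_def transpose_def matrix_matrix_mult_def matrix_vector_mult_def vec_eq_iff)
  have cX: "const_mat B *v (\<chi> k. [:v $ k:]) = (\<chi> k. [:(B *v v) $ k:])" for B :: "complex^'n^'n" and v
    by (simp add: const_mat_def matrix_vector_mult_def vec_eq_iff const_poly_sum mult.commute)
  have tX: "mat [:0, 1:] *v w = [:0,1:] *s w" for w :: "complex poly^'n"
    by (simp add: matrix_vector_mult_def mat_def vec_eq_iff if_distrib if_distribR cong: if_cong)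
  have MX: "M *v X = [:-\<alpha>, 1:] *s X"
  proof -
    have "M *v X = [:0,1:] *s X - (\<chi> k. [:(\<alpha> *s x) $ k:])"
      by (simp only: M_def matrix_vector_mult_diff_rdistrib tX X_def cX x)
    then show ?thesis by (simp add: vec_eq_iff X_def)
  qed
  have MY: "M *v Y = [:-\<alpha>, 1:] *s Y + [:-c:] *s X"
  proof -
    have "M *v Y = [:0,1:] *s Y - (\<chi> k. [:(\<alpha> *s y + c *s x) $ k:])"
      by (simp only: M_def matrix_vector_mult_diff_rdistrib tX Y_def cX y)
    then show ?thesis by (simp add: vec_eq_iff X_def Y_def)
  qed
  let ?t = "[:-\<alpha>, 1:]"
  define R where "R = (\<chi> k. if k = i then X else N $ k)"
  define R' where "R' = (\<chi> k. if k = j then ?t *s Y else R $ k)"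
  define R'' where "R'' = (\<chi> k. if k = j then Y else R $ k)"
  have "N = (\<chi> k. if k = i then ?t *s X else N $ k)"
    by (intro vec_eq_iff[THEN iffD2] allI) (simp add: Nrow col MX)
  from arg_cong[OF this, of det] have "det N = ?t * det R"
    unfolding R_def det_row_mul .
  \<comment> \<open>With its factor taken out, row \<open>i\<close> is \<open>x\<close> itself and
    clears the multiple of \<open>x\<close> in row \<open>j\<close>.\<close>
  moreover have "det R = det R'"
  proof -
    have "R = (\<chi> k. if k = j then row j R' + [:-c:] *s row i R' else row k R')"
    proof (rule vec_eq_iff[THEN iffD2], rule allI)
      fix k show "R $ k = (\<chi> k. if k = j then row j R' + [:-c:] *s row i R' else row k R') $ k"
        using \<open>i \<noteq> j\<close> by (auto simp: R'_def row_def R_def Nrow col MY) (simp add: vec_eq_iff)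
    qed
    from arg_cong[OF this, of det] show ?thesis
      using det_row_operation[of j i R' "[:-c:]"] \<open>i \<noteq> j\<close> by metis
  qed
  moreover have "det R' = ?t * det R''"
    unfolding R'_def R''_def det_row_mul ..
  ultimately have "det N = ?t\<^sup>2 * det R''" by (simp only: power2_eq_square mult.assoc)
  moreover have "det N = complex_charpoly A * [:det S:]"
    by (simp add: N_def det_mul det_const_mat complex_charpoly_alt M_def)
  ultimately have "smult (det S) (complex_charpoly A) = ?t\<^sup>2 * det R''" by simp
  then have "?t\<^sup>2 dvd smult (det S) (complex_charpoly A)" by (metis dvd_triv_left)
  then show ?thesis using \<open>det S \<noteq> 0\<close> by (simp add: dvd_smult_iff)
qed

section \<open>Powers of a matrix with a dominant eigenvalue\<close>

primrec matpow :: "'a::semiring_1^'n^'n \<Rightarrow> nat \<Rightarrow> 'a^'n^'n" where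
  "matpow A 0 = mat 1"
| "matpow A (Suc n) = A ** matpow A n"

text \<open>The value \<open>p(C) v\<close> by Horner's rule: \<open>V\<close> as a module over
  polynomials.\<close>

definition pev :: "complex^'n^'n \<Rightarrow> complex poly \<Rightarrow> complex^'n \<Rightarrow> complex^'n" where
  "pev C p v = fold_coeffs (\<lambda>a w. a *s v + C *v w) p 0"

lemma pev_0 [simp]: "pev C 0 v = 0"
  by (simp add: pev_def)

lemma pev_pCons [simp]: "pev C (pCons a p) v = a *s v + C *v pev C p v"
  by (cases "p = 0 \<and> a = 0") (auto simp: pev_def)

lemma matrix_vector_mult_vscale: "(A :: 'a::comm_semiring_1^'n^'m) *v (c *s v) = c *s (A *v v)"
  by (simp add: matrix_vector_mult_def vec_eq_iff sum_distrib_left mult_ac)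

lemma pev_smult: "pev C (smult c p) v = c *s pev C p v"
  by (induction p) (auto simp: vector_add_ldistrib vector_smult_assoc matrix_vector_mult_vscale)

lemma pev_add: "pev C (p + q) v = pev C p v + pev C q v"
  by (induction p q rule: poly_induct2)
     (auto simp: vector_sadd_rdistrib matrix_vector_right_distrib algebra_simps)

lemma pev_sum: "pev C (\<Sum>i\<in>I. p i) v = (\<Sum>i\<in>I. pev C (p i) v)"
  by (induction I rule: infinite_finite_induct) (auto simp: pev_add)

lemma pev_mult: "pev C (p * q) v = pev C p (pev C q v)"
  by (induction p) (auto simp: pev_add pev_smult)

lemma pev_add_right: "pev C p (v + w) = pev C p v + pev C p w"
  by (induction p) (auto simp: vector_add_ldistrib matrix_vector_right_distrib algebra_simps)

lemma pev_scale_right: "pev C p (c *s v) = c *s pev C p v"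
  by (induction p) (auto simp: vector_add_ldistrib matrix_vector_mult_vscale vector_smult_assoc mult.commute)

lemma pev_monom: "pev C (monom a n) v = a *s ((*v) C ^^ n) v"
  by (induction n) (auto simp: monom_0 monom_Suc matrix_vector_mult_vscale)

lemma pev_fixed: "C *v x = x \<Longrightarrow> pev C p x = poly p 1 *s x"
  by (induction p) (auto simp: matrix_vector_mult_vscale vector_sadd_rdistrib)

text \<open>Among \<open>v, C v, C\<^sup>2 v, ...\<close>, one more vector than the real dimension
  forces a linear relation.\<close>

lemma exists_annihilator:
  fixes C :: "complex^'n^'n"
  shows "\<exists>p. p \<noteq> 0 \<and> pev C p v = 0"
proof -
  let ?f = "\<lambda>i. ((*v) C ^^ i) v"
  show ?thesis
  \<comment> \<open>A repetition makes the set of iterates too small for the dimension count, but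
    yields \<open>X^i - X^j\<close> directly.\<close>
  proof (cases "inj_on ?f {..DIM(complex^'n)}")
    case False
    then obtain i j where ij: "?f i = ?f j" "i \<noteq> j" by (auto simp: inj_on_def)
    let ?p = "monom (1::complex) i + monom (-1) j"
    have "coeff ?p i = 1" using ij by simp
    then have "?p \<noteq> 0" by (metis coeff_0 zero_neq_one)
    moreover have "pev C ?p v = 0"
      by (simp add: pev_add pev_monom ij)
    ultimately show ?thesis by blast
  next
    case True
    let ?S = "?f ` {..DIM(complex^'n)}"
    have "card ?S = Suc DIM(complex^'n)" using True by (simp add: card_image)
    then have "dependent ?S"
      by (intro dependent_biggerset) linarith
    then obtain u y where u: "y \<in> ?S" "u y \<noteq> 0" "(\<Sum>x\<in>?S. u x *\<^sub>R x) = 0"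
      using dependent_finite[of ?S] by auto
    then obtain j where j: "j \<le> DIM(complex^'n)" "y = ?f j" by auto
    define p where "p = (\<Sum>i\<le>DIM(complex^'n). monom (complex_of_real (u (?f i))) i)"
    have "coeff p j = complex_of_real (u y)"
      using j by (simp add: p_def coeff_sum)
    then have "p \<noteq> 0" using u(2) by auto
    have "pev C p v = (\<Sum>i\<le>DIM(complex^'n). u (?f i) *\<^sub>R ?f i)"
      unfolding p_def pev_sum pev_monom
      by (intro sum.cong refl) (simp add: vec_eq_iff scaleR_conv_of_real[where 'a=complex])
    also have "\<dots> = 0" using u(3) True by (simp add: sum.reindex)
    finally show ?thesis using \<open>p \<noteq> 0\<close> by blast
  qed
qed

text \<open>Errors below \<open>e / 2 * (1 - r)\<close> add up, weighted by powers of
  \<open>r\<close>, to at most \<open>e / 2\<close>.\<close>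

lemma perturbed_contraction_tendsto_0:
  fixes z :: "nat \<Rightarrow> complex"
  assumes "cmod \<mu> < 1" and y: "(\<lambda>n. z (Suc n) - \<mu> * z n) \<longlonglongrightarrow> 0"
  shows "z \<longlonglongrightarrow> 0"
proof (rule LIMSEQ_I)
  fix e :: real assume "e > 0"
  define r where "r = cmod \<mu>"
  have r: "0 \<le> r" "r < 1" using assms by (auto simp: r_def)
  obtain N where N: "\<And>n. n \<ge> N \<Longrightarrow> norm (z (Suc n) - \<mu> * z n) < e / 2 * (1 - r)"
    using LIMSEQ_D[OF y, of "e / 2 * (1 - r)"] \<open>e > 0\<close> r by auto
  have bd: "cmod (z (N + k)) \<le> r ^ k * cmod (z N) + e / 2" for k
  proof (induction k)
    case (Suc k)
    have "cmod (z (N + Suc k)) \<le> cmod (z (Suc (N + k)) - \<mu> * z (N + k)) + cmod (\<mu> * z (N + k))"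
      using norm_triangle_ineq[of "z (Suc (N + k)) - \<mu> * z (N + k)" "\<mu> * z (N + k)"] by simp
    also have "\<dots> \<le> e / 2 * (1 - r) + r * (r ^ k * cmod (z N) + e / 2)"
      using N[of "N + k"] Suc r by (intro add_mono) (auto simp: norm_mult r_def intro: mult_left_mono)
    finally show ?case by (simp add: field_simps)
  qed (use \<open>e > 0\<close> in auto)
  have "(\<lambda>k. r ^ k * cmod (z N)) \<longlonglongrightarrow> 0 * cmod (z N)"
    using r by (intro tendsto_mult LIMSEQ_realpow_zero) auto
  then obtain K where K: "\<And>k. k \<ge> K \<Longrightarrow> norm (r ^ k * cmod (z N) - 0 * cmod (z N)) < e / 2"
    using LIMSEQ_D[of _ _ "e / 2"] \<open>e > 0\<close> by (metis half_gt_zero)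
  show "\<exists>M. \<forall>n\<ge>M. norm (z n - 0) < e"
  proof (intro exI allI impI)
    fix n assume "n \<ge> N + K"
    then obtain k where "n = N + k" "k \<ge> K" by (metis le_add_diff_inverse add_leD1 nat_add_left_cancel_le)
    then show "norm (z n - 0) < e" using bd[of k] K[of k] r by auto
  qed
qed

lemma tendsto_matrix_vector_mult [tendsto_intros]:
  fixes A :: "_ \<Rightarrow> 'a::real_normed_field^'n^'m"
  assumes "(A \<longlongrightarrow> A0) F" "(x \<longlongrightarrow> x0) F"
  shows "((\<lambda>n. A n *v x n) \<longlongrightarrow> A0 *v x0) F"
  unfolding matrix_vector_mult_def
  by (intro vec_tendstoI) (auto intro!: tendsto_sum tendsto_mult tendsto_vec_nth assms)

lemma tendsto_matrix_matrix_mult [tendsto_intros]: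
  fixes A :: "_ \<Rightarrow> 'a::real_normed_field^'n^'m" and B :: "_ \<Rightarrow> 'a^'k^'n"
  assumes "(A \<longlongrightarrow> A0) F" "(B \<longlongrightarrow> B0) F"
  shows "((\<lambda>n. A n ** B n) \<longlongrightarrow> A0 ** B0) F"
  unfolding matrix_matrix_mult_def
  by (intro vec_tendstoI) (auto intro!: tendsto_sum tendsto_mult tendsto_vec_nth assms)

text \<open>One linear factor is removed at a time: \<open>C v - \<mu> v\<close> is killed by the
  remaining ones. If \<mu> is an eigenvalue, this is a contraction with vanishing error; otherwise
  \<open>C - \<mu>\<close> is invertible and the iterates of \<open>v\<close> are recovered from
  those of that vector.\<close>

lemma iterate_tendsto_0:
  assumes ev: "\<And>\<mu> z. C *v z = \<mu> *s z \<Longrightarrow> z \<noteq> 0 \<Longrightarrow> \<mu> = 1 \<or> cmod \<mu> < 1"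
    and "pev C (\<Prod>\<mu>\<in>#M. [:-\<mu>, 1:]) v = 0" "1 \<notin># M"
  shows "(\<lambda>n. ((*v) C ^^ n) v) \<longlonglongrightarrow> (0 :: complex^'n)"
  using assms(2,3)
proof (induction M arbitrary: v)
  case empty
  have "((*v) C ^^ n) 0 = 0" for n by (induction n) auto
  with empty show ?case by (simp add: one_pCons)
next
  case (add \<mu> M)
  have \<mu>: "\<mu> \<noteq> 1" using add.prems by auto
  define w where "w = C *v v - \<mu> *s v"
  have "pev C ((\<Prod>\<mu>\<in>#M. [:-\<mu>, 1:]) * [:-\<mu>, 1:]) v = 0"
    using add.prems by (simp add: mult.commute)
  then have "pev C (\<Prod>\<mu>\<in>#M. [:-\<mu>, 1:]) w = 0"
    by (simp only: pev_mult) (simp add: w_def algebra_simps)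
  then have w: "(\<lambda>n. ((*v) C ^^ n) w) \<longlonglongrightarrow> 0" using add by auto
  have it: "((*v) C ^^ n) w = ((*v) C ^^ Suc n) v - \<mu> *s ((*v) C ^^ n) v" for n
    by (induction n) (auto simp: w_def matrix_vector_mult_diff_distrib matrix_vector_mult_vscale)
  show ?case
  proof (cases "\<exists>z. C *v z = \<mu> *s z \<and> z \<noteq> 0")
    case True
    then have "cmod \<mu> < 1" using ev \<mu> by blast
    show ?thesis
    proof (rule vec_tendstoI)
      fix i
      have "(\<lambda>n. (((*v) C ^^ n) w) $ i) \<longlonglongrightarrow> (0 :: complex^'n) $ i"
        by (intro tendsto_vec_nth w)
      then show "(\<lambda>n. (((*v) C ^^ n) v) $ i) \<longlonglongrightarrow> (0 :: complex^'n) $ i"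
        using perturbed_contraction_tendsto_0[OF \<open>cmod \<mu> < 1\<close>, of "\<lambda>n. (((*v) C ^^ n) v) $ i"]
        by (simp add: it)
    qed
  next
    case False
    have M: "(C - mat \<mu>) *v z = C *v z - \<mu> *s z" for z
    proof -
      have "mat \<mu> *v z = \<mu> *s z"
        by (simp add: matrix_vector_mult_def mat_def vec_eq_iff if_distrib if_distribR cong: if_cong)
      then show ?thesis by (simp add: matrix_vector_mult_diff_rdistrib)
    qed
    have "\<forall>z. (C - mat \<mu>) *v z = 0 \<longrightarrow> z = 0" using False by (auto simp: M)
    then obtain D where D: "D ** (C - mat \<mu>) = mat 1"
      using matrix_left_invertible_ker by blast
    have "((*v) C ^^ n) v = D *v (((*v) C ^^ n) w)" for n
    proof -
      have "D *v (((*v) C ^^ n) w) = D *v ((C - mat \<mu>) *v (((*v) C ^^ n) v))"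
        by (simp add: it M)
      also have "\<dots> = ((*v) C ^^ n) v" by (simp add: matrix_vector_mul_assoc D)
      finally show ?thesis by simp
    qed
    moreover have "(\<lambda>n. D *v (((*v) C ^^ n) w)) \<longlonglongrightarrow> D *v 0"
      by (intro tendsto_intros w)
    ultimately show ?thesis by simp
  qed
qed

text \<open>\<open>gen\<close> says that the generalised eigenspace of 1 is the line of
  \<open>x\<close>. If an annihilator of \<open>v\<close> is a power of \<open>X - 1\<close> times
  \<open>q\<close>, then \<open>q(C) v\<close> lies on that line, and \<open>v\<close> minus a
  suitable multiple of \<open>x\<close> is annihilated by \<open>q\<close>.\<close>

lemma iterate_tendsto_multiple:
  fixes x :: "complex^'n"
  assumes x: "C *v x = x" "x \<noteq> 0"
    and ev: "\<And>\<mu> z. C *v z = \<mu> *s z \<Longrightarrow> z \<noteq> 0 \<Longrightarrow> \<mu> = 1 \<or> cmod \<mu> < 1"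
    and gen: "\<And>y c. C *v y = y + c *s x \<Longrightarrow> \<exists>b. y = b *s x"
  shows "\<exists>c. (\<lambda>n. ((*v) C ^^ n) v) \<longlonglongrightarrow> c *s x"
proof -
  obtain p where p: "p \<noteq> 0" "pev C p v = 0" using exists_annihilator by blast
  obtain q where q: "p = [:-1, 1:] ^ Polynomial.order 1 p * q" "\<not> [:-1, 1:] dvd q"
    using order_decomp[OF p(1), of 1] by auto
  have q1: "poly q 1 \<noteq> 0" using q(2) by (simp add: poly_eq_0_iff_dvd)
  have "pev C ([:-1, 1:] ^ k) w = 0 \<Longrightarrow> \<exists>b. w = b *s x" for k w
  proof (induction k arbitrary: w)
    case 0
    then show ?case by (simp add: one_pCons exI[of _ 0])
  next
    case (Suc k)
    have "pev C ([:-1, 1:] ^ k * [:-1, 1:]) w = 0" using Suc.prems by (simp only: power_Suc mult.commute)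
    then have "pev C ([:-1, 1:] ^ k) (C *v w - w) = 0"
      by (simp only: pev_mult) (simp add: algebra_simps)
    then obtain b where "C *v w - w = b *s x" using Suc.IH by blast
    then have "C *v w = w + b *s x" by (metis add.commute diff_add_cancel)
    then show ?case by (rule gen)
  qed
  then obtain b where b: "pev C q v = b *s x" using p q(1) by (metis pev_mult)
  \<comment> \<open>Since \<open>q(C) x = q(1) x\<close>, this multiple cancels
    \<open>q(C) v = b x\<close>.\<close>
  define v' where "v' = v + (- b / poly q 1) *s x"
  have qv': "pev C q v' = 0"
  proof -
    have "pev C q v' = b *s x + (- b / poly q 1 * poly q 1) *s x"
      unfolding v'_def pev_add_right pev_scale_right b pev_fixed[OF x(1)] vector_smult_assoc ..
    then show ?thesis using q1 by (simp add: vec_eq_iff)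
  qed
  have "q \<noteq> 0" using q1 by auto
  then obtain M where M: "q = smult (lead_coeff q) (\<Prod>\<mu>\<in>#M. [:-\<mu>, 1:])"
    using alg_closed_imp_factorization by blast
  have "pev C (\<Prod>\<mu>\<in>#M. [:-\<mu>, 1:]) v' = 0"
    using qv' \<open>q \<noteq> 0\<close> by (subst (asm) M) (simp add: pev_smult)
  moreover have "1 \<notin># M"
  proof
    assume "1 \<in># M"
    then have "[:-1, 1:] dvd (\<Prod>\<mu>\<in>#M. [:-\<mu>, 1::complex:])"
      by (metis dvd_prod_mset image_eqI set_image_mset)
    then show False using q(2) M by (metis dvd_smult)
  qed
  ultimately have lim: "(\<lambda>n. ((*v) C ^^ n) v') \<longlonglongrightarrow> 0" using iterate_tendsto_0 ev by blast
  have "((*v) C ^^ n) v = ((*v) C ^^ n) v' + (b / poly q 1) *s x" for n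
  proof (induction n)
    case 0
    show ?case by (simp add: v'_def vec_eq_iff)
  next
    case (Suc n)
    then show ?case by (simp add: matrix_vector_right_distrib matrix_vector_mult_vscale x)
  qed
  then have "(\<lambda>n. ((*v) C ^^ n) v) \<longlonglongrightarrow> 0 + (b / poly q 1) *s x"
    using tendsto_add[OF lim tendsto_const[of "(b / poly q 1) *s x"]] by simp
  then show ?thesis by auto
qed

definition outer :: "real^'n \<Rightarrow> real^'n \<Rightarrow> real^'n^'n" where
  "outer p \<xi> = (\<chi> i j. p $ i * \<xi> $ j)"

lemma outer_mult_vector: "outer p \<xi> *v x = (\<xi> \<bullet> x) *\<^sub>R p"
  by (simp add: outer_def matrix_vector_mult_def vec_eq_iff inner_vec_def sum_distrib_left mult_ac)

lemma complexify_vector: "complexify A *v (\<chi> i. complex_of_real (v $ i)) = (\<chi> i. complex_of_real ((A *v v) $ i))"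
  by (simp add: complexify_def matrix_vector_mult_def vec_eq_iff)

lemma complexify_iterate:
  "((*v) (complexify A) ^^ n) (\<chi> i. complex_of_real (v $ i)) = (\<chi> i. complex_of_real ((matpow A n *v v) $ i))"
  by (induction n) (auto simp: complexify_vector matrix_vector_mul_assoc[symmetric])

text \<open>Otherwise every number would be a root, including one of modulus larger than that of
  \<alpha>.\<close>

lemma complex_charpoly_nz:
  assumes "dominant_eigenvalue A \<alpha>" shows "complex_charpoly A \<noteq> 0"
proof
  assume 0: "complex_charpoly A = 0"
  define \<mu> where "\<mu> = complex_of_real (cmod \<alpha> + 1)"
  have "cmod \<mu> = cmod \<alpha> + 1" unfolding \<mu>_def norm_of_real by simp
  with 0 assms show False unfolding dominant_eigenvalue_def by (metis less_add_one order_less_asym poly_0)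
qed

lemma matpow_scaleR: "matpow (c *\<^sub>R A) n = c ^ n *\<^sub>R matpow (A :: real^'n^'n) n"
  by (induction n) (auto simp: scalar_matrix_assoc matrix_scalar_ac mult.commute)

text \<open>Divided by \<alpha>, the matrix fixes \<open>x\<close>; dominance bounds its other
  eigenvalues, and simplicity of the root excludes Jordan chains over \<open>x\<close>. The columns
  of the limit are the limits for the basis vectors.\<close>

lemma dominant_powers_tendsto:
  assumes dom: "dominant_eigenvalue A (complex_of_real \<alpha>)" and "\<alpha> \<noteq> 0"
    and x: "A *v x = \<alpha> *\<^sub>R x" "x \<noteq> 0"
  obtains \<xi> where "\<xi> \<bullet> x = 1" "(\<lambda>n. inverse \<alpha> ^ n *\<^sub>R matpow A n) \<longlonglongrightarrow> outer x \<xi>"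
proof -
  define B where "B = inverse \<alpha> *\<^sub>R A"
  define C where "C = complexify B"
  define X where "X = (\<chi> i. complex_of_real (x $ i))"
  have Bx: "B *v x = x"
    using x \<open>\<alpha> \<noteq> 0\<close> by (simp add: B_def scaleR_matrix_vector_assoc[symmetric])
  have X: "C *v X = X" "X \<noteq> 0"
    using x(2) by (auto simp: C_def X_def complexify_vector Bx vec_eq_iff)
  have AC: "complexify A *v z = complex_of_real \<alpha> *s (C *v z)" for z
    using \<open>\<alpha> \<noteq> 0\<close>
    by (simp add: C_def B_def complexify_def matrix_vector_mult_def vec_eq_iff sum_distrib_left field_simps)
  have ev: "\<mu> = 1 \<or> cmod \<mu> < 1" if "C *v z = \<mu> *s z" "z \<noteq> 0" for \<mu> z
  proof -
    have "complexify A *v z = (complex_of_real \<alpha> * \<mu>) *s z"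
      by (simp add: AC that vector_smult_assoc)
    from eigenvalue_root_charpoly[OF this that(2)] dom
    have "complex_of_real \<alpha> * \<mu> = complex_of_real \<alpha> \<or> cmod (complex_of_real \<alpha> * \<mu>) < cmod (complex_of_real \<alpha>)"
      unfolding dominant_eigenvalue_def by blast
    then show ?thesis using \<open>\<alpha> \<noteq> 0\<close> by (auto simp: norm_mult)
  qed
  have gen: "\<exists>b. y = b *s X" if "C *v y = y + c *s X" for y c
  proof (rule ccontr)
    assume "\<nexists>b. y = b *s X"
    moreover have "complexify A *v X = complex_of_real \<alpha> *s X"
      by (simp add: AC X)
    moreover have "complexify A *v y = complex_of_real \<alpha> *s y + (complex_of_real \<alpha> * c) *s X"
      by (simp add: AC that vector_add_ldistrib vector_smult_assoc)
    ultimately have "[:- complex_of_real \<alpha>, 1:]\<^sup>2 dvd complex_charpoly A"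
      using order_ge_2_charpoly X(2) by blast
    then have "2 \<le> Polynomial.order (complex_of_real \<alpha>) (complex_charpoly A)"
      using complex_charpoly_nz[OF dom] by (simp add: order_divides)
    then show False using dom by (simp add: dominant_eigenvalue_def)
  qed
  have "\<exists>c. (\<lambda>n. ((*v) C ^^ n) v) \<longlonglongrightarrow> c *s X" for v
    by (rule iterate_tendsto_multiple[OF X ev gen])
  then obtain c where c: "\<And>v. (\<lambda>n. ((*v) C ^^ n) v) \<longlonglongrightarrow> c v *s X" by metis
  define \<xi> where "\<xi> = (\<chi> j. Re (c (\<chi> i. complex_of_real (axis j 1 $ i))))"
  have "(\<lambda>n. matpow B n $ i $ j) \<longlonglongrightarrow> outer x \<xi> $ i $ j" for i j
  proof -
    have "(\<lambda>n. (((*v) C ^^ n) (\<chi> i. complex_of_real (axis j 1 $ i))) $ i)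
        \<longlonglongrightarrow> (c (\<chi> i. complex_of_real (axis j 1 $ i)) *s X) $ i"
      by (intro tendsto_vec_nth c)
    from tendsto_Re[OF this]
    show ?thesis
      unfolding C_def complexify_iterate
      by (simp add: X_def outer_def \<xi>_def matrix_vector_mul_component inner_axis mult.commute)
  qed
  then have lim: "(\<lambda>n. matpow B n) \<longlonglongrightarrow> outer x \<xi>" by (intro vec_tendstoI)
  have "matpow B n *v x = x" for n
    by (induction n) (auto simp: Bx matrix_vector_mul_assoc[symmetric])
  moreover have "(\<lambda>n. matpow B n *v x) \<longlonglongrightarrow> outer x \<xi> *v x"
    by (intro tendsto_intros lim)
  ultimately have "(\<xi> \<bullet> x) *\<^sub>R x = x"
    by (simp add: outer_mult_vector LIMSEQ_const_iff)
  then have "\<xi> \<bullet> x = 1" using x(2) by (metis scaleR_cancel_right scaleR_one)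
  then show ?thesis using lim that by (simp add: B_def matpow_scaleR)
qed

section \<open>Elements in general position in a strongly irreducible group\<close>

lemma matrix_inv_mult:
  assumes "invertible (A :: real^'n^'n)"
  shows "A ** matrix_inv A = mat 1" "matrix_inv A ** A = mat 1"
  using someI_ex[OF assms[unfolded invertible_def]] by (auto simp: matrix_inv_def)

lemma matrix_inv_vector:
  assumes "invertible (A :: real^'n^'n)"
  shows "A *v (matrix_inv A *v x) = x" "matrix_inv A *v (A *v x) = x"
  using matrix_inv_mult[OF assms] by (simp_all add: matrix_vector_mul_assoc)

lemma matrix_inv_unique:
  fixes A B :: "real^'n^'n"
  assumes "A ** B = mat 1"
  shows "matrix_inv A = B"
proof -
  have "invertible A" using assms invertible_right_inverse by metis
  then have "matrix_inv A = matrix_inv A ** (A ** B)" by (simp add: assms)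
  also have "\<dots> = B" using matrix_inv_mult[OF \<open>invertible A\<close>] by (simp add: matrix_mul_assoc)
  finally show ?thesis .
qed

lemma invertible_matrix_inv: "invertible (A :: real^'n^'n) \<Longrightarrow> invertible (matrix_inv A)"
  using matrix_inv_mult by (auto simp: invertible_def)

lemma matrix_inv_matrix_inv: "invertible (A :: real^'n^'n) \<Longrightarrow> matrix_inv (matrix_inv A) = A"
  by (intro matrix_inv_unique matrix_inv_mult)

lemma matrix_inv_prod:
  assumes "invertible (A :: real^'n^'n)" "invertible (B :: real^'n^'n)"
  shows "matrix_inv (A ** B) = matrix_inv B ** matrix_inv A"
proof (rule matrix_inv_unique)
  have "A ** B ** (matrix_inv B ** matrix_inv A) = A ** (B ** matrix_inv B) ** matrix_inv A"
    by (simp only: matrix_mul_assoc)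
  then show "A ** B ** (matrix_inv B ** matrix_inv A) = mat 1"
    by (simp only: matrix_inv_mult[OF assms(1)] matrix_inv_mult[OF assms(2)] matrix_mul_rid)
qed

lemma matrix_add_rdistrib: "(A + B) ** C = A ** C + B ** (C :: real^'n^'m)"
  by (simp add: matrix_matrix_mult_def vec_eq_iff algebra_simps sum.distrib)

text \<open>Irreducibility for the topology whose closed sets are the finite unions of linear
  subspaces, which is all that strong irreducibility can see: \<open>W \<inter> S\<close> is dense
  in \<open>W\<close>.\<close>

definition essential :: "'a::euclidean_space set \<Rightarrow> 'a set \<Rightarrow> bool" where
  "essential S W \<longleftrightarrow> subspace W \<and>
     \<not> (\<exists>\<F>. finite \<F> \<and> (\<forall>F\<in>\<F>. subspace F \<and> F \<subset> W) \<and> W \<inter> S \<subseteq> \<Union>\<F>)"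

text \<open>If \<open>W\<close> is not essential, the proper subspaces covering its part of
  \<open>S\<close> have smaller dimension and are covered in turn.\<close>

lemma essential_cover:
  assumes "subspace W"
  shows "\<exists>\<F>. finite \<F> \<and> (\<forall>F\<in>\<F>. essential S F \<and> F \<subseteq> W) \<and> W \<inter> S \<subseteq> \<Union>\<F>"
  using assms
proof (induction "dim W" arbitrary: W rule: less_induct)
  case less
  show ?case
  proof (cases "essential S W")
    case True
    then show ?thesis by (intro exI[of _ "{W}"]) auto
  next
    case False
    then obtain \<F> where \<F>: "finite \<F>" "\<And>F. F \<in> \<F> \<Longrightarrow> subspace F \<and> F \<subset> W" "W \<inter> S \<subseteq> \<Union>\<F>"
      using less.prems by (auto simp: essential_def)
    have "\<exists>\<G>. finite \<G> \<and> (\<forall>H\<in>\<G>. essential S H \<and> H \<subseteq> F) \<and> F \<inter> S \<subseteq> \<Union>\<G>" if "F \<in> \<F>" for F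
    proof (rule less.hyps)
      have "span F = F" "span W = W" using \<F>(2)[OF that] less.prems by (auto simp: span_eq_iff)
      then show "dim F < dim W" using dim_psubset[of F W] \<F>(2)[OF that] by metis
      show "subspace F" using \<F>(2)[OF that] by simp
    qed
    then have "\<forall>F\<in>\<F>. \<exists>\<G>. finite \<G> \<and> (\<forall>H\<in>\<G>. essential S H \<and> H \<subseteq> F) \<and> F \<inter> S \<subseteq> \<Union>\<G>"
      by blast
    from bchoice[OF this]
    obtain \<G> where \<G>: "\<forall>F\<in>\<F>. finite (\<G> F) \<and> (\<forall>H\<in>\<G> F. essential S H \<and> H \<subseteq> F) \<and> F \<inter> S \<subseteq> \<Union>(\<G> F)"
      by blast
    have "W \<inter> S \<subseteq> \<Union>(\<Union>F\<in>\<F>. \<G> F)"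
    proof
      fix x assume x: "x \<in> W \<inter> S"
      then obtain F where F: "F \<in> \<F>" "x \<in> F \<inter> S" using \<F>(3) by auto
      then have "x \<in> \<Union>(\<G> F)" using bspec[OF \<G> F(1)] by (meson subsetD)
      then show "x \<in> \<Union>(\<Union>F\<in>\<F>. \<G> F)" using F(1) by auto
    qed
    moreover have "\<forall>H\<in>(\<Union>F\<in>\<F>. \<G> F). essential S H \<and> H \<subseteq> W"
    proof
      fix H assume "H \<in> (\<Union>F\<in>\<F>. \<G> F)"
      then obtain F where F: "F \<in> \<F>" "H \<in> \<G> F" by auto
      then show "essential S H \<and> H \<subseteq> W" using bspec[OF \<G> F(1)] \<F>(2)[OF F(1)] by (meson psubsetE subset_trans)
    qed
    ultimately show ?thesis using \<F>(1) \<G> by (intro exI[of _ "\<Union>F\<in>\<F>. \<G> F"]) auto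
  qed
qed

text \<open>Otherwise the intersections with \<open>W\<close> would be proper subspaces covering
  \<open>W \<inter> S\<close>.\<close>

lemma essential_subset_member:
  assumes "essential S W" "finite \<F>" "\<And>F. F \<in> \<F> \<Longrightarrow> subspace F" "W \<inter> S \<subseteq> \<Union>\<F>"
  obtains F where "F \<in> \<F>" "W \<subseteq> F"
proof (rule ccontr)
  assume "\<not> thesis"
  then have "\<forall>F\<in>\<F>. W \<inter> F \<subset> W" using that by auto
  moreover have "\<forall>F\<in>\<F>. subspace (W \<inter> F)" using assms by (auto simp: essential_def subspace_inter)
  moreover have "W \<inter> S \<subseteq> \<Union>((\<inter>) W ` \<F>)" using assms(4) by auto
  ultimately show False using assms(1,2) unfolding essential_def by (metis (no_types, lifting) finite_imageI imageE)
qed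

text \<open>The irreducible components of \<open>S\<close>. There are finitely many, and linear
  automorphisms preserving \<open>S\<close> permute them; so a group acting on \<open>S\<close> has
  finite orbits on these subspaces.\<close>

definition max_essential :: "'a::euclidean_space set \<Rightarrow> 'a set set" where
  "max_essential S = {W. essential S W \<and> (\<forall>W'. essential S W' \<and> W \<subseteq> W' \<longrightarrow> W' = W)}"

lemma finite_max_essential: "finite (max_essential S)"
  and max_essential_nonempty: "S \<noteq> {} \<Longrightarrow> max_essential S \<noteq> {}"
proof -
  obtain \<F> where \<F>: "finite \<F>" "\<And>F. F \<in> \<F> \<Longrightarrow> essential S F" "S \<subseteq> \<Union>\<F>"
    using essential_cover[OF subspace_UNIV, of S] by auto
  have in_\<F>: "\<exists>F\<in>\<F>. W \<subseteq> F" if "essential S W" for W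
    using essential_subset_member[OF that \<F>(1)] \<F>(2,3) by (metis essential_def inf.coboundedI2)
  have "max_essential S \<subseteq> \<F>"
    using in_\<F> \<F>(2) by (force simp: max_essential_def)
  then show "finite (max_essential S)" using \<F>(1) finite_subset by blast
  assume "S \<noteq> {}"
  then have "\<F> \<noteq> {}" using \<F>(3) by auto
  then obtain F where F: "F \<in> \<F>" "\<And>F'. F' \<in> \<F> \<Longrightarrow> F \<subseteq> F' \<Longrightarrow> F' = F"
    using finite_has_maximal[OF \<F>(1)] by blast
  have "F \<in> max_essential S"
    unfolding max_essential_def
  proof (intro CollectI conjI allI impI)
    show "essential S F" using F \<F> by blast
    fix W' assume W': "essential S W' \<and> F \<subseteq> W'"
    then obtain F' where "F' \<in> \<F>" "W' \<subseteq> F'" using in_\<F> by blast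
    with F W' show "W' = F" by blast
  qed
  then show "max_essential S \<noteq> {}" by blast
qed

lemma essential_image:
  assumes W: "essential S W" and "linear L" "linear L'" "\<And>x. L' (L x) = x" "\<And>x. L (L' x) = x"
    and "L ` S = S"
  shows "essential S (L ` W)"
  unfolding essential_def
proof (intro conjI notI)
  show "subspace (L ` W)" using assms by (simp add: essential_def linear_subspace_image)
  assume "\<exists>\<F>. finite \<F> \<and> (\<forall>F\<in>\<F>. subspace F \<and> F \<subset> L ` W) \<and> L ` W \<inter> S \<subseteq> \<Union>\<F>"
  then obtain \<F> where "finite \<F> \<and> (\<forall>F\<in>\<F>. subspace F \<and> F \<subset> L ` W) \<and> L ` W \<inter> S \<subseteq> \<Union>\<F>" ..
  then have \<F>: "finite \<F>" "\<And>F. F \<in> \<F> \<Longrightarrow> subspace F \<and> F \<subset> L ` W" "L ` W \<inter> S \<subseteq> \<Union>\<F>"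
    by simp_all
  have L'L: "L' ` L ` X = X" "L ` L' ` X = X" for X
    using assms(4,5) by (simp_all add: image_image)
  have "subspace F \<and> F \<subset> W" if F: "F \<in> (`) L' ` \<F>" for F
  proof -
    obtain F0 where F0: "F0 \<in> \<F>" "F = L' ` F0" using F by blast
    then have "F \<subseteq> L' ` L ` W" using \<F>(2)[OF F0(1)] by (metis image_mono psubsetE)
    moreover have "F \<noteq> W" using \<F>(2)[OF F0(1)] F0(2) L'L(2)[of F0] by auto
    ultimately show ?thesis using F0 \<F>(2)[OF F0(1)] assms(3) by (auto simp: L'L linear_subspace_image)
  qed
  then have "\<forall>F\<in>(`) L' ` \<F>. subspace F \<and> F \<subset> W" by blast
  moreover have "W \<inter> S \<subseteq> \<Union>((`) L' ` \<F>)"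
  proof
    fix x assume x: "x \<in> W \<inter> S"
    then have "L x \<in> L ` W \<inter> S" using assms(6) by blast
    then have "L x \<in> \<Union>\<F>" using \<F>(3) by (rule rev_subsetD)
    then obtain F where "F \<in> \<F>" "L x \<in> F" by (rule UnionE)
    moreover have "x \<in> L' ` F" using \<open>L x \<in> F\<close> assms(4)[of x] by (metis imageI)
    ultimately show "x \<in> \<Union>((`) L' ` \<F>)" by blast
  qed
  ultimately show False using W \<F>(1) unfolding essential_def by (metis finite_imageI)
qed

lemma max_essential_image:
  assumes W: "W \<in> max_essential S" and L: "linear L" "linear L'" "\<And>x. L' (L x) = x" "\<And>x. L (L' x) = x"
    and S: "L ` S = S"
  shows "L ` W \<in> max_essential S"
  unfolding max_essential_def
proof (intro CollectI conjI allI impI)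
  show "essential S (L ` W)"
    using W by (intro essential_image[OF _ L S]) (auto simp: max_essential_def)
  fix W' assume W': "essential S W' \<and> L ` W \<subseteq> W'"
  have im: "L' ` L ` X = X" "L ` L' ` X = X" for X
    using L(3,4) by (simp_all add: image_image)
  have S': "L' ` S = S" using im(1)[of S] S by simp
  have "essential S (L' ` W')" using W' by (intro essential_image[OF _ L(2,1,4,3) S']) auto
  moreover have "W \<subseteq> L' ` W'" using W' im(1)[of W] by (metis image_mono)
  ultimately have "L' ` W' = W" using W by (auto simp: max_essential_def)
  then show "W' = L ` W" using im(2)[of W'] by simp
qed

text \<open>\<open>strong\<close> is about families of subspaces instead of their unions: an
  invariant family would have an invariant union.\<close>

locale irreducible_matrix_group =
  fixes G :: "(real^'n^'n) set"
  assumes inv: "A \<in> G \<Longrightarrow> invertible A"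
    and mult: "A \<in> G \<Longrightarrow> B \<in> G \<Longrightarrow> A ** B \<in> G"
    and inverse: "A \<in> G \<Longrightarrow> matrix_inv A \<in> G"
    and nonempty: "G \<noteq> {}"
    and strong: "\<lbrakk>finite \<S>; \<S> \<noteq> {}; \<And>S. S \<in> \<S> \<Longrightarrow> subspace S \<and> S \<noteq> {0} \<and> S \<noteq> UNIV\<rbrakk>
      \<Longrightarrow> \<exists>A\<in>G. \<exists>S\<in>\<S>. (*v) A ` S \<notin> \<S>"
begin

text \<open>The orbit of a proper non-zero \<open>U\<close> would be a finite family permuted by
  \<open>G\<close>.\<close>

lemma not_proper_finite_orbit:
  assumes "finite ((\<lambda>A. (*v) A ` U) ` G)" "subspace U" "U \<noteq> {0}"
  shows "U = UNIV"
proof (rule ccontr)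
  assume "U \<noteq> UNIV"
  let ?S = "(\<lambda>A. (*v) A ` U) ` G"
  have "subspace S \<and> S \<noteq> {0} \<and> S \<noteq> UNIV" if S: "S \<in> ?S" for S
  proof -
    obtain A where A: "A \<in> G" "S = (*v) A ` U" using S by blast
    have "invertible A" using A inv by blast
    obtain u where "u \<in> U" "u \<noteq> 0" using assms(2,3) subspace_0 by blast
    then have "A *v u \<in> S" "A *v u \<noteq> 0" using A matrix_vector_nz[OF \<open>invertible A\<close>] by auto
    moreover obtain w where "w \<notin> U" using \<open>U \<noteq> UNIV\<close> by blast
    then have "A *v w \<notin> S" using A inj_matrix_vector_mult[OF \<open>invertible A\<close>] by (auto simp: inj_def)
    ultimately show ?thesis using assms(2) A by (auto intro!: linear_subspace_image matrix_vector_mul_linear)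
  qed
  moreover have "\<forall>A\<in>G. \<forall>S\<in>?S. (*v) A ` S \<in> ?S"
  proof (intro ballI)
    fix A S assume "A \<in> G" "S \<in> ?S"
    then obtain B where B: "B \<in> G" "S = (*v) B ` U" by blast
    then have "(*v) A ` S = (*v) (A ** B) ` U" by (simp add: image_image matrix_vector_mul_assoc)
    then show "(*v) A ` S \<in> ?S" using mult \<open>A \<in> G\<close> B by blast
  qed
  ultimately show False using strong[OF assms(1)] nonempty by blast
qed

definition inv_graph :: "((real^'n^'n) \<times> (real^'n^'n)) set" where
  "inv_graph = (\<lambda>A. (A, matrix_inv A)) ` G"

text \<open>Left translation by \<open>B\<close> on the graph of inversion, extended linearly to all
  pairs of matrices.\<close>

definition left_shift :: "real^'n^'n \<Rightarrow> (real^'n^'n) \<times> (real^'n^'n) \<Rightarrow> (real^'n^'n) \<times> (real^'n^'n)" where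
  "left_shift B Z = (B ** fst Z, snd Z ** matrix_inv B)"

lemma linear_left_shift: "linear (left_shift B)"
  by (rule linearI)
     (auto simp: left_shift_def matrix_add_ldistrib matrix_add_rdistrib scalar_matrix_assoc matrix_scalar_ac)

lemma left_shift_left_shift:
  assumes "invertible B" shows "left_shift (matrix_inv B) (left_shift B Z) = Z" "left_shift B (left_shift (matrix_inv B) Z) = Z"
proof -
  have "X ** (B ** matrix_inv B) = X" "X ** (matrix_inv B ** B) = X"
    "(B ** matrix_inv B) ** X = X" "(matrix_inv B ** B) ** X = X" for X
    by (simp_all add: matrix_inv_mult assms)
  then show "left_shift (matrix_inv B) (left_shift B Z) = Z" "left_shift B (left_shift (matrix_inv B) Z) = Z"
    by (simp_all add: left_shift_def matrix_inv_matrix_inv assms matrix_mul_assoc)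
qed

lemma left_shift_inv_graph: assumes "B \<in> G" shows "left_shift B ` inv_graph = inv_graph"
proof -
  have sub: "left_shift B ` inv_graph \<subseteq> inv_graph" if "B \<in> G" for B
  proof
    fix Z assume "Z \<in> left_shift B ` inv_graph"
    then obtain A where A: "A \<in> G" "Z = left_shift B (A, matrix_inv A)" by (auto simp: inv_graph_def)
    then have "Z = (B ** A, matrix_inv (B ** A))"
      using inv[OF A(1)] inv[OF that] by (simp add: left_shift_def matrix_inv_prod)
    then show "Z \<in> inv_graph" using mult[OF that A(1)] by (simp add: inv_graph_def)
  qed
  show ?thesis
  proof
    show "inv_graph \<subseteq> left_shift B ` inv_graph"
    proof
      fix Z assume "Z \<in> inv_graph"
      then have "left_shift (matrix_inv B) Z \<in> inv_graph" using sub[OF inverse[OF assms]] by (meson imageI subsetD)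
      then show "Z \<in> left_shift B ` inv_graph" using left_shift_left_shift(2)[OF inv[OF assms]] by (metis imageI)
    qed
  qed (use sub assms in blast)
qed

text \<open>If no element worked, finitely many hyperplanes would cover the graph of inversion, and
  a component \<open>W\<close> of the graph would lie in one of them. The translates of
  \<open>W\<close> are finitely many, so a subspace of \<open>V\<close> attached equivariantly to
  \<open>W\<close> has a finite orbit; but it is neither zero nor everything.\<close>

lemma generic_element:
  assumes P: "finite P" "\<And>\<xi> v. (\<xi>, v) \<in> P \<Longrightarrow> \<xi> \<noteq> 0 \<and> v \<noteq> 0"
  shows "\<exists>A\<in>G. \<forall>(\<xi>, v)\<in>P. \<xi> \<bullet> (A *v v) \<noteq> 0 \<and> \<xi> \<bullet> (matrix_inv A *v v) \<noteq> 0"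
proof (rule ccontr)
  assume neg: "\<not> ?thesis"
  define H1 where "H1 = (\<lambda>(\<xi>, v). {Z :: (real^'n^'n) \<times> (real^'n^'n). \<xi> \<bullet> (fst Z *v v) = 0})"
  define H2 where "H2 = (\<lambda>(\<xi>, v). {Z :: (real^'n^'n) \<times> (real^'n^'n). \<xi> \<bullet> (snd Z *v v) = 0})"
  have sub: "subspace F" if "F \<in> H1 ` P \<union> H2 ` P" for F
    using that by (auto simp: H1_def H2_def subspace_def matrix_vector_mult_add_rdistrib inner_add_right
        scaleR_matrix_vector_assoc[symmetric])
  have cov: "inv_graph \<subseteq> \<Union>(H1 ` P \<union> H2 ` P)"
    using neg by (fastforce simp: inv_graph_def H1_def H2_def)
  have "inv_graph \<noteq> {}" using nonempty by (simp add: inv_graph_def)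
  then obtain W where W: "W \<in> max_essential inv_graph" using max_essential_nonempty by blast
  then have essW: "essential inv_graph W" and subW: "subspace W"
    by (auto simp: max_essential_def essential_def)
  have orbW: "(\<lambda>B. left_shift B ` W) ` G \<subseteq> max_essential inv_graph"
    using max_essential_image[OF W linear_left_shift linear_left_shift] left_shift_left_shift inv left_shift_inv_graph by blast
  then have fin: "finite ((\<lambda>B. left_shift B ` W) ` G)" using finite_max_essential finite_subset by blast
  \<comment> \<open>Otherwise the empty family of proper subspaces would be a cover.\<close>
  have "\<exists>Z. Z \<in> W \<inter> inv_graph"
    using essW unfolding essential_def by (metis Union_empty empty_iff equals0I finite.emptyI order_refl)
  then obtain A where A: "A \<in> G" "(A, matrix_inv A) \<in> W" by (auto simp: inv_graph_def)
  obtain F where F: "F \<in> H1 ` P \<union> H2 ` P" "W \<subseteq> F"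
  proof (rule essential_subset_member[OF essW, of "H1 ` P \<union> H2 ` P"])
    show "finite (H1 ` P \<union> H2 ` P)" using P(1) by simp
    show "W \<inter> inv_graph \<subseteq> \<Union>(H1 ` P \<union> H2 ` P)" using cov by (rule le_infI2)
  qed (use sub in auto)
  then consider \<xi> v where "(\<xi>, v) \<in> P" "W \<subseteq> H1 (\<xi>, v)" | \<xi> v where "(\<xi>, v) \<in> P" "W \<subseteq> H2 (\<xi>, v)"
    by force
  then show False
  proof cases
    case 1
    then have nz: "\<xi> \<noteq> 0" "v \<noteq> 0" using P(2) by auto
    define f where "f W = (\<lambda>Z. fst Z *v v) ` W" for W :: "((real^'n^'n) \<times> (real^'n^'n)) set"
    have lin: "linear (\<lambda>Z :: (real^'n^'n) \<times> (real^'n^'n). fst Z *v v)"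
      by (rule linearI) (auto simp: matrix_vector_mult_add_rdistrib scaleR_matrix_vector_assoc[symmetric])
    have "(*v) B ` f W = f (left_shift B ` W)" for B
      by (simp add: f_def left_shift_def image_image matrix_vector_mul_assoc)
    then have "(\<lambda>B. (*v) B ` f W) ` G = f ` ((\<lambda>B. left_shift B ` W) ` G)" by (simp add: image_image)
    then have "finite ((\<lambda>B. (*v) B ` f W) ` G)" using fin by simp
    moreover have "subspace (f W)" unfolding f_def using lin subW by (rule linear_subspace_image)
    moreover have "f W \<noteq> {0}"
    proof -
      have "A *v v \<in> f W" using A(2) by (force simp: f_def)
      then show ?thesis using matrix_vector_nz[OF inv[OF A(1)] nz(2)] by auto
    qed
    ultimately have "f W = UNIV" by (rule not_proper_finite_orbit)
    then have "\<xi> \<in> f W" by simp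
    then have "\<xi> \<bullet> \<xi> = 0" using 1(2) by (auto simp: f_def H1_def)
    then show False using nz by simp
  next
    case 2
    then have nz: "\<xi> \<noteq> 0" "v \<noteq> 0" using P(2) by auto
    \<comment> \<open>On second components a translation acts from the right, so the equivariant
      subspace is a common kernel; in the first case it is an image.\<close>
    define f where "f W = {x. \<forall>Z\<in>W. \<xi> \<bullet> (snd Z *v x) = 0}" for W :: "((real^'n^'n) \<times> (real^'n^'n)) set"
    have "(*v) B ` f W = f (left_shift B ` W)" if "B \<in> G" for B
    proof
      show "(*v) B ` f W \<subseteq> f (left_shift B ` W)"
        using matrix_inv_vector[OF inv[OF that]]
        by (auto simp: f_def left_shift_def matrix_vector_mul_assoc[symmetric])
      show "f (left_shift B ` W) \<subseteq> (*v) B ` f W"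
      proof
        fix x assume x: "x \<in> f (left_shift B ` W)"
        then have "matrix_inv B *v x \<in> f W"
          by (auto simp: f_def left_shift_def matrix_vector_mul_assoc[symmetric])
        then show "x \<in> (*v) B ` f W" using matrix_inv_vector(1)[OF inv[OF that]] by (metis imageI)
      qed
    qed
    then have "(\<lambda>B. (*v) B ` f W) ` G = f ` ((\<lambda>B. left_shift B ` W) ` G)" by (force simp: image_image)
    then have "finite ((\<lambda>B. (*v) B ` f W) ` G)" using fin by simp
    moreover have "subspace (f W)"
      by (auto simp: f_def subspace_def matrix_vector_right_distrib inner_add_right matrix_vector_mult_scaleR)
    moreover have "f W \<noteq> {0}"
    proof -
      have "v \<in> f W" using 2(2) by (auto simp: f_def H2_def)
      then show ?thesis using nz by auto
    qed
    ultimately have "f W = UNIV" by (rule not_proper_finite_orbit)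
    \<comment> \<open>Tested on the pair \<open>(A, matrix_inv A)\<close> of \<open>W\<close>, this
      vector gives \<open>\<xi> \<bullet> \<xi>\<close>.\<close>
    then have "A *v \<xi> \<in> f W" by simp
    then have "\<xi> \<bullet> (matrix_inv A *v (A *v \<xi>)) = 0" using A(2) by (force simp: f_def)
    then show False using nz matrix_inv_vector[OF inv[OF A(1)]] by simp
  qed
qed

end

section \<open>Perturbation of rank one projections\<close>

lemma norm_matrix_vector_mult_le: "norm (A *v x) \<le> norm (A :: real^'n^'m) * norm x"
proof -
  have "norm (A *v x) = L2_set (\<lambda>i. \<bar>A $ i \<bullet> x\<bar>) UNIV"
    by (simp add: norm_vec_def matrix_vector_mul_component)
  also have "\<dots> \<le> L2_set (\<lambda>i. norm (A $ i) * norm x) UNIV"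
    by (intro L2_set_mono) (auto intro: Cauchy_Schwarz_ineq2)
  also have "\<dots> = norm A * norm x"
    by (simp add: L2_set_left_distrib[symmetric] norm_vec_def)
  finally show ?thesis .
qed

lemma matrix_tendstoI:
  assumes "\<And>v. ((\<lambda>n. A n *v v) \<longlongrightarrow> (B :: real^'n^'m) *v v) F"
  shows "(A \<longlongrightarrow> B) F"
proof (intro vec_tendstoI)
  fix i j
  have "((\<lambda>n. (A n *v axis j 1) $ i) \<longlongrightarrow> (B *v axis j 1) $ i) F"
    by (intro tendsto_vec_nth assms)
  then show "((\<lambda>n. A n $ i $ j) \<longlongrightarrow> B $ i $ j) F"
    by (simp add: matrix_vector_mul_component inner_axis)
qed

text \<open>Brouwer's theorem for \<open>D\<close>, rescaled so that \<open>\<xi>\<close> takes the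
  value 1, on a small ball around \<open>p\<close>. When \<open>D\<close> is the projection itself
  this map is constantly \<open>p\<close>; its fixed points are eigenvectors.\<close>

lemma eigenvector_near_projection:
  fixes p \<xi> :: "real^'n"
  assumes "\<xi> \<bullet> p = 1" "r > 0"
  shows "\<exists>e>0. \<forall>D. norm (D - outer p \<xi>) < e \<longrightarrow>
    (\<exists>q l. norm (q - p) \<le> r \<and> l \<ge> 1/4 \<and> D *v q = l *\<^sub>R q)"
proof -
  have "\<xi> \<noteq> 0" using assms by auto
  \<comment> \<open>Keeps \<open>\<xi> \<bullet> x\<close> within 1/2 of 1 on the ball of radius
    \<open>s\<close>.\<close>
  define s where "s = min r (1 / (2 * norm \<xi>))"
  have s: "s > 0" "s \<le> r" "norm \<xi> * s \<le> 1/2"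
    using assms \<open>\<xi> \<noteq> 0\<close> by (auto simp: s_def min_def field_simps)
  define b where "b = norm p + s"
  \<comment> \<open>\<open>b\<close> bounds the vectors of the ball. The first term keeps
    \<open>\<xi> \<bullet> (D *v x)\<close> above 1/4; the second makes the displacement at most
    \<open>s / 4\<close> before the division by that number, hence at most \<open>s\<close> after
    it.\<close>
  define e where "e = min (1 / (4 * (norm \<xi> * b + 1))) (s / (4 * (b * (1 + norm \<xi> * norm p) + 1)))"
  have b: "b > 0" using s by (simp add: b_def add_nonneg_pos)
  have e: "e > 0" using s b by (auto simp: e_def intro!: divide_pos_pos add_nonneg_pos mult_nonneg_nonneg)
  have nn: "norm \<xi> * b \<ge> 0" "b * (1 + norm \<xi> * norm p) \<ge> 0" using b by auto
  have "e * (4 * (norm \<xi> * b + 1)) \<le> 1"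
  proof -
    have "e \<le> 1 / (4 * (norm \<xi> * b + 1))" by (simp add: e_def)
    then show ?thesis using nn by (simp add: pos_le_divide_eq)
  qed
  then have e1: "norm \<xi> * (e * b) \<le> 1/4" using e nn by (simp add: algebra_simps)
  have "e * (4 * (b * (1 + norm \<xi> * norm p) + 1)) \<le> s"
  proof -
    have "e \<le> s / (4 * (b * (1 + norm \<xi> * norm p) + 1))" by (simp add: e_def)
    then show ?thesis using nn by (simp add: pos_le_divide_eq)
  qed
  then have e2: "e * b + norm \<xi> * (e * b) * norm p \<le> s / 4" using e nn by (simp add: algebra_simps)
  show ?thesis
  proof (rule exI[of _ e], intro conjI allI impI)
    show "e > 0" by fact
    fix D assume D: "norm (D - outer p \<xi>) < e"
    define E where "E = D - outer p \<xi>"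
    have Dx: "D *v x = (\<xi> \<bullet> x) *\<^sub>R p + E *v x" for x
      by (simp add: E_def matrix_vector_mult_diff_rdistrib outer_mult_vector)
    have Ex: "norm (E *v x) \<le> e * b" if "x \<in> cball p s" for x
    proof -
      have "norm x \<le> b" using that norm_triangle_sub[of x p] by (simp add: b_def dist_norm norm_minus_commute)
      then have "norm E * norm x \<le> e * b" using D b e by (intro mult_mono) (auto simp: E_def)
      then show ?thesis using norm_matrix_vector_mult_le[of E x] by linarith
    qed
    have xiE: "\<bar>\<xi> \<bullet> (E *v x)\<bar> \<le> norm \<xi> * (e * b)" if "x \<in> cball p s" for x
      using Cauchy_Schwarz_ineq2[of \<xi> "E *v x"] mult_left_mono[OF Ex[OF that], of "norm \<xi>"] by simp
    have xix: "\<bar>\<xi> \<bullet> x - 1\<bar> \<le> 1/2" if "x \<in> cball p s" for x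
    proof -
      have "\<xi> \<bullet> x - 1 = \<xi> \<bullet> (x - p)" using assms by (simp add: inner_diff_right)
      then have "\<bar>\<xi> \<bullet> x - 1\<bar> \<le> norm \<xi> * norm (x - p)" using Cauchy_Schwarz_ineq2 by metis
      also have "\<dots> \<le> norm \<xi> * s" using that by (intro mult_left_mono) (auto simp: dist_norm norm_minus_commute)
      finally show ?thesis using s by simp
    qed
    have xiD: "\<xi> \<bullet> (D *v x) = \<xi> \<bullet> x + \<xi> \<bullet> (E *v x)" for x
      using assms by (simp add: Dx inner_add_right)
    have pos: "\<xi> \<bullet> (D *v x) \<ge> 1/4" if "x \<in> cball p s" for x
    proof -
      have "\<xi> \<bullet> x \<ge> 1/2" "\<xi> \<bullet> (E *v x) \<ge> - (1/4)"
        using xix[OF that] xiE[OF that] e1 by linarith+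
      then show ?thesis unfolding xiD by linarith
    qed
    define f where "f x = inverse (\<xi> \<bullet> (D *v x)) *\<^sub>R (D *v x)" for x
    have "continuous_on (cball p s) f"
      unfolding f_def using pos
      by (intro continuous_intros matrix_vector_mult_linear_continuous_on) force
    moreover have "f \<in> cball p s \<rightarrow> cball p s"
    proof
      fix x assume x: "x \<in> cball p s"
      have "f x - p = inverse (\<xi> \<bullet> (D *v x)) *\<^sub>R (D *v x - (\<xi> \<bullet> (D *v x)) *\<^sub>R p)"
        using pos[OF x] by (simp add: f_def algebra_simps)
      also have "D *v x - (\<xi> \<bullet> (D *v x)) *\<^sub>R p = E *v x - (\<xi> \<bullet> (E *v x)) *\<^sub>R p"
        using Dx[of x] xiD[of x] by (simp add: algebra_simps)
      finally have "norm (f x - p) = inverse (\<xi> \<bullet> (D *v x)) * norm (E *v x - (\<xi> \<bullet> (E *v x)) *\<^sub>R p)"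
        using pos[OF x] by simp
      also have "\<dots> \<le> 4 * (e * b + norm \<xi> * (e * b) * norm p)"
      proof (intro mult_mono)
        show "inverse (\<xi> \<bullet> (D *v x)) \<le> 4" using pos[OF x] by (simp add: field_simps)
        have "norm (E *v x - (\<xi> \<bullet> (E *v x)) *\<^sub>R p) \<le> norm (E *v x) + \<bar>\<xi> \<bullet> (E *v x)\<bar> * norm p"
          by (metis norm_scaleR norm_triangle_ineq4)
        also have "\<dots> \<le> e * b + norm \<xi> * (e * b) * norm p"
          using Ex[OF x] xiE[OF x] by (intro add_mono mult_right_mono) auto
        finally show "norm (E *v x - (\<xi> \<bullet> (E *v x)) *\<^sub>R p) \<le> e * b + norm \<xi> * (e * b) * norm p" .
      qed auto
      also have "\<dots> \<le> s" using e2 by simp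
      finally show "f x \<in> cball p s" by (simp add: dist_norm norm_minus_commute)
    qed
    ultimately obtain q where q: "q \<in> cball p s" "f q = q" using brouwer_ball[OF s(1)] by blast
    then have "D *v q = (\<xi> \<bullet> (D *v q)) *\<^sub>R q"
      using pos[OF q(1)] unfolding f_def by (metis (no_types, lifting) less_le_trans not_less
          right_inverse scaleR_one scaleR_scaleR zero_less_divide_1_iff zero_less_numeral order_refl)
    then show "\<exists>q l. norm (q - p) \<le> r \<and> l \<ge> 1/4 \<and> D *v q = l *\<^sub>R q"
      using pos[OF q(1)] q(1) s(2) by (intro exI[of _ q] exI[of _ "\<xi> \<bullet> (D *v q)"])
        (auto simp: dist_norm norm_minus_commute)
  qed
qed

lemma norm_transpose: "norm (transpose A) = norm (A :: real^'n^'m)"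
proof -
  have "(norm (transpose A))\<^sup>2 = (\<Sum>j\<in>UNIV. \<Sum>i\<in>UNIV. (A $ i $ j)\<^sup>2)"
    by (simp add: norm_vec_def L2_set_def transpose_def sum_nonneg)
  also have "\<dots> = (\<Sum>i\<in>UNIV. \<Sum>j\<in>UNIV. (A $ i $ j)\<^sup>2)" by (rule sum.swap)
  also have "\<dots> = (norm A)\<^sup>2" by (simp add: norm_vec_def L2_set_def sum_nonneg)
  finally show ?thesis by simp
qed

text \<open>Eigenvectors \<open>q\<close> of \<open>D\<close> and \<open>\<eta>\<close> of its
  transpose exist near \<open>p\<close> and \<open>\<xi>\<close>. They pair to a non-zero number, so
  they share the eigenvalue \<open>l\<close>, and \<open>V\<close> splits into the line of
  \<open>q\<close> and the kernel of \<open>\<eta>\<close>. On that kernel \<open>D\<close> has norm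
  at most 1/8, while \<open>l\<close> is at least 1/4.\<close>

lemma matpow_near_projection:
  fixes p \<xi> :: "real^'n"
  assumes "\<xi> \<bullet> p = 1"
  shows "\<exists>e>0. \<forall>D. norm (D - outer p \<xi>) < e \<longrightarrow>
    (\<exists>q \<eta> l. l > 0 \<and> \<eta> \<bullet> q = 1 \<and> (\<lambda>n. inverse l ^ n *\<^sub>R matpow D n) \<longlonglongrightarrow> outer q \<eta>)"
proof -
  define c where "c = norm p + norm \<xi> + 1"
  \<comment> \<open>On the kernel of \<open>\<eta>\<close>, \<open>\<xi>\<close> is at most
    \<open>r\<close> times the norm; so \<open>(\<xi> \<bullet> x) p\<close> contributes at most
    \<open>r * c = 1/16\<close>, and the distance of \<open>D\<close> to the projection another
    1/16.\<close>
  define r where "r = 1 / (16 * c)"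
  have c: "c \<ge> 1" by (simp add: c_def)
  then have r: "r > 0" "r * c = 1/16" "r \<le> 1/16" by (auto simp: r_def field_simps)
  obtain e1 where e1: "e1 > 0" "\<And>D. norm (D - outer p \<xi>) < e1 \<Longrightarrow>
      \<exists>q l. norm (q - p) \<le> r \<and> l \<ge> 1/4 \<and> D *v q = l *\<^sub>R q"
    using eigenvector_near_projection[OF assms r(1)] by blast
  have "p \<bullet> \<xi> = 1" using assms by (simp add: inner_commute)
  from eigenvector_near_projection[OF this r(1)]
  obtain e2 where e2: "e2 > 0" "\<And>D. norm (D - outer \<xi> p) < e2 \<Longrightarrow>
      \<exists>q l. norm (q - \<xi>) \<le> r \<and> l \<ge> 1/4 \<and> D *v q = l *\<^sub>R q"
    by blast
  show ?thesis
  proof (rule exI[of _ "min (min e1 e2) (1/16)"], intro conjI allI impI)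
    show "min (min e1 e2) (1/16) > 0" using e1 e2 by simp
    fix D assume D: "norm (D - outer p \<xi>) < min (min e1 e2) (1/16)"
    then obtain q l where q: "norm (q - p) \<le> r" "l \<ge> 1/4" "D *v q = l *\<^sub>R q" using e1(2)[of D] by auto
    have "transpose D - outer \<xi> p = transpose (D - outer p \<xi>)"
      by (simp add: transpose_def outer_def vec_eq_iff mult.commute)
    then have "norm (transpose D - outer \<xi> p) < e2" using D by (simp add: norm_transpose)
    then obtain \<eta> l' where \<eta>: "norm (\<eta> - \<xi>) \<le> r" "l' \<ge> 1/4" "transpose D *v \<eta> = l' *\<^sub>R \<eta>"
      using e2(2) by blast
    have \<eta>D: "\<eta> \<bullet> (D *v x) = l' * (\<eta> \<bullet> x)" for x
    proof -
      have "\<eta> \<bullet> (D *v x) = (transpose D *v \<eta>) \<bullet> x"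
        by (metis dot_lmul_matrix transpose_matrix_vector)
      then show ?thesis using \<eta>(3) by simp
    qed
    have "\<bar>\<eta> \<bullet> q - 1\<bar> \<le> 1/2"
    proof -
      have "\<eta> \<bullet> q - 1 = (\<eta> - \<xi>) \<bullet> (q - p) + (\<eta> - \<xi>) \<bullet> p + \<xi> \<bullet> (q - p)"
        using assms by (simp add: inner_diff_left inner_diff_right)
      also have "\<bar>\<dots>\<bar> \<le> norm (\<eta> - \<xi>) * norm (q - p) + norm (\<eta> - \<xi>) * norm p + norm \<xi> * norm (q - p)"
        using Cauchy_Schwarz_ineq2[of "\<eta> - \<xi>" "q - p"] Cauchy_Schwarz_ineq2[of "\<eta> - \<xi>" p]
          Cauchy_Schwarz_ineq2[of \<xi> "q - p"] by linarith
      also have "\<dots> \<le> r * r + r * norm p + norm \<xi> * r"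
        using q(1) \<eta>(1) r by (intro add_mono mult_mono) auto
      also have "\<dots> \<le> r * c" using r by (simp add: c_def algebra_simps mult_left_le)
      finally show ?thesis using r by simp
    qed
    then have nz: "\<eta> \<bullet> q \<ge> 1/2" by linarith
    have "l * (\<eta> \<bullet> q) = l' * (\<eta> \<bullet> q)" using \<eta>D[of q] q(3) by simp
    then have "l' = l" using nz by simp
    define \<zeta> where "\<zeta> = inverse (\<eta> \<bullet> q) *\<^sub>R \<eta>"
    have \<zeta>q: "\<zeta> \<bullet> q = 1" using nz by (simp add: \<zeta>_def)
    have small: "norm (D *v x) \<le> 1/8 * norm x" if "\<eta> \<bullet> x = 0" for x
    proof -
      have "D *v x = (\<xi> \<bullet> x) *\<^sub>R p + (D - outer p \<xi>) *v x"
        by (simp add: matrix_vector_mult_diff_rdistrib outer_mult_vector)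
      then have "norm (D *v x) \<le> \<bar>\<xi> \<bullet> x\<bar> * norm p + norm (D - outer p \<xi>) * norm x"
        by (metis norm_matrix_vector_mult_le norm_scaleR norm_triangle_mono order_refl)
      also have "\<bar>\<xi> \<bullet> x\<bar> = \<bar>(\<xi> - \<eta>) \<bullet> x\<bar>" using that by (simp add: inner_diff_left)
      also have "\<dots> \<le> r * norm x"
        using Cauchy_Schwarz_ineq2[of "\<xi> - \<eta>" x] \<eta>(1) mult_right_mono[of "norm (\<xi> - \<eta>)" r "norm x"]
        by (simp add: norm_minus_commute)
      finally have "norm (D *v x) \<le> r * norm x * norm p + norm (D - outer p \<xi>) * norm x"
        by (simp add: mult_right_mono)
      also have "\<dots> \<le> r * norm x * c + 1/16 * norm x"
        using D r by (intro add_mono mult_mono) (auto simp: c_def)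
      also have "\<dots> = (r * c) * norm x + 1/16 * norm x" by simp
      finally show ?thesis using r(2) by simp
    qed
    have iter: "norm ((inverse l ^ n *\<^sub>R matpow D n) *v x) \<le> (1/2) ^ n * norm x \<and>
        \<eta> \<bullet> ((inverse l ^ n *\<^sub>R matpow D n) *v x) = 0" if "\<eta> \<bullet> x = 0" for n x
    proof (induction n)
      case (Suc n)
      let ?y = "(inverse l ^ n *\<^sub>R matpow D n) *v x"
      have eq: "(inverse l ^ Suc n *\<^sub>R matpow D (Suc n)) *v x = inverse l *\<^sub>R (D *v ?y)"
        by (simp add: scaleR_matrix_vector_assoc[symmetric] matrix_vector_mult_scaleR matrix_vector_mul_assoc)
      have "norm (inverse l *\<^sub>R (D *v ?y)) \<le> 4 * (1/8 * norm ?y)"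
        unfolding norm_scaleR using small[of ?y] Suc q(2)
        by (intro mult_mono) (auto simp: field_simps)
      moreover have "\<eta> \<bullet> (inverse l *\<^sub>R (D *v ?y)) = 0" using Suc \<eta>D by simp
      ultimately show ?case unfolding eq using Suc by simp
    qed (use that in simp)
    have "(\<lambda>n. inverse l ^ n *\<^sub>R matpow D n) \<longlonglongrightarrow> outer q \<zeta>"
    proof (rule matrix_tendstoI)
      fix v
      define k where "k = v - (\<zeta> \<bullet> v) *\<^sub>R q"
      have "\<eta> \<bullet> k = 0" using nz by (simp add: k_def \<zeta>_def inner_diff_right)
      have "(\<lambda>n. (1/2) ^ n * norm k) \<longlonglongrightarrow> 0 * norm k"
        by (intro tendsto_mult LIMSEQ_realpow_zero) auto
      then have k0: "(\<lambda>n. (inverse l ^ n *\<^sub>R matpow D n) *v k) \<longlonglongrightarrow> 0"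
        unfolding mult_zero_left
        by (rule Lim_null_comparison[rotated])
           (intro always_eventually allI iter[OF \<open>\<eta> \<bullet> k = 0\<close>, THEN conjunct1])
      have "matpow D n *v q = l ^ n *\<^sub>R q" for n
        by (induction n) (auto simp: matrix_vector_mul_assoc[symmetric] matrix_vector_mult_scaleR q(3))
      then have "(inverse l ^ n *\<^sub>R matpow D n) *v q = q" for n
        using q(2) by (simp add: scaleR_matrix_vector_assoc[symmetric] power_mult_distrib[symmetric])
      then have "(inverse l ^ n *\<^sub>R matpow D n) *v v = (inverse l ^ n *\<^sub>R matpow D n) *v k + (\<zeta> \<bullet> v) *\<^sub>R q" for n
        by (simp add: k_def matrix_vector_mult_diff_distrib matrix_vector_mult_scaleR)
      then show "(\<lambda>n. (inverse l ^ n *\<^sub>R matpow D n) *v v) \<longlonglongrightarrow> outer q \<zeta> *v v"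
        using tendsto_add[OF k0 tendsto_const[of "(\<zeta> \<bullet> v) *\<^sub>R q"]] by (simp add: outer_mult_vector)
    qed
    then show "\<exists>q \<eta> l. l > 0 \<and> \<eta> \<bullet> q = 1 \<and> (\<lambda>n. inverse l ^ n *\<^sub>R matpow D n) \<longlonglongrightarrow> outer q \<eta>"
      using \<zeta>q q(2) by (intro exI[of _ q] exI[of _ \<zeta>] exI[of _ l]) auto
  qed
qed

section \<open>Biproximal elements\<close>

lemma matpow_add: "matpow A (m + n) = matpow A m ** matpow (A :: real^'n^'n) n"
  by (induction m) (auto simp: matrix_mul_assoc)

lemma matpow_Suc2: "matpow A (Suc n) = matpow A n ** (A :: real^'n^'n)"
  using matpow_add[of A n 1] by simp

lemma matpow_square: "matpow (A ** A) n = matpow (A :: real^'n^'n) (2 * n)"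
proof (induction n)
  case (Suc n)
  have "2 * Suc n = Suc (Suc (2 * n))" by simp
  then show ?case using Suc by (simp add: matrix_mul_assoc)
qed simp

lemma matpow_inverse:
  assumes "invertible (A :: real^'n^'n)"
  shows "invertible (matpow A n)" "matrix_inv (matpow A n) = matpow (matrix_inv A) n"
proof -
  have *: "invertible (matpow A n) \<and> matrix_inv (matpow A n) = matpow (matrix_inv A) n"
  proof (induction n)
    case 0
    show ?case using matrix_inv_unique[of "mat 1" "mat 1 :: real^'n^'n"] invertible_mat_1 by simp
  next
    case (Suc n)
    then show ?case
      using matrix_inv_prod[OF assms, of "matpow A n"] assms matpow_Suc2[of "matrix_inv A" n]
      by (auto intro: invertible_mult)
  qed
  then show "invertible (matpow A n)" "matrix_inv (matpow A n) = matpow (matrix_inv A) n" by auto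
qed

lemma transpose_inner: "(transpose A *v x) \<bullet> y = x \<bullet> ((A :: real^'n^'m) *v y)"
  by (metis dot_lmul_matrix transpose_matrix_vector)

lemma mult_outer: "A ** outer x \<xi> = outer ((A :: real^'n^'n) *v x) \<xi>"
  by (simp add: outer_def matrix_matrix_mult_def matrix_vector_mult_def vec_eq_iff sum_distrib_left mult_ac)

lemma outer_mult: "outer x \<xi> ** A = outer x (transpose (A :: real^'n^'n) *v \<xi>)"
  by (simp add: outer_def matrix_matrix_mult_def matrix_vector_mult_def transpose_def vec_eq_iff
      sum_distrib_left mult_ac)

lemma outer_mult_outer: "outer x \<xi> ** outer y \<eta> = (\<xi> \<bullet> y) *\<^sub>R outer x \<eta>"
  by (simp add: outer_def matrix_matrix_mult_def vec_eq_iff inner_vec_def sum_distrib_left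
      sum_distrib_right mult_ac)

lemma scaleR_outer: "c *\<^sub>R outer x \<xi> = outer x (c *\<^sub>R \<xi>)"
  by (simp add: outer_def vec_eq_iff)

lemma scaleR_outer2: "c *\<^sub>R outer x \<xi> = outer (c *\<^sub>R x) \<xi>"
  by (simp add: outer_def vec_eq_iff)

text \<open>\<open>l\<close> and \<open>m\<close> are the eigenvalues of \<open>D\<close> of largest
  and smallest modulus, both positive, with eigenvectors \<open>p\<close>, \<open>q\<close> and
  eigenforms \<open>\<xi>\<close>, \<open>\<eta>\<close>; so \<open>ln (l / m)\<close> is a positive
  number.\<close>

definition biproximal ::
    "real^'n^'n \<Rightarrow> real \<Rightarrow> real \<Rightarrow> real^'n \<Rightarrow> real^'n \<Rightarrow> real^'n \<Rightarrow> real^'n \<Rightarrow> bool" where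
  "biproximal D l m p \<xi> q \<eta> \<longleftrightarrow> invertible D \<and> 0 < m \<and> m < l \<and> \<xi> \<bullet> p = 1 \<and> \<eta> \<bullet> q = 1 \<and>
     (\<lambda>n. inverse l ^ n *\<^sub>R matpow D n) \<longlonglongrightarrow> outer p \<xi> \<and>
     (\<lambda>n. m ^ n *\<^sub>R matpow (matrix_inv D) n) \<longlonglongrightarrow> outer q \<eta>"

lemma scaled_limit_square:
  assumes "(\<lambda>n. c ^ n *\<^sub>R matpow A n) \<longlonglongrightarrow> (B :: real^'n^'n)"
  shows "(\<lambda>n. (c\<^sup>2) ^ n *\<^sub>R matpow (A ** A) n) \<longlonglongrightarrow> B"
proof -
  have "strict_mono (\<lambda>n::nat. 2 * n)" by (simp add: strict_mono_def)
  from LIMSEQ_subseq_LIMSEQ[OF assms this] show ?thesis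
    by (simp add: o_def matpow_square power_mult)
qed

context irreducible_matrix_group
begin

lemma one: "mat 1 \<in> G"
  using nonempty mult inverse inv matrix_inv_mult by (metis ex_in_conv)

lemma matpow_mem: "A \<in> G \<Longrightarrow> matpow A n \<in> G"
  by (induction n) (auto simp: one mult)

text \<open>In \<open>A^n Q A^-n Q'\<close> as well as in its inverse
  \<open>Q'^-1 A^n Q^-1 A^-n\<close>, the scaled powers of \<open>A\<close> tend to rank one, while
  those of \<open>A^-1\<close> only need some limit \<open>T0\<close>. So both products have rank
  one limits. Generic \<open>Q\<close> and \<open>Q'\<close> keep these from being nilpotent, and
  matrices near them have powers of the required form.\<close>

lemma exists_biproximal:
  fixes A :: "real^'n^'n"
  assumes A: "A \<in> G" "\<xi> \<bullet> x = 1" "(\<lambda>n. inverse \<alpha> ^ n *\<^sub>R matpow A n) \<longlonglongrightarrow> outer x \<xi>"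
    and dim: "CARD('n) \<ge> 2"
  shows "\<exists>D l m p \<xi> q \<eta>. D \<in> G \<and> biproximal D l m p \<xi> q \<eta>"
proof -
  note [simp del] = transpose_matrix_vector
  have invA: "invertible A" using A inv by blast
  have "x \<noteq> 0" "\<xi> \<noteq> 0" using A(2) by auto
  define An where "An n = matpow A n" for n
  \<comment> \<open>Powers of the inverse need not have a rank one limit; divided by their norms
    they have a non-zero limit along a subsequence.\<close>
  define T where "T n = inverse (norm (matrix_inv (An n))) *\<^sub>R matrix_inv (An n)" for n
  have invAn: "invertible (An n)" for n unfolding An_def by (rule matpow_inverse[OF invA])
  have nz: "matrix_inv (An n) \<noteq> 0" for n
  proof
    assume "matrix_inv (An n) = 0"
    then have "x = An n *v 0" using matrix_inv_vector(1)[OF invAn[of n], of x] by simp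
    then show False using \<open>x \<noteq> 0\<close> by simp
  qed
  have "norm (T n) = 1" for n using nz[of n] by (simp add: T_def)
  then have "bounded (range T)" by (auto simp: bounded_iff)
  then obtain T0 r where r: "strict_mono r" "(T \<circ> r) \<longlonglongrightarrow> T0"
    using bounded_imp_convergent_subsequence by blast
  have "norm T0 = 1"
    using tendsto_norm[OF r(2)] \<open>\<And>n. norm (T n) = 1\<close> by (simp add: LIMSEQ_const_iff)
  have "\<exists>e. T0 *v e \<noteq> 0"
  proof (rule ccontr)
    assume "\<nexists>e. T0 *v e \<noteq> 0"
    then have "T0 = 0" by (intro matrix_eq[THEN iffD2]) auto
    then show False using \<open>norm T0 = 1\<close> by simp
  qed
  then obtain e where e: "T0 *v e \<noteq> 0" by blast
  \<comment> \<open>\<open>t \<bullet> y\<close> is the inner product of \<open>T0 e\<close> and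
    \<open>T0 y\<close>, so \<open>t \<bullet> y \<noteq> 0\<close> keeps \<open>y\<close> out of
    the kernel of \<open>T0\<close>.\<close>
  define t where "t = transpose T0 *v (T0 *v e)"
  have "t \<bullet> e \<noteq> 0" using e by (simp add: t_def transpose_inner)
  then have "t \<noteq> 0" by auto
  have "\<exists>Q'\<in>G. \<forall>(\<xi>, v)\<in>{(t, x)}. \<xi> \<bullet> (Q' *v v) \<noteq> 0 \<and> \<xi> \<bullet> (matrix_inv Q' *v v) \<noteq> 0"
    by (rule generic_element) (use \<open>t \<noteq> 0\<close> \<open>x \<noteq> 0\<close> in auto)
  then obtain Q' where Q': "Q' \<in> G" "t \<bullet> (Q' *v x) \<noteq> 0" "t \<bullet> (matrix_inv Q' *v x) \<noteq> 0" by auto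
  then have nz': "T0 *v (Q' *v x) \<noteq> 0" "T0 *v (matrix_inv Q' *v x) \<noteq> 0"
    by (auto simp: t_def transpose_inner)
  have "\<exists>Q\<in>G. \<forall>(\<xi>, v)\<in>{(\<xi>, T0 *v (Q' *v x)), (\<xi>, T0 *v (matrix_inv Q' *v x))}.
      \<xi> \<bullet> (Q *v v) \<noteq> 0 \<and> \<xi> \<bullet> (matrix_inv Q *v v) \<noteq> 0"
    by (rule generic_element) (use \<open>\<xi> \<noteq> 0\<close> nz' in auto)
  then obtain Q where Q: "Q \<in> G" "\<xi> \<bullet> (Q *v (T0 *v (Q' *v x))) \<noteq> 0"
      "\<xi> \<bullet> (matrix_inv Q *v (T0 *v (matrix_inv Q' *v x))) \<noteq> 0" by auto
  have invQ: "invertible Q" "invertible Q'" using Q Q' inv by auto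
  define c1 where "c1 = \<xi> \<bullet> (Q *v (T0 *v (Q' *v x)))"
  define c2 where "c2 = \<xi> \<bullet> (matrix_inv Q *v (T0 *v (matrix_inv Q' *v x)))"
  define B where "B n = An n ** Q ** matrix_inv (An n) ** Q'" for n
  define s where "s n = inverse \<alpha> ^ n * inverse (norm (matrix_inv (An n)))" for n
  have BG: "B n \<in> G" for n
    unfolding B_def An_def by (intro mult inverse matpow_mem A Q Q')
  have Binv: "matrix_inv (B n) = matrix_inv Q' ** An n ** matrix_inv Q ** matrix_inv (An n)" for n
    by (simp add: B_def matrix_inv_prod invertible_mult invAn invQ invertible_matrix_inv
        matrix_inv_matrix_inv matrix_mul_assoc)
  define \<xi>1 where "\<xi>1 = inverse c1 *\<^sub>R (transpose (Q ** T0 ** Q') *v \<xi>)"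
  define \<xi>2 where "\<xi>2 = inverse c2 *\<^sub>R (transpose (matrix_inv Q ** T0) *v \<xi>)"
  have S: "(\<lambda>n. inverse \<alpha> ^ r n *\<^sub>R An (r n)) \<longlonglongrightarrow> outer x \<xi>"
    using LIMSEQ_subseq_LIMSEQ[OF A(3) r(1)] by (simp add: o_def An_def)
  have T: "(\<lambda>n. T (r n)) \<longlonglongrightarrow> T0" using r(2) by (simp add: o_def)
  have "(\<lambda>n. inverse c1 *\<^sub>R ((inverse \<alpha> ^ r n *\<^sub>R An (r n)) ** Q ** T (r n) ** Q'))
      \<longlonglongrightarrow> inverse c1 *\<^sub>R (outer x \<xi> ** Q ** T0 ** Q')"
    by (intro tendsto_intros S T)
  also have "inverse c1 *\<^sub>R (outer x \<xi> ** Q ** T0 ** Q') = outer x \<xi>1"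
    by (simp add: \<xi>1_def outer_mult scaleR_outer matrix_transpose_mul matrix_vector_mul_assoc matrix_mul_assoc)
  also have "(\<lambda>n. inverse c1 *\<^sub>R ((inverse \<alpha> ^ r n *\<^sub>R An (r n)) ** Q ** T (r n) ** Q'))
      = (\<lambda>n. (inverse c1 * s (r n)) *\<^sub>R B (r n))"
    by (simp add: B_def T_def s_def matrix_scalar_ac scalar_matrix_assoc[symmetric] mult_ac)
  finally have lim1: "(\<lambda>n. (inverse c1 * s (r n)) *\<^sub>R B (r n)) \<longlonglongrightarrow> outer x \<xi>1" .
  have "(\<lambda>n. inverse c2 *\<^sub>R (matrix_inv Q' ** (inverse \<alpha> ^ r n *\<^sub>R An (r n)) ** matrix_inv Q ** T (r n)))
      \<longlonglongrightarrow> inverse c2 *\<^sub>R (matrix_inv Q' ** outer x \<xi> ** matrix_inv Q ** T0)"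
    by (intro tendsto_intros S T)
  also have "inverse c2 *\<^sub>R (matrix_inv Q' ** outer x \<xi> ** matrix_inv Q ** T0) = outer (matrix_inv Q' *v x) \<xi>2"
    by (simp add: \<xi>2_def outer_mult mult_outer scaleR_outer matrix_transpose_mul matrix_vector_mul_assoc matrix_mul_assoc)
  also have "(\<lambda>n. inverse c2 *\<^sub>R (matrix_inv Q' ** (inverse \<alpha> ^ r n *\<^sub>R An (r n)) ** matrix_inv Q ** T (r n)))
      = (\<lambda>n. (inverse c2 * s (r n)) *\<^sub>R matrix_inv (B (r n)))"
    unfolding Binv by (simp add: T_def s_def matrix_scalar_ac scalar_matrix_assoc[symmetric] mult_ac)
  finally have lim2: "(\<lambda>n. (inverse c2 * s (r n)) *\<^sub>R matrix_inv (B (r n))) \<longlonglongrightarrow> outer (matrix_inv Q' *v x) \<xi>2" .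
  have one1: "\<xi>1 \<bullet> x = 1" using Q(2)
    by (simp add: \<xi>1_def transpose_inner c1_def matrix_vector_mul_assoc[symmetric])
  have one2: "\<xi>2 \<bullet> (matrix_inv Q' *v x) = 1" using Q(3)
    by (simp add: \<xi>2_def transpose_inner c2_def matrix_vector_mul_assoc[symmetric])
  obtain e1 where e1: "e1 > 0" "\<And>D. norm (D - outer x \<xi>1) < e1 \<Longrightarrow>
      \<exists>q \<eta> l. l > 0 \<and> \<eta> \<bullet> q = 1 \<and> (\<lambda>n. inverse l ^ n *\<^sub>R matpow D n) \<longlonglongrightarrow> outer q \<eta>"
    using matpow_near_projection[OF one1] by blast
  obtain e2 where e2: "e2 > 0" "\<And>D. norm (D - outer (matrix_inv Q' *v x) \<xi>2) < e2 \<Longrightarrow>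
      \<exists>q \<eta> l. l > 0 \<and> \<eta> \<bullet> q = 1 \<and> (\<lambda>n. inverse l ^ n *\<^sub>R matpow D n) \<longlonglongrightarrow> outer q \<eta>"
    using matpow_near_projection[OF one2] by blast
  have "\<forall>\<^sub>F n in sequentially. norm ((inverse c1 * s (r n)) *\<^sub>R B (r n) - outer x \<xi>1) < e1"
    using lim1 e1(1) by (auto simp: tendsto_iff dist_norm)
  moreover have "\<forall>\<^sub>F n in sequentially.
      norm ((inverse c2 * s (r n)) *\<^sub>R matrix_inv (B (r n)) - outer (matrix_inv Q' *v x) \<xi>2) < e2"
    using lim2 e2(1) by (auto simp: tendsto_iff dist_norm)
  ultimately have "\<forall>\<^sub>F n in sequentially. norm ((inverse c1 * s (r n)) *\<^sub>R B (r n) - outer x \<xi>1) < e1 \<and>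
      norm ((inverse c2 * s (r n)) *\<^sub>R matrix_inv (B (r n)) - outer (matrix_inv Q' *v x) \<xi>2) < e2"
    by (rule eventually_conj)
  then obtain n where n: "norm ((inverse c1 * s (r n)) *\<^sub>R B (r n) - outer x \<xi>1) < e1"
      "norm ((inverse c2 * s (r n)) *\<^sub>R matrix_inv (B (r n)) - outer (matrix_inv Q' *v x) \<xi>2) < e2"
    by (auto simp: eventually_sequentially)
  define E where "E = B (r n)"
  obtain p \<zeta> l1 where p: "l1 > 0" "\<zeta> \<bullet> p = 1"
      "(\<lambda>k. inverse l1 ^ k *\<^sub>R matpow ((inverse c1 * s (r n)) *\<^sub>R E) k) \<longlonglongrightarrow> outer p \<zeta>"
    using e1(2)[OF n(1)] unfolding E_def by blast
  obtain q \<eta> l2 where q: "l2 > 0" "\<eta> \<bullet> q = 1"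
      "(\<lambda>k. inverse l2 ^ k *\<^sub>R matpow ((inverse c2 * s (r n)) *\<^sub>R matrix_inv E) k) \<longlonglongrightarrow> outer q \<eta>"
    using e2(2)[OF n(2)] unfolding E_def by blast
  \<comment> \<open>The scaling factors may be negative; passing from \<open>E\<close> to its square
    replaces them by their squares.\<close>
  define a where "a = (inverse l1 * (inverse c1 * s (r n)))\<^sup>2"
  define m where "m = (inverse l2 * (inverse c2 * s (r n)))\<^sup>2"
  define D where "D = E ** E"
  have EG: "E \<in> G" unfolding E_def by (rule BG)
  then have DG: "D \<in> G" unfolding D_def by (intro mult)
  have Dinv: "matrix_inv D = matrix_inv E ** matrix_inv E"
    unfolding D_def by (intro matrix_inv_prod inv EG)
  have l1: "(\<lambda>k. a ^ k *\<^sub>R matpow D k) \<longlonglongrightarrow> outer p \<zeta>"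
    unfolding a_def D_def
    by (rule scaled_limit_square) (use p(3) in \<open>simp add: matpow_scaleR power_mult_distrib mult_ac\<close>)
  have l2: "(\<lambda>k. m ^ k *\<^sub>R matpow (matrix_inv D) k) \<longlonglongrightarrow> outer q \<eta>"
    unfolding m_def Dinv
    by (rule scaled_limit_square) (use q(3) in \<open>simp add: matpow_scaleR power_mult_distrib mult_ac\<close>)
  \<comment> \<open>A vanishing factor would make the limit zero, but the limit fixes
    \<open>p\<close>.\<close>
  have pos: "c > 0" if "(\<lambda>k. (c\<^sup>2) ^ k *\<^sub>R M k) \<longlonglongrightarrow> outer p \<zeta>" "\<zeta> \<bullet> p = 1" "c \<ge> 0"
    for c and M :: "nat \<Rightarrow> real^'n^'n" and p \<zeta>
  proof (rule ccontr)
    assume "\<not> c > 0"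
    then have "c = 0" using that by simp
    have "(\<lambda>k. (c\<^sup>2) ^ Suc k *\<^sub>R M (Suc k)) \<longlonglongrightarrow> outer p \<zeta>" using LIMSEQ_Suc[OF that(1)] .
    then have "outer p \<zeta> = 0" using \<open>c = 0\<close> by (simp add: LIMSEQ_const_iff)
    then have "outer p \<zeta> *v p = 0" by simp
    then show False using that(2) by (simp add: outer_mult_vector)
  qed
  have "a > 0"
    using pos[of "\<bar>inverse l1 * (inverse c1 * s (r n))\<bar>" "matpow D" p \<zeta>] l1 p(2) by (auto simp: a_def)
  have "m > 0"
    using pos[of "\<bar>inverse l2 * (inverse c2 * s (r n))\<bar>" "matpow (matrix_inv D)" q \<eta>] l2 q(2) by (auto simp: m_def)
  have "(\<lambda>k. (a ^ k *\<^sub>R matpow D k) ** (m ^ k *\<^sub>R matpow (matrix_inv D) k)) \<longlonglongrightarrow> outer p \<zeta> ** outer q \<eta>"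
    by (intro tendsto_intros l1 l2)
  moreover have "(a ^ k *\<^sub>R matpow D k) ** (m ^ k *\<^sub>R matpow (matrix_inv D) k) = (a * m) ^ k *\<^sub>R mat 1" for k
    using matrix_inv_mult(1)[OF matpow_inverse(1)[OF inv[OF DG], of k]]
    by (simp add: matpow_inverse(2)[OF inv[OF DG]] matrix_scalar_ac scalar_matrix_assoc[symmetric]
        power_mult_distrib mult_ac)
  ultimately have lim: "(\<lambda>k. (a * m) ^ k *\<^sub>R mat 1) \<longlonglongrightarrow> (\<zeta> \<bullet> q) *\<^sub>R outer p \<eta>"
    by (simp add: outer_mult_outer)
  \<comment> \<open>The scaled powers of \<open>D\<close> and of its inverse multiply to the scalar
    matrices \<open>(a * m)^k\<close>, whose limit has rank at most one. If \<open>a * m\<close>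
    were at least 1, a two by two minor of the limit could not vanish.\<close>
  have "a * m < 1"
  proof (rule ccontr)
    assume "\<not> a * m < 1"
    then have ge: "(a * m) ^ k \<ge> 1" for k by (simp add: one_le_power)
    define N where "N = (\<zeta> \<bullet> q) *\<^sub>R outer p \<eta>"
    have N: "(\<lambda>k. (a * m) ^ k * mat 1 $ i $ j) \<longlonglongrightarrow> N $ i $ j" for i j :: 'n
      using tendsto_vec_nth[OF tendsto_vec_nth[OF lim]] by (simp add: N_def)
    obtain i j :: 'n where ij: "i \<noteq> j"
    proof -
      have "\<not> CARD('n) \<le> Suc 0" using dim by simp
      then show ?thesis using that by (auto simp: card_le_Suc0_iff_eq)
    qed
    have offd: "N $ i $ j = 0" using N[of i j] ij by (simp add: mat_def LIMSEQ_const_iff)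
    have d1: "N $ i $ i \<ge> 1" using N[of i i] ge by (intro LIMSEQ_le_const[OF N[of i i]]) (auto simp: mat_def)
    have d2: "N $ j $ j \<ge> 1" using N[of j j] ge by (intro LIMSEQ_le_const[OF N[of j j]]) (auto simp: mat_def)
    have "N $ i $ i * N $ j $ j = N $ i $ j * N $ j $ i" by (simp add: N_def outer_def mult_ac)
    then have "N $ i $ i * N $ j $ j = 0" using offd by simp
    then show False using d1 d2 by auto
  qed
  then have "m < inverse a" using \<open>a > 0\<close> by (simp add: field_simps)
  then have "biproximal D (inverse a) m p \<zeta> q \<eta>"
    unfolding biproximal_def using l1 l2 p(2) q(2) \<open>m > 0\<close> inv[OF DG] by simp
  then show ?thesis using DG by blast
qed

end

text \<open>Let \<open>n\<close> tend to infinity in \<open>D D^n = D^n D = D^(n+1)\<close>.\<close>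

lemma biproximal_limit_eigen:
  assumes "\<xi> \<bullet> p = 1" "l \<noteq> 0" "(\<lambda>n. inverse l ^ n *\<^sub>R matpow D n) \<longlonglongrightarrow> outer p \<xi>"
  shows "D *v p = l *\<^sub>R p" "\<xi> \<bullet> (D *v x) = l * (\<xi> \<bullet> x)"
proof -
  have e1: "D ** (inverse l ^ n *\<^sub>R matpow D n) = l *\<^sub>R (inverse l ^ Suc n *\<^sub>R matpow D (Suc n))"
    and e2: "(inverse l ^ n *\<^sub>R matpow D n) ** D = l *\<^sub>R (inverse l ^ Suc n *\<^sub>R matpow D (Suc n))" for n
    using assms(2) matpow_Suc2[of D n]
    by (simp_all add: matrix_scalar_ac scalar_matrix_assoc[symmetric])
  have lim: "(\<lambda>n. l *\<^sub>R (inverse l ^ Suc n *\<^sub>R matpow D (Suc n))) \<longlonglongrightarrow> l *\<^sub>R outer p \<xi>"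
    by (intro tendsto_intros LIMSEQ_Suc assms)
  have "(\<lambda>n. D ** (inverse l ^ n *\<^sub>R matpow D n)) \<longlonglongrightarrow> D ** outer p \<xi>"
    by (intro tendsto_intros assms)
  then have "D ** outer p \<xi> = l *\<^sub>R outer p \<xi>" unfolding e1 using lim LIMSEQ_unique by blast
  then have "(D ** outer p \<xi>) *v p = (l *\<^sub>R outer p \<xi>) *v p" by simp
  then show "D *v p = l *\<^sub>R p"
    using assms(1) by (simp add: matrix_vector_mul_assoc[symmetric] outer_mult_vector scaleR_matrix_vector_assoc[symmetric])
  have "(\<lambda>n. (inverse l ^ n *\<^sub>R matpow D n) ** D) \<longlonglongrightarrow> outer p \<xi> ** D"
    by (intro tendsto_intros assms)
  then have "outer p \<xi> ** D = l *\<^sub>R outer p \<xi>" unfolding e2 using lim LIMSEQ_unique by blast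
  then have "(outer p \<xi> ** D) *v x = (l *\<^sub>R outer p \<xi>) *v x" by simp
  then have "(\<xi> \<bullet> (D *v x)) *\<^sub>R p = (l * (\<xi> \<bullet> x)) *\<^sub>R p"
    by (simp add: matrix_vector_mul_assoc[symmetric] outer_mult_vector scaleR_matrix_vector_assoc[symmetric])
  moreover have "p \<noteq> 0" using assms(1) by auto
  ultimately show "\<xi> \<bullet> (D *v x) = l * (\<xi> \<bullet> x)" by simp
qed

lemma biproximal_props:
  assumes "biproximal D l m p \<xi> q \<eta>"
  shows "D *v p = l *\<^sub>R p" "\<xi> \<bullet> (D *v x) = l * (\<xi> \<bullet> x)" "D *v q = m *\<^sub>R q" "\<eta> \<bullet> (D *v x) = m * (\<eta> \<bullet> x)"
    "\<eta> \<bullet> p = 0" "\<xi> \<bullet> q = 0"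
proof -
  note b = assms[unfolded biproximal_def]
  have p: "D *v p = l *\<^sub>R p" and \<xi>: "\<And>x. \<xi> \<bullet> (D *v x) = l * (\<xi> \<bullet> x)"
    using biproximal_limit_eigen[of \<xi> p l D] b by auto
  have q': "matrix_inv D *v q = inverse m *\<^sub>R q" and \<eta>': "\<And>x. \<eta> \<bullet> (matrix_inv D *v x) = inverse m * (\<eta> \<bullet> x)"
    using biproximal_limit_eigen[of \<eta> q "inverse m" "matrix_inv D"] b by auto
  have "q = D *v (matrix_inv D *v q)" using matrix_inv_vector b by metis
  then have "q = inverse m *\<^sub>R (D *v q)" by (simp add: q' matrix_vector_mult_scaleR)
  then have "m *\<^sub>R q = m *\<^sub>R (inverse m *\<^sub>R (D *v q))" by simp
  then have q: "D *v q = m *\<^sub>R q" using b by simp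
  have \<eta>: "\<eta> \<bullet> (D *v x) = m * (\<eta> \<bullet> x)" for x
    using \<eta>'[of "D *v x"] matrix_inv_vector(2)[of D x] b by (simp add: field_simps)
  show "D *v p = l *\<^sub>R p" "\<xi> \<bullet> (D *v x) = l * (\<xi> \<bullet> x)" "D *v q = m *\<^sub>R q" "\<eta> \<bullet> (D *v x) = m * (\<eta> \<bullet> x)"
    by fact+
  have "l * (\<eta> \<bullet> p) = m * (\<eta> \<bullet> p)" using \<eta>[of p] p by simp
  then show "\<eta> \<bullet> p = 0" using b by auto
  have "m * (\<xi> \<bullet> q) = l * (\<xi> \<bullet> q)" using \<xi>[of q] q by simp
  then show "\<xi> \<bullet> q = 0" using b by auto
qed

section \<open>Non-arithmeticity of translation lengths\<close>

text \<open>\<Phi> vanishes on the span \<open>K\<close> of the late differences of the sequence.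
  \<open>A\<close> maps \<open>K\<close> into itself injectively, so by finite dimension its inverse
  preserves \<open>K\<close> too. Hence \<Phi> kills all earlier differences, including those of
  negative index.\<close>

lemma iterate_constant_backwards:
  fixes A B :: "'a::euclidean_space \<Rightarrow> 'a"
  assumes A: "linear A" and B: "linear B" "\<And>x. B (A x) = x" "\<And>x. A (B x) = x"
    and \<Phi>: "linear (\<Phi> :: 'a \<Rightarrow> real)"
    and const: "\<And>n. n \<ge> M \<Longrightarrow> \<Phi> ((A ^^ n) Z) = c"
  shows "\<Phi> ((B ^^ k) Z) = \<Phi> Z"
proof -
  define w where "w = (A ^^ M) (Z - A Z)"
  define K where "K = span (range (\<lambda>n. (A ^^ n) w))"
  have lA: "linear (A ^^ n)" for n by (induction n) (auto simp: linear_id id_def[symmetric] intro!: linear_compose[OF _ A, unfolded o_def])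
  have BA: "(B ^^ n) ((A ^^ n) x) = x" for n x
  proof (induction n arbitrary: x)
    case (Suc n)
    have "(B ^^ Suc n) ((A ^^ Suc n) x) = (B ^^ n) (B (A ((A ^^ n) x)))" by (simp add: funpow_swap1)
    then show ?case using Suc B by simp
  qed simp
  have \<Phi>K: "\<Phi> x = 0" if "x \<in> K" for x
  proof -
    show ?thesis
      using that unfolding K_def
    proof (rule span_induct)
      show "subspace {x. \<Phi> x = 0}" using \<Phi> by (rule linear_subspace_kernel)
      fix y assume "y \<in> range (\<lambda>n. (A ^^ n) w)"
      then obtain n where "y = (A ^^ n) w" by blast
      also have "\<dots> = (A ^^ (n + M)) (Z - A Z)" by (simp add: w_def funpow_add)
      also have "\<dots> = (A ^^ (n + M)) Z - (A ^^ Suc (n + M)) Z"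
        using linear_diff[OF lA] by (simp add: funpow_swap1)
      finally have "\<Phi> y = c - c" using const[of "n + M"] const[of "Suc (n + M)"] linear_diff[OF \<Phi>] by simp
      then show "\<Phi> y = 0" by simp
    qed
  qed
  have "A ` K \<subseteq> K"
  proof -
    have "A ` range (\<lambda>n. (A ^^ n) w) \<subseteq> range (\<lambda>n. (A ^^ n) w)"
      by (auto intro: range_eqI[of _ _ "Suc _"])
    then show ?thesis unfolding K_def linear_span_image[OF A, symmetric] by (rule span_mono)
  qed
  moreover have "inj A" by (metis B(2) injI)
  then have "dim (A ` K) = dim K" by (intro dim_image_eq A) (auto intro: inj_on_subset)
  ultimately have AK: "A ` K = K"
    unfolding K_def using linear_subspace_image[OF A] by (intro subspace_dim_equal) auto
  have BK: "B x \<in> K" if "x \<in> K" for x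
    using that AK B(2) by (metis imageE)
  have "(B ^^ j) w \<in> K" for j
  proof (induction j)
    case 0
    show ?case unfolding K_def by (auto intro!: span_base range_eqI[of _ _ 0])
  qed (use BK in auto)
  then have *: "\<Phi> ((B ^^ (k + M)) w) = 0" for k using \<Phi>K by blast
  have lB: "linear (B ^^ n)" for n by (induction n) (auto simp: linear_id id_def[symmetric] intro!: linear_compose[OF _ B(1), unfolded o_def])
  have "\<Phi> ((B ^^ k) (Z - A Z)) = 0" for k
    using *[of k] by (simp add: funpow_add w_def BA)
  then have **: "\<Phi> ((B ^^ k) Z) = \<Phi> ((B ^^ k) (A Z))" for k
    using linear_diff[OF lB] linear_diff[OF \<Phi>] by (metis eq_iff_diff_eq_0)
  show ?thesis
  proof (induction k)
    case (Suc k)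
    have "\<Phi> ((B ^^ Suc k) Z) = \<Phi> ((B ^^ k) (B (A Z)))" using **[of "Suc k"] by (simp add: funpow_swap1)
    then show ?case using Suc B(2) by simp
  qed simp
qed

text \<open>Two late members \<open>x\<close>, \<open>y\<close> of the sequence are distinct and
  close. \<open>- y\<close> need not be in \<open>X\<close>, but Dirichlet's theorem makes some
  multiple \<open>k y\<close> almost a multiple \<open>h L\<close>, so
  \<open>(k - 1) y - h L\<close> can stand in for it. This gives a small non-zero step
  \<open>d\<close> near \<open>x - y\<close>, whose sign is not controlled.\<close>

lemma dense_semigroup:
  fixes X :: "real set"
  assumes add: "\<And>x y. x \<in> X \<Longrightarrow> y \<in> X \<Longrightarrow> x + y \<in> X"
    and L: "L > 0" "L \<in> X" "- L \<in> X"
    and s: "\<And>n. n \<ge> N \<Longrightarrow> s n \<in> X" "s \<longlonglongrightarrow> s0"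
    and nc: "\<And>M c. \<exists>n\<ge>M. s n \<noteq> (c::real)"
    and "e > 0"
  shows "\<exists>x\<in>X. \<bar>x - t\<bar> < e"
proof -
  have zero: "0 \<in> X" using add[OF L(2,3)] by simp
  have nat_mult: "real k * x \<in> X" if "x \<in> X" for k x
    by (induction k) (auto simp: zero algebra_simps intro: add that)
  have int_mult: "of_int k * L \<in> X" for k
  proof (cases "k \<ge> 0")
    case True
    then show ?thesis using nat_mult[OF L(2), of "nat k"] by simp
  next
    case False
    then have "of_int k * L = real (nat (-k)) * (- L)" by simp
    then show ?thesis using nat_mult[OF L(3), of "nat (-k)"] by simp
  qed
  have "Cauchy s" using s(2) by (rule LIMSEQ_imp_Cauchy)
  then obtain M where M: "\<And>m n. m \<ge> M \<Longrightarrow> n \<ge> M \<Longrightarrow> norm (s m - s n) < e / 2"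
    using \<open>e > 0\<close> by (meson CauchyD half_gt_zero)
  obtain n where n: "n \<ge> max M N" "s n \<noteq> s (max M N)" using nc by blast
  define x where "x = s n"
  define y where "y = s (max M N)"
  have xy: "x \<in> X" "y \<in> X" "x \<noteq> y" "\<bar>x - y\<bar> < e / 2"
    using n s(1) M[of n "max M N"] by (auto simp: x_def y_def)
  define \<delta> where "\<delta> = \<bar>x - y\<bar>"
  have \<delta>: "\<delta> > 0" using xy by (simp add: \<delta>_def)
  \<comment> \<open>Makes the Dirichlet error, times \<open>L\<close>, smaller than half of
    \<open>\<bar>x - y\<bar>\<close>, so that it cannot cancel the step.\<close>
  obtain K where K: "real K > 2 * L / \<delta>" "K > 0"
    using reals_Archimedean2[of "max 1 (2 * L / \<delta>)"] by force
  obtain h k where hk: "0 < k" "k \<le> int K" "\<bar>of_int k * (y / L) - of_int h\<bar> < 1 / K"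
    by (rule Dirichlet_approx[OF K(2), of "y / L"])
  have "of_int k * y - of_int h * L = (of_int k * (y / L) - of_int h) * L"
    using L(1) by (simp add: field_simps)
  then have "\<bar>of_int k * y - of_int h * L\<bar> = \<bar>of_int k * (y / L) - of_int h\<bar> * L"
    using L(1) by (simp add: abs_mult)
  also have "\<dots> < 1 / K * L" using hk(3) L(1) by (intro mult_strict_right_mono)
  also have "\<dots> < \<delta> / 2" using K \<delta> L(1) by (simp add: field_simps)
  finally have close: "\<bar>of_int k * y - of_int h * L\<bar> < \<delta> / 2" .
  define d where "d = x + (real (nat (k - 1)) * y + of_int (- h) * L)"
  have dX: "d \<in> X" unfolding d_def by (intro add xy nat_mult int_mult)
  have "d = (x - y) + (of_int k * y - of_int h * L)"
    using hk(1) by (simp add: d_def algebra_simps)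
  moreover have "u \<noteq> - v \<and> \<bar>u + v\<bar> < e" if "\<bar>v\<bar> < \<bar>u\<bar> / 2" "\<bar>u\<bar> < e / 2" for u v :: real
    using that by arith
  ultimately have d: "d \<noteq> 0" "\<bar>d\<bar> < e"
    using close xy(4) unfolding \<delta>_def by (metis add.commute eq_neg_iff_add_eq_0)+
  show ?thesis
  \<comment> \<open>Only non-negative multiples of \<open>d\<close> are available: a positive
    \<open>d\<close> climbs to \<open>t\<close> from a multiple of \<open>L\<close> below, a
    negative one descends from a multiple above.\<close>
  proof (cases "d > 0")
    case True
    define m where "m = \<lfloor>t / L\<rfloor>"
    have m: "of_int m * L \<le> t"
      using mult_right_mono[OF of_int_floor_le[of "t / L"], of L] L(1) by (simp add: m_def)
    define j where "j = \<lfloor>(t - of_int m * L) / d\<rfloor>"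
    have "j \<ge> 0" using m True by (simp add: j_def)
    have "of_int j * d \<le> t - of_int m * L" "t - of_int m * L < (of_int j + 1) * d"
      using True of_int_floor_le[of "(t - of_int m * L) / d"] floor_correct[of "(t - of_int m * L) / d"]
      unfolding j_def[symmetric] by (simp_all only: pos_le_divide_eq pos_divide_less_eq of_int_add of_int_1)
    then have "\<bar>(of_int m * L + real (nat j) * d) - t\<bar> < e"
    proof -
      have "real (nat j) = of_int j" using \<open>j \<ge> 0\<close> by simp
      then show ?thesis
        using \<open>of_int j * d \<le> t - of_int m * L\<close> \<open>t - of_int m * L < (of_int j + 1) * d\<close> d(2) True
        unfolding distrib_right by auto
    qed
    then show ?thesis using add[OF int_mult nat_mult[OF dX]] by blast
  next
    case False
    define c where "c = - d"
    have c: "c > 0" using False d by (simp add: c_def)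
    define m where "m = \<lceil>t / L\<rceil>"
    have m: "of_int m * L \<ge> t"
      using mult_right_mono[OF le_of_int_ceiling[of "t / L"], of L] L(1) by (simp add: m_def)
    define j where "j = \<lfloor>(of_int m * L - t) / c\<rfloor>"
    have "j \<ge> 0" using m c by (simp add: j_def)
    have "of_int j * c \<le> of_int m * L - t" "of_int m * L - t < (of_int j + 1) * c"
      using c of_int_floor_le[of "(of_int m * L - t) / c"] floor_correct[of "(of_int m * L - t) / c"]
      unfolding j_def[symmetric] by (simp_all only: pos_le_divide_eq pos_divide_less_eq of_int_add of_int_1)
    then have "\<bar>(of_int m * L + real (nat j) * d) - t\<bar> < e"
    proof -
      have "real (nat j) * d = - (of_int j * c)" using \<open>j \<ge> 0\<close> by (simp add: c_def)
      then show ?thesis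
        using \<open>of_int j * c \<le> of_int m * L - t\<close> \<open>of_int m * L - t < (of_int j + 1) * c\<close> d(2) c
        unfolding distrib_right c_def by auto
    qed
    then show ?thesis using add[OF int_mult nat_mult[OF dX]] by blast
  qed
qed

text \<open>\<open>nonneg\<close> is what remains of the cone: \<open>p\<close> and \<open>q\<close>
  will lie in its closure, \<open>\<xi>\<close> and \<open>\<eta>\<close> in the dual cone. It makes
  non-zero gains positive, so that they have logarithms.\<close>

locale biproximal_matrix_group = irreducible_matrix_group G for G :: "(real^'n^'n) set" +
  fixes D :: "real^'n^'n" and l m :: real and p \<xi> q \<eta> :: "real^'n"
  assumes DG: "D \<in> G" and biproximal: "biproximal D l m p \<xi> q \<eta>"
    and nonneg: "H \<in> G \<Longrightarrow> \<xi> \<bullet> (H *v p) \<ge> 0" "H \<in> G \<Longrightarrow> \<eta> \<bullet> (H *v q) \<ge> 0"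
begin

lemma ml: "0 < m" "m < l" "0 < l" and unit: "\<xi> \<bullet> p = 1" "\<eta> \<bullet> q = 1"
  and lim: "(\<lambda>n. inverse l ^ n *\<^sub>R matpow D n) \<longlonglongrightarrow> outer p \<xi>"
  and lim': "(\<lambda>n. m ^ n *\<^sub>R matrix_inv (matpow D n)) \<longlonglongrightarrow> outer q \<eta>"
  using biproximal matpow_inverse(2)[OF inv[OF DG]] by (auto simp: biproximal_def)

definition L :: real where "L = ln (l / m)"

lemma exp_L: "exp L = l / m" "exp (real n * L) = (l / m) ^ n"
  using ml by (simp_all add: L_def exp_of_nat_mult)

lemma L_pos: "L > 0"
  using ml by (simp add: L_def)

text \<open>Between two copies of \<open>outer p \<xi>\<close>, an element \<open>H\<close>
  contributes the factor \<open>\<xi> \<bullet> (H *v p)\<close>; its inverse contributes the other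
  factor between two copies of \<open>outer q \<eta>\<close>.\<close>

definition gain :: "real^'n^'n \<Rightarrow> real" where
  "gain H = (\<xi> \<bullet> (H *v p)) * (\<eta> \<bullet> (matrix_inv H *v q))"

text \<open>\<open>shifts\<close> consists of the \<open>s\<close> such that some elements of \<open>G\<close> look like \<open>D\<^sup>n\<close> for large \<open>n\<close>,
  except that they translate along the axis by an extra \<open>s\<close> (in the scale in which \<open>D\<close>
  translates by \<open>L\<close>).\<close>

definition translation_seq :: "real \<Rightarrow> (nat \<Rightarrow> real^'n^'n) \<Rightarrow> (nat \<Rightarrow> real) \<Rightarrow> (nat \<Rightarrow> real) \<Rightarrow> bool" where
  "translation_seq s B \<sigma> \<tau> \<longleftrightarrow> (\<forall>n. B n \<in> G \<and> \<sigma> n > 0 \<and> \<tau> n > 0) \<and>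
     (\<lambda>n. \<sigma> n *\<^sub>R B n) \<longlonglongrightarrow> outer p \<xi> \<and> (\<lambda>n. \<tau> n *\<^sub>R matrix_inv (B n)) \<longlonglongrightarrow> outer q \<eta> \<and>
     (\<lambda>n. \<sigma> n * \<tau> n * exp (real n * L)) \<longlonglongrightarrow> exp (- s)"

definition shifts :: "real set" where
  "shifts = {s. \<exists>B \<sigma> \<tau>. translation_seq s B \<sigma> \<tau>}"

lemma L_in_shifts: "L \<in> shifts"
proof -
  have "inverse l ^ Suc n * m ^ Suc n * exp (real n * L) = exp (- L)" for n
    using ml by (simp add: exp_L exp_minus field_simps)
  then have "translation_seq L (\<lambda>n. matpow D (Suc n)) (\<lambda>n. inverse l ^ Suc n) (\<lambda>n. m ^ Suc n)"
    unfolding translation_seq_def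
    using LIMSEQ_Suc[OF lim] LIMSEQ_Suc[OF lim'] matpow_mem[OF DG] ml
    by (auto simp del: matpow.simps power_Suc)
  then show ?thesis unfolding shifts_def by blast
qed

text \<open>\<open>D^(n-1)\<close> stands in the place of \<open>D^n\<close>. At
  \<open>n = 0\<close> the subtraction is truncated, but only the limit matters.\<close>

lemma minus_L_in_shifts: "- L \<in> shifts"
proof -
  have *: "(\<lambda>n. f (n - 1)) \<longlonglongrightarrow> x" if "f \<longlonglongrightarrow> x" for f :: "nat \<Rightarrow> real^'n^'n" and x
    using that by (subst filterlim_sequentially_Suc[symmetric]) simp
  have "inverse l ^ n * m ^ n * exp (real (Suc n) * L) = exp L" for n
    using ml by (simp add: exp_L field_simps del: of_nat_Suc)
  then have "(\<lambda>n. inverse l ^ (n - 1) * m ^ (n - 1) * exp (real n * L)) \<longlonglongrightarrow> exp (- (- L))"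
    by (subst filterlim_sequentially_Suc[symmetric]) (simp del: of_nat_Suc)
  then have "translation_seq (- L) (\<lambda>n. matpow D (n - 1)) (\<lambda>n. inverse l ^ (n - 1)) (\<lambda>n. m ^ (n - 1))"
    unfolding translation_seq_def
    using *[OF lim] *[OF lim'] matpow_mem[OF DG] ml by auto
  then show ?thesis unfolding shifts_def by blast
qed

lemma filterlim_halves:
  "filterlim (\<lambda>n::nat. n div 2) sequentially sequentially"
  "filterlim (\<lambda>n::nat. n - n div 2) sequentially sequentially"
proof -
  show "filterlim (\<lambda>n::nat. n div 2) sequentially sequentially"
    unfolding filterlim_at_top eventually_sequentially
    by (metis div_le_mono mult.commute nonzero_mult_div_cancel_left zero_neq_numeral)
  then show "filterlim (\<lambda>n::nat. n - n div 2) sequentially sequentially"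
    by (rule filterlim_at_top_mono) (auto intro: always_eventually)
qed

text \<open>The indices \<open>n div 2\<close> and \<open>n - n div 2\<close> both tend to infinity
  and add up to \<open>n\<close>, so the factor \<open>exp (real n * L)\<close> splits
  exactly.\<close>

lemma translation_seq_compose:
  assumes B: "translation_seq s B \<sigma> \<tau>" and B': "translation_seq s' B' \<sigma>' \<tau>'" and H: "H \<in> G" "gain H > 0"
  shows "s + s' + ln (gain H) \<in> shifts"
proof -
  define x where "x = \<xi> \<bullet> (H *v p)"
  define y where "y = \<eta> \<bullet> (matrix_inv H *v q)"
  have xy: "x > 0" "y > 0"
    using H nonneg(1)[OF H(1)] nonneg(2)[OF inverse[OF H(1)]]
    by (auto simp: gain_def x_def y_def zero_less_mult_iff)
  let ?a = "\<lambda>n::nat. n div 2" and ?b = "\<lambda>n::nat. n - n div 2"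
  note sub = filterlim_compose[OF _ filterlim_halves(1)] filterlim_compose[OF _ filterlim_halves(2)]
  define C where "C n = B (?a n) ** H ** B' (?b n)" for n
  define \<sigma>'' where "\<sigma>'' n = inverse x * (\<sigma> (?a n) * \<sigma>' (?b n))" for n
  define \<tau>'' where "\<tau>'' n = inverse y * (\<tau> (?a n) * \<tau>' (?b n))" for n
  note b = B[unfolded translation_seq_def] and b' = B'[unfolded translation_seq_def]
  have invB: "invertible (B n)" "invertible (B' n)" "invertible H" for n using b b' H inv by auto
  have "(\<lambda>n. inverse x *\<^sub>R ((\<sigma> (?a n) *\<^sub>R B (?a n)) ** H ** (\<sigma>' (?b n) *\<^sub>R B' (?b n))))
      \<longlonglongrightarrow> inverse x *\<^sub>R (outer p \<xi> ** H ** outer p \<xi>)"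
    using b b' by (intro tendsto_intros sub[of "\<lambda>n. \<sigma> n *\<^sub>R B n"] sub[of "\<lambda>n. \<sigma>' n *\<^sub>R B' n"]) auto
  also have "inverse x *\<^sub>R (outer p \<xi> ** H ** outer p \<xi>) = outer p \<xi>"
    using xy by (simp add: mult_outer outer_mult_vector matrix_vector_mul_assoc[symmetric] scaleR_outer2[symmetric] x_def)
  also have "(\<lambda>n. inverse x *\<^sub>R ((\<sigma> (?a n) *\<^sub>R B (?a n)) ** H ** (\<sigma>' (?b n) *\<^sub>R B' (?b n))))
      = (\<lambda>n. \<sigma>'' n *\<^sub>R C n)"
    by (simp add: C_def \<sigma>''_def matrix_scalar_ac scalar_matrix_assoc[symmetric] mult_ac)
  finally have 1: "(\<lambda>n. \<sigma>'' n *\<^sub>R C n) \<longlonglongrightarrow> outer p \<xi>" .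
  have Cinv: "matrix_inv (C n) = matrix_inv (B' (?b n)) ** matrix_inv H ** matrix_inv (B (?a n))" for n
    by (simp add: C_def matrix_inv_prod invertible_mult invB matrix_mul_assoc)
  have "(\<lambda>n. inverse y *\<^sub>R ((\<tau>' (?b n) *\<^sub>R matrix_inv (B' (?b n))) ** matrix_inv H ** (\<tau> (?a n) *\<^sub>R matrix_inv (B (?a n)))))
      \<longlonglongrightarrow> inverse y *\<^sub>R (outer q \<eta> ** matrix_inv H ** outer q \<eta>)"
    using b b' by (intro tendsto_intros sub[of "\<lambda>n. \<tau> n *\<^sub>R matrix_inv (B n)"]
        sub[of "\<lambda>n. \<tau>' n *\<^sub>R matrix_inv (B' n)"]) auto
  also have "inverse y *\<^sub>R (outer q \<eta> ** matrix_inv H ** outer q \<eta>) = outer q \<eta>"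
    using xy by (simp add: mult_outer outer_mult_vector matrix_vector_mul_assoc[symmetric] scaleR_outer2[symmetric] y_def)
  also have "(\<lambda>n. inverse y *\<^sub>R ((\<tau>' (?b n) *\<^sub>R matrix_inv (B' (?b n))) ** matrix_inv H ** (\<tau> (?a n) *\<^sub>R matrix_inv (B (?a n)))))
      = (\<lambda>n. \<tau>'' n *\<^sub>R matrix_inv (C n))"
    by (simp add: Cinv \<tau>''_def matrix_scalar_ac scalar_matrix_assoc[symmetric] mult_ac)
  finally have 2: "(\<lambda>n. \<tau>'' n *\<^sub>R matrix_inv (C n)) \<longlonglongrightarrow> outer q \<eta>" .
  have "(\<lambda>n. inverse (gain H) * ((\<sigma> (?a n) * \<tau> (?a n) * exp (real (?a n) * L)) * (\<sigma>' (?b n) * \<tau>' (?b n) * exp (real (?b n) * L))))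
      \<longlonglongrightarrow> inverse (gain H) * (exp (- s) * exp (- s'))"
    using b b' by (intro tendsto_intros sub[of "\<lambda>n. \<sigma> n * \<tau> n * exp (real n * L)"]
        sub[of "\<lambda>n. \<sigma>' n * \<tau>' n * exp (real n * L)"]) auto
  also have "inverse (gain H) * (exp (- s) * exp (- s')) = exp (- (s + s' + ln (gain H)))"
    using H(2) by (simp add: exp_add exp_diff exp_minus field_simps)
  also have "(\<lambda>n. inverse (gain H) * ((\<sigma> (?a n) * \<tau> (?a n) * exp (real (?a n) * L)) * (\<sigma>' (?b n) * \<tau>' (?b n) * exp (real (?b n) * L))))
      = (\<lambda>n. \<sigma>'' n * \<tau>'' n * exp (real n * L))"
  proof
    fix n
    have "real n * L = real (?a n) * L + real (?b n) * L" by (simp add: of_nat_diff algebra_simps)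
    then have "exp (real n * L) = exp (real (?a n) * L) * exp (real (?b n) * L)" by (simp only: exp_add)
    then show "inverse (gain H) * ((\<sigma> (?a n) * \<tau> (?a n) * exp (real (?a n) * L)) * (\<sigma>' (?b n) * \<tau>' (?b n) * exp (real (?b n) * L)))
        = \<sigma>'' n * \<tau>'' n * exp (real n * L)"
      by (simp add: \<sigma>''_def \<tau>''_def gain_def x_def y_def mult_ac)
  qed
  finally have 3: "(\<lambda>n. \<sigma>'' n * \<tau>'' n * exp (real n * L)) \<longlonglongrightarrow> exp (- (s + s' + ln (gain H)))" .
  have "translation_seq (s + s' + ln (gain H)) C \<sigma>'' \<tau>''"
    unfolding translation_seq_def using 1 2 3 b b' xy H by (auto simp: C_def \<sigma>''_def \<tau>''_def intro!: mult)
  then show ?thesis unfolding shifts_def by blast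
qed

lemma gain_one: "gain (mat 1) = 1"
proof -
  have "matrix_inv (mat 1) = (mat 1 :: real^'n^'n)" by (rule matrix_inv_unique) simp
  then show ?thesis by (simp add: gain_def unit)
qed

lemma shifts_add: "s \<in> shifts \<Longrightarrow> s' \<in> shifts \<Longrightarrow> s + s' \<in> shifts"
  using translation_seq_compose[OF _ _ one] gain_one unfolding shifts_def by fastforce

lemma ln_gain_in_shifts:
  assumes "H \<in> G" "gain H > 0"
  shows "ln (gain H) \<in> shifts"
proof -
  have "0 \<in> shifts" using shifts_add[OF L_in_shifts minus_L_in_shifts] by simp
  then show ?thesis using translation_seq_compose[OF _ _ assms, of 0 _ _ _ 0] unfolding shifts_def by fastforce
qed

text \<open>The first limit concerns \<open>D^n\<close>, the second \<open>D^-n\<close> with the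
  same normalisation; there \<open>H p\<close> is caught by \<open>outer q \<eta>\<close> and
  \<open>H^-1 q\<close> by \<open>outer p \<xi>\<close>.\<close>

lemma gain_sequence:
  assumes H: "H \<in> G"
  shows "(\<lambda>n. (m / l) ^ n * gain (H ** matpow D n ** H)) \<longlonglongrightarrow> (gain H)\<^sup>2"
    and "(\<lambda>n. (m / l) ^ n * ((\<xi> \<bullet> (H *v (matrix_inv (matpow D n) *v (H *v p)))) *
      (\<eta> \<bullet> (matrix_inv H *v (matpow D n *v (matrix_inv H *v q)))))) \<longlonglongrightarrow>
      (\<xi> \<bullet> (H *v q)) * (\<eta> \<bullet> (H *v p)) * ((\<eta> \<bullet> (matrix_inv H *v p)) * (\<xi> \<bullet> (matrix_inv H *v q)))"
proof -
  have iv: "matrix_inv (H ** matpow D n ** H) = matrix_inv H ** matrix_inv (matpow D n) ** matrix_inv H" for n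
    using inv[OF H] matpow_inverse(1)[OF inv[OF DG]]
    by (simp add: matrix_inv_prod invertible_mult matrix_mul_assoc)
  have "(\<lambda>n. (\<xi> \<bullet> (H *v ((inverse l ^ n *\<^sub>R matpow D n) *v (H *v p)))) *
      (\<eta> \<bullet> (matrix_inv H *v ((m ^ n *\<^sub>R matrix_inv (matpow D n)) *v (matrix_inv H *v q)))))
    \<longlonglongrightarrow> (\<xi> \<bullet> (H *v (outer p \<xi> *v (H *v p)))) * (\<eta> \<bullet> (matrix_inv H *v (outer q \<eta> *v (matrix_inv H *v q))))"
    by (intro tendsto_intros lim lim')
  then show "(\<lambda>n. (m / l) ^ n * gain (H ** matpow D n ** H)) \<longlonglongrightarrow> (gain H)\<^sup>2"
    by (simp add: gain_def iv outer_mult_vector matrix_vector_mul_assoc[symmetric] scaleR_matrix_vector_assoc[symmetric]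
        matrix_vector_mult_scaleR power2_eq_square power_mult_distrib power_inverse divide_inverse mult_ac)
  have "(\<lambda>n. (\<xi> \<bullet> (H *v ((m ^ n *\<^sub>R matrix_inv (matpow D n)) *v (H *v p)))) *
      (\<eta> \<bullet> (matrix_inv H *v ((inverse l ^ n *\<^sub>R matpow D n) *v (matrix_inv H *v q)))))
    \<longlonglongrightarrow> (\<xi> \<bullet> (H *v (outer q \<eta> *v (H *v p)))) * (\<eta> \<bullet> (matrix_inv H *v (outer p \<xi> *v (matrix_inv H *v q))))"
    by (intro tendsto_intros lim lim')
  then show "(\<lambda>n. (m / l) ^ n * ((\<xi> \<bullet> (H *v (matrix_inv (matpow D n) *v (H *v p)))) *
      (\<eta> \<bullet> (matrix_inv H *v (matpow D n *v (matrix_inv H *v q)))))) \<longlonglongrightarrow>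
      (\<xi> \<bullet> (H *v q)) * (\<eta> \<bullet> (H *v p)) * ((\<eta> \<bullet> (matrix_inv H *v p)) * (\<xi> \<bullet> (matrix_inv H *v q)))"
    by (simp add: outer_mult_vector scaleR_matrix_vector_assoc[symmetric]
        matrix_vector_mult_scaleR power_mult_distrib power_inverse divide_inverse mult_ac)
qed

text \<open>The renormalised gains along \<open>H D\<^sup>n H\<close> satisfy a linear recurrence which can be run
  backwards. If they were eventually constant for \<open>n \<rightarrow> \<infinity>\<close>, they would be constant for all
  \<open>n \<in> \<int>\<close>, but for \<open>n \<rightarrow> -\<infinity>\<close> they grow like \<open>(l / m)\<^sup>2\<^sup>|\<^sup>n\<^sup>|\<close>.\<close>

lemma gain_not_eventually_constant:
  assumes H: "H \<in> G" and nz: "\<xi> \<bullet> (H *v q) \<noteq> 0" "\<eta> \<bullet> (H *v p) \<noteq> 0"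
      "\<eta> \<bullet> (matrix_inv H *v p) \<noteq> 0" "\<xi> \<bullet> (matrix_inv H *v q) \<noteq> 0"
  shows "\<exists>n\<ge>M. (m / l) ^ n * gain (H ** matpow D n ** H) \<noteq> c"
proof (rule ccontr)
  assume "\<not> ?thesis"
  then have const: "(m / l) ^ n * gain (H ** matpow D n ** H) = c" if "n \<ge> M" for n using that by blast
  have invD: "invertible D" using inv DG by blast
  \<comment> \<open>The product of the two coefficients in the gain is linear in
    \<open>D^n Z0 D^-n\<close>, where \<open>Z0\<close> is \<open>H p\<close> tensored with the form
    \<open>\<eta>\<close> composed with \<open>H^-1\<close>. So the renormalised gain is
    \<open>\<Phi>\<close> along the orbit of \<open>Z0\<close> under the linear map
    \<open>A\<close>.\<close>
  define A where "A Z = (m / l) *\<^sub>R (D ** Z ** matrix_inv D)" for Z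
  define B where "B Z = (l / m) *\<^sub>R (matrix_inv D ** Z ** D)" for Z
  define \<Phi> where "\<Phi> Z = \<xi> \<bullet> ((H ** Z ** matrix_inv H) *v q)" for Z
  define Z0 where "Z0 = outer (H *v p) (transpose (matrix_inv H) *v \<eta>)"
  have Z0: "X *v (Z0 *v y) = (\<eta> \<bullet> (matrix_inv H *v y)) *\<^sub>R (X *v (H *v p))" for X :: "real^'n^'n" and y
    unfolding Z0_def outer_mult_vector transpose_inner by (simp add: matrix_vector_mult_scaleR)
  have An: "(A ^^ n) Z = (m / l) ^ n *\<^sub>R (matpow D n ** Z ** matrix_inv (matpow D n))" for n Z
  proof (induction n)
    case 0
    have "matrix_inv (mat 1) = (mat 1 :: real^'n^'n)" by (rule matrix_inv_unique) simp
    then show ?case by simp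
  next
    case (Suc n)
    have "matrix_inv (matpow D (Suc n)) = matrix_inv (matpow D n) ** matrix_inv D"
      using matrix_inv_prod[OF invD matpow_inverse(1)[OF invD]] by simp
    then show ?case using Suc by (simp add: A_def matrix_scalar_ac scalar_matrix_assoc[symmetric] matrix_mul_assoc)
  qed
  have Bn: "(B ^^ n) Z = (l / m) ^ n *\<^sub>R (matrix_inv (matpow D n) ** Z ** matpow D n)" for n Z
  proof (induction n)
    case 0
    have "matrix_inv (mat 1) = (mat 1 :: real^'n^'n)" by (rule matrix_inv_unique) simp
    then show ?case by simp
  next
    case (Suc n)
    have "matpow D (Suc n) = matpow D n ** D" by (rule matpow_Suc2)
    moreover have "matrix_inv (matpow D (Suc n)) = matrix_inv D ** matrix_inv (matpow D n)"
      unfolding matpow_Suc2 by (rule matrix_inv_prod[OF matpow_inverse(1)[OF invD] invD])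
    ultimately show ?case using Suc
      by (simp add: B_def matrix_scalar_ac scalar_matrix_assoc[symmetric] matrix_mul_assoc del: matpow.simps)
  qed
  have lin: "linear A" "linear B" "linear \<Phi>"
    by (rule linearI, auto simp: A_def B_def \<Phi>_def matrix_add_ldistrib matrix_add_rdistrib matrix_scalar_ac
        scalar_matrix_assoc[symmetric] scaleR_add_right matrix_vector_mult_add_rdistrib inner_add_right
        scaleR_matrix_vector_assoc[symmetric])+
  have DD: "D ** (matrix_inv D ** X) = X" "matrix_inv D ** (D ** X) = X" for X :: "real^'n^'n"
    by (simp_all add: matrix_mul_assoc matrix_inv_mult[OF invD])
  have BA: "B (A Z) = Z" "A (B Z) = Z" for Z
    using ml by (simp_all add: A_def B_def matrix_scalar_ac scalar_matrix_assoc[symmetric]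
        matrix_mul_assoc[symmetric] DD matrix_inv_mult[OF invD])
  have "\<Phi> ((A ^^ n) Z0) = (m / l) ^ n * gain (H ** matpow D n ** H)" for n
  proof -
    have "matrix_inv (H ** matpow D n ** H) = matrix_inv H ** matrix_inv (matpow D n) ** matrix_inv H"
      using inv[OF H] matpow_inverse(1)[OF invD]
      by (simp add: matrix_inv_prod invertible_mult matrix_mul_assoc)
    then show ?thesis
      by (simp add: \<Phi>_def An gain_def Z0 matrix_vector_mul_assoc[symmetric] scaleR_matrix_vector_assoc[symmetric]
          matrix_vector_mult_scaleR)
  qed
  then have "\<Phi> ((A ^^ n) Z0) = c" if "n \<ge> M" for n using const that by simp
  then have bwd: "\<Phi> ((B ^^ k) Z0) = \<Phi> Z0" for k
    using iterate_constant_backwards[OF lin(1,2) BA lin(3)] by blast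
  define E where "E n = (\<xi> \<bullet> (H *v (matrix_inv (matpow D n) *v (H *v p)))) *
      (\<eta> \<bullet> (matrix_inv H *v (matpow D n *v (matrix_inv H *v q))))" for n
  \<comment> \<open>Constancy in the backward direction makes \<open>E n\<close> decay like
    \<open>(m / l)^n\<close>, while by \<open>gain_sequence\<close> it grows like
    \<open>(l / m)^n\<close> with a non-zero coefficient.\<close>
  have eq: "(m / l) ^ n * E n = (m / l) ^ n * (m / l) ^ n * \<Phi> Z0" for n
  proof -
    have "\<Phi> ((B ^^ n) Z0) = (l / m) ^ n * E n"
      by (simp add: E_def \<Phi>_def Bn Z0 matrix_vector_mul_assoc[symmetric] scaleR_matrix_vector_assoc[symmetric]
          matrix_vector_mult_scaleR)
    moreover have "(m / l) ^ n * (l / m) ^ n = 1" using ml by (simp add: power_mult_distrib[symmetric])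
    ultimately show ?thesis unfolding bwd[of n, symmetric] by (metis mult.assoc mult_1)
  qed
  have "(\<lambda>n. (m / l) ^ n * (m / l) ^ n * \<Phi> Z0) \<longlonglongrightarrow> 0 * 0 * \<Phi> Z0"
    using ml by (intro tendsto_intros LIMSEQ_realpow_zero) auto
  moreover have "(\<lambda>n. (m / l) ^ n * (m / l) ^ n * \<Phi> Z0) \<longlonglongrightarrow>
      (\<xi> \<bullet> (H *v q)) * (\<eta> \<bullet> (H *v p)) * ((\<eta> \<bullet> (matrix_inv H *v p)) * (\<xi> \<bullet> (matrix_inv H *v q)))"
    using gain_sequence(2)[OF H] unfolding E_def[symmetric] eq .
  ultimately have "0 * 0 * \<Phi> Z0 =
      (\<xi> \<bullet> (H *v q)) * (\<eta> \<bullet> (H *v p)) * ((\<eta> \<bullet> (matrix_inv H *v p)) * (\<xi> \<bullet> (matrix_inv H *v q)))"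
    by (rule LIMSEQ_unique)
  then show False using nz by simp
qed

text \<open>\<open>s n\<close> is the logarithm of the renormalised gain of \<open>H D^n H\<close>.
  Two of the six non-vanishing coefficients of \<open>H\<close> make its limit finite, the other
  four keep it from being eventually constant.\<close>

theorem shifts_dense:
  assumes "e > 0" shows "\<exists>s\<in>shifts. \<bar>s - t\<bar> < e"
proof -
  have nz: "p \<noteq> 0" "q \<noteq> 0" "\<xi> \<noteq> 0" "\<eta> \<noteq> 0" using unit by auto
  have "\<exists>H\<in>G. \<forall>(\<xi>, v)\<in>{(\<xi>, p), (\<xi>, q), (\<eta>, p), (\<eta>, q)}. \<xi> \<bullet> (H *v v) \<noteq> 0 \<and> \<xi> \<bullet> (matrix_inv H *v v) \<noteq> 0"
    by (rule generic_element) (use nz in auto)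
  then obtain H where H: "H \<in> G" and n: "\<xi> \<bullet> (H *v p) \<noteq> 0" "\<eta> \<bullet> (matrix_inv H *v q) \<noteq> 0"
    "\<xi> \<bullet> (H *v q) \<noteq> 0" "\<eta> \<bullet> (H *v p) \<noteq> 0" "\<eta> \<bullet> (matrix_inv H *v p) \<noteq> 0" "\<xi> \<bullet> (matrix_inv H *v q) \<noteq> 0"
    by auto
  have gain: "(gain H)\<^sup>2 > 0" using n by (simp add: gain_def)
  define g where "g n = (m / l) ^ n * gain (H ** matpow D n ** H)" for n
  define s where "s n = ln (g n)" for n
  have g: "g \<longlonglongrightarrow> (gain H)\<^sup>2" unfolding g_def by (rule gain_sequence(1)[OF H])
  have "\<forall>\<^sub>F n in sequentially. g n > 0" using order_tendstoD(1)[OF g gain] .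
  then obtain N where N: "\<And>n. n \<ge> N \<Longrightarrow> g n > 0" by (auto simp: eventually_sequentially)
  have zero: "0 \<in> shifts" using shifts_add[OF L_in_shifts minus_L_in_shifts] by simp
  have mult_L: "- (real n * L) \<in> shifts" for n
  proof (induction n)
    case (Suc n)
    have "- (real (Suc n) * L) = - (real n * L) + - L" by (simp add: algebra_simps)
    then show ?case using shifts_add[OF Suc minus_L_in_shifts] by simp
  qed (simp add: zero)
  have sX: "s n \<in> shifts" if "n \<ge> N" for n
  proof -
    have HG: "H ** matpow D n ** H \<in> G" by (intro mult H matpow_mem DG)
    have pos: "gain (H ** matpow D n ** H) > 0" using N[OF that] ml unfolding g_def
      by (metis divide_pos_pos zero_less_mult_pos zero_less_power)
    \<comment> \<open>The logarithm of the normalising factor is itself a shift, so it can be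
      added.\<close>
    have "ln ((m / l) ^ n) = - (real n * L)" using ml by (simp add: L_def ln_realpow ln_div algebra_simps)
    moreover have "(m / l) ^ n > 0" using ml by simp
    ultimately have "s n = - (real n * L) + ln (gain (H ** matpow D n ** H))"
      unfolding s_def g_def using pos by (subst ln_mult_pos) auto
    then show ?thesis using shifts_add[OF mult_L ln_gain_in_shifts[OF HG pos]] by simp
  qed
  have s: "s \<longlonglongrightarrow> ln ((gain H)\<^sup>2)" unfolding s_def using gain by (intro tendsto_intros g) auto
  have nc: "\<exists>n\<ge>M. s n \<noteq> c" for M c
  proof -
    obtain n where n: "n \<ge> max M N" "g n \<noteq> exp c"
      using gain_not_eventually_constant[OF H n(3-6), of "max M N" "exp c"] unfolding g_def by blast
    then have "s n \<noteq> c" using N[of n] by (auto simp: s_def)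
    then show ?thesis using n by auto
  qed
  show ?thesis
    by (rule dense_semigroup[OF shifts_add L_pos L_in_shifts minus_L_in_shifts sX s nc assms])
qed

end

section \<open>Cones over properly convex sets\<close>

lemma proj_pt_eqD:
  assumes "proj_pt x = proj_pt y" "x \<noteq> 0" "y \<noteq> 0"
  obtains c where "c \<noteq> 0" "y = c *\<^sub>R x"
  using assms proj_pt_eq_iff by blast

lemma proj_pt_scaleR: "x \<noteq> 0 \<Longrightarrow> c \<noteq> 0 \<Longrightarrow> proj_pt (c *\<^sub>R x) = proj_pt x"
  using proj_pt_eq_iff[of x "c *\<^sub>R x"] by auto

lemma proj_pt_minus: "x \<noteq> 0 \<Longrightarrow> proj_pt (- x) = proj_pt x"
  using proj_pt_scaleR[of x "-1"] by simp

lemma tvec_eq_iff: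
  assumes "fst v \<noteq> 0" "fst w \<noteq> 0"
  shows "tvec v = tvec w \<longleftrightarrow> (\<exists>l m. l \<noteq> 0 \<and> fst w = l *\<^sub>R fst v \<and> snd w = l *\<^sub>R snd v + m *\<^sub>R fst v)"
  using Quotient3_rel[OF Quotient3_tproj, of v w] tproj_rel_refl assms by (auto simp: tproj_rel_def)

lemma tproj_cases: obtains x \<xi> where "x \<noteq> 0" "v = tvec (x, \<xi>)"
  using Quotient3_abs_rep[OF Quotient3_tproj, of v] Quotient3_rep_reflp[OF Quotient3_tproj, of v]
  by (metis tproj_rel_def prod.collapse)

lemma footpoint_tvec: "x \<noteq> 0 \<Longrightarrow> footpoint (tvec (x, \<xi>)) = proj_pt x"
  using footpoint.abs_eq[OF tproj_rel_refl, of "(x, \<xi>)"] by simp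

lemma pgl_act_pgl: "invertible A \<Longrightarrow> x \<noteq> 0 \<Longrightarrow> pgl_act (pgl A) (proj_pt x) = proj_pt (A *v x)"
  by (rule pgl_act.abs_eq[OF pgl_rel_refl proj_rel_refl])

lemma pgl_tact_pgl:
  "invertible A \<Longrightarrow> x \<noteq> 0 \<Longrightarrow> pgl_tact (pgl A) (tvec (x, \<xi>)) = tvec (A *v x, A *v \<xi>)"
  using pgl_tact.abs_eq[OF pgl_rel_refl tproj_rel_refl, of A "(x, \<xi>)"] by simp

lemma pgl_mult_pgl: "invertible A \<Longrightarrow> invertible B \<Longrightarrow> pgl_mult (pgl A) (pgl B) = pgl (A ** B)"
  by (rule pgl_mult.abs_eq[OF pgl_rel_refl pgl_rel_refl])

lemma open_proj_preimage: "open U \<Longrightarrow> open {x. x \<noteq> 0 \<and> proj_pt x \<in> U}"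
  by (simp add: open_proj_def)

lemma continuous_on_proj_pt: "continuous_on (- {0}) proj_pt"
proof (subst continuous_on_open_vimage)
  show "open (- {0} :: (real^'n) set)" by (simp add: open_Compl)
  show "\<forall>B. open B \<longrightarrow> open (proj_pt -` B \<inter> - {0 :: real^'n})"
  proof (intro allI impI)
    fix B :: "'n proj set" assume "open B"
    moreover have "proj_pt -` B \<inter> - {0} = {x. x \<noteq> 0 \<and> proj_pt x \<in> B}" by auto
    ultimately show "open (proj_pt -` B \<inter> - {0 :: real^'n})" by (simp add: open_proj_preimage)
  qed
qed

lemma tendsto_proj_pt:
  assumes "(X \<longlongrightarrow> x) F" "x \<noteq> 0"
  shows "((\<lambda>n. proj_pt (X n)) \<longlongrightarrow> proj_pt x) F"
proof -
  have "isCont proj_pt x"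
    using continuous_on_proj_pt assms(2) by (auto simp: continuous_on_eq_continuous_at open_Compl)
  then show ?thesis using assms(1) by (rule isCont_tendsto_compose)
qed

text \<open>\<open>f\<close> and \<open>R\<close> express that the slice where \<open>f\<close> is 1
  is bounded, so that the cone is sharp; written as homogeneous inequalities they pass to the
  closure.\<close>

locale proper_cone =
  fixes C :: "(real^'n) set" and f :: "real^'n" and R :: real
  assumes open_C: "open C"
    and add_C: "x \<in> C \<Longrightarrow> y \<in> C \<Longrightarrow> x + y \<in> C"
    and scale_C: "x \<in> C \<Longrightarrow> c > 0 \<Longrightarrow> c *\<^sub>R x \<in> C"
    and f_pos: "x \<in> C \<Longrightarrow> f \<bullet> x > 0"
    and norm_le: "x \<in> C \<Longrightarrow> norm x \<le> R * (f \<bullet> x)"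
begin

lemma closure_norm_le: "x \<in> closure C \<Longrightarrow> norm x \<le> R * (f \<bullet> x)"
proof -
  have "closed {x. norm x \<le> R * (f \<bullet> x)}" by (intro closed_Collect_le continuous_intros)
  then have "closure C \<subseteq> {x. norm x \<le> R * (f \<bullet> x)}" using norm_le by (intro closure_minimal) auto
  then show "x \<in> closure C \<Longrightarrow> norm x \<le> R * (f \<bullet> x)" by blast
qed

lemma closure_f_nonneg: "x \<in> closure C \<Longrightarrow> f \<bullet> x \<ge> 0"
proof -
  have "closed {x. f \<bullet> x \<ge> 0}" by (intro closed_Collect_le continuous_intros)
  then have "closure C \<subseteq> {x. f \<bullet> x \<ge> 0}" using f_pos by (intro closure_minimal) (auto intro: less_imp_le)
  then show "x \<in> closure C \<Longrightarrow> f \<bullet> x \<ge> 0" by blast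
qed

lemma closure_f_pos: "x \<in> closure C \<Longrightarrow> x \<noteq> 0 \<Longrightarrow> f \<bullet> x > 0"
  using closure_norm_le[of x] closure_f_nonneg[of x] by (cases "f \<bullet> x = 0") auto

lemma minus_closure: "x \<in> closure C \<Longrightarrow> - x \<in> closure C \<Longrightarrow> x = 0"
  using closure_f_pos[of x] closure_f_nonneg[of "- x"] by force

lemma nz: "x \<in> C \<Longrightarrow> x \<noteq> 0"
  using f_pos by force

lemma add_closure: assumes "x \<in> C" "y \<in> closure C" shows "x + y \<in> C"
proof -
  obtain Y where Y: "\<And>n. Y n \<in> C" "Y \<longlonglongrightarrow> y" using assms(2) closure_sequential by metis
  have "(\<lambda>n. x + (y - Y n)) \<longlonglongrightarrow> x + (y - y)" by (intro tendsto_intros Y)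
  then have "\<forall>\<^sub>F n in sequentially. x + (y - Y n) \<in> C"
    using topological_tendstoD[OF _ open_C] assms(1) by simp
  then obtain n where "x + (y - Y n) \<in> C" by (auto simp: eventually_sequentially)
  from add_C[OF this Y(1)[of n]] show ?thesis by simp
qed

lemma scale_closure: assumes "x \<in> closure C" "c > 0" shows "c *\<^sub>R x \<in> closure C"
proof -
  obtain X where "\<And>n. X n \<in> C" "X \<longlonglongrightarrow> x" using assms(1) closure_sequential by metis
  then have "\<And>n. c *\<^sub>R X n \<in> C" "(\<lambda>n. c *\<^sub>R X n) \<longlonglongrightarrow> c *\<^sub>R x" using scale_C assms by (auto intro: tendsto_intros)
  then show ?thesis unfolding closure_sequential by (intro exI[of _ "\<lambda>n. c *\<^sub>R X n"]) simp
qed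

text \<open>Contains 0 as soon as the cone is non-empty; in a \<open>bpair\<close> the condition on
  the sum excludes it.\<close>

definition bd :: "(real^'n) set" where "bd = closure C - C"

lemma scale_C_iff: "c > 0 \<Longrightarrow> c *\<^sub>R x \<in> C \<longleftrightarrow> x \<in> C"
  using scale_C[of x c] scale_C[of "c *\<^sub>R x" "inverse c"] by auto

lemma scale_bd: "x \<in> bd \<Longrightarrow> c > 0 \<Longrightarrow> c *\<^sub>R x \<in> bd"
  using scale_closure scale_C_iff by (auto simp: bd_def)

definition bpair :: "real^'n \<Rightarrow> real^'n \<Rightarrow> bool" where
  "bpair u w \<longleftrightarrow> u \<in> bd \<and> w \<in> bd \<and> u + w \<in> C"

lemma bpair_sym: "bpair u w \<Longrightarrow> bpair w u"
  by (auto simp: bpair_def add.commute)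

lemma comb_in_C:
  assumes "u \<in> closure C" "w \<in> closure C" "u + w \<in> C" "s > 0" "t > 0"
  shows "s *\<^sub>R u + t *\<^sub>R w \<in> C"
proof -
  have *: "s *\<^sub>R u + t *\<^sub>R w \<in> C"
    if "u \<in> closure C" "w \<in> closure C" "u + w \<in> C" "s > 0" "t > 0" "s \<le> t" for s t u w
  proof (cases "s = t")
    case True
    then show ?thesis using scale_C[OF that(3,4)] by (simp add: scaleR_add_right)
  next
    case False
    have "s *\<^sub>R u + t *\<^sub>R w = s *\<^sub>R (u + w) + (t - s) *\<^sub>R w" by (simp add: algebra_simps)
    then show ?thesis using add_closure scale_C scale_closure False that by simp
  qed
  show ?thesis
  proof (cases "s \<le> t")
    case False
    then show ?thesis using *[of w u t s] assms by (simp add: add.commute)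
  qed (use * assms in blast)
qed

lemma bpair_comb: "bpair u w \<Longrightarrow> s > 0 \<Longrightarrow> t > 0 \<Longrightarrow> s *\<^sub>R u + t *\<^sub>R w \<in> C"
  using comb_in_C by (auto simp: bpair_def bd_def)

lemma bpair_scale: "bpair u w \<Longrightarrow> s > 0 \<Longrightarrow> t > 0 \<Longrightarrow> bpair (s *\<^sub>R u) (t *\<^sub>R w)"
  using bpair_comb scale_bd by (auto simp: bpair_def)

lemma bpair_nz: assumes "bpair u w" shows "u \<noteq> 0" "w \<noteq> 0"
  using assms by (auto simp: bpair_def bd_def)

text \<open>In the plane of \<open>u\<close> and \<open>w\<close> the cone is the open quadrant: if
  \<open>s\<close> were not positive, adding \<open>- s\<close> times \<open>u\<close> would put a
  multiple of \<open>w\<close> into \<open>C\<close>.\<close>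

lemma bpair_coeff_pos:
  assumes p: "bpair u w" and in_C: "s *\<^sub>R u + t *\<^sub>R w \<in> C"
  shows "s > 0" "t > 0"
proof -
  have *: False if "bpair u w" "s *\<^sub>R u + t *\<^sub>R w \<in> C" "s \<le> 0" for s t u w
  proof -
    have cl: "u \<in> closure C" "w \<in> closure C" "w \<notin> C" using that by (auto simp: bpair_def bd_def)
    have "(s *\<^sub>R u + t *\<^sub>R w) + (- s) *\<^sub>R u \<in> C"
    proof (cases "s = 0")
      case False
      then show ?thesis using that(3) by (intro add_closure that(2) scale_closure cl) auto
    qed (use that in simp)
    then have tw: "t *\<^sub>R w \<in> C" by (simp add: algebra_simps)
    show False
    proof (cases "t > 0")
      case True
      then show False using tw cl scale_C_iff by blast
    next
      case False
      then have "t * (f \<bullet> w) \<le> 0" using closure_f_nonneg[OF cl(2)] by (simp add: mult_nonpos_nonneg)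
      then show False using f_pos[OF tw] by simp
    qed
  qed
  show "s > 0" using *[OF p in_C] by (meson not_less)
  show "t > 0" using *[OF bpair_sym[OF p], of t s] in_C by (metis add.commute not_less)
qed

lemma bpair_closure_coeff_nonneg:
  assumes p: "bpair u w" and cl: "s *\<^sub>R u + t *\<^sub>R w \<in> closure C"
  shows "s \<ge> 0" "t \<ge> 0"
proof -
  have "s + e > 0 \<and> t + e > 0" if "e > 0" for e
  proof -
    have "e *\<^sub>R (u + w) + (s *\<^sub>R u + t *\<^sub>R w) \<in> C"
      using add_closure[OF scale_C[OF _ that] cl] p by (simp add: bpair_def)
    then have "(s + e) *\<^sub>R u + (t + e) *\<^sub>R w \<in> C" by (simp add: algebra_simps)
    then show ?thesis using bpair_coeff_pos[OF p] by blast
  qed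
  from this[of "- s"] this[of "- t"] show "s \<ge> 0" "t \<ge> 0" by fastforce+
qed

text \<open>A relation would allow the coefficients of the fixed vector \<open>u + w\<close> to be
  changed arbitrarily, but they have to stay positive.\<close>

lemma bpair_independent:
  assumes p: "bpair u w" and eq: "a *\<^sub>R u + b *\<^sub>R w = 0"
  shows "a = 0" "b = 0"
proof -
  have uw: "u + w \<in> C" using p by (simp add: bpair_def)
  have "(1 + k * a) *\<^sub>R u + (1 + k * b) *\<^sub>R w = u + w" for k
  proof -
    have "(1 + k * a) *\<^sub>R u + (1 + k * b) *\<^sub>R w = u + w + k *\<^sub>R (a *\<^sub>R u + b *\<^sub>R w)"
      by (simp add: algebra_simps)
    then show ?thesis by (simp add: eq)
  qed
  then have "1 + k * a > 0 \<and> 1 + k * b > 0" for k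
    using bpair_coeff_pos[OF p, of "1 + k * a" "1 + k * b"] uw by simp
  note pos = this
  show "a = 0"
  proof (rule ccontr)
    assume "a \<noteq> 0" then show False using pos[of "- inverse a"] by simp
  qed
  show "b = 0"
  proof (rule ccontr)
    assume "b \<noteq> 0" then show False using pos[of "- inverse b"] by simp
  qed
qed

text \<open>A direction in the kernel of \<open>f\<close> stays in one slice. The cap at
  \<open>2 * (f \<bullet> x)\<close> makes the set bounded, and the ray cannot leave through
  it.\<close>

lemma exists_boundary_point:
  assumes "x \<in> C" "g \<noteq> 0" "f \<bullet> g = 0"
  obtains d where "d > 0" "x + d *\<^sub>R g \<in> bd"
proof -
  define S where "S = C \<inter> {y. f \<bullet> y < 2 * (f \<bullet> x)}"
  have "open S" unfolding S_def by (intro open_Int open_C open_Collect_less continuous_intros)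
  have fx: "f \<bullet> x > 0" using assms f_pos by blast
  have "R \<ge> 0"
  proof (rule ccontr)
    assume "\<not> R \<ge> 0"
    then have "R * (f \<bullet> x) < 0" using fx by (simp add: mult_neg_pos)
    then show False using norm_le[OF assms(1)] norm_ge_zero[of x] by linarith
  qed
  have "norm y \<le> R * (2 * (f \<bullet> x))" if "y \<in> S" for y
  proof -
    have "norm y \<le> R * (f \<bullet> y)" using that norm_le by (auto simp: S_def)
    also have "\<dots> \<le> R * (2 * (f \<bullet> x))" using that \<open>R \<ge> 0\<close> by (intro mult_left_mono) (auto simp: S_def)
    finally show ?thesis .
  qed
  then have "bounded S" by (auto simp: bounded_iff)
  have "x \<in> S" using assms fx by (simp add: S_def)
  then have "x \<in> interior S" using interior_open[OF \<open>open S\<close>] by simp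
  from ray_to_frontier[OF \<open>bounded S\<close> this assms(2)] obtain d where d: "d > 0" "x + d *\<^sub>R g \<in> frontier S" by blast
  then have "x + d *\<^sub>R g \<in> closure S" "x + d *\<^sub>R g \<notin> S"
    using \<open>open S\<close> by (auto simp: frontier_def interior_open)
  moreover have "closure S \<subseteq> closure C" by (rule closure_mono) (auto simp: S_def)
  moreover have "f \<bullet> (x + d *\<^sub>R g) < 2 * (f \<bullet> x)" using fx by (simp add: inner_add_right assms(3))
  ultimately have "x + d *\<^sub>R g \<in> bd" by (auto simp: S_def bd_def)
  then show ?thesis using d that by blast
qed

text \<open>The chord through \<open>x\<close> in the direction of \<xi> modulo \<open>x\<close>
  ends on the boundary, and its ends are rescaled to have sum \<open>x\<close>. The factor
  \<open>c\<close> will be the Finsler norm of \<xi>.\<close>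

lemma exists_bpair:
  assumes x: "x \<in> C" and \<xi>: "\<And>c. \<xi> \<noteq> c *\<^sub>R x"
  obtains u w c m where "bpair u w" "x = u + w" "c > 0" "\<xi> = c *\<^sub>R (w - u) + m *\<^sub>R x"
proof -
  have fx: "f \<bullet> x > 0" using x f_pos by blast
  define k where "k = (f \<bullet> \<xi>) / (f \<bullet> x)"
  define g where "g = \<xi> - k *\<^sub>R x"
  have "g \<noteq> 0" using \<xi>[of k] by (simp add: g_def)
  have fg: "f \<bullet> g = 0" using fx by (simp add: g_def k_def inner_diff_right)
  obtain d where d: "d > 0" "x + d *\<^sub>R g \<in> bd" using exists_boundary_point[OF x \<open>g \<noteq> 0\<close> fg] .
  obtain e where e: "e > 0" "x + e *\<^sub>R (- g) \<in> bd"
    using exists_boundary_point[OF x, of "- g"] \<open>g \<noteq> 0\<close> fg by auto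
  define u where "u = (d / (d + e)) *\<^sub>R (x + e *\<^sub>R (- g))"
  define w where "w = (e / (d + e)) *\<^sub>R (x + d *\<^sub>R g)"
  have de: "d + e > 0" "d + e \<noteq> 0" using d e by auto
  have sum: "u + w = x"
  proof -
    have "u + w = (d / (d + e) + e / (d + e)) *\<^sub>R x + (e * d / (d + e) - d * e / (d + e)) *\<^sub>R g"
      by (simp add: u_def w_def algebra_simps)
    also have "d / (d + e) + e / (d + e) = 1" using de by (simp add: add_divide_distrib[symmetric])
    finally show ?thesis by (simp add: mult.commute)
  qed
  have "w - u = (e / (d + e) - d / (d + e)) *\<^sub>R x + (2 * d * e / (d + e)) *\<^sub>R g"
    by (simp add: u_def w_def algebra_simps scaleR_add_left[symmetric])
  then have "((d + e) / (2 * d * e)) *\<^sub>R (w - u) =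
      (((d + e) / (2 * d * e)) * (e / (d + e) - d / (d + e))) *\<^sub>R x + g"
    using de d e by (simp add: scaleR_add_right)
  then have "\<xi> = ((d + e) / (2 * d * e)) *\<^sub>R (w - u) +
      (k - ((d + e) / (2 * d * e)) * (e / (d + e) - d / (d + e))) *\<^sub>R x"
    by (simp add: g_def algebra_simps)
  moreover have "bpair u w"
    using d e de x sum by (auto simp: bpair_def u_def w_def intro!: scale_bd)
  moreover have "(d + e) / (2 * d * e) > 0" using d e by simp
  ultimately show ?thesis using that sum by blast
qed

end

locale convex_domain = proper_cone C f R for C :: "(real^'n) set" and f :: "real^'n" and R :: real +
  fixes \<Omega> :: "'n proj set"
  assumes mem_\<Omega>: "x \<noteq> 0 \<Longrightarrow> proj_pt x \<in> \<Omega> \<longleftrightarrow> x \<in> C \<or> - x \<in> C"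
    and open_\<Omega>: "open \<Omega>"
begin

lemma proj_pt_in: "x \<in> C \<Longrightarrow> proj_pt x \<in> \<Omega>"
  using mem_\<Omega> nz by blast

lemma mem_\<Omega>E: assumes "a \<in> \<Omega>" obtains x where "x \<in> C" "a = proj_pt x"
proof -
  obtain x where x: "x \<noteq> 0" "a = proj_pt x" by (rule proj_cases)
  then have "x \<in> C \<or> - x \<in> C" using mem_\<Omega> assms by blast
  then show ?thesis using that x proj_pt_minus[of x] by metis
qed

text \<open>The image of the closed cone is closed, because its preimage is the union of the closed
  cone and its negative, without 0; conversely, vectors of the closed cone are limits of vectors of
  \<open>C\<close>.\<close>

lemma mem_closure_\<Omega>: assumes "x \<noteq> 0" shows "proj_pt x \<in> closure \<Omega> \<longleftrightarrow> x \<in> closure C \<or> - x \<in> closure C"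
proof
  define K where "K = proj_pt ` (closure C - {0})"
  have K_iff: "proj_pt x \<in> K \<longleftrightarrow> x \<in> closure C \<or> - x \<in> closure C" if nzx: "x \<noteq> 0" for x
  proof
    assume "proj_pt x \<in> K"
    then obtain y where "y \<in> closure C - {0}" "proj_pt x = proj_pt y" unfolding K_def by (rule imageE)
    then have y: "y \<in> closure C" "y \<noteq> 0" "proj_pt y = proj_pt x" by auto
    obtain c where c: "c \<noteq> 0" "x = c *\<^sub>R y" by (rule proj_pt_eqD[OF y(3,2) nzx])
    then show "x \<in> closure C \<or> - x \<in> closure C"
      using scale_closure[OF y(1), of c] scale_closure[OF y(1), of "- c"] by (cases "c > 0") auto
  next
    assume "x \<in> closure C \<or> - x \<in> closure C"
    then show "proj_pt x \<in> K"
    proof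
      assume "x \<in> closure C"
      then have "x \<in> closure C - {0}" using nzx by simp
      then show ?thesis unfolding K_def by (rule imageI)
    next
      assume "- x \<in> closure C"
      then have "- x \<in> closure C - {0}" using nzx by simp
      then have "proj_pt (- x) \<in> K" unfolding K_def by (rule imageI)
      then show ?thesis using proj_pt_minus[OF nzx] by simp
    qed
  qed
  have "x \<in> uminus ` closure C \<longleftrightarrow> - x \<in> closure C" for x
    by (metis image_iff minus_minus)
  then have pre: "{x. x \<noteq> 0 \<and> proj_pt x \<in> - K} = - {0} \<inter> - (closure C \<union> uminus ` closure C)"
    by (auto simp: K_iff)
  have "closed (uminus ` closure C)" by (simp add: closed_negations)
  then have "open (- {0} \<inter> - (closure C \<union> uminus ` closure C))" by (intro open_Int open_Compl closed_Un) auto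
  then have "open (- K)" unfolding open_proj_def pre .
  then have "closed K" by (simp add: closed_def)
  moreover have "\<Omega> \<subseteq> K"
  proof
    fix a assume "a \<in> \<Omega>"
    then obtain y where "y \<in> C" "a = proj_pt y" by (rule mem_\<Omega>E)
    then show "a \<in> K" using nz closure_subset[of C] by (auto simp: K_def)
  qed
  ultimately have "closure \<Omega> \<subseteq> K" by (intro closure_minimal)
  moreover assume "proj_pt x \<in> closure \<Omega>"
  ultimately show "x \<in> closure C \<or> - x \<in> closure C" using K_iff[OF assms] by blast
next
  have *: "proj_pt x \<in> closure \<Omega>" if x: "x \<in> closure C" "x \<noteq> 0" for x
  proof -
    obtain X where X: "\<And>n. X n \<in> C" "X \<longlonglongrightarrow> x" using x(1) closure_sequential by metis
    have lim: "(\<lambda>n. proj_pt (X n)) \<longlonglongrightarrow> proj_pt x" using X x by (intro tendsto_proj_pt)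
    have "proj_pt (X n) \<in> closure \<Omega>" for n using proj_pt_in[OF X(1)] closure_subset by (rule subsetD[rotated])
    then have "\<forall>\<^sub>F n in sequentially. proj_pt (X n) \<in> closure \<Omega>" by (rule always_eventually[OF allI])
    from Lim_in_closed_set[OF closed_closure this sequentially_bot lim] show ?thesis .
  qed
  assume "x \<in> closure C \<or> - x \<in> closure C"
  then show "proj_pt x \<in> closure \<Omega>" using *[of x] *[of "- x"] assms proj_pt_minus[of x] by auto
qed

lemma mem_frontier_\<Omega>: assumes "x \<noteq> 0" shows "proj_pt x \<in> frontier \<Omega> \<longleftrightarrow> x \<in> bd \<or> - x \<in> bd"
proof -
  have "proj_pt x \<in> frontier \<Omega> \<longleftrightarrow> (x \<in> closure C \<or> - x \<in> closure C) \<and> \<not> (x \<in> C \<or> - x \<in> C)"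
    using open_\<Omega> assms by (simp add: frontier_def interior_open mem_closure_\<Omega> mem_\<Omega>)
  moreover have "\<not> (x \<in> closure C \<and> - x \<in> C)" "\<not> (- x \<in> closure C \<and> x \<in> C)"
    using minus_closure[of x] closure_subset[of C] assms by auto
  ultimately show ?thesis by (auto simp: bd_def)
qed

end

text \<open>The cone over the affine slice. Convexity of the slice gives sums: \<open>x + y\<close>
  is a multiple of a convex combination of the rescaled \<open>x\<close> and
  \<open>y\<close>.\<close>

lemma properly_convex_imp_convex_domain:
  fixes \<Omega> :: "('n::finite) proj set"
  assumes "open \<Omega>" "properly_convex \<Omega>"
  obtains C f R where "convex_domain C f R \<Omega>"
proof -
  obtain f where f: "f \<noteq> 0" "\<And>x. x \<noteq> 0 \<Longrightarrow> proj_pt x \<in> \<Omega> \<Longrightarrow> f \<bullet> x \<noteq> 0"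
    "convex {x. f \<bullet> x = 1 \<and> proj_pt x \<in> \<Omega>}" "bounded {x. f \<bullet> x = 1 \<and> proj_pt x \<in> \<Omega>}"
    using assms(2) unfolding properly_convex_def by blast
  obtain R where R: "\<And>x. f \<bullet> x = 1 \<Longrightarrow> proj_pt x \<in> \<Omega> \<Longrightarrow> norm x \<le> R"
    using f(4) by (auto simp: bounded_iff)
  define C where "C = {x. f \<bullet> x > 0 \<and> proj_pt x \<in> \<Omega>}"
  have nz: "x \<noteq> 0" if "f \<bullet> x > 0" for x using that by auto
  have slice: "f \<bullet> (inverse (f \<bullet> x) *\<^sub>R x) = 1" "proj_pt (inverse (f \<bullet> x) *\<^sub>R x) \<in> \<Omega>" if "x \<in> C" for x
    using that nz[of x] by (auto simp: C_def proj_pt_scaleR)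
  have scale: "c *\<^sub>R x \<in> C" if "x \<in> C" "c > 0" for x c
    using that nz[of x] by (simp add: C_def proj_pt_scaleR)
  have "convex_domain C f R \<Omega>"
  proof
    have "C = {x. x \<noteq> 0 \<and> proj_pt x \<in> \<Omega>} \<inter> {x. f \<bullet> x > 0}" using nz by (auto simp: C_def)
    also have "open \<dots>" by (intro open_Int open_proj_preimage assms(1) open_Collect_less continuous_intros)
    finally show "open C" .
    show "c *\<^sub>R x \<in> C" if "x \<in> C" "c > 0" for x c by (rule scale[OF that])
    show "f \<bullet> x > 0" if "x \<in> C" for x using that by (simp add: C_def)
    show "norm x \<le> R * (f \<bullet> x)" if "x \<in> C" for x
    proof -
      have "norm (inverse (f \<bullet> x) *\<^sub>R x) \<le> R" using R[OF slice[OF that]] .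
      then show ?thesis using that by (simp add: C_def field_simps)
    qed
    show "x + y \<in> C" if "x \<in> C" "y \<in> C" for x y
    proof -
      let ?a = "f \<bullet> x" and ?b = "f \<bullet> y"
      have ab: "?a > 0" "?b > 0" using that by (auto simp: C_def)
      have "(?a / (?a + ?b)) *\<^sub>R (inverse ?a *\<^sub>R x) + (?b / (?a + ?b)) *\<^sub>R (inverse ?b *\<^sub>R y)
          \<in> {x. f \<bullet> x = 1 \<and> proj_pt x \<in> \<Omega>}"
        using slice that ab by (intro convexD[OF f(3)]) (auto simp: add_divide_distrib[symmetric])
      moreover have "(?a / (?a + ?b)) *\<^sub>R (inverse ?a *\<^sub>R x) = inverse (?a + ?b) *\<^sub>R x"
        "(?b / (?a + ?b)) *\<^sub>R (inverse ?b *\<^sub>R y) = inverse (?a + ?b) *\<^sub>R y"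
        using ab by (simp_all add: divide_inverse)
      ultimately have "inverse (?a + ?b) *\<^sub>R (x + y) \<in> {x. f \<bullet> x = 1 \<and> proj_pt x \<in> \<Omega>}"
        by (simp only: scaleR_add_right)
      then have "inverse (?a + ?b) *\<^sub>R (x + y) \<in> C" by (simp add: C_def)
      then have "(?a + ?b) *\<^sub>R (inverse (?a + ?b) *\<^sub>R (x + y)) \<in> C" by (rule scale) (use ab in auto)
      then show ?thesis using ab by (simp only: scaleR_scaleR right_inverse) simp
    qed
    show "proj_pt x \<in> \<Omega> \<longleftrightarrow> x \<in> C \<or> - x \<in> C" if "x \<noteq> 0" for x
      using f(2)[OF that] that proj_pt_minus[OF that] by (auto simp: C_def)
    show "open \<Omega>" by fact
  qed
  then show ?thesis by (rule that)
qed

section \<open>The Hilbert metric and its geodesic flow\<close>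

definition indep :: "real^'n \<Rightarrow> real^'n \<Rightarrow> bool" where
  "indep u w \<longleftrightarrow> (\<forall>a b. a *\<^sub>R u + b *\<^sub>R w = 0 \<longrightarrow> a = 0 \<and> b = 0)"

lemma indep_eq:
  assumes "indep u w" "a *\<^sub>R u + b *\<^sub>R w = a' *\<^sub>R u + b' *\<^sub>R w"
  shows "a = a'" "b = b'"
proof -
  have "(a - a') *\<^sub>R u + (b - b') *\<^sub>R w = 0" using assms(2) by (simp add: algebra_simps)
  then have "a - a' = 0 \<and> b - b' = 0" using assms(1) unfolding indep_def by blast
  then show "a = a'" "b = b'" by simp_all
qed

lemma indep_nz: assumes "indep u w" "a \<noteq> 0 \<or> b \<noteq> 0" shows "a *\<^sub>R u + b *\<^sub>R w \<noteq> 0"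
  using assms unfolding indep_def by blast

lemma indep_nz1: assumes "indep u w" shows "u \<noteq> 0" "w \<noteq> 0" "u + b *\<^sub>R w \<noteq> 0"
  using indep_nz[OF assms, of 1 0] indep_nz[OF assms, of 0 1] indep_nz[OF assms, of 1 b] by auto

lemma proj_pt_neq_imp_indep:
  assumes "u \<noteq> 0" "w \<noteq> 0" "proj_pt u \<noteq> proj_pt w"
  shows "indep u w"
  unfolding indep_def
proof (intro allI impI)
  fix a b assume eq: "a *\<^sub>R u + b *\<^sub>R w = 0"
  show "a = 0 \<and> b = 0"
  proof (cases "b = 0")
    case True
    then show ?thesis using eq assms by simp
  next
    case False
    have "w = inverse b *\<^sub>R (b *\<^sub>R w)" using False by simp
    also have "b *\<^sub>R w = - a *\<^sub>R u" using eq by (simp add: add_eq_0_iff)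
    finally have w: "w = (inverse b * - a) *\<^sub>R u" by simp
    then have "inverse b * - a \<noteq> 0" using assms(2) by auto
    then have "proj_pt w = proj_pt u" using proj_pt_scaleR[OF assms(1)] w by metis
    then show ?thesis using assms(3) by simp
  qed
qed

lemma proj_pt_line_eqD:
  assumes "indep u w" "proj_pt (u + s *\<^sub>R w) = proj_pt (u + t *\<^sub>R w)"
  shows "s = t"
proof -
  obtain c where "c \<noteq> 0" "u + t *\<^sub>R w = c *\<^sub>R (u + s *\<^sub>R w)"
    by (rule proj_pt_eqD[OF assms(2) indep_nz1(3)[OF assms(1)] indep_nz1(3)[OF assms(1)]])
  then have "1 *\<^sub>R u + t *\<^sub>R w = c *\<^sub>R u + (c * s) *\<^sub>R w" by (simp add: scaleR_add_right)
  then have "1 = c" "t = c * s" using indep_eq[OF assms(1)] by blast+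
  then show ?thesis by simp
qed

lemma cross_ratio_line:
  assumes i: "indep u w" and s: "s \<noteq> 0"
  shows "cross_ratio (proj_pt u) (proj_pt (u + s *\<^sub>R w)) (proj_pt (u + t *\<^sub>R w)) (proj_pt w) = t / s"
  unfolding cross_ratio_def
proof (rule the_equality)
  show "\<exists>u' w'. u' \<noteq> 0 \<and> w' \<noteq> 0 \<and> proj_pt u = proj_pt u' \<and> proj_pt w = proj_pt w' \<and>
      proj_pt (u + s *\<^sub>R w) = proj_pt (u' + w') \<and> proj_pt (u + t *\<^sub>R w) = proj_pt (u' + (t / s) *\<^sub>R w')"
    using s indep_nz1[OF i] by (intro exI[of _ u] exI[of _ "s *\<^sub>R w"]) (simp add: proj_pt_scaleR)
  fix t' assume "\<exists>u' w'. u' \<noteq> 0 \<and> w' \<noteq> 0 \<and> proj_pt u = proj_pt u' \<and> proj_pt w = proj_pt w' \<and>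
      proj_pt (u + s *\<^sub>R w) = proj_pt (u' + w') \<and> proj_pt (u + t *\<^sub>R w) = proj_pt (u' + t' *\<^sub>R w')"
  then obtain u' w' where *: "u' \<noteq> 0" "w' \<noteq> 0" "proj_pt u = proj_pt u'" "proj_pt w = proj_pt w'"
      "proj_pt (u + s *\<^sub>R w) = proj_pt (u' + w')" "proj_pt (u + t *\<^sub>R w) = proj_pt (u' + t' *\<^sub>R w')" by blast
  obtain \<alpha> where \<alpha>: "\<alpha> \<noteq> 0" "u' = \<alpha> *\<^sub>R u" by (rule proj_pt_eqD[OF *(3) indep_nz1(1)[OF i] *(1)])
  obtain \<beta> where \<beta>: "\<beta> \<noteq> 0" "w' = \<beta> *\<^sub>R w" by (rule proj_pt_eqD[OF *(4) indep_nz1(2)[OF i] *(2)])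
  have nz: "u' + t' *\<^sub>R w' \<noteq> 0" "u' + w' \<noteq> 0"
    using indep_nz[OF i, of \<alpha> "t' * \<beta>"] indep_nz[OF i, of \<alpha> \<beta>] \<alpha> \<beta> by simp_all
  obtain c where c: "c \<noteq> 0" "u' + w' = c *\<^sub>R (u + s *\<^sub>R w)"
    by (rule proj_pt_eqD[OF *(5) indep_nz1(3)[OF i] nz(2)])
  obtain d where d: "d \<noteq> 0" "u' + t' *\<^sub>R w' = d *\<^sub>R (u + t *\<^sub>R w)"
    by (rule proj_pt_eqD[OF *(6) indep_nz1(3)[OF i] nz(1)])
  have "\<alpha> *\<^sub>R u + \<beta> *\<^sub>R w = c *\<^sub>R u + (c * s) *\<^sub>R w" using c \<alpha> \<beta> by (simp add: scaleR_add_right)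
  then have 1: "\<alpha> = c" "\<beta> = c * s" using indep_eq[OF i] by blast+
  have "\<alpha> *\<^sub>R u + (t' * \<beta>) *\<^sub>R w = d *\<^sub>R u + (d * t) *\<^sub>R w" using d \<alpha> \<beta> by (simp add: scaleR_add_right)
  then have 2: "\<alpha> = d" "t' * \<beta> = d * t" using indep_eq[OF i] by blast+
  have "c * (t' * s) = c * t" using 1 2 by simp
  then show "t' = t / s" using c s by (simp add: field_simps)
qed

text \<open>The cross-ratio of the points at times \<open>s\<close> and \<open>t\<close> with the
  two end points is \<open>exp (2 * (t - s))\<close>, so the factor 1/2 in the Hilbert metric makes
  \<open>t\<close> arc length.\<close>

definition geo :: "real^'n \<Rightarrow> real^'n \<Rightarrow> real \<Rightarrow> 'n proj" where
  "geo u w t = proj_pt (exp (- t) *\<^sub>R u + exp t *\<^sub>R w)"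

definition bvec :: "real^'n \<Rightarrow> real^'n \<Rightarrow> 'n tproj" where
  "bvec u w = tvec (u + w, w - u)"

lemma geo_minus: "geo u w (- t) = geo w u t"
  by (simp add: geo_def add.commute)

lemma geo_alt: assumes "indep u w" shows "geo u w t = proj_pt (u + exp (2 * t) *\<^sub>R w)"
proof -
  have "exp t = exp (- t) * exp (2 * t)" by (simp add: exp_add[symmetric])
  then have "exp (- t) *\<^sub>R u + exp t *\<^sub>R w = exp (- t) *\<^sub>R (u + exp (2 * t) *\<^sub>R w)"
    by (simp add: scaleR_add_right)
  then show ?thesis
    unfolding geo_def using proj_pt_scaleR[of "u + exp (2 * t) *\<^sub>R w" "exp (- t)"] indep_nz1(3)[OF assms] by simp
qed

text \<open>Two lifts of the curve differ by a scalar function about which nothing is assumed. Near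
  \<open>t\<close> it is the quotient of two inner products with \<open>X t\<close>, hence
  differentiable at \<open>t\<close>.\<close>

lemma has_velocity_unique:
  assumes "has_velocity c v t" "has_velocity c v' t"
  shows "v = v'"
proof -
  obtain X \<xi> where X: "\<And>s. X s \<noteq> 0" "\<And>s. c s = proj_pt (X s)"
      "(X has_vector_derivative \<xi>) (at t)" "v = tvec (X t, \<xi>)"
    using assms(1) unfolding has_velocity_def by blast
  obtain Y \<eta> where Y: "\<And>s. Y s \<noteq> 0" "\<And>s. c s = proj_pt (Y s)"
      "(Y has_vector_derivative \<eta>) (at t)" "v' = tvec (Y t, \<eta>)"
    using assms(2) unfolding has_velocity_def by blast
  have "\<exists>k. k \<noteq> 0 \<and> Y s = k *\<^sub>R X s" for s
    using proj_pt_eq_iff[of "X s" "Y s"] X(1,2)[of s] Y(1,2)[of s] by simp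
  then obtain k where k: "\<And>s. k s \<noteq> 0 \<and> Y s = k s *\<^sub>R X s" by metis
  define e where "e = X t"
  define \<mu> where "\<mu> s = (e \<bullet> Y s) / (e \<bullet> X s)" for s
  have e: "e \<bullet> X t \<noteq> 0" using X(1)[of t] by (simp add: e_def)
  have dX: "((\<lambda>s. e \<bullet> X s) has_real_derivative e \<bullet> \<xi>) (at t)"
    and dY: "((\<lambda>s. e \<bullet> Y s) has_real_derivative e \<bullet> \<eta>) (at t)"
    using bounded_linear.has_vector_derivative[OF bounded_linear_inner_right X(3)]
      bounded_linear.has_vector_derivative[OF bounded_linear_inner_right Y(3)]
    by (auto simp: has_real_derivative_iff_has_vector_derivative)
  obtain \<mu>' where \<mu>': "(\<mu> has_real_derivative \<mu>') (at t)"
    using DERIV_divide[OF dY dX e] unfolding \<mu>_def by blast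
  have dP: "((\<lambda>s. \<mu> s *\<^sub>R X s) has_vector_derivative (\<mu> t *\<^sub>R \<xi> + \<mu>' *\<^sub>R X t)) (at t)"
    by (rule has_vector_derivative_scaleR[OF \<mu>' X(3)])
  have "isCont (\<lambda>s. e \<bullet> X s) t" using dX by (rule DERIV_isCont)
  then have "((\<lambda>s. e \<bullet> X s) \<longlongrightarrow> e \<bullet> X t) (nhds t)" by (simp only: isCont_def tendsto_at_iff_tendsto_nhds[of "\<lambda>s. e \<bullet> X s"])
  then have "\<forall>\<^sub>F s in nhds t. e \<bullet> X s \<noteq> 0" using e by (rule tendsto_imp_eventually_ne)
  then have ev: "\<forall>\<^sub>F s in nhds t. \<mu> s *\<^sub>R X s = Y s"
  proof (rule eventually_mono)
    fix s assume "e \<bullet> X s \<noteq> 0"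
    then have "\<mu> s = k s" using k[of s] by (simp add: \<mu>_def)
    then show "\<mu> s *\<^sub>R X s = Y s" using k[of s] by simp
  qed
  then have ev': "\<forall>\<^sub>F s in nhds t. s \<in> UNIV \<longrightarrow> \<mu> s *\<^sub>R X s = Y s" by simp
  have "(Y has_vector_derivative (\<mu> t *\<^sub>R \<xi> + \<mu>' *\<^sub>R X t)) (at t)"
    using has_vector_derivative_cong_ev[OF ev' eventually_nhds_x_imp_x[OF ev]] dP by simp
  then have \<eta>: "\<eta> = \<mu> t *\<^sub>R \<xi> + \<mu>' *\<^sub>R X t" using Y(3) vector_derivative_unique_at by blast
  have "\<mu> t *\<^sub>R X t = Y t" using ev by (rule eventually_nhds_x_imp_x)
  moreover from this have "\<mu> t \<noteq> 0" using Y(1)[of t] by auto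
  ultimately show ?thesis
    unfolding X(4) Y(4) using X(1)[of t] Y(1)[of t] \<eta> by (subst tvec_eq_iff) auto
qed

lemma has_velocity_geo:
  assumes "indep u w"
  shows "has_velocity (geo u w) (bvec (exp (- t) *\<^sub>R u) (exp t *\<^sub>R w)) t"
  unfolding has_velocity_def
proof (intro exI conjI allI)
  let ?X = "\<lambda>s. exp (- s) *\<^sub>R u + exp s *\<^sub>R w"
  show "?X s \<noteq> 0" for s using indep_nz[OF assms, of "exp (- s)" "exp s"] by simp
  show "geo u w s = proj_pt (?X s)" for s by (simp add: geo_def)
  show "(?X has_vector_derivative (exp t *\<^sub>R w - exp (- t) *\<^sub>R u)) (at t)"
    by (auto intro!: derivative_eq_intros)
  show "bvec (exp (- t) *\<^sub>R u) (exp t *\<^sub>R w) = tvec (?X t, exp t *\<^sub>R w - exp (- t) *\<^sub>R u)"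
    by (simp add: bvec_def)
qed

section \<open>Distances, norms and geodesics in terms of boundary pairs\<close>

context convex_domain
begin

lemma bpair_indep: "bpair u w \<Longrightarrow> indep u w"
  using bpair_independent by (auto simp: indep_def)

lemma bd_comb: assumes "bpair u w" "a *\<^sub>R u + b *\<^sub>R w \<in> bd" shows "a = 0 \<or> b = 0"
  using bpair_closure_coeff_nonneg[OF assms(1), of a b] bpair_comb[OF assms(1), of a b] assms(2)
  by (force simp: bd_def)

lemma frontier_comb:
  assumes "bpair u w" "a *\<^sub>R u + b *\<^sub>R w \<noteq> 0" "proj_pt (a *\<^sub>R u + b *\<^sub>R w) \<in> frontier \<Omega>"
  shows "a = 0 \<or> b = 0"
proof -
  have "a *\<^sub>R u + b *\<^sub>R w \<in> bd \<or> - (a *\<^sub>R u + b *\<^sub>R w) \<in> bd" using assms mem_frontier_\<Omega> by blast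
  moreover have "- (a *\<^sub>R u + b *\<^sub>R w) = (- a) *\<^sub>R u + (- b) *\<^sub>R w" by simp
  ultimately show ?thesis using bd_comb[OF assms(1), of a b] bd_comb[OF assms(1), of "- a" "- b"] by auto
qed

text \<open>The point is that the ends \<open>a\<close> and \<open>b\<close> in the definition are
  determined: they lie in the plane of \<open>u\<close> and \<open>w\<close>, and being on the
  frontier each is the class of \<open>u\<close> or of \<open>w\<close>.\<close>

lemma hilbert_dist_line:
  assumes p: "bpair u w" and st: "0 < s" "s < t"
  shows "hilbert_dist \<Omega> (proj_pt (u + s *\<^sub>R w)) (proj_pt (u + t *\<^sub>R w)) = 1 / 2 * ln (t / s)"
proof -
  note i = bpair_indep[OF p]
  let ?x = "proj_pt (u + s *\<^sub>R w)" and ?y = "proj_pt (u + t *\<^sub>R w)"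
  have "?x \<noteq> ?y" using proj_pt_line_eqD[OF i] st by fastforce
  moreover have "(THE r. \<exists>a\<in>frontier \<Omega>. \<exists>b\<in>frontier \<Omega>.
      aligned_in_order a ?x ?y b \<and> r = 1 / 2 * ln (cross_ratio a ?x ?y b)) = 1 / 2 * ln (t / s)"
  proof (rule the_equality)
    have "proj_pt u \<in> frontier \<Omega>" "proj_pt w \<in> frontier \<Omega>"
      using p bpair_nz[OF p] mem_frontier_\<Omega> by (auto simp: bpair_def)
    moreover have "proj_pt u \<noteq> proj_pt w"
    proof
      assume "proj_pt u = proj_pt w"
      then obtain c where "w = c *\<^sub>R u" using proj_pt_eqD bpair_nz[OF p] by blast
      then have "c *\<^sub>R u + (-1) *\<^sub>R w = 0" by simp
      from bpair_independent(2)[OF p this] show False by simp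
    qed
    then have "aligned_in_order (proj_pt u) ?x ?y (proj_pt w)"
      unfolding aligned_in_order_def using st bpair_nz[OF p] by (metis less_imp_le)
    moreover have "1 / 2 * ln (t / s) = 1 / 2 * ln (cross_ratio (proj_pt u) ?x ?y (proj_pt w))"
      using cross_ratio_line[OF i, of s t] st by simp
    ultimately show "\<exists>a\<in>frontier \<Omega>. \<exists>b\<in>frontier \<Omega>.
      aligned_in_order a ?x ?y b \<and> 1 / 2 * ln (t / s) = 1 / 2 * ln (cross_ratio a ?x ?y b)" by blast
  next
    fix r assume "\<exists>a\<in>frontier \<Omega>. \<exists>b\<in>frontier \<Omega>. aligned_in_order a ?x ?y b \<and> r = 1 / 2 * ln (cross_ratio a ?x ?y b)"
    then obtain a b where ab: "a \<in> frontier \<Omega>" "b \<in> frontier \<Omega>" "aligned_in_order a ?x ?y b"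
      and r: "r = 1 / 2 * ln (cross_ratio a ?x ?y b)" by blast
    obtain u' w' s' t' where h: "a \<noteq> b" "u' \<noteq> 0" "w' \<noteq> 0" "0 < s'" "s' \<le> t'" "a = proj_pt u'" "b = proj_pt w'"
        "?x = proj_pt (u' + s' *\<^sub>R w')" "?y = proj_pt (u' + t' *\<^sub>R w')"
      using ab(3) unfolding aligned_in_order_def by blast
    have i': "indep u' w'" using h proj_pt_neq_imp_indep by blast
    have "s' \<noteq> t'" using h(8,9) \<open>?x \<noteq> ?y\<close> by auto
    then have "s' < t'" using h(5) by simp
    obtain c where c: "c \<noteq> 0" "u' + s' *\<^sub>R w' = c *\<^sub>R (u + s *\<^sub>R w)"
      by (rule proj_pt_eqD[OF h(8) indep_nz1(3)[OF i] indep_nz1(3)[OF i']])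
    obtain d where d: "d \<noteq> 0" "u' + t' *\<^sub>R w' = d *\<^sub>R (u + t *\<^sub>R w)"
      by (rule proj_pt_eqD[OF h(9) indep_nz1(3)[OF i] indep_nz1(3)[OF i']])
    \<comment> \<open>Solves for the coordinates of \<open>w'\<close> and \<open>u'\<close> with
      respect to \<open>u\<close> and \<open>w\<close>, from the two points \<open>?x\<close> and
      \<open>?y\<close>.\<close>
    define k where "k = inverse (t' - s')"
    have k: "k * (t' - s') = 1" using \<open>s' < t'\<close> by (simp add: k_def)
    define \<gamma> where "\<gamma> = k * (d - c)"
    define \<delta> where "\<delta> = k * (d * t - c * s)"
    have "w' = (k * (t' - s')) *\<^sub>R w'" by (simp add: k)
    also have "\<dots> = k *\<^sub>R ((u' + t' *\<^sub>R w') - (u' + s' *\<^sub>R w'))" by (simp add: algebra_simps)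
    also have "\<dots> = \<gamma> *\<^sub>R u + \<delta> *\<^sub>R w" unfolding c(2) d(2) \<gamma>_def \<delta>_def by (simp add: algebra_simps)
    finally have w': "w' = \<gamma> *\<^sub>R u + \<delta> *\<^sub>R w" .
    define \<alpha> where "\<alpha> = c - s' * \<gamma>"
    define \<beta> where "\<beta> = c * s - s' * \<delta>"
    have "u' = (u' + s' *\<^sub>R w') - s' *\<^sub>R w'" by simp
    also have "\<dots> = \<alpha> *\<^sub>R u + \<beta> *\<^sub>R w" unfolding c(2) \<alpha>_def \<beta>_def by (simp add: w' algebra_simps)
    finally have u': "u' = \<alpha> *\<^sub>R u + \<beta> *\<^sub>R w" .
    have \<alpha>\<beta>: "\<alpha> = 0 \<or> \<beta> = 0" using frontier_comb[OF p, of \<alpha> \<beta>] h(2,6) ab(1) u' by simp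
    have \<gamma>\<delta>: "\<gamma> = 0 \<or> \<delta> = 0" using frontier_comb[OF p, of \<gamma> \<delta>] h(3,7) ab(2) w' by simp
    have "\<not> (\<alpha> = 0 \<and> \<gamma> = 0)"
    proof
      assume "\<alpha> = 0 \<and> \<gamma> = 0"
      then have "\<delta> *\<^sub>R u' + (- \<beta>) *\<^sub>R w' = 0" by (simp add: u' w' mult.commute)
      then have "\<delta> = 0" using i' unfolding indep_def by blast
      then show False using h(3) w' \<open>\<alpha> = 0 \<and> \<gamma> = 0\<close> by simp
    qed
    moreover have "\<not> (\<beta> = 0 \<and> \<delta> = 0)"
    proof
      assume "\<beta> = 0 \<and> \<delta> = 0"
      then have "\<gamma> *\<^sub>R u' + (- \<alpha>) *\<^sub>R w' = 0" by (simp add: u' w' mult.commute)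
      then have "\<gamma> = 0" using i' unfolding indep_def by blast
      then show False using h(3) w' \<open>\<beta> = 0 \<and> \<delta> = 0\<close> by simp
    qed
    \<comment> \<open>The case of exchanged ends: \<open>s' * s\<close> would have to equal
      \<open>t' * t\<close>, although both factors are smaller.\<close>
    moreover have "\<not> (\<alpha> = 0 \<and> \<delta> = 0)"
    proof
      assume 0: "\<alpha> = 0 \<and> \<delta> = 0"
      then have "c = s' * \<gamma>" "\<beta> = c * s" by (auto simp: \<alpha>_def \<beta>_def)
      moreover have "d = t' * \<gamma> \<and> \<beta> = d * t"
      proof -
        have "(t' * \<gamma>) *\<^sub>R u + \<beta> *\<^sub>R w = d *\<^sub>R u + (d * t) *\<^sub>R w"
          using d(2) 0 by (simp add: u' w' algebra_simps)
        then show ?thesis using indep_eq[OF i] by metis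
      qed
      ultimately have "s' * \<gamma> * s = t' * \<gamma> * t" by metis
      then have "\<gamma> * (s' * s) = \<gamma> * (t' * t)" by (simp only: mult_ac)
      moreover have "\<gamma> \<noteq> 0" using h(3) w' 0 by auto
      ultimately have "s' * s = t' * t" by (simp only: mult_cancel_left) simp
      moreover have "s' * s < t' * t" using st h(4) \<open>s' < t'\<close> by (intro mult_strict_mono) auto
      ultimately show False by simp
    qed
    ultimately have 0: "\<beta> = 0" "\<gamma> = 0" using \<alpha>\<beta> \<gamma>\<delta> by blast+
    have "\<alpha> \<noteq> 0" "\<delta> \<noteq> 0" using h(2,3) u' w' 0 by auto
    then have "a = proj_pt u" "b = proj_pt w"
      using h(6,7) u' w' 0 proj_pt_scaleR bpair_nz[OF p] by auto
    then show "r = 1 / 2 * ln (t / s)" using r cross_ratio_line[OF i, of s t] st by simp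
  qed
  ultimately show ?thesis by (simp add: hilbert_dist_def)
qed

lemma hilbert_dist_geo:
  assumes p: "bpair u w"
  shows "hilbert_dist \<Omega> (geo u w s) (geo u w t) = \<bar>s - t\<bar>"
proof -
  have *: "hilbert_dist \<Omega> (geo u w s) (geo u w t) = t - s" if "s < t" "bpair u w" for s t u w
  proof -
    have "exp (2 * t) / exp (2 * s) = exp (2 * (t - s))" by (simp add: exp_diff[symmetric] algebra_simps)
    then show ?thesis
      unfolding geo_alt[OF bpair_indep[OF that(2)]]
      using hilbert_dist_line[OF that(2), of "exp (2 * s)" "exp (2 * t)"] that(1) by simp
  qed
  consider "s < t" | "s = t" | "t < s" by linarith
  then show ?thesis
  proof cases
    case 1
    then show ?thesis using *[OF 1 p] by simp
  next
    case 2
    then show ?thesis by (simp add: hilbert_dist_def)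
  next
    case 3
    then show ?thesis using *[OF _ bpair_sym[OF p], of "- s" "- t"] geo_minus[of w u] by simp
  qed
qed

lemma proj_pt_comb_eq_geo:
  assumes p: "bpair u w" and "a > 0" "b > 0"
  shows "proj_pt (a *\<^sub>R u + b *\<^sub>R w) = geo u w (1 / 2 * ln (b / a))"
proof -
  have "a *\<^sub>R u + b *\<^sub>R w = a *\<^sub>R (u + (b / a) *\<^sub>R w)" using assms by (simp add: scaleR_add_right)
  then show ?thesis
    using assms geo_alt[OF bpair_indep[OF p]] proj_pt_scaleR[OF indep_nz1(3)[OF bpair_indep[OF p]], of a "b / a"]
    by simp
qed

lemma ln_one_plus_quotient_tendsto: "((\<lambda>s. ln (1 + s * a) / s) \<longlongrightarrow> a) (at_right (0::real))"
proof -
  have "((\<lambda>s. ln (1 + s * a)) has_real_derivative a) (at 0)"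
    by (auto intro!: derivative_eq_intros)
  then have "((\<lambda>s. ln (1 + s * a) / s) \<longlongrightarrow> a) (at 0)" by (simp add: DERIV_def)
  then show ?thesis by (rule tendsto_mono[OF at_le, rotated]) simp
qed

text \<open>The moving vector is \<open>(1 + s (m - c)) u + (1 + s (m + c)) w\<close>. Its distance
  is half the logarithm of the quotient of the coefficients, from which \<open>m\<close> drops out
  to first order.\<close>

lemma hilbert_speed:
  assumes p: "bpair u w"
  shows "((\<lambda>s. hilbert_dist \<Omega> (proj_pt (u + w)) (proj_pt ((u + w) + s *\<^sub>R (c *\<^sub>R (w - u) + m *\<^sub>R (u + w)))) / s)
    \<longlongrightarrow> \<bar>c\<bar>) (at_right 0)"
proof -
  let ?h = "\<lambda>s. 1 / 2 * (ln (1 + s * (m + c)) / s - ln (1 + s * (m - c)) / s)"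
  have "(?h \<longlongrightarrow> 1 / 2 * ((m + c) - (m - c))) (at_right 0)"
    by (intro tendsto_intros ln_one_plus_quotient_tendsto)
  then have lim: "((\<lambda>s. \<bar>?h s\<bar>) \<longlongrightarrow> \<bar>c\<bar>) (at_right 0)" by (intro tendsto_rabs) simp
  have "((\<lambda>s. 1 + s * k) \<longlongrightarrow> 1 + 0 * k) (at_right 0)" for k :: real by (intro tendsto_intros)
  then have pos: "\<forall>\<^sub>F s in at_right 0. 1 + s * k > 0" for k :: real
    using order_tendstoD(1)[of "\<lambda>s. 1 + s * k" 1 "at_right 0" 0] by simp
  have "\<forall>\<^sub>F s in at_right 0. \<bar>?h s\<bar> =
      hilbert_dist \<Omega> (proj_pt (u + w)) (proj_pt ((u + w) + s *\<^sub>R (c *\<^sub>R (w - u) + m *\<^sub>R (u + w)))) / s"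
    using pos[of "m + c"] pos[of "m - c"] eventually_at_right_less[of 0]
  proof eventually_elim
    case (elim s)
    have "(u + w) + s *\<^sub>R (c *\<^sub>R (w - u) + m *\<^sub>R (u + w)) = (1 + s * (m - c)) *\<^sub>R u + (1 + s * (m + c)) *\<^sub>R w"
      by (simp add: algebra_simps)
    moreover have "proj_pt (u + w) = geo u w 0" by (simp add: geo_def)
    ultimately have "hilbert_dist \<Omega> (proj_pt (u + w)) (proj_pt ((u + w) + s *\<^sub>R (c *\<^sub>R (w - u) + m *\<^sub>R (u + w))))
        = \<bar>1 / 2 * ln ((1 + s * (m + c)) / (1 + s * (m - c)))\<bar>"
      using proj_pt_comb_eq_geo[OF p elim(2,1)] hilbert_dist_geo[OF p] by simp
    also have "\<dots> = \<bar>1 / 2 * (ln (1 + s * (m + c)) - ln (1 + s * (m - c)))\<bar>"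
      using elim by (simp add: ln_div)
    also have "1 / 2 * (ln (1 + s * (m + c)) - ln (1 + s * (m - c))) = s * ?h s"
      using elim(3) by (simp add: field_simps)
    finally show ?case using elim(3) by (simp add: abs_mult)
  qed
  then show ?thesis using lim by (rule Lim_transform_eventually[rotated])
qed

lemma hilbert_norm_bpair:
  assumes p: "bpair u w"
  shows "hilbert_norm \<Omega> (tvec (u + w, c *\<^sub>R (w - u) + m *\<^sub>R (u + w))) = \<bar>c\<bar>"
  unfolding hilbert_norm_def
proof (rule the_equality)
  have uw: "u + w \<noteq> 0" using p nz by (auto simp: bpair_def)
  let ?v = "tvec (u + w, c *\<^sub>R (w - u) + m *\<^sub>R (u + w))"
  show "\<exists>x \<xi>. x \<noteq> 0 \<and> ?v = tvec (x, \<xi>) \<and>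
      ((\<lambda>s. hilbert_dist \<Omega> (proj_pt x) (proj_pt (x + s *\<^sub>R \<xi>)) / s) \<longlongrightarrow> \<bar>c\<bar>) (at_right 0)"
    using uw hilbert_speed[OF p] by blast
  fix F assume "\<exists>x \<xi>. x \<noteq> 0 \<and> ?v = tvec (x, \<xi>) \<and>
      ((\<lambda>s. hilbert_dist \<Omega> (proj_pt x) (proj_pt (x + s *\<^sub>R \<xi>)) / s) \<longlongrightarrow> F) (at_right 0)"
  then obtain x \<xi> where x: "x \<noteq> 0" "?v = tvec (x, \<xi>)"
      "((\<lambda>s. hilbert_dist \<Omega> (proj_pt x) (proj_pt (x + s *\<^sub>R \<xi>)) / s) \<longlongrightarrow> F) (at_right 0)" by blast
  obtain l k where l: "l \<noteq> 0" "x = l *\<^sub>R (u + w)"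
      "\<xi> = l *\<^sub>R (c *\<^sub>R (w - u) + m *\<^sub>R (u + w)) + k *\<^sub>R (u + w)"
    using x(2) tvec_eq_iff[of "(u + w, c *\<^sub>R (w - u) + m *\<^sub>R (u + w))" "(x, \<xi>)"] uw x(1) by auto
  \<comment> \<open>Another representative of the same tangent vector changes the radial part and a
    common factor only.\<close>
  define m' where "m' = m + k / l"
  have \<xi>: "\<xi> = l *\<^sub>R (c *\<^sub>R (w - u) + m' *\<^sub>R (u + w))"
    using l by (simp add: m'_def algebra_simps)
  have "((u + w) + s *\<^sub>R (c *\<^sub>R (w - u) + m' *\<^sub>R (u + w))) = (1 + s * (m' - c)) *\<^sub>R u + (1 + s * (m' + c)) *\<^sub>R w" for s
    by (simp add: algebra_simps)
  then have nz': "((u + w) + s *\<^sub>R (c *\<^sub>R (w - u) + m' *\<^sub>R (u + w))) \<noteq> 0" if "1 + s * (m' + c) > 0" for s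
    using indep_nz[OF bpair_indep[OF p]] that by simp
  have "((\<lambda>s. 1 + s * (m' + c)) \<longlongrightarrow> 1 + 0 * (m' + c)) (at_right 0)" by (intro tendsto_intros)
  then have "\<forall>\<^sub>F s in at_right 0. 1 + s * (m' + c) > 0"
    using order_tendstoD(1)[of "\<lambda>s. 1 + s * (m' + c)" 1 "at_right 0" 0] by simp
  then have "\<forall>\<^sub>F s in at_right 0. hilbert_dist \<Omega> (proj_pt x) (proj_pt (x + s *\<^sub>R \<xi>)) / s =
      hilbert_dist \<Omega> (proj_pt (u + w)) (proj_pt ((u + w) + s *\<^sub>R (c *\<^sub>R (w - u) + m' *\<^sub>R (u + w)))) / s"
  proof eventually_elim
    case (elim s)
    have "x + s *\<^sub>R \<xi> = l *\<^sub>R ((u + w) + s *\<^sub>R (c *\<^sub>R (w - u) + m' *\<^sub>R (u + w)))"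
      unfolding \<xi> l(2) by (simp only: scaleR_add_right scaleR_left_commute)
    then show ?case using proj_pt_scaleR[OF nz'[OF elim] l(1)] proj_pt_scaleR[OF uw l(1)] l(2) by simp
  qed
  then have "((\<lambda>s. hilbert_dist \<Omega> (proj_pt (u + w)) (proj_pt ((u + w) + s *\<^sub>R (c *\<^sub>R (w - u) + m' *\<^sub>R (u + w)))) / s) \<longlongrightarrow> F) (at_right 0)"
    using x(3) by (rule Lim_transform_eventually[rotated])
  from tendsto_unique[OF trivial_limit_at_right_real this hilbert_speed[OF p]] show "F = \<bar>c\<bar>" .
qed

text \<open>This keeps zero tangent vectors, whose representatives are radial, out of the unit
  tangent bundle.\<close>

lemma hilbert_norm_radial:
  assumes "x \<noteq> 0"
  shows "hilbert_norm \<Omega> (tvec (x, k *\<^sub>R x)) = 0"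
  unfolding hilbert_norm_def
proof (rule the_equality)
  have lim: "((\<lambda>s. hilbert_dist \<Omega> (proj_pt x) (proj_pt (x + s *\<^sub>R (k *\<^sub>R x))) / s) \<longlongrightarrow> 0) (at_right 0)"
    if "x \<noteq> 0" for x :: "real^'n" and k
  proof -
    have "((\<lambda>s. 1 + s * k) \<longlongrightarrow> 1 + 0 * k) (at_right 0)" by (intro tendsto_intros)
    then have "\<forall>\<^sub>F s in at_right 0. 1 + s * k > 0"
      using order_tendstoD(1)[of "\<lambda>s. 1 + s * k" 1 "at_right 0" 0] by simp
    then have "\<forall>\<^sub>F s in at_right 0. 0 = hilbert_dist \<Omega> (proj_pt x) (proj_pt (x + s *\<^sub>R (k *\<^sub>R x))) / s"
    proof eventually_elim
      case (elim s)
      have "x + s *\<^sub>R (k *\<^sub>R x) = (1 + s * k) *\<^sub>R x" by (simp add: algebra_simps)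
      then show ?case using proj_pt_scaleR[OF that, of "1 + s * k"] elim by (simp add: hilbert_dist_def)
    qed
    then show ?thesis by (rule Lim_transform_eventually[OF tendsto_const])
  qed
  show "\<exists>y \<xi>. y \<noteq> 0 \<and> tvec (x, k *\<^sub>R x) = tvec (y, \<xi>) \<and>
      ((\<lambda>s. hilbert_dist \<Omega> (proj_pt y) (proj_pt (y + s *\<^sub>R \<xi>)) / s) \<longlongrightarrow> 0) (at_right 0)"
    using lim[OF assms] assms by blast
  fix F assume "\<exists>y \<xi>. y \<noteq> 0 \<and> tvec (x, k *\<^sub>R x) = tvec (y, \<xi>) \<and>
      ((\<lambda>s. hilbert_dist \<Omega> (proj_pt y) (proj_pt (y + s *\<^sub>R \<xi>)) / s) \<longlongrightarrow> F) (at_right 0)"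
  then obtain y \<xi> where y: "y \<noteq> 0" "tvec (x, k *\<^sub>R x) = tvec (y, \<xi>)"
      "((\<lambda>s. hilbert_dist \<Omega> (proj_pt y) (proj_pt (y + s *\<^sub>R \<xi>)) / s) \<longlongrightarrow> F) (at_right 0)" by blast
  obtain l m where l: "l \<noteq> 0" "y = l *\<^sub>R x" "\<xi> = l *\<^sub>R (k *\<^sub>R x) + m *\<^sub>R x"
    using y(2) tvec_eq_iff[of "(x, k *\<^sub>R x)" "(y, \<xi>)"] assms y(1) by auto
  then have \<xi>: "\<xi> = (k + m / l) *\<^sub>R y" by (simp add: algebra_simps)
  from tendsto_unique[OF trivial_limit_at_right_real y(3)[unfolded \<xi>] lim[OF y(1)]] show "F = 0" .
qed

text \<open>After a change of sign the foot vector lies in \<open>C\<close>, so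
  \<open>exists_bpair\<close> applies, and norm 1 forces \<open>c = 1\<close>.\<close>

lemma unit_tangent_eq: "unit_tangent \<Omega> = {bvec u w | u w. bpair u w}"
proof (intro equalityI subsetI)
  fix v assume "v \<in> unit_tangent \<Omega>"
  then have v: "footpoint v \<in> \<Omega>" "hilbert_norm \<Omega> v = 1" by (auto simp: unit_tangent_def)
  obtain x0 \<xi>0 where x0: "x0 \<noteq> 0" "v = tvec (x0, \<xi>0)" by (rule tproj_cases)
  have "x0 \<in> C \<or> - x0 \<in> C" using v(1) x0 mem_\<Omega> by (simp add: footpoint_tvec)
  moreover have "\<exists>l m. l \<noteq> 0 \<and> - x0 = l *\<^sub>R x0 \<and> - \<xi>0 = l *\<^sub>R \<xi>0 + m *\<^sub>R x0"
    by (rule exI[of _ "-1"], rule exI[of _ 0]) simp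
  then have "v = tvec (- x0, - \<xi>0)"
    unfolding x0(2) using x0(1) by (simp add: tvec_eq_iff)
  ultimately obtain x \<xi> where x: "x \<in> C" "v = tvec (x, \<xi>)" using x0 by blast
  have "\<xi> \<noteq> k *\<^sub>R x" for k using hilbert_norm_radial[OF nz[OF x(1)], of k] v(2) x(2) by auto
  then obtain u w c m where uw: "bpair u w" "x = u + w" "c > 0" "\<xi> = c *\<^sub>R (w - u) + m *\<^sub>R x"
    using exists_bpair[OF x(1)] by blast
  then have "c = 1" using hilbert_norm_bpair[OF uw(1), of c m] v(2) x(2) by simp
  then have "\<exists>l k. l \<noteq> 0 \<and> u + w = l *\<^sub>R x \<and> w - u = l *\<^sub>R \<xi> + k *\<^sub>R x"
    using uw(2,4) by (intro exI[of _ 1] exI[of _ "- m"]) simp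
  then have "v = bvec u w"
    unfolding bvec_def x(2) using nz[OF x(1)] uw(2) by (simp add: tvec_eq_iff)
  then show "v \<in> {bvec u w | u w. bpair u w}" using uw(1) by blast
next
  fix v assume "v \<in> {bvec u w | u w. bpair u w}"
  then obtain u w where uw: "bpair u w" "v = bvec u w" by blast
  have "u + w \<in> C" using uw by (simp add: bpair_def)
  then show "v \<in> unit_tangent \<Omega>"
    using uw hilbert_norm_bpair[OF uw(1), of 1 0] nz proj_pt_in
    by (simp add: unit_tangent_def bvec_def footpoint_tvec)
qed

text \<open>Equal tangent vectors allow \<open>u'\<close> and \<open>w'\<close> to differ from a
  common multiple of \<open>u\<close> and \<open>w\<close> by opposite multiples of
  \<open>u + w\<close>. Unless these vanish, one of \<open>u'\<close>, \<open>w'\<close> would be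
  interior.\<close>

lemma bvec_eq:
  assumes p: "bpair u w" "bpair u' w'" and eq: "bvec u w = bvec u' w'"
  obtains r where "r > 0" "u' = r *\<^sub>R u" "w' = r *\<^sub>R w"
proof -
  have C: "u + w \<in> C" "u' + w' \<in> C" using p by (auto simp: bpair_def)
  then have "u + w \<noteq> 0" "u' + w' \<noteq> 0" using nz by blast+
  then obtain l m where l: "l \<noteq> 0" "u' + w' = l *\<^sub>R (u + w)" "w' - u' = l *\<^sub>R (w - u) + m *\<^sub>R (u + w)"
    using eq tvec_eq_iff[of "(u + w, w - u)" "(u' + w', w' - u')"] by (auto simp: bvec_def)
  have "l > 0"
  proof -
    have "l * (f \<bullet> (u + w)) > 0" using f_pos[OF C(2)] l(2) by simp
    then show ?thesis using f_pos[OF C(1)] zero_less_mult_pos2 by blast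
  qed
  have "2 *\<^sub>R w' = (u' + w') + (w' - u')" by (simp add: scaleR_2)
  also have "\<dots> = l *\<^sub>R ((u + w) + (w - u)) + m *\<^sub>R (u + w)" by (simp only: l(2,3) scaleR_add_right add.assoc)
  also have "(u + w) + (w - u) = 2 *\<^sub>R w" by (simp add: scaleR_2)
  also have "l *\<^sub>R (2 *\<^sub>R w) + m *\<^sub>R (u + w) = 2 *\<^sub>R (l *\<^sub>R w + (m / 2) *\<^sub>R (u + w))"
    by (simp only: scaleR_add_right[of 2] scaleR_scaleR) (simp add: mult.commute)
  finally have "2 *\<^sub>R w' = 2 *\<^sub>R (l *\<^sub>R w + (m / 2) *\<^sub>R (u + w))" .
  then have w': "w' = l *\<^sub>R w + (m / 2) *\<^sub>R (u + w)" by (simp only: scaleR_cancel_left) simp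
  have "u' = l *\<^sub>R (u + w) - w'" unfolding l(2)[symmetric] by simp
  also have "\<dots> = l *\<^sub>R u + (- m / 2) *\<^sub>R (u + w)" unfolding w' by (simp add: algebra_simps)
  finally have u': "u' = l *\<^sub>R u + (- m / 2) *\<^sub>R (u + w)" .
  have cl: "l *\<^sub>R u \<in> closure C" "l *\<^sub>R w \<in> closure C"
    using p \<open>l > 0\<close> by (auto simp: bpair_def bd_def intro!: scale_closure)
  have "\<not> m > 0"
  proof
    assume "m > 0"
    then have "w' \<in> C" unfolding w' using add_closure[OF scale_C[OF C(1), of "m / 2"] cl(2)] by (simp add: add.commute)
    then show False using p by (simp add: bpair_def bd_def)
  qed
  moreover have "\<not> m < 0"
  proof
    assume "m < 0"
    then have "u' \<in> C" unfolding u' using add_closure[OF scale_C[OF C(1), of "- m / 2"] cl(1)] by (simp add: add.commute)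
    then show False using p by (simp add: bpair_def bd_def)
  qed
  ultimately have "m = 0" by simp
  then show ?thesis using that[OF \<open>l > 0\<close>] u' w' by simp
qed

lemma tangent_line_bvec:
  assumes p: "bpair u w"
  shows "\<Omega> \<inter> tangent_line (bvec u w) = range (geo u w)"
proof (intro equalityI subsetI)
  have uw: "u + w \<noteq> 0" using p nz by (auto simp: bpair_def)
  fix a assume "a \<in> \<Omega> \<inter> tangent_line (bvec u w)"
  then obtain x \<xi> where a: "a \<in> \<Omega>" "x \<noteq> 0" "bvec u w = tvec (x, \<xi>)" "a \<in> proj_subspace (span {x, \<xi>})"
    unfolding tangent_line_def by blast
  obtain l m where l: "x = l *\<^sub>R (u + w)" "\<xi> = l *\<^sub>R (w - u) + m *\<^sub>R (u + w)"
    using a(3) tvec_eq_iff[of "(u + w, w - u)" "(x, \<xi>)"] uw a(2) by (auto simp: bvec_def)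
  obtain z where z: "z \<in> span {x, \<xi>}" "z \<noteq> 0" "a = proj_pt z" using a(4) by (auto simp: proj_subspace_def)
  have "{x, \<xi>} \<subseteq> span {u, w}" unfolding l
    by (auto intro!: span_add span_scale span_diff intro: span_base)
  then have "z \<in> span {u, w}" using z(1) span_mono[of "{x, \<xi>}" "span {u, w}"] by (auto simp: span_span)
  then obtain \<alpha> \<beta> where z': "z = \<alpha> *\<^sub>R u + \<beta> *\<^sub>R w"
    by (auto simp: span_insert span_singleton) (metis add.commute diff_add_cancel)
  have "z \<in> C \<or> - z \<in> C" using mem_\<Omega> z a(1) by blast
  then show "a \<in> range (geo u w)"
  proof
    assume "z \<in> C"
    then have "\<alpha> > 0" "\<beta> > 0" using bpair_coeff_pos[OF p] z' by blast+
    then show ?thesis using proj_pt_comb_eq_geo[OF p] z' z(3) by auto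
  next
    assume m: "- z \<in> C"
    have mz: "- z = (- \<alpha>) *\<^sub>R u + (- \<beta>) *\<^sub>R w" using z' by simp
    then have "- \<alpha> > 0" "- \<beta> > 0" using bpair_coeff_pos[OF p, of "- \<alpha>" "- \<beta>"] m by auto
    then have "proj_pt (- z) = geo u w (1 / 2 * ln (- \<beta> / - \<alpha>))"
      unfolding mz by (rule proj_pt_comb_eq_geo[OF p])
    then have "proj_pt (- z) \<in> range (geo u w)" by simp
    then show ?thesis unfolding z(3) proj_pt_minus[OF z(2)] .
  qed
next
  have uw: "u + w \<noteq> 0" using p nz by (auto simp: bpair_def)
  fix a assume "a \<in> range (geo u w)"
  then obtain t where t: "a = geo u w t" by blast
  define z where "z = exp (- t) *\<^sub>R u + exp t *\<^sub>R w"
  have z: "z \<in> C" unfolding z_def by (intro bpair_comb p) auto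
  have "(u + w) - (w - u) = 2 *\<^sub>R u" "(u + w) + (w - u) = 2 *\<^sub>R w" by (simp_all add: scaleR_2)
  then have "u = (1 / 2) *\<^sub>R ((u + w) - (w - u))" "w = (1 / 2) *\<^sub>R ((u + w) + (w - u))" by simp_all
  moreover have "(1 / 2) *\<^sub>R ((u + w) - (w - u)) \<in> span {u + w, w - u}" "(1 / 2) *\<^sub>R ((u + w) + (w - u)) \<in> span {u + w, w - u}"
    by (intro span_scale span_diff span_add span_base; simp)+
  ultimately have "u \<in> span {u + w, w - u}" "w \<in> span {u + w, w - u}" by simp_all
  then have "z \<in> span {u + w, w - u}" unfolding z_def by (intro span_add span_scale)
  then have "a \<in> proj_subspace (span {u + w, w - u})"
    using z nz t by (auto simp: proj_subspace_def geo_def z_def)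
  then show "a \<in> \<Omega> \<inter> tangent_line (bvec u w)"
    using z proj_pt_in[OF z] t uw unfolding tangent_line_def bvec_def geo_def z_def by blast
qed

lemma is_geodesic_geo: assumes p: "bpair u w" shows "is_geodesic \<Omega> (bvec u w) (geo u w)"
  unfolding is_geodesic_def
  using tangent_line_bvec[OF p] hilbert_dist_geo[OF p] has_velocity_geo[OF bpair_indep[OF p], of 0] by simp

lemma isometry_fixing_0:
  fixes \<tau> :: "real \<Rightarrow> real"
  assumes "\<And>s t. \<bar>\<tau> s - \<tau> t\<bar> = \<bar>s - t\<bar>" "\<tau> 0 = 0"
  shows "(\<forall>t. \<tau> t = t) \<or> (\<forall>t. \<tau> t = - t)"
proof -
  have 1: "\<bar>\<tau> t\<bar> = \<bar>t\<bar>" for t using assms(1)[of t 0] assms(2) by simp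
  have 2: "\<bar>\<tau> t - \<tau> 1\<bar> = \<bar>t - 1\<bar>" for t using assms(1) by blast
  consider "\<tau> 1 = 1" | "\<tau> 1 = -1" using 1[of 1] by linarith
  then show ?thesis
  proof cases
    case 1
    have "\<tau> t = t" for t using \<open>\<And>t. \<bar>\<tau> t\<bar> = \<bar>t\<bar>\<close>[of t] 2[of t] 1 by linarith
    then show ?thesis by blast
  next
    case 2
    have "\<tau> t = - t" for t using 1[of t] \<open>\<And>t. \<bar>\<tau> t - \<tau> 1\<bar> = \<bar>t - 1\<bar>\<close>[of t] 2 by linarith
    then show ?thesis by blast
  qed
qed

text \<open>Another parametrisation differs by an isometry of the real line fixing 0, and the
  velocity excludes the reflection.\<close>

lemma is_geodesic_unique:
  assumes p: "bpair u w" and g: "is_geodesic \<Omega> (bvec u w) c"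
  shows "c = geo u w"
proof -
  have uw: "u + w \<noteq> 0" using p nz by (auto simp: bpair_def)
  have "c t \<in> range (geo u w)" for t
    using g tangent_line_bvec[OF p] unfolding is_geodesic_def by blast
  then have "\<forall>t. \<exists>s. c t = geo u w s" by blast
  then obtain \<tau> where \<tau>: "\<And>t. c t = geo u w (\<tau> t)" by metis
  have iso: "\<bar>\<tau> s - \<tau> t\<bar> = \<bar>s - t\<bar>" for s t
    using g hilbert_dist_geo[OF p, of "\<tau> s" "\<tau> t"] unfolding is_geodesic_def \<tau> by simp
  have vel: "has_velocity c (bvec u w) 0" using g by (simp add: is_geodesic_def)
  then obtain X \<xi> where X': "\<forall>s. X s \<noteq> 0 \<and> c s = proj_pt (X s)" "bvec u w = tvec (X 0, \<xi>)"
    unfolding has_velocity_def by blast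
  then have X: "X 0 \<noteq> 0" "c 0 = proj_pt (X 0)" "bvec u w = tvec (X 0, \<xi>)" by simp_all
  have "c 0 = footpoint (bvec u w)" using X footpoint_tvec by metis
  also have "\<dots> = geo u w 0" using uw by (simp add: bvec_def footpoint_tvec geo_def)
  finally have "hilbert_dist \<Omega> (geo u w (\<tau> 0)) (geo u w 0) = 0" by (simp add: \<tau> hilbert_dist_def)
  then have "\<tau> 0 = 0" using hilbert_dist_geo[OF p] by simp
  then consider "\<And>t. \<tau> t = t" | "\<And>t. \<tau> t = - t" using isometry_fixing_0[OF iso] by blast
  then show ?thesis
  proof cases
    case 1
    then show ?thesis using \<tau> by auto
  next
    case 2
    then have "c = geo w u" using \<tau> geo_minus[of u w] by auto
    then have "has_velocity c (bvec w u) 0"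
      using has_velocity_geo[OF bpair_indep[OF bpair_sym[OF p]], of 0] by simp
    then have "bvec u w = bvec w u" using vel by (rule has_velocity_unique[rotated])
    then obtain r where r: "w = r *\<^sub>R u" using bvec_eq[OF p bpair_sym[OF p]] by blast
    then have "r *\<^sub>R u + (-1) *\<^sub>R w = 0" by simp
    from bpair_independent(2)[OF p this] show ?thesis by simp
  qed
qed

lemma geodesic_flow_bvec:
  assumes p: "bpair u w"
  shows "geodesic_flow \<Omega> t (bvec u w) = bvec (exp (- t) *\<^sub>R u) (exp t *\<^sub>R w)"
  unfolding geodesic_flow_def
proof (rule the_equality)
  show "\<exists>c. is_geodesic \<Omega> (bvec u w) c \<and> has_velocity c (bvec (exp (- t) *\<^sub>R u) (exp t *\<^sub>R w)) t"
    using is_geodesic_geo[OF p] has_velocity_geo[OF bpair_indep[OF p]] by blast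
  show "w' = bvec (exp (- t) *\<^sub>R u) (exp t *\<^sub>R w)"
    if "\<exists>c. is_geodesic \<Omega> (bvec u w) c \<and> has_velocity c w' t" for w'
    using that is_geodesic_unique[OF p] has_velocity_geo[OF bpair_indep[OF p]] has_velocity_unique by blast
qed

lemma footpoint_flow:
  assumes p: "bpair u w"
  shows "footpoint (geodesic_flow \<Omega> t (bvec u w)) = geo u w t"
proof -
  have "exp (- t) *\<^sub>R u + exp t *\<^sub>R w \<in> C" by (intro bpair_comb p) auto
  then show ?thesis unfolding geodesic_flow_bvec[OF p] using nz by (simp add: bvec_def footpoint_tvec geo_def)
qed

lemma geo_tendsto_at_bot:
  assumes p: "bpair u w" shows "(geo u w \<longlongrightarrow> proj_pt u) at_bot"
proof -
  have "((\<lambda>t. exp (2 * t)) \<longlongrightarrow> (0::real)) at_bot"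
    by (rule filterlim_compose[OF exp_at_bot]) (auto intro!: filterlim_tendsto_pos_mult_at_bot filterlim_ident)
  then have "((\<lambda>t. u + exp (2 * t) *\<^sub>R w) \<longlongrightarrow> u + 0 *\<^sub>R w) at_bot" by (intro tendsto_intros)
  then have "((\<lambda>t. proj_pt (u + exp (2 * t) *\<^sub>R w)) \<longlongrightarrow> proj_pt u) at_bot"
    using bpair_nz[OF p] by (intro tendsto_proj_pt) auto
  then show ?thesis using geo_alt[OF bpair_indep[OF p]] by presburger
qed

lemma flow_at_minus_infinity_bvec:
  assumes p: "bpair u w" shows "flow_at_minus_infinity \<Omega> (bvec u w) = proj_pt u"
  unfolding flow_at_minus_infinity_def footpoint_flow[OF p]
  by (rule tendsto_Lim[OF trivial_limit_at_bot_linorder geo_tendsto_at_bot[OF p]])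

lemma flow_at_plus_infinity_bvec:
  assumes p: "bpair u w" shows "flow_at_plus_infinity \<Omega> (bvec u w) = proj_pt w"
proof -
  have "((\<lambda>t. geo w u (- t)) \<longlongrightarrow> proj_pt w) at_top"
    by (rule filterlim_compose[OF geo_tendsto_at_bot[OF bpair_sym[OF p]] filterlim_uminus_at_bot_at_top])
  then show ?thesis
    unfolding flow_at_plus_infinity_def footpoint_flow[OF p] geo_minus
    by (rule tendsto_Lim[OF trivial_limit_at_top_linorder])
qed

end

section \<open>The automorphism group\<close>

lemma pgl_scaleR:
  assumes "invertible A" "c \<noteq> 0"
  shows "pgl (c *\<^sub>R A) = pgl A" "invertible (c *\<^sub>R A)"
proof -
  have "(c *\<^sub>R A) ** (inverse c *\<^sub>R matrix_inv A) = mat 1"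
    using matrix_inv_mult(1)[OF assms(1)] assms(2)
    by (simp add: matrix_scalar_ac scalar_matrix_assoc[symmetric])
  then show inv: "invertible (c *\<^sub>R A)" using invertible_right_inverse by blast
  have "pgl_rel A (c *\<^sub>R A)" using assms inv by (auto simp: pgl_rel_def)
  then show "pgl (c *\<^sub>R A) = pgl A"
    using Quotient3_rel[OF Quotient3_pgl, of A "c *\<^sub>R A"] pgl_rel_refl assms inv by auto
qed

lemma open_proj_image: assumes "open S" shows "open (proj_pt ` (S - {0}))"
proof -
  have "{x. x \<noteq> 0 \<and> proj_pt x \<in> proj_pt ` (S - {0})} = (\<Union>c\<in>-{0}. - {0} \<inter> (\<lambda>x. c *\<^sub>R x) -` S)"
    (is "?L = ?R")
  proof (intro equalityI subsetI)
    fix x assume "x \<in> ?L"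
    then obtain y where y: "x \<noteq> 0" "y \<in> S" "y \<noteq> 0" "proj_pt x = proj_pt y" by auto
    obtain c where "c \<noteq> 0" "y = c *\<^sub>R x" by (rule proj_pt_eqD[OF y(4,1,3)])
    then show "x \<in> ?R" using y by auto
  next
    fix x assume "x \<in> ?R"
    then obtain c where c: "c \<noteq> 0" "x \<noteq> 0" "c *\<^sub>R x \<in> S" by auto
    then have "c *\<^sub>R x \<in> S - {0}" by simp
    then have "proj_pt (c *\<^sub>R x) \<in> proj_pt ` (S - {0})" by (rule imageI)
    then show "x \<in> ?L" using c proj_pt_scaleR[OF c(2,1)] by simp
  qed
  moreover have "open ?R"
    by (intro open_UN ballI open_Int open_vimage assms continuous_intros open_Compl closed_singleton)
  ultimately show ?thesis by (simp add: open_proj_def)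
qed

lemma open_pgl_act_preimage:
  assumes "open U" shows "open (pgl_act g -` U)"
proof -
  obtain A where A: "invertible A" "g = pgl A" by (rule pgl_cases)
  have "x \<noteq> 0 \<and> proj_pt x \<in> pgl_act g -` U \<longleftrightarrow> A *v x \<noteq> 0 \<and> proj_pt (A *v x) \<in> U" for x
  proof (cases "x = 0")
    case False
    then show ?thesis unfolding A(2) vimage_eq pgl_act_pgl[OF A(1) False] using matrix_vector_nz[OF A(1)] by simp
  qed simp
  then have "{x. x \<noteq> 0 \<and> proj_pt x \<in> pgl_act g -` U} = (*v) A -` {y. y \<noteq> 0 \<and> proj_pt y \<in> U}"
    unfolding vimage_def by simp
  also have "open \<dots>"
    by (intro open_vimage open_proj_preimage assms matrix_vector_mult_linear_continuous_on)
  finally show ?thesis by (simp add: open_proj_def)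
qed

lemma indep_imp_CARD: assumes "indep (u :: real^'n) w" shows "CARD('n) \<ge> 2"
proof -
  have nz: "u \<noteq> 0" "w \<noteq> 0" using indep_nz1[OF assms] by auto
  have notin: "w \<notin> span {u}"
  proof
    assume "w \<in> span {u}"
    then obtain c where "w = c *\<^sub>R u" by (auto simp: span_singleton)
    then have "c *\<^sub>R u + (-1) *\<^sub>R w = 0" by simp
    then show False using indep_nz[OF assms, of c "-1"] by simp
  qed
  then have "independent {w, u}" using nz by (simp add: independent_insert)
  then have "card {w, u} \<le> DIM(real^'n)" using independent_bound by blast
  moreover have "w \<noteq> u" using notin span_base by blast
  ultimately show ?thesis by simp
qed

locale automorphism_group = convex_domain C f R \<Omega>
  for C :: "(real^'n) set" and f :: "real^'n" and R :: real and \<Omega> :: "'n proj set" +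
  fixes \<Gamma> :: "'n pgl set"
  assumes subgroup: "subgroup \<Gamma> PGL" and aut: "\<Gamma> \<subseteq> Aut \<Omega>" and C_nonempty: "C \<noteq> {}"
    and strongly_irreducible: "strongly_irreducible \<Gamma>"
begin

text \<open>The lifts that preserve the cone itself and not only up to sign. Positive multiples are
  included; they account for the common factor of a boundary pair.\<close>

definition GG :: "(real^'n^'n) set" where
  "GG = {A. invertible A \<and> pgl A \<in> \<Gamma> \<and> (*v) A ` C = C}"

text \<open>A lift maps \<open>C\<close> into the union of \<open>C\<close> and its negative, and by
  convexity not partly into each: some positive combination would be mapped to a zero of
  \<open>f\<close>.\<close>

lemma lift_sign:
  assumes A: "invertible A" "pgl A \<in> \<Gamma>"
  shows "A \<in> GG \<or> (-1) *\<^sub>R A \<in> GG"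
proof -
  have act: "pgl_act (pgl A) ` \<Omega> = \<Omega>" using A aut by (auto simp: Aut_def)
  have pm: "A *v x \<in> C \<or> - (A *v x) \<in> C" if "x \<in> C" for x
  proof -
    have "pgl_act (pgl A) (proj_pt x) \<in> pgl_act (pgl A) ` \<Omega>" by (rule imageI[OF proj_pt_in[OF that]])
    then have "proj_pt (A *v x) \<in> \<Omega>" unfolding act pgl_act_pgl[OF A(1) nz[OF that]] .
    then show ?thesis using mem_\<Omega>[OF matrix_vector_nz[OF A(1) nz[OF that]]] by simp
  qed
  have same: "- (A *v y) \<notin> C" if "x \<in> C" "y \<in> C" "A *v x \<in> C" for x y
  proof
    assume "- (A *v y) \<in> C"
    define a where "a = f \<bullet> (A *v x)"
    define b where "b = f \<bullet> (- (A *v y))"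
    have ab: "a > 0" "b > 0" using f_pos[OF that(3)] f_pos[OF \<open>- (A *v y) \<in> C\<close>] unfolding a_def b_def by blast+
    define z where "z = b *\<^sub>R x + a *\<^sub>R y"
    have "z \<in> C" unfolding z_def using ab that by (intro add_C scale_C)
    moreover have "f \<bullet> (A *v z) = 0"
      by (simp add: z_def matrix_vector_right_distrib matrix_vector_mult_scaleR inner_add_right a_def b_def
          matrix_vector_mult_diff_distrib inner_diff_right)
    ultimately show False using pm[of z] f_pos[of "A *v z"] f_pos[of "- (A *v z)"] by auto
  qed
  have *: "B \<in> GG" if B: "invertible B" "pgl B = pgl A" "\<And>x. x \<in> C \<Longrightarrow> B *v x \<in> C" for B
  proof -
    have "C \<subseteq> (*v) B ` C"
    proof
      fix x assume x: "x \<in> C"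
      then have "proj_pt x \<in> pgl_act (pgl B) ` \<Omega>" unfolding B(2) act by (rule proj_pt_in)
      then obtain a where a: "proj_pt x = pgl_act (pgl B) a" "a \<in> \<Omega>" by (rule imageE)
      obtain y where y: "y \<in> C" "a = proj_pt y" using a(2) by (rule mem_\<Omega>E)
      have eq: "proj_pt (B *v y) = proj_pt x"
        unfolding a(1) y(2) by (rule pgl_act_pgl[OF B(1) nz[OF y(1)], symmetric])
      obtain c where c: "c \<noteq> 0" "x = c *\<^sub>R (B *v y)"
        by (rule proj_pt_eqD[OF eq nz[OF B(3)[OF y(1)]] nz[OF x]])
      have "c * (f \<bullet> (B *v y)) > 0" using f_pos[OF x] c(2) by simp
      then have "c > 0" using f_pos[OF B(3)[OF y(1)]] zero_less_mult_pos2 by blast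
      then have "c *\<^sub>R y \<in> C" using y scale_C by blast
      moreover have "x = B *v (c *\<^sub>R y)" using c by (simp add: matrix_vector_mult_scaleR)
      ultimately show "x \<in> (*v) B ` C" by blast
    qed
    then show ?thesis using B A(2) by (auto simp: GG_def)
  qed
  obtain x where x: "x \<in> C" using C_nonempty by blast
  have neg: "((-1) *\<^sub>R A) *v y = - (A *v y)" for y
    unfolding scaleR_matrix_vector_assoc[symmetric] by simp
  from pm[OF x] show ?thesis
  proof
    assume Ax: "A *v x \<in> C"
    have "A *v y \<in> C" if "y \<in> C" for y using pm[OF that] same[OF x that Ax] by blast
    then have "A \<in> GG" by (rule *[OF A(1) refl])
    then show ?thesis ..
  next
    assume Ax: "- (A *v x) \<in> C"
    have "- (A *v y) \<in> C" if "y \<in> C" for y using pm[OF that] same[OF that x] Ax by blast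
    then have "((-1) *\<^sub>R A) *v y \<in> C" if "y \<in> C" for y unfolding neg using that by blast
    then have "(-1) *\<^sub>R A \<in> GG"
      by (intro *[OF pgl_scaleR(2)[OF A(1)] pgl_scaleR(1)[OF A(1)]]) auto
    then show ?thesis ..
  qed
qed

lemma exists_lift: assumes "g \<in> \<Gamma>" obtains A where "A \<in> GG" "g = pgl A"
proof -
  obtain A where A: "invertible A" "g = pgl A" by (rule pgl_cases)
  then have "A \<in> GG \<or> (-1) *\<^sub>R A \<in> GG" using lift_sign assms by blast
  then show ?thesis
  proof
    assume "A \<in> GG"
    then show ?thesis using that A(2) by blast
  next
    assume "(-1) *\<^sub>R A \<in> GG"
    moreover have "g = pgl ((-1) *\<^sub>R A)" unfolding A(2) by (rule pgl_scaleR(1)[OF A(1), symmetric]) simp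
    ultimately show ?thesis by (rule that)
  qed
qed

lemma GG_invertible: "A \<in> GG \<Longrightarrow> invertible A"
  by (simp add: GG_def)

lemma GG_C: "A \<in> GG \<Longrightarrow> x \<in> C \<Longrightarrow> A *v x \<in> C"
  by (auto simp: GG_def)

lemma GG_mult: assumes "A \<in> GG" "B \<in> GG" shows "A ** B \<in> GG"
proof -
  have "pgl (A ** B) \<in> \<Gamma>"
    using subgroup.m_closed[OF subgroup, of "pgl A" "pgl B"] assms
    by (auto simp: GG_def PGL_def pgl_mult_pgl)
  moreover have "(*v) (A ** B) ` C = (*v) A ` (*v) B ` C" by (simp add: image_image matrix_vector_mul_assoc)
  ultimately show ?thesis using assms by (auto simp: GG_def intro: invertible_mult)
qed

lemma GG_inverse: assumes "A \<in> GG" shows "matrix_inv A \<in> GG"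
proof -
  have A: "invertible A" "pgl A \<in> \<Gamma>" "(*v) A ` C = C" using assms by (auto simp: GG_def)
  have "pgl_mult (pgl (matrix_inv A)) (pgl A) = pgl_one"
    using pgl_mult_pgl[OF invertible_matrix_inv[OF A(1)] A(1)] matrix_inv_mult[OF A(1)] by (simp add: pgl_one.abs_eq)
  then have "inv\<^bsub>PGL\<^esub> (pgl A) = pgl (matrix_inv A)"
    by (intro group.inv_equality[OF group_PGL]) (auto simp: PGL_def)
  then have "pgl (matrix_inv A) \<in> \<Gamma>" using subgroup.m_inv_closed[OF subgroup A(2)] by simp
  moreover have "(*v) (matrix_inv A) ` C = C"
  proof -
    have "(*v) (matrix_inv A) ` C = (*v) (matrix_inv A) ` (*v) A ` C" by (simp add: A(3))
    also have "\<dots> = C" using matrix_inv_vector(2)[OF A(1)] by (simp add: image_image)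
    finally show ?thesis .
  qed
  ultimately show ?thesis using invertible_matrix_inv[OF A(1)] by (simp add: GG_def)
qed

lemma GG_scale: assumes "A \<in> GG" "c > 0" shows "c *\<^sub>R A \<in> GG"
proof -
  have A: "invertible A" "pgl A \<in> \<Gamma>" "(*v) A ` C = C" using assms by (auto simp: GG_def)
  have "(*v) (c *\<^sub>R A) ` C = C"
  proof (intro equalityI subsetI)
    fix y assume "y \<in> (*v) (c *\<^sub>R A) ` C"
    then obtain x where "x \<in> C" "y = c *\<^sub>R (A *v x)" by (auto simp: scaleR_matrix_vector_assoc)
    then show "y \<in> C" using A(3) scale_C assms(2) by blast
  next
    fix y assume "y \<in> C"
    then have "inverse c *\<^sub>R y \<in> (*v) A ` C" using A(3) scale_C assms(2) by simp
    then obtain x where "x \<in> C" "inverse c *\<^sub>R y = A *v x" by blast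
    then have "x \<in> C" "y = (c *\<^sub>R A) *v x" using assms(2)
      by (auto simp: scaleR_matrix_vector_assoc[symmetric] dest: arg_cong[of _ _ "\<lambda>z. c *\<^sub>R z"])
    then show "y \<in> (*v) (c *\<^sub>R A) ` C" by blast
  qed
  then show ?thesis using pgl_scaleR[OF A(1)] A assms(2) by (simp add: GG_def)
qed

lemma GG_closure: assumes "A \<in> GG" "x \<in> closure C" shows "A *v x \<in> closure C"
proof -
  obtain X where X: "\<And>n. X n \<in> C" "X \<longlonglongrightarrow> x" using assms(2) closure_sequential by metis
  have "(\<lambda>n. A *v X n) \<longlonglongrightarrow> A *v x" by (intro tendsto_intros X)
  moreover have "A *v X n \<in> C" for n using GG_C[OF assms(1) X(1)] .
  ultimately show ?thesis unfolding closure_sequential by (intro exI[of _ "\<lambda>n. A *v X n"]) simp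
qed

lemma GG_bd: assumes A: "A \<in> GG" and x: "x \<in> bd" shows "A *v x \<in> bd"
proof -
  have "A *v x \<notin> C"
  proof
    assume "A *v x \<in> C"
    then have "matrix_inv A *v (A *v x) \<in> C" by (rule GG_C[OF GG_inverse[OF A]])
    then show False using x matrix_inv_vector(2)[OF GG_invertible[OF A]] by (simp add: bd_def)
  qed
  then show ?thesis using GG_closure[OF A] x by (simp add: bd_def)
qed

lemma GG_bpair: "A \<in> GG \<Longrightarrow> bpair u w \<Longrightarrow> bpair (A *v u) (A *v w)"
  using GG_bd GG_C[of A "u + w"] by (auto simp: bpair_def matrix_vector_right_distrib)

lemma pgl_act_proj_subspace:
  assumes "invertible A"
  shows "pgl_act (pgl A) ` proj_subspace S = proj_subspace ((*v) A ` S)"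
proof -
  have "(*v) A ` S - {0} = (*v) A ` (S - {0})" using matrix_vector_nz[OF assms] by fastforce
  then have "proj_subspace ((*v) A ` S) = (\<lambda>x. proj_pt (A *v x)) ` (S - {0})"
    by (simp add: proj_subspace_def image_image)
  also have "\<dots> = (\<lambda>x. pgl_act (pgl A) (proj_pt x)) ` (S - {0})"
    by (rule image_cong) (auto simp: pgl_act_pgl[OF assms])
  finally show ?thesis by (simp add: proj_subspace_def image_image)
qed

sublocale irreducible_matrix_group GG
proof
  show "invertible A" if "A \<in> GG" for A by (rule GG_invertible[OF that])
  show "A ** B \<in> GG" if "A \<in> GG" "B \<in> GG" for A B by (rule GG_mult[OF that])
  show "matrix_inv A \<in> GG" if "A \<in> GG" for A by (rule GG_inverse[OF that])
  show "GG \<noteq> {}"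
  proof -
    have "pgl_one \<in> \<Gamma>" using subgroup.one_closed[OF subgroup] by (simp add: PGL_def)
    then show ?thesis using exists_lift by blast
  qed
  fix \<S> :: "(real^'n) set set"
  assume S: "finite \<S>" "\<S> \<noteq> {}" "\<And>S. S \<in> \<S> \<Longrightarrow> subspace S \<and> S \<noteq> {0} \<and> S \<noteq> UNIV"
  show "\<exists>A\<in>GG. \<exists>S\<in>\<S>. (*v) A ` S \<notin> \<S>"
  proof (rule ccontr)
    assume "\<not> ?thesis"
    then have perm: "(*v) A ` S \<in> \<S>" if "A \<in> GG" "S \<in> \<S>" for A S using that by blast
    have "pgl_act g ` (\<Union>S\<in>\<S>. proj_subspace S) = (\<Union>S\<in>\<S>. proj_subspace S)" if g: "g \<in> \<Gamma>" for g
    proof -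
      obtain A where A: "A \<in> GG" "g = pgl A" using exists_lift[OF g] .
      have "(\<lambda>S. (*v) A ` S) ` \<S> = \<S>"
      proof (intro equalityI subsetI)
        fix S assume S: "S \<in> \<S>"
        have "S = (*v) A ` ((*v) (matrix_inv A) ` S)"
          using matrix_inv_vector(1)[OF GG_invertible[OF A(1)]] by (simp add: image_image)
        then show "S \<in> (\<lambda>S. (*v) A ` S) ` \<S>" using perm[OF GG_inverse[OF A(1)] S] by blast
      qed (use perm A in blast)
      then have "(\<Union>S\<in>\<S>. proj_subspace S) = (\<Union>S\<in>(\<lambda>S. (*v) A ` S) ` \<S>. proj_subspace S)" by simp
      also have "\<dots> = (\<Union>S\<in>\<S>. pgl_act g ` proj_subspace S)"
        unfolding A(2) pgl_act_proj_subspace[OF GG_invertible[OF A(1)]] by simp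
      finally have eq: "(\<Union>S\<in>\<S>. proj_subspace S) = (\<Union>S\<in>\<S>. pgl_act g ` proj_subspace S)" .
      show ?thesis unfolding image_UN by (rule eq[symmetric])
    qed
    then have "finite \<S> \<and> \<S> \<noteq> {} \<and> (\<forall>S\<in>\<S>. subspace S \<and> S \<noteq> {0} \<and> S \<noteq> UNIV) \<and>
        (\<forall>g\<in>\<Gamma>. pgl_act g ` (\<Union>S\<in>\<S>. proj_subspace S) = (\<Union>S\<in>\<S>. proj_subspace S))"
      using S by simp
    then have "\<not> strongly_irreducible \<Gamma>" unfolding strongly_irreducible_def not_not by (rule exI)
    then show False using strongly_irreducible by simp
  qed
qed

section \<open>The cone over the proximal limit set, with both signs\<close>

definition LC :: "(real^'n) set" where
  "LC = {x. x \<noteq> 0 \<and> proj_pt x \<in> proximal_limit_set \<Gamma>}"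

lemma LC_scale: "x \<in> LC \<Longrightarrow> c \<noteq> 0 \<Longrightarrow> c *\<^sub>R x \<in> LC"
  by (simp add: LC_def proj_pt_scaleR)

lemma LC_limit:
  assumes "\<And>n. X n \<in> LC" "X \<longlonglongrightarrow> x" "x \<noteq> 0" shows "x \<in> LC"
proof -
  have "(\<lambda>n. proj_pt (X n)) \<longlonglongrightarrow> proj_pt x" using assms by (intro tendsto_proj_pt)
  moreover have "\<forall>\<^sub>F n in sequentially. proj_pt (X n) \<in> proximal_limit_set \<Gamma>"
    using assms(1) by (intro always_eventually allI) (simp add: LC_def)
  moreover have "closed (proximal_limit_set \<Gamma>)" by (simp add: proximal_limit_set_def)
  ultimately have "proj_pt x \<in> proximal_limit_set \<Gamma>" using Lim_in_closed_set sequentially_bot by metis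
  then show ?thesis using assms(3) by (simp add: LC_def)
qed

lemma attracting_fixed_point_conj:
  assumes H: "invertible H" and g: "attracting_fixed_point g a"
  shows "attracting_fixed_point (pgl_mult (pgl H) (pgl_mult g (pgl (matrix_inv H)))) (pgl_act (pgl H) a)"
    "proximal (pgl_mult (pgl H) (pgl_mult g (pgl (matrix_inv H))))"
proof -
  obtain A \<alpha> x where A: "invertible A" "g = pgl A" "dominant_eigenvalue A (complex_of_real \<alpha>)"
      "x \<noteq> 0" "A *v x = \<alpha> *\<^sub>R x" "a = proj_pt x"
    using g unfolding attracting_fixed_point_def by blast
  define B where "B = H ** A ** matrix_inv H"
  have B: "invertible B" "pgl_mult (pgl H) (pgl_mult g (pgl (matrix_inv H))) = pgl B"
    using A H invertible_matrix_inv[OF H]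
    by (simp_all add: B_def pgl_mult_pgl invertible_mult matrix_mul_assoc)
  have "complex_charpoly B = complex_charpoly A"
    unfolding B_def by (rule complex_charpoly_conj[OF matrix_inv_mult(1)[OF H]])
  then have dom: "dominant_eigenvalue B (complex_of_real \<alpha>)" using A(3) by (simp add: dominant_eigenvalue_def)
  have "B *v (H *v x) = H *v (A *v (matrix_inv H *v (H *v x)))"
    by (simp add: B_def matrix_vector_mul_assoc matrix_mul_assoc)
  also have "\<dots> = \<alpha> *\<^sub>R (H *v x)" by (simp add: matrix_inv_vector(2)[OF H] A(5) matrix_vector_mult_scaleR)
  finally have ev: "B *v (H *v x) = \<alpha> *\<^sub>R (H *v x)" .
  show "attracting_fixed_point (pgl_mult (pgl H) (pgl_mult g (pgl (matrix_inv H)))) (pgl_act (pgl H) a)"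
    unfolding attracting_fixed_point_def
    using B dom ev matrix_vector_nz[OF H A(4)] pgl_act_pgl[OF H A(4)] A(6) by blast
  show "proximal (pgl_mult (pgl H) (pgl_mult g (pgl (matrix_inv H))))"
    unfolding proximal_def using B dom by blast
qed

lemma LC_invariant: assumes H: "H \<in> GG" and x: "x \<in> LC" shows "H *v x \<in> LC"
proof -
  let ?S = "{p. \<exists>g\<in>\<Gamma>. proximal g \<and> attracting_fixed_point g p}"
  have iH: "invertible H" and h: "pgl H \<in> \<Gamma>" "pgl (matrix_inv H) \<in> \<Gamma>"
    using H GG_inverse[OF H] by (auto simp: GG_def)
  have "?S \<subseteq> pgl_act (pgl H) -` closure ?S"
  proof
    fix a assume "a \<in> ?S"
    then obtain g where g: "g \<in> \<Gamma>" "attracting_fixed_point g a" by blast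
    have "pgl_mult (pgl H) (pgl_mult g (pgl (matrix_inv H))) \<in> \<Gamma>"
      using subgroup.m_closed[OF subgroup] h g(1) by (simp add: PGL_def)
    then have "pgl_act (pgl H) a \<in> ?S" using attracting_fixed_point_conj[OF iH g(2)] by blast
    then show "a \<in> pgl_act (pgl H) -` closure ?S" unfolding vimage_eq by (rule subsetD[OF closure_subset])
  qed
  moreover have "closed (pgl_act (pgl H) -` closure ?S)"
    unfolding closed_def vimage_Compl[symmetric] by (intro open_pgl_act_preimage open_Compl closed_closure)
  ultimately have "closure ?S \<subseteq> pgl_act (pgl H) -` closure ?S" by (intro closure_minimal)
  moreover have x': "x \<noteq> 0" "proj_pt x \<in> closure ?S" using x by (simp_all add: LC_def proximal_limit_set_def)
  ultimately have "pgl_act (pgl H) (proj_pt x) \<in> proximal_limit_set \<Gamma>"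
    unfolding proximal_limit_set_def by (meson subsetD vimageD)
  then show ?thesis using x'(1) matrix_vector_nz[OF iH x'(1)] pgl_act_pgl[OF iH x'(1)] by (simp add: LC_def)
qed

text \<open>If the lift reverses the cone, its negative is taken; the eigenvalue changes sign as
  well, and the normalised powers stay the same.\<close>

lemma proximal_powers:
  assumes "g \<in> \<Gamma>" "attracting_fixed_point g (proj_pt x)" "x \<noteq> 0"
  obtains A \<alpha> \<xi> where "A \<in> GG" "\<xi> \<bullet> x = 1" "(\<lambda>n. inverse \<alpha> ^ n *\<^sub>R matpow A n) \<longlonglongrightarrow> outer x \<xi>"
proof -
  obtain A \<alpha> y where A: "invertible A" "g = pgl A" "dominant_eigenvalue A (complex_of_real \<alpha>)"
      "y \<noteq> 0" "A *v y = \<alpha> *\<^sub>R y" "proj_pt x = proj_pt y"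
    using assms(2) unfolding attracting_fixed_point_def by blast
  obtain c where c: "c \<noteq> 0" "x = c *\<^sub>R y" by (rule proj_pt_eqD[OF A(6)[symmetric] A(4) assms(3)])
  have Ax: "A *v x = \<alpha> *\<^sub>R x" by (simp add: c matrix_vector_mult_scaleR A(5))
  have "\<alpha> \<noteq> 0" using Ax matrix_vector_nz[OF A(1) assms(3)] by auto
  obtain \<xi> where \<xi>: "\<xi> \<bullet> x = 1" "(\<lambda>n. inverse \<alpha> ^ n *\<^sub>R matpow A n) \<longlonglongrightarrow> outer x \<xi>"
    using dominant_powers_tendsto[OF A(3) \<open>\<alpha> \<noteq> 0\<close> Ax assms(3)] by blast
  have "A \<in> GG \<or> (-1) *\<^sub>R A \<in> GG" using lift_sign A assms(1) by blast
  then show ?thesis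
  proof
    assume "A \<in> GG"
    then show ?thesis using that \<xi> by blast
  next
    assume G: "(-1) *\<^sub>R A \<in> GG"
    have "inverse (- \<alpha>) ^ n *\<^sub>R matpow ((-1) *\<^sub>R A) n = inverse \<alpha> ^ n *\<^sub>R matpow A n" for n
      unfolding matpow_scaleR by (simp add: power_mult_distrib[symmetric])
    then have "(\<lambda>n. inverse (- \<alpha>) ^ n *\<^sub>R matpow ((-1) *\<^sub>R A) n) \<longlonglongrightarrow> outer x \<xi>" using \<xi>(2) by presburger
    then show ?thesis using that[OF G \<xi>(1)] by blast
  qed
qed

lemma LC_approx_attracting:
  assumes "w \<in> LC" "e > 0"
  obtains x g where "g \<in> \<Gamma>" "attracting_fixed_point g (proj_pt x)" "x \<noteq> 0" "norm (x - w) < e"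
proof -
  let ?U = "proj_pt ` (ball w e - {0})"
  have "open ?U" by (intro open_proj_image open_ball)
  moreover have "proj_pt w \<in> ?U" using assms by (auto simp: LC_def)
  moreover have "proj_pt w \<in> closure {p. \<exists>g\<in>\<Gamma>. proximal g \<and> attracting_fixed_point g p}"
    using assms(1) by (simp add: LC_def proximal_limit_set_def)
  ultimately have "?U \<inter> {p. \<exists>g\<in>\<Gamma>. proximal g \<and> attracting_fixed_point g p} \<noteq> {}"
    using open_Int_closure_eq_empty by blast
  then obtain x g where "x \<in> ball w e" "x \<noteq> 0" "g \<in> \<Gamma>" "attracting_fixed_point g (proj_pt x)" by blast
  then show ?thesis using that by (simp add: dist_norm norm_minus_commute)
qed

text \<open>Minimality of the limit set, for vectors in place of points: \<open>w\<close> is close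
  to an attracting eigenvector \<open>x\<close>, and high powers of a proximal element move a
  generic translate of \<open>v\<close> towards the line of \<open>x\<close>.\<close>

lemma orbit_approx:
  assumes w: "w \<in> LC" "w \<in> closure C" and v: "v \<in> closure C" "v \<noteq> 0" and "e > 0"
  obtains A c where "A \<in> GG" "c > 0" "norm (c *\<^sub>R (A *v v) - w) < e"
proof -
  have fw: "f \<bullet> w > 0" using closure_f_pos w by (auto simp: LC_def)
  have "f \<noteq> 0" using fw by auto
  \<comment> \<open>At distance less than \<open>f \<bullet> w / norm f\<close> from
    \<open>w\<close> the form \<open>f\<close> is positive, which forces \<open>c\<close> to be
    positive.\<close>
  define d where "d = min e (f \<bullet> w / norm f)"
  have d: "d > 0" "d \<le> e" "d * norm f \<le> f \<bullet> w" using \<open>e > 0\<close> fw \<open>f \<noteq> 0\<close> by (auto simp: d_def min_def field_simps)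
  have "d / 2 > 0" using d by simp
  then obtain x g where x: "g \<in> \<Gamma>" "attracting_fixed_point g (proj_pt x)" "x \<noteq> 0" "norm (x - w) < d / 2"
    by (rule LC_approx_attracting[OF w(1)])
  obtain A \<alpha> \<xi> where A: "A \<in> GG" "\<xi> \<bullet> x = 1" "(\<lambda>n. inverse \<alpha> ^ n *\<^sub>R matpow A n) \<longlonglongrightarrow> outer x \<xi>"
    by (rule proximal_powers[OF x(1-3)])
  have "\<xi> \<noteq> 0" using A(2) by auto
  have "\<exists>H\<in>GG. \<forall>(\<xi>, v)\<in>{(\<xi>, v)}. \<xi> \<bullet> (H *v v) \<noteq> 0 \<and> \<xi> \<bullet> (matrix_inv H *v v) \<noteq> 0"
    by (rule generic_element) (use \<open>\<xi> \<noteq> 0\<close> v in auto)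
  then obtain H where H: "H \<in> GG" "\<xi> \<bullet> (H *v v) \<noteq> 0" by auto
  have "(\<lambda>n. inverse (\<xi> \<bullet> (H *v v)) *\<^sub>R ((inverse \<alpha> ^ n *\<^sub>R matpow A n) *v (H *v v))) \<longlonglongrightarrow>
      inverse (\<xi> \<bullet> (H *v v)) *\<^sub>R (outer x \<xi> *v (H *v v))"
    by (intro tendsto_intros A(3))
  then have "(\<lambda>n. inverse (\<xi> \<bullet> (H *v v)) *\<^sub>R ((inverse \<alpha> ^ n *\<^sub>R matpow A n) *v (H *v v))) \<longlonglongrightarrow> x"
    using H(2) by (simp add: outer_mult_vector)
  from LIMSEQ_D[OF this \<open>d / 2 > 0\<close>] obtain n where
    n: "norm (inverse (\<xi> \<bullet> (H *v v)) *\<^sub>R ((inverse \<alpha> ^ n *\<^sub>R matpow A n) *v (H *v v)) - x) < d / 2" by blast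
  define B where "B = matpow A n ** H"
  define c where "c = inverse (\<xi> \<bullet> (H *v v)) * inverse \<alpha> ^ n"
  have BG: "B \<in> GG" unfolding B_def by (intro mult matpow_mem A H)
  have "norm (c *\<^sub>R (B *v v) - x) < d / 2"
    using n by (simp add: B_def c_def scaleR_matrix_vector_assoc[symmetric] matrix_vector_mul_assoc[symmetric])
  then have near: "norm (c *\<^sub>R (B *v v) - w) < d"
    using x(4) norm_triangle_ineq[of "c *\<^sub>R (B *v v) - x" "x - w"] by simp
  have "c > 0"
  proof (rule ccontr)
    assume "\<not> c > 0"
    then have "f \<bullet> (c *\<^sub>R (B *v v)) \<le> 0"
      using closure_f_nonneg[OF GG_closure[OF BG v(1)]] by (simp add: mult_nonpos_nonneg)
    then have "f \<bullet> w \<le> \<bar>f \<bullet> (c *\<^sub>R (B *v v) - w)\<bar>" by (simp add: inner_diff_right)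
    also have "\<dots> \<le> norm f * norm (c *\<^sub>R (B *v v) - w)" by (rule Cauchy_Schwarz_ineq2)
    also have "\<dots> < norm f * d" using near \<open>f \<noteq> 0\<close> by simp
    finally show False using d(3) by (simp add: mult.commute)
  qed
  then show ?thesis using that[OF BG] near d(2) by fastforce
qed

text \<open>The limit maps the closed cone into itself and the closed cone contains no opposite
  vectors, so \<open>\<xi>\<close> has one sign on it; dividing by \<open>s\<close> makes this sign
  positive and puts the compensating factor on \<open>p\<close>.\<close>

lemma rank_one_limit_sign:
  assumes A: "\<And>n. A n \<in> GG" "\<And>n. c n > 0" and lim: "(\<lambda>n. c n *\<^sub>R A n) \<longlonglongrightarrow> outer p \<xi>" and "\<xi> \<bullet> p = 1"
  obtains s where "s \<noteq> 0" "s *\<^sub>R p \<in> closure C" "outer (s *\<^sub>R p) (inverse s *\<^sub>R \<xi>) = outer p \<xi>"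
    "\<And>x. x \<in> closure C \<Longrightarrow> (inverse s *\<^sub>R \<xi>) \<bullet> x \<ge> 0" "\<And>x. x \<in> C \<Longrightarrow> (inverse s *\<^sub>R \<xi>) \<bullet> x > 0"
proof -
  have nz': "\<xi> \<noteq> 0" "p \<noteq> 0" using assms(4) by auto
  have in_cl: "(\<xi> \<bullet> x) *\<^sub>R p \<in> closure C" if "x \<in> closure C" for x
  proof -
    have "(\<lambda>n. (c n *\<^sub>R A n) *v x) \<longlonglongrightarrow> outer p \<xi> *v x" by (intro tendsto_intros lim)
    from closed_sequentially[OF closed_closure GG_closure[OF GG_scale[OF A(1,2)] that] this]
    show ?thesis unfolding outer_mult_vector .
  qed
  have open_step: "\<exists>e>0. y - e *\<^sub>R \<xi> \<in> C" if y: "y \<in> C" for y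
  proof -
    have "((\<lambda>e. y - e *\<^sub>R \<xi>) \<longlongrightarrow> y - 0 *\<^sub>R \<xi>) (at_right 0)" by (intro tendsto_intros)
    then have "\<forall>\<^sub>F e in at_right 0. y - e *\<^sub>R \<xi> \<in> C"
      using topological_tendstoD[OF _ open_C] y by simp
    then have "\<forall>\<^sub>F e in at_right 0. y - e *\<^sub>R \<xi> \<in> C \<and> e > (0::real)"
      using eventually_at_right_less[of 0] by eventually_elim simp
    then show ?thesis using eventually_happens'[OF trivial_limit_at_right_real] by blast
  qed
  obtain y where y: "y \<in> C" using C_nonempty by blast
  obtain y' where y': "y' \<in> C" "\<xi> \<bullet> y' \<noteq> 0"
  proof (cases "\<xi> \<bullet> y = 0")
    case True
    obtain e where "e > 0" "y - e *\<^sub>R \<xi> \<in> C" using open_step[OF y] by blast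
    moreover have "\<xi> \<bullet> (y - e *\<^sub>R \<xi>) \<noteq> 0" using True nz' \<open>e > 0\<close> by (simp add: inner_diff_right)
    ultimately show ?thesis using that by blast
  qed (use y that in blast)
  define s where "s = \<xi> \<bullet> y'"
  have s: "s \<noteq> 0" "s *\<^sub>R p \<in> closure C" using y' in_cl closure_subset by (auto simp: s_def)
  have nonneg: "(inverse s *\<^sub>R \<xi>) \<bullet> x \<ge> 0" if x: "x \<in> closure C" for x
  proof (rule ccontr)
    define k where "k = (inverse s *\<^sub>R \<xi>) \<bullet> x"
    assume "\<not> (inverse s *\<^sub>R \<xi>) \<bullet> x \<ge> 0"
    then have "k < 0" by (simp add: k_def)
    have "k * s = \<xi> \<bullet> x" using s(1) by (simp add: k_def)
    then have "k *\<^sub>R (s *\<^sub>R p) \<in> closure C" using in_cl[OF x] by simp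
    then have "inverse (- k) *\<^sub>R (k *\<^sub>R (s *\<^sub>R p)) \<in> closure C"
      by (rule scale_closure) (use \<open>k < 0\<close> in simp)
    moreover have "inverse (- k) *\<^sub>R (k *\<^sub>R z) = - z" for z :: "real^'n" using \<open>k < 0\<close> by simp
    ultimately have "- (s *\<^sub>R p) \<in> closure C" by metis
    then have "s *\<^sub>R p = 0" using s(2) minus_closure by blast
    then show False using s nz' by simp
  qed
  have pos: "(inverse s *\<^sub>R \<xi>) \<bullet> x > 0" if x: "x \<in> C" for x
  proof -
    have "(inverse s *\<^sub>R \<xi>) \<bullet> x \<noteq> 0"
    proof
      assume 0: "(inverse s *\<^sub>R \<xi>) \<bullet> x = 0"
      then have \<xi>x: "\<xi> \<bullet> x = 0" using s by simp
      \<comment> \<open>From a zero in the open cone one can move in the directions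
        \<open>\<xi>\<close> and \<open>- \<xi>\<close>, which would produce both signs.\<close>
      obtain e where e: "e > 0" "x - e *\<^sub>R \<xi> \<in> C" using open_step[OF x] by blast
      have "((\<lambda>e. x + e *\<^sub>R \<xi>) \<longlongrightarrow> x + 0 *\<^sub>R \<xi>) (at_right 0)" by (intro tendsto_intros)
      then have "\<forall>\<^sub>F e in at_right 0. x + e *\<^sub>R \<xi> \<in> C"
        using topological_tendstoD[OF _ open_C] x by simp
      then have "\<forall>\<^sub>F e in at_right 0. x + e *\<^sub>R \<xi> \<in> C \<and> e > (0::real)"
        using eventually_at_right_less[of 0] by eventually_elim simp
      then obtain e' where e': "e' > 0" "x + e' *\<^sub>R \<xi> \<in> C"
        using eventually_happens'[OF trivial_limit_at_right_real] by blast
      have 1: "(inverse s *\<^sub>R \<xi>) \<bullet> (x - e *\<^sub>R \<xi>) \<ge> 0" "(inverse s *\<^sub>R \<xi>) \<bullet> (x + e' *\<^sub>R \<xi>) \<ge> 0"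
        using nonneg e e' closure_subset by blast+
      have "inverse s * (e * (\<xi> \<bullet> \<xi>)) \<le> 0" "inverse s * (e' * (\<xi> \<bullet> \<xi>)) \<ge> 0"
        using 1 \<xi>x by (simp_all add: inner_diff_right inner_add_right mult.left_commute)
      moreover have "e * (\<xi> \<bullet> \<xi>) > 0" "e' * (\<xi> \<bullet> \<xi>) > 0" using e e' nz' by simp_all
      ultimately have "\<not> inverse s > 0" "\<not> inverse s < 0"
        using mult_pos_pos[of "inverse s" "e * (\<xi> \<bullet> \<xi>)"] mult_neg_pos[of "inverse s" "e' * (\<xi> \<bullet> \<xi>)"] by linarith+
      then show False using s(1) by simp
    qed
    moreover have "(inverse s *\<^sub>R \<xi>) \<bullet> x \<ge> 0" using closure_subset x by (intro nonneg) (rule subsetD)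
    ultimately show ?thesis by linarith
  qed
  have "outer (s *\<^sub>R p) (inverse s *\<^sub>R \<xi>) = outer p \<xi>"
    using s(1) by (simp add: outer_def vec_eq_iff)
  from that[OF s this nonneg pos] show ?thesis .
qed

end

section \<open>Mixing for boundary pairs\<close>

context automorphism_group
begin

text \<open>\<open>w\<close> supplies a proximal element, and the pair shows that the dimension is
  at least two. Adjusting the signs of \<open>p\<close>, \<open>\<xi>\<close> and of
  \<open>q\<close>, \<open>\<eta>\<close> to the cone gives \<open>nonneg\<close>.\<close>

lemma exists_biproximal_matrix_group:
  assumes p: "bpair u w" and w: "w \<in> LC"
  obtains D l m p \<xi> q \<eta> where "biproximal_matrix_group GG D l m p \<xi> q \<eta>"
    "p \<in> closure C" "q \<in> closure C" "p \<noteq> 0" "q \<noteq> 0"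
    "\<And>x. x \<in> C \<Longrightarrow> \<xi> \<bullet> x > 0" "\<And>x. x \<in> C \<Longrightarrow> \<eta> \<bullet> x > 0"
proof -
  obtain x g where x: "g \<in> \<Gamma>" "attracting_fixed_point g (proj_pt x)" "x \<noteq> 0"
    by (rule LC_approx_attracting[OF w zero_less_one])
  obtain A \<alpha> \<xi>0 where A: "A \<in> GG" "\<xi>0 \<bullet> x = 1" "(\<lambda>n. inverse \<alpha> ^ n *\<^sub>R matpow A n) \<longlonglongrightarrow> outer x \<xi>0"
    by (rule proximal_powers[OF x])
  obtain D l m p \<xi> q \<eta> where D: "D \<in> GG" and bi: "biproximal D l m p \<xi> q \<eta>"
    using exists_biproximal[OF A indep_imp_CARD[OF bpair_indep[OF p]]] by blast
  note b = bi[unfolded biproximal_def]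
  have pos: "inverse l ^ n > 0" "m ^ n > 0" for n using b by auto
  obtain s where s: "s \<noteq> 0" "s *\<^sub>R p \<in> closure C" "outer (s *\<^sub>R p) (inverse s *\<^sub>R \<xi>) = outer p \<xi>"
      "\<And>x. x \<in> closure C \<Longrightarrow> (inverse s *\<^sub>R \<xi>) \<bullet> x \<ge> 0" "\<And>x. x \<in> C \<Longrightarrow> (inverse s *\<^sub>R \<xi>) \<bullet> x > 0"
    using rank_one_limit_sign[of "matpow D" "\<lambda>n. inverse l ^ n" p \<xi>] matpow_mem[OF D] pos(1) b by blast
  obtain t where t: "t \<noteq> 0" "t *\<^sub>R q \<in> closure C" "outer (t *\<^sub>R q) (inverse t *\<^sub>R \<eta>) = outer q \<eta>"
      "\<And>x. x \<in> closure C \<Longrightarrow> (inverse t *\<^sub>R \<eta>) \<bullet> x \<ge> 0" "\<And>x. x \<in> C \<Longrightarrow> (inverse t *\<^sub>R \<eta>) \<bullet> x > 0"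
    using rank_one_limit_sign[of "matpow (matrix_inv D)" "\<lambda>n. m ^ n" q \<eta>] matpow_mem[OF GG_inverse[OF D]] pos(2) b
    by blast
  have "biproximal D l m (s *\<^sub>R p) (inverse s *\<^sub>R \<xi>) (t *\<^sub>R q) (inverse t *\<^sub>R \<eta>)"
    unfolding biproximal_def s(3) t(3) using b s(1) t(1) by simp
  then have "biproximal_matrix_group GG D l m (s *\<^sub>R p) (inverse s *\<^sub>R \<xi>) (t *\<^sub>R q) (inverse t *\<^sub>R \<eta>)"
    using D s(4)[OF GG_closure[OF _ s(2)]] t(4)[OF GG_closure[OF _ t(2)]]
    by (intro biproximal_matrix_group.intro irreducible_matrix_group_axioms biproximal_matrix_group_axioms.intro)
  moreover have "s *\<^sub>R p \<noteq> 0" "t *\<^sub>R q \<noteq> 0" using b s(1) t(1) by auto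
  ultimately show ?thesis using that s(2,5) t(2,5) by blast
qed

lemma open_add_C: assumes "u + w \<in> C" "e > 0" obtains d where "d > 0" "d \<le> e" "\<And>y. norm (y - w) < d \<Longrightarrow> u + y \<in> C"
proof -
  obtain r where r: "r > 0" "\<And>y. dist y (u + w) < r \<Longrightarrow> y \<in> C"
    using open_C assms(1) unfolding open_dist by blast
  show ?thesis
  proof (rule that[of "min r e"])
    show "u + y \<in> C" if "norm (y - w) < min r e" for y
      using that by (intro r(2)) (simp add: dist_norm)
  qed (use r assms in auto)
qed

text \<open>\<open>X = H M E^-1\<close> follows a translation sequence \<open>M\<close>. The second
  component is matched exactly by taking \<open>y = \<rho> X^-1 w1\<close>, which is near
  \<open>w0\<close> since \<open>M^-1\<close> pulls towards \<open>q\<close>; the first one is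
  matched approximately. This happens when \<open>2 * t\<close> is close to
  \<open>k0 + n L + s\<close>, and by density finitely many shifts \<open>s\<close> serve all large
  \<open>t\<close>.\<close>

lemma mix_pairs:
  assumes p0: "bpair u0 w0" "u0 \<in> LC" "w0 \<in> LC" and p1: "bpair u1 w1" "u1 \<in> LC" "w1 \<in> LC" and "e > 0"
  shows "\<exists>T. \<forall>t\<ge>T. \<exists>A r y. A \<in> GG \<and> r > 0 \<and> bpair u0 y \<and> y \<in> LC \<and> norm (y - w0) < e \<and>
    norm ((r * exp (- t)) *\<^sub>R (A *v u0) - u1) < e \<and> (r * exp t) *\<^sub>R (A *v y) = w1"
proof -
  obtain D l m p \<xi> q \<eta> where bi: "biproximal_matrix_group GG D l m p \<xi> q \<eta>"
    and pq: "p \<in> closure C" "q \<in> closure C" "p \<noteq> 0" "q \<noteq> 0"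
    and pos: "\<And>x. x \<in> C \<Longrightarrow> \<xi> \<bullet> x > 0" "\<And>x. x \<in> C \<Longrightarrow> \<eta> \<bullet> x > 0"
    by (rule exists_biproximal_matrix_group[OF p0(1,3)]) blast
  interpret B: biproximal_matrix_group GG D l m p \<xi> q \<eta> by (rule bi)
  note props = biproximal_props(5,6)[OF B.biproximal]
  have cl: "u1 \<in> closure C" "w0 \<in> closure C" using p0 p1 by (auto simp: bpair_def bd_def)
  have C01: "u0 + w0 \<in> C" "w1 + u1 \<in> C" using p0 p1 by (auto simp: bpair_def add.commute)
  obtain e1 where e1: "e1 > 0" "e1 \<le> e" "\<And>y. norm (y - w0) < e1 \<Longrightarrow> u0 + y \<in> C"
    using open_add_C[OF C01(1) \<open>e > 0\<close>] by blast
  obtain e2 where e2: "e2 > 0" "e2 \<le> e" "\<And>y. norm (y - u1) < e2 \<Longrightarrow> w1 + y \<in> C"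
    using open_add_C[OF C01(2) \<open>e > 0\<close>] by blast
  obtain H c where H: "H \<in> GG" "c > 0" "norm (c *\<^sub>R (H *v p) - u1) < e2"
    by (rule orbit_approx[OF p1(2) cl(1) pq(1,3) e2(1)])
  obtain E k where E: "E \<in> GG" "k > 0" "norm (k *\<^sub>R (E *v q) - w0) < e1"
    by (rule orbit_approx[OF p0(3) cl(2) pq(2,4) e1(1)])
  define a where "a = c *\<^sub>R (H *v p)"
  define b where "b = k *\<^sub>R (E *v q)"
  note iH = GG_invertible[OF H(1)] and iE = GG_invertible[OF E(1)]
  define x1 where "x1 = \<xi> \<bullet> (matrix_inv E *v u0)"
  define y1 where "y1 = \<eta> \<bullet> (matrix_inv H *v w1)"
  \<comment> \<open>\<open>u0\<close> is only a boundary vector, but \<open>u0 + b\<close> is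
    interior, and \<open>matrix_inv E\<close> maps \<open>b\<close> to a multiple of
    \<open>q\<close>, on which \<open>\<xi>\<close> vanishes.\<close>
  have x1: "x1 > 0"
  proof -
    have "matrix_inv E *v (u0 + b) \<in> C" using e1(3)[of b] E(3) by (intro GG_C GG_inverse E(1)) (simp add: b_def)
    then have "\<xi> \<bullet> (matrix_inv E *v (u0 + b)) > 0" by (rule pos(1))
    then show ?thesis
      by (simp add: b_def x1_def matrix_vector_right_distrib matrix_vector_mult_scaleR matrix_inv_vector(2)[OF iE]
          inner_add_right props)
  qed
  have y1: "y1 > 0"
  proof -
    have "matrix_inv H *v (w1 + a) \<in> C" using e2(3)[of a] H(3) by (intro GG_C GG_inverse H(1)) (simp add: a_def)
    then have "\<eta> \<bullet> (matrix_inv H *v (w1 + a)) > 0" by (rule pos(2))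
    then show ?thesis
      by (simp add: a_def y1_def matrix_vector_right_distrib matrix_vector_mult_scaleR matrix_inv_vector(2)[OF iH]
          inner_add_right props)
  qed
  obtain \<epsilon> where \<epsilon>: "\<epsilon> > 0" "\<And>x y. \<bar>x\<bar> < \<epsilon> \<Longrightarrow> norm (y - a) < \<epsilon> \<Longrightarrow> norm (exp x *\<^sub>R y - u1) < e"
  proof -
    let ?S = "{z :: real \<times> (real^'n). norm (exp (fst z) *\<^sub>R snd z - u1) < e}"
    have "open ?S" by (intro open_Collect_less continuous_intros)
    moreover have "(0, a) \<in> ?S" using H(3) e2(2) by (simp add: a_def)
    ultimately obtain d where d: "d > 0" "\<And>z. dist z (0, a) < d \<Longrightarrow> z \<in> ?S" unfolding open_dist by blast
    show ?thesis
    proof (rule that[of "d / 2"])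
      fix x y assume xy: "\<bar>x\<bar> < d / 2" "norm (y - a) < d / 2"
      have "dist (x, y) (0, a) \<le> \<bar>x\<bar> + norm (y - a)"
        using norm_Pair_le[of x "y - a"] by (simp add: dist_norm)
      then have "(x, y) \<in> ?S" using xy by (intro d(2)) linarith
      then show "norm (exp x *\<^sub>R y - u1) < e" by simp
    qed (use d in simp)
  qed
  \<comment> \<open>Collects the constants of the two limits: the factor \<open>c / x1\<close>
    brings the first component to \<open>a\<close>, the factor \<open>k / y1\<close> the second one
    to \<open>b\<close>.\<close>
  define k0 where "k0 = ln (x1 * y1 / (k * c))"
  have ek0: "exp k0 = x1 * y1 / (k * c)" unfolding k0_def using x1 y1 E(2) H(2) by simp
  \<comment> \<open>At index \<open>n\<close> the shift \<open>s\<close> realises the doubled time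
    \<open>k0 + n L + s\<close>, up to the error \<open>\<theta>\<close> in time and the error of
    \<open>z\<close> in direction.\<close>
  define good where "good s n \<longleftrightarrow> (\<exists>X \<rho> \<theta> z. X \<in> GG \<and> \<rho> > 0 \<and> norm (\<rho> *\<^sub>R (matrix_inv X *v w1) - w0) < e1 \<and>
      \<bar>\<theta>\<bar> < \<epsilon> / 2 \<and> norm (z - a) < \<epsilon> \<and> X *v u0 = (\<rho> * exp (k0 + real n * B.L + s + \<theta>)) *\<^sub>R z)" for s n
  have ev_good: "\<forall>\<^sub>F n in sequentially. good s n" if sh: "s \<in> B.shifts" for s
  proof -
    obtain M \<sigma> \<tau> where M: "B.translation_seq s M \<sigma> \<tau>" using sh unfolding B.shifts_def by blast
    note M' = M[unfolded B.translation_seq_def]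
    define X where "X n = H ** M n ** matrix_inv E" for n
    define \<rho> where "\<rho> n = k / y1 * \<tau> n" for n
    define z where "z n = (c / x1 * \<sigma> n) *\<^sub>R (X n *v u0)" for n
    define \<theta> where "\<theta> n = - ln (\<sigma> n * \<tau> n * exp (real n * B.L)) - s" for n
    have XG: "X n \<in> GG" for n unfolding X_def using M' by (intro GG_mult H(1) GG_inverse E(1)) auto
    have iM: "invertible (M n)" for n using M' GG_invertible by blast
    have Xinv: "matrix_inv (X n) = E ** matrix_inv (M n) ** matrix_inv H" for n
      using iM iH iE invertible_matrix_inv[OF iE]
      by (simp add: X_def matrix_inv_prod invertible_mult matrix_inv_matrix_inv matrix_mul_assoc)
    have "(\<lambda>n. (c / x1) *\<^sub>R (H *v ((\<sigma> n *\<^sub>R M n) *v (matrix_inv E *v u0)))) \<longlonglongrightarrow>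
        (c / x1) *\<^sub>R (H *v (outer p \<xi> *v (matrix_inv E *v u0)))"
      using M' by (intro tendsto_intros) auto
    also have "(c / x1) *\<^sub>R (H *v (outer p \<xi> *v (matrix_inv E *v u0))) = a"
      using x1 by (simp add: outer_mult_vector matrix_vector_mult_scaleR a_def x1_def)
    also have "(\<lambda>n. (c / x1) *\<^sub>R (H *v ((\<sigma> n *\<^sub>R M n) *v (matrix_inv E *v u0)))) = z"
      by (simp add: fun_eq_iff z_def X_def matrix_vector_mul_assoc[symmetric] scaleR_matrix_vector_assoc[symmetric]
          matrix_vector_mult_scaleR)
    finally have lim_z: "z \<longlonglongrightarrow> a" .
    have "(\<lambda>n. (k / y1) *\<^sub>R (E *v ((\<tau> n *\<^sub>R matrix_inv (M n)) *v (matrix_inv H *v w1)))) \<longlonglongrightarrow>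
        (k / y1) *\<^sub>R (E *v (outer q \<eta> *v (matrix_inv H *v w1)))"
      using M' by (intro tendsto_intros) auto
    also have "(k / y1) *\<^sub>R (E *v (outer q \<eta> *v (matrix_inv H *v w1))) = b"
      using y1 by (simp add: outer_mult_vector matrix_vector_mult_scaleR b_def y1_def)
    also have "(\<lambda>n. (k / y1) *\<^sub>R (E *v ((\<tau> n *\<^sub>R matrix_inv (M n)) *v (matrix_inv H *v w1)))) =
        (\<lambda>n. \<rho> n *\<^sub>R (matrix_inv (X n) *v w1))"
      by (simp add: fun_eq_iff \<rho>_def Xinv matrix_vector_mul_assoc[symmetric] scaleR_matrix_vector_assoc[symmetric]
          matrix_vector_mult_scaleR)
    finally have lim_w: "(\<lambda>n. \<rho> n *\<^sub>R (matrix_inv (X n) *v w1)) \<longlonglongrightarrow> b" .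
    have "\<theta> \<longlonglongrightarrow> - ln (exp (- s)) - s" unfolding \<theta>_def using M' by (intro tendsto_intros) auto
    then have lim_\<theta>: "\<theta> \<longlonglongrightarrow> 0" by simp
    have "\<forall>\<^sub>F n in sequentially. dist (z n) a < \<epsilon>" using tendstoD[OF lim_z \<epsilon>(1)] .
    moreover have "\<forall>\<^sub>F n in sequentially. dist (\<theta> n) 0 < \<epsilon> / 2" by (rule tendstoD[OF lim_\<theta>]) (use \<epsilon>(1) in simp)
    moreover have "\<forall>\<^sub>F n in sequentially. norm (\<rho> n *\<^sub>R (matrix_inv (X n) *v w1) - w0) < e1"
    proof -
      have "(\<lambda>n. norm (\<rho> n *\<^sub>R (matrix_inv (X n) *v w1) - w0)) \<longlonglongrightarrow> norm (b - w0)" by (intro tendsto_intros lim_w)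
      then show ?thesis by (rule order_tendstoD(2)) (use E(3) in \<open>simp add: b_def\<close>)
    qed
    ultimately show ?thesis
    proof eventually_elim
      case (elim n)
      have st: "\<sigma> n > 0" "\<tau> n > 0" using M' by auto
      have "exp (k0 + real n * B.L + s + \<theta> n) = exp k0 * (exp (real n * B.L) * exp (s + \<theta> n))"
        by (simp add: exp_add)
      also have "exp (s + \<theta> n) = inverse (\<sigma> n * \<tau> n * exp (real n * B.L))"
        using st by (simp add: \<theta>_def exp_minus)
      finally have ex: "exp (k0 + real n * B.L + s + \<theta> n) = x1 * y1 / (k * c) * inverse (\<sigma> n * \<tau> n)"
        by (simp add: ek0)
      have "X n *v u0 = (x1 / (c * \<sigma> n)) *\<^sub>R z n" using x1 H(2) st by (simp add: z_def)
      also have "x1 / (c * \<sigma> n) = \<rho> n * exp (k0 + real n * B.L + s + \<theta> n)"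
        unfolding ex \<rho>_def using x1 y1 E(2) H(2) st by (simp add: field_simps)
      finally have "X n *v u0 = (\<rho> n * exp (k0 + real n * B.L + s + \<theta> n)) *\<^sub>R z n" .
      moreover have "\<rho> n > 0" using E(2) y1 st by (simp add: \<rho>_def)
      ultimately show "good s n" unfolding good_def
        using elim XG by (intro exI[of _ "X n"] exI[of _ "\<rho> n"] exI[of _ "\<theta> n"] exI[of _ "z n"]) (simp add: dist_norm)
    qed
  qed
  \<comment> \<open>A finite net of one period makes the threshold for \<open>n\<close> uniform in
    \<open>t\<close>.\<close>
  have "\<exists>K. finite K \<and> {0..B.L} \<subseteq> (\<Union>x\<in>K. ball x (\<epsilon> / 4))"
    using compact_Icc[of 0 B.L] \<epsilon>(1) unfolding compact_eq_totally_bounded by (metis divide_pos_pos zero_less_numeral)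
  then obtain K where K: "finite K" "{0..B.L} \<subseteq> (\<Union>x\<in>K. ball x (\<epsilon> / 4))" by blast
  have "\<forall>x. \<exists>s. s \<in> B.shifts \<and> \<bar>s - x\<bar> < \<epsilon> / 4" using B.shifts_dense[of "\<epsilon> / 4"] \<epsilon>(1) by auto
  then obtain sh where sh: "\<And>x. sh x \<in> B.shifts" "\<And>x. \<bar>sh x - x\<bar> < \<epsilon> / 4" by metis
  have "\<forall>\<^sub>F n in sequentially. \<forall>x\<in>K. good (sh x) n"
    by (rule eventually_ball_finite[OF K(1)]) (use ev_good sh in blast)
  then obtain N where N: "\<And>n x. n \<ge> N \<Longrightarrow> x \<in> K \<Longrightarrow> good (sh x) n" by (auto simp: eventually_sequentially)
  show ?thesis
  proof (intro exI[of _ "(k0 + real N * B.L) / 2"] allI impI)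
    fix t assume t: "t \<ge> (k0 + real N * B.L) / 2"
    \<comment> \<open>\<open>n\<close> full periods are taken out of the doubled time; the
      remainder, between 0 and \<open>L\<close>, is left to a shift.\<close>
    define j where "j = \<lfloor>(2 * t - k0) / B.L\<rfloor>"
    have "real N \<le> (2 * t - k0) / B.L" using t B.L_pos by (simp add: field_simps)
    then have jN: "j \<ge> int N" unfolding j_def by (simp add: le_floor_iff)
    define n where "n = nat j"
    have n: "n \<ge> N" "real n = of_int j" using jN by (auto simp: n_def)
    define y0 where "y0 = (2 * t - k0) - real n * B.L"
    have "of_int j \<le> (2 * t - k0) / B.L" "(2 * t - k0) / B.L < of_int j + 1"
      unfolding j_def by linarith+
    then have "y0 \<in> {0..B.L}" using B.L_pos by (simp add: y0_def n(2) field_simps)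
    then have "y0 \<in> (\<Union>x\<in>K. ball x (\<epsilon> / 4))" by (rule subsetD[OF K(2)])
    then obtain x where x: "x \<in> K" "dist x y0 < \<epsilon> / 4" by auto
    have close: "\<bar>sh x - y0\<bar> < \<epsilon> / 2" using x(2) sh(2)[of x] unfolding dist_real_def by linarith
    obtain X \<rho> \<theta> z where X: "X \<in> GG" "\<rho> > 0" "norm (\<rho> *\<^sub>R (matrix_inv X *v w1) - w0) < e1"
        "\<bar>\<theta>\<bar> < \<epsilon> / 2" "norm (z - a) < \<epsilon>" "X *v u0 = (\<rho> * exp (k0 + real n * B.L + sh x + \<theta>)) *\<^sub>R z"
      using N[OF n(1) x(1)] unfolding good_def by blast
    define y where "y = \<rho> *\<^sub>R (matrix_inv X *v w1)"
    have Xy: "X *v y = \<rho> *\<^sub>R w1"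
      by (simp add: y_def matrix_vector_mult_scaleR matrix_inv_vector(1)[OF GG_invertible[OF X(1)]])
    show "\<exists>A r y. A \<in> GG \<and> r > 0 \<and> bpair u0 y \<and> y \<in> LC \<and> norm (y - w0) < e \<and>
        norm ((r * exp (- t)) *\<^sub>R (A *v u0) - u1) < e \<and> (r * exp t) *\<^sub>R (A *v y) = w1"
    \<comment> \<open>The common factor is chosen to make the second component at time
      \<open>t\<close> exactly \<open>w1\<close>.\<close>
    proof (intro exI[of _ X] exI[of _ "exp (- t) / \<rho>"] exI[of _ y] conjI)
      show "X \<in> GG" "exp (- t) / \<rho> > 0" using X by auto
      have "y \<in> bd" unfolding y_def
        using p1(1) by (intro scale_bd GG_bd GG_inverse X(1,2)) (simp add: bpair_def)
      then show "bpair u0 y" using p0(1) e1(3)[of y] X(3) by (simp add: bpair_def y_def)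
      show "y \<in> LC" unfolding y_def using X(2) by (intro LC_scale LC_invariant GG_inverse X(1) p1(3)) simp
      show "norm (y - w0) < e" using X(3) e1(2) by (simp add: y_def)
      show "(exp (- t) / \<rho> * exp t) *\<^sub>R (X *v y) = w1"
        unfolding Xy using X(2) by (simp add: exp_minus)
      have "(exp (- t) / \<rho> * exp (- t)) *\<^sub>R (X *v u0) = exp (sh x - y0 + \<theta>) *\<^sub>R z"
      proof -
        have "sh x - y0 + \<theta> = - t + (- t + (k0 + real n * B.L + sh x + \<theta>))" by (simp add: y0_def)
        then have "exp (sh x - y0 + \<theta>) = exp (- t) * (exp (- t) * exp (k0 + real n * B.L + sh x + \<theta>))"
          by (simp only: exp_add)
        then show ?thesis unfolding X(6) using X(2) by simp
      qed
      moreover have "norm (exp (sh x - y0 + \<theta>) *\<^sub>R z - u1) < e"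
        using close X(4,5) by (intro \<epsilon>(2)) linarith+
      ultimately show "norm ((exp (- t) / \<rho> * exp (- t)) *\<^sub>R (X *v u0) - u1) < e" by simp
    qed
  qed
qed

end

section \<open>The flow on the quotient\<close>

text \<open>The saturation of \<open>W\<close> is a union of preimages of \<open>W\<close> under the
  linear changes of representative.\<close>

lemma open_tvec_image:
  assumes "open W" "\<And>v. v \<in> W \<Longrightarrow> fst v \<noteq> 0"
  shows "open (tvec ` W)"
proof -
  have "fst v \<noteq> 0 \<and> tvec v \<in> tvec ` W \<longleftrightarrow> (\<exists>l m. l \<noteq> 0 \<and> (l *\<^sub>R fst v, l *\<^sub>R snd v + m *\<^sub>R fst v) \<in> W)" for v
  proof
    assume v: "fst v \<noteq> 0 \<and> tvec v \<in> tvec ` W"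
    then obtain z where z: "tvec v = tvec z" "z \<in> W" by (auto elim: imageE)
    then obtain l m where "l \<noteq> 0" "fst z = l *\<^sub>R fst v" "snd z = l *\<^sub>R snd v + m *\<^sub>R fst v"
      using tvec_eq_iff[of v z] v assms(2) by blast
    then show "\<exists>l m. l \<noteq> 0 \<and> (l *\<^sub>R fst v, l *\<^sub>R snd v + m *\<^sub>R fst v) \<in> W"
      using z(2) by (metis prod.collapse)
  next
    assume "\<exists>l m. l \<noteq> 0 \<and> (l *\<^sub>R fst v, l *\<^sub>R snd v + m *\<^sub>R fst v) \<in> W"
    then obtain l m where lm: "l \<noteq> 0" "(l *\<^sub>R fst v, l *\<^sub>R snd v + m *\<^sub>R fst v) \<in> W" by blast
    have v: "fst v \<noteq> 0" using assms(2)[OF lm(2)] by auto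
    moreover have "tvec v = tvec (l *\<^sub>R fst v, l *\<^sub>R snd v + m *\<^sub>R fst v)"
      using lm(1) v by (subst tvec_eq_iff) auto
    ultimately show "fst v \<noteq> 0 \<and> tvec v \<in> tvec ` W" using lm(2) by (metis imageI)
  qed
  then have "{v. fst v \<noteq> 0 \<and> tvec v \<in> tvec ` W} =
      (\<Union>l\<in>-{0}. \<Union>m. (\<lambda>v. (l *\<^sub>R fst v, l *\<^sub>R snd v + m *\<^sub>R fst v)) -` W)"
    by auto
  also have "open \<dots>" by (intro open_UN ballI open_vimage assms continuous_intros)
  finally show ?thesis by (simp add: open_tproj_def)
qed

lemma bvec_scale:
  assumes "r \<noteq> 0" "u + w \<noteq> 0" shows "bvec (r *\<^sub>R u) (r *\<^sub>R w) = bvec u w"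
proof -
  have "\<exists>l m. l \<noteq> 0 \<and> r *\<^sub>R u + r *\<^sub>R w = l *\<^sub>R (u + w) \<and> r *\<^sub>R w - r *\<^sub>R u = l *\<^sub>R (w - u) + m *\<^sub>R (u + w)"
    using assms(1) by (intro exI[of _ r] exI[of _ 0]) (simp add: scaleR_add_right scaleR_diff_right)
  moreover have "r *\<^sub>R u + r *\<^sub>R w \<noteq> 0" using assms by (simp add: scaleR_add_right[symmetric])
  ultimately show ?thesis unfolding bvec_def using assms(2) tvec_eq_iff[of "(u + w, w - u)" "(r *\<^sub>R u + r *\<^sub>R w, r *\<^sub>R w - r *\<^sub>R u)"]
    by simp
qed

lemma bvec_open_nbhd:
  assumes "open O'" "bvec u w \<in> O'" "u + w \<noteq> 0"
  shows "\<exists>e>0. \<forall>u' w'. norm (u' - u) < e \<longrightarrow> norm (w' - w) < e \<longrightarrow> bvec u' w' \<in> O'"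
proof -
  let ?g = "\<lambda>z :: (real^'n) \<times> (real^'n). (fst z + snd z, snd z - fst z)"
  have "open (?g -` {v. fst v \<noteq> 0 \<and> tvec v \<in> O'})"
    using assms(1) by (intro open_vimage continuous_intros) (simp add: open_tproj_def)
  moreover have "(u, w) \<in> ?g -` {v. fst v \<noteq> 0 \<and> tvec v \<in> O'}" using assms by (simp add: bvec_def)
  ultimately obtain d where d: "d > 0" "\<And>z. dist z (u, w) < d \<Longrightarrow> z \<in> ?g -` {v. fst v \<noteq> 0 \<and> tvec v \<in> O'}"
    unfolding open_dist by blast
  show ?thesis
  proof (rule exI[of _ "d / 2"], intro conjI allI impI)
    fix u' w' assume uw: "norm (u' - u) < d / 2" "norm (w' - w) < d / 2"
    have "dist (u', w') (u, w) \<le> norm (u' - u) + norm (w' - w)"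
      using norm_Pair_le[of "u' - u" "w' - w"] by (simp add: dist_norm)
    then have "dist (u', w') (u, w) < d" using uw by linarith
    then show "bvec u' w' \<in> O'" using d(2)[of "(u', w')"] by (simp add: bvec_def)
  qed (use d in simp)
qed

context convex_domain
begin

text \<open>If \<open>tvec (a + b, b - a)\<close> is close to \<open>bvec u w\<close>, then a boundary pair representing it differs from
  \<open>(a, b)\<close>, up to scaling, by \<open>(k (a + b), - k (a + b))\<close> for some \<open>k\<close>, and \<open>|k|\<close> is small since
  \<open>a + \<delta> (a + b)\<close> and \<open>b + \<delta> (a + b)\<close> are in the interior.\<close>

lemma bvec_nbhd:
  assumes p: "bpair u w" and "e > 0"
  obtains O' where "open O'" "bvec u w \<in> O'"
    "\<And>c d. bpair c d \<Longrightarrow> bvec c d \<in> O' \<Longrightarrow> \<exists>r>0. norm (r *\<^sub>R c - u) < e \<and> norm (r *\<^sub>R d - w) < e"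
proof -
  define M where "M = norm (u + w) + 1"
  have M: "M > 0" by (simp add: M_def add_nonneg_pos)
  \<comment> \<open>Leaves room for the distance to \<open>(u, w)\<close> and for the correction by
    \<open>k (a + b)\<close>, of norm at most \<open>\<delta> * M\<close>.\<close>
  define \<delta> where "\<delta> = e / (2 * (1 + M))"
  have "\<delta> * (2 * (1 + M)) = e" using M by (simp add: \<delta>_def)
  moreover have "\<delta> > 0" using M \<open>e > 0\<close> by (simp add: \<delta>_def)
  ultimately have \<delta>: "\<delta> > 0" "\<delta> + \<delta> * M = e / 2" by (simp_all add: algebra_simps)
  define a where "a z = (1/2) *\<^sub>R (fst z - snd z)" for z :: "(real^'n) \<times> (real^'n)"
  define b where "b z = (1/2) *\<^sub>R (fst z + snd z)" for z :: "(real^'n) \<times> (real^'n)"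
  have cont: "continuous_on UNIV a" "continuous_on UNIV b" unfolding a_def b_def by (intro continuous_intros)+
  define W where "W = fst -` C \<inter> {z. norm (a z - u) < \<delta>} \<inter> {z. norm (b z - w) < \<delta>} \<inter>
    (\<lambda>z. a z + \<delta> *\<^sub>R fst z) -` C \<inter> (\<lambda>z. b z + \<delta> *\<^sub>R fst z) -` C \<inter> {z. norm (fst z) < M}"
  have "open W" unfolding W_def
    by (intro open_Int open_vimage open_C open_Collect_less continuous_intros cont)
  have W_fst: "fst z \<noteq> 0" if "z \<in> W" for z using that nz by (auto simp: W_def)
  have uw: "u \<in> bd" "w \<in> bd" "u + w \<in> C" using p by (auto simp: bpair_def)
  have "(u + w) - (w - u) = 2 *\<^sub>R u" "(u + w) + (w - u) = 2 *\<^sub>R w" by (simp_all add: scaleR_2)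
  then have ab: "a (u + w, w - u) = u" "b (u + w, w - u) = w" unfolding a_def b_def fst_conv snd_conv by simp_all
  have "(u + w, w - u) \<in> W"
  proof -
    have "\<delta> *\<^sub>R (u + w) + u \<in> C" "\<delta> *\<^sub>R (u + w) + w \<in> C"
      using uw by (auto intro!: add_closure scale_C \<delta> simp: bd_def)
    then have "u + \<delta> *\<^sub>R (u + w) \<in> C" "w + \<delta> *\<^sub>R (u + w) \<in> C" by (simp_all only: add.commute)
    then show ?thesis using \<delta> uw by (simp add: W_def ab M_def)
  qed
  show ?thesis
  proof (rule that[of "tvec ` W"])
    show "open (tvec ` W)" by (rule open_tvec_image[OF \<open>open W\<close> W_fst])
    show "bvec u w \<in> tvec ` W" unfolding bvec_def using \<open>(u + w, w - u) \<in> W\<close> by (rule imageI)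
    fix c d assume cd: "bpair c d" "bvec c d \<in> tvec ` W"
    have cdC: "c \<in> bd" "d \<in> bd" "c + d \<in> C" using cd(1) by (auto simp: bpair_def)
    obtain z where z: "tvec (c + d, d - c) = tvec z" "z \<in> W" using cd(2) unfolding bvec_def by (rule imageE)
    then obtain l m where l: "l \<noteq> 0" "fst z = l *\<^sub>R (c + d)" "snd z = l *\<^sub>R (d - c) + m *\<^sub>R (c + d)"
      using tvec_eq_iff[of "(c + d, d - c)" z] W_fst[OF z(2)] nz[OF cdC(3)] by auto
    have zC: "fst z \<in> C" "norm (a z - u) < \<delta>" "norm (b z - w) < \<delta>" "a z + \<delta> *\<^sub>R fst z \<in> C"
        "b z + \<delta> *\<^sub>R fst z \<in> C" "norm (fst z) < M" using z(2) by (auto simp: W_def)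
    have "l > 0"
    proof -
      have "l * (f \<bullet> (c + d)) > 0" using f_pos[OF zC(1)] l(2) by simp
      then show ?thesis using f_pos[OF cdC(3)] zero_less_mult_pos2 by blast
    qed
    define k where "k = m / (2 * l)"
    have kz: "k *\<^sub>R fst z = (m / 2) *\<^sub>R (c + d)" using l(1) by (simp add: k_def l(2))
    have g: "(P + Q) - ((Q - P) + N) = (P + P) - N" "(P + Q) + ((Q - P) + N) = (Q + Q) + N" for P Q N :: "real^'n"
      by simp_all
    have az: "l *\<^sub>R c = a z + k *\<^sub>R fst z"
    proof -
      have "(l *\<^sub>R (c + d)) - (l *\<^sub>R (d - c) + m *\<^sub>R (c + d)) = 2 *\<^sub>R (l *\<^sub>R c) - m *\<^sub>R (c + d)"
        by (simp only: scaleR_add_right[of l] scaleR_diff_right[of l] g scaleR_2)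
      then have "a z = (1/2) *\<^sub>R (2 *\<^sub>R (l *\<^sub>R c) - m *\<^sub>R (c + d))" unfolding a_def l(2,3) by (rule arg_cong)
      also have "\<dots> = l *\<^sub>R c - (m / 2) *\<^sub>R (c + d)" by (simp add: scaleR_diff_right)
      finally have "a z = l *\<^sub>R c - (m / 2) *\<^sub>R (c + d)" .
      then show ?thesis unfolding kz by simp
    qed
    have bz: "l *\<^sub>R d = b z - k *\<^sub>R fst z"
    proof -
      have "(l *\<^sub>R (c + d)) + (l *\<^sub>R (d - c) + m *\<^sub>R (c + d)) = 2 *\<^sub>R (l *\<^sub>R d) + m *\<^sub>R (c + d)"
        by (simp only: scaleR_add_right[of l] scaleR_diff_right[of l] g scaleR_2)
      then have "b z = (1/2) *\<^sub>R (2 *\<^sub>R (l *\<^sub>R d) + m *\<^sub>R (c + d))" unfolding b_def l(2,3) by (rule arg_cong)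
      also have "\<dots> = l *\<^sub>R d + (m / 2) *\<^sub>R (c + d)" by (simp only: scaleR_add_right scaleR_scaleR) simp
      finally have "b z = l *\<^sub>R d + (m / 2) *\<^sub>R (c + d)" .
      then show ?thesis unfolding kz by simp
    qed
    have ld: "l *\<^sub>R c \<notin> C" "l *\<^sub>R d \<notin> C" using scale_C_iff[OF \<open>l > 0\<close>] cdC by (auto simp: bd_def)
    have "k < \<delta>"
    proof (rule ccontr)
      assume "\<not> k < \<delta>"
      have "l *\<^sub>R c = (a z + \<delta> *\<^sub>R fst z) + (k - \<delta>) *\<^sub>R fst z" unfolding az by (simp add: algebra_simps)
      also have "\<dots> \<in> C"
      proof (cases "k = \<delta>")
        case False
        then show ?thesis using \<open>\<not> k < \<delta>\<close> by (intro add_C zC(4) scale_C zC(1)) simp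
      qed (use zC in simp)
      finally show False using ld by simp
    qed
    moreover have "- k < \<delta>"
    proof (rule ccontr)
      assume "\<not> - k < \<delta>"
      have "l *\<^sub>R d = (b z + \<delta> *\<^sub>R fst z) + (- k - \<delta>) *\<^sub>R fst z" unfolding bz by (simp add: algebra_simps)
      also have "\<dots> \<in> C"
      proof (cases "- k = \<delta>")
        case True
        then have "- k - \<delta> = 0" by simp
        then show ?thesis using zC(5) by (simp only: scaleR_zero_left add_0_right)
      next
        case False
        then show ?thesis using \<open>\<not> - k < \<delta>\<close> by (intro add_C zC(5) scale_C zC(1)) simp
      qed
      finally show False using ld by simp
    qed
    ultimately have "\<bar>k\<bar> \<le> \<delta>" by simp
    then have kM: "norm (k *\<^sub>R fst z) \<le> \<delta> * M" unfolding norm_scaleR using zC(6) \<delta>(1) by (intro mult_mono) auto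
    have 1: "norm (l *\<^sub>R c - u) < e"
    proof -
      have "l *\<^sub>R c - u = (a z - u) + k *\<^sub>R fst z" unfolding az by simp
      then have "norm (l *\<^sub>R c - u) \<le> norm (a z - u) + norm (k *\<^sub>R fst z)" by (simp only: norm_triangle_ineq)
      then show ?thesis using zC(2) kM \<delta>(2) \<open>e > 0\<close> by linarith
    qed
    have 2: "norm (l *\<^sub>R d - w) < e"
    proof -
      have "l *\<^sub>R d - w = (b z - w) - k *\<^sub>R fst z" unfolding bz by simp
      then have "norm (l *\<^sub>R d - w) \<le> norm (b z - w) + norm (k *\<^sub>R fst z)" by (simp only: norm_triangle_ineq4)
      then show ?thesis using zC(3) kM \<delta>(2) \<open>e > 0\<close> by linarith
    qed
    show "\<exists>r>0. norm (r *\<^sub>R c - u) < e \<and> norm (r *\<^sub>R d - w) < e" using \<open>l > 0\<close> 1 2 by blast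
  qed
qed

end

context automorphism_group
begin

section \<open>Points of the quotient as linear orbits of boundary pairs\<close>

abbreviation orb :: "real^'n \<Rightarrow> real^'n \<Rightarrow> 'n tproj set" where
  "orb u w \<equiv> tangent_orbit \<Gamma> (bvec u w)"

lemma bpair_sum_nz: "bpair u w \<Longrightarrow> u + w \<noteq> 0"
  using nz by (auto simp: bpair_def)

lemma orb_eq_image: assumes p: "bpair u w" shows "orb u w = (\<lambda>A. bvec (A *v u) (A *v w)) ` GG"
proof -
  have tact: "pgl_tact (pgl A) (bvec u w) = bvec (A *v u) (A *v w)" if "A \<in> GG" for A
    using pgl_tact_pgl[OF GG_invertible[OF that] bpair_sum_nz[OF p], of "w - u"]
    by (simp add: bvec_def matrix_vector_right_distrib matrix_vector_mult_diff_distrib)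
  have "\<Gamma> = pgl ` GG"
  proof (intro equalityI subsetI)
    fix g assume "g \<in> \<Gamma>"
    then obtain A where "A \<in> GG" "g = pgl A" by (rule exists_lift)
    then show "g \<in> pgl ` GG" by simp
  qed (auto simp: GG_def)
  then have "orb u w = (\<lambda>g. pgl_tact g (bvec u w)) ` (pgl ` GG)" unfolding tangent_orbit_def by (rule arg_cong)
  also have "\<dots> = (\<lambda>A. pgl_tact (pgl A) (bvec u w)) ` GG" by (rule image_image)
  also have "\<dots> = (\<lambda>A. bvec (A *v u) (A *v w)) ` GG" by (rule image_cong) (simp_all add: tact)
  finally show ?thesis .
qed

lemma orb_GG: assumes A: "A \<in> GG" and p: "bpair u w" shows "orb (A *v u) (A *v w) = orb u w"
proof -
  have "orb (A *v u) (A *v w) = (\<lambda>B. bvec (B *v u) (B *v w)) ` ((\<lambda>B. B ** A) ` GG)"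
    unfolding orb_eq_image[OF GG_bpair[OF A p]] by (simp add: image_image matrix_vector_mul_assoc)
  also have "(\<lambda>B. B ** A) ` GG = GG"
  proof (intro equalityI subsetI)
    fix B assume B: "B \<in> GG"
    have "B = (B ** matrix_inv A) ** A"
      using matrix_inv_mult(2)[OF GG_invertible[OF A]] by (simp add: matrix_mul_assoc[symmetric])
    moreover have "B ** matrix_inv A \<in> GG" by (intro GG_mult B GG_inverse A)
    ultimately show "B \<in> (\<lambda>B. B ** A) ` GG" by (rule image_eqI)
  qed (use GG_mult A in blast)
  finally show ?thesis unfolding orb_eq_image[OF p] .
qed

lemma orb_scale: assumes p: "bpair u w" and "r > 0" shows "orb (r *\<^sub>R u) (r *\<^sub>R w) = orb u w"
  using bvec_scale[OF _ bpair_sum_nz[OF p], of r] assms(2) by simp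

text \<open>The positive factor left open by \<open>bvec_eq\<close> is absorbed into
  \<open>A\<close>, since \<open>GG\<close> contains positive multiples.\<close>

lemma orb_eqD:
  assumes p: "bpair u w" "bpair u' w'" and eq: "orb u w = orb u' w'"
  obtains A where "A \<in> GG" "u' = A *v u" "w' = A *v w"
proof -
  have "bvec (mat 1 *v u') (mat 1 *v w') \<in> orb u' w'" unfolding orb_eq_image[OF p(2)] using one by (rule imageI)
  then have "bvec u' w' \<in> (\<lambda>A. bvec (A *v u) (A *v w)) ` GG" unfolding eq[symmetric] orb_eq_image[OF p(1)] by simp
  then obtain A where A: "bvec u' w' = bvec (A *v u) (A *v w)" "A \<in> GG" by (rule imageE)
  obtain r where r: "r > 0" "u' = r *\<^sub>R (A *v u)" "w' = r *\<^sub>R (A *v w)"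
    by (rule bvec_eq[OF GG_bpair[OF A(2) p(1)] p(2) A(1)[symmetric]])
  then show ?thesis using that[OF GG_scale[OF A(2) r(1)]] by (simp add: scaleR_matrix_vector_assoc)
qed

lemma flow_orb:
  assumes p: "bpair u w"
  shows "quotient_flow \<Omega> t (orb u w) = orb (exp (- t) *\<^sub>R u) (exp t *\<^sub>R w)"
proof -
  have p': "bpair (exp (- t) *\<^sub>R u) (exp t *\<^sub>R w)" by (intro bpair_scale p) auto
  have "quotient_flow \<Omega> t (orb u w) = (\<lambda>A. geodesic_flow \<Omega> t (bvec (A *v u) (A *v w))) ` GG"
    unfolding quotient_flow_def orb_eq_image[OF p] by (simp add: image_image)
  also have "\<dots> = (\<lambda>A. bvec (A *v (exp (- t) *\<^sub>R u)) (A *v (exp t *\<^sub>R w))) ` GG"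
    by (rule image_cong) (simp_all add: geodesic_flow_bvec[OF GG_bpair[OF _ p]] matrix_vector_mult_scaleR)
  finally show ?thesis unfolding orb_eq_image[OF p'] .
qed

lemma orbit_space: "tangent_orbit \<Gamma> ` unit_tangent \<Omega> = {orb u w | u w. bpair u w}"
  unfolding unit_tangent_eq by blast

lemma topspace_T1M: "topspace (T1M \<Omega> \<Gamma>) = {orb u w | u w. bpair u w}"
  unfolding T1M_def topspace_quotient_topology using orbit_space by simp

lemma openin_T1M:
  "openin (T1M \<Omega> \<Gamma>) U \<longleftrightarrow> U \<subseteq> {orb u w | u w. bpair u w} \<and>
    openin (top_of_set (unit_tangent \<Omega>)) {v \<in> unit_tangent \<Omega>. tangent_orbit \<Gamma> v \<in> U}"
  unfolding T1M_def openin_quotient_topology topspace_euclidean_subtopology orbit_space ..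

lemma T1M_open_contains_nbhd:
  assumes U: "openin (T1M \<Omega> \<Gamma>) U" and p: "bpair u w" "orb u w \<in> U"
  shows "\<exists>e>0. \<forall>u' w'. bpair u' w' \<longrightarrow> norm (u' - u) < e \<longrightarrow> norm (w' - w) < e \<longrightarrow> orb u' w' \<in> U"
proof -
  have UT: "bvec u' w' \<in> unit_tangent \<Omega>" if "bpair u' w'" for u' w'
    unfolding unit_tangent_eq using that by blast
  obtain O' where O': "open O'" "{v \<in> unit_tangent \<Omega>. tangent_orbit \<Gamma> v \<in> U} = unit_tangent \<Omega> \<inter> O'"
    using U unfolding openin_T1M openin_open by blast
  have "bvec u w \<in> unit_tangent \<Omega> \<inter> O'" unfolding O'(2)[symmetric] using UT[OF p(1)] p(2) by simp
  then have "bvec u w \<in> O'" by simp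
  then obtain e where e: "e > 0" "\<And>u' w'. norm (u' - u) < e \<Longrightarrow> norm (w' - w) < e \<Longrightarrow> bvec u' w' \<in> O'"
    using bvec_open_nbhd[OF O'(1) _ bpair_sum_nz[OF p(1)]] by blast
  have "orb u' w' \<in> U" if "bpair u' w'" "norm (u' - u) < e" "norm (w' - w) < e" for u' w'
  proof -
    have "bvec u' w' \<in> {v \<in> unit_tangent \<Omega>. tangent_orbit \<Gamma> v \<in> U}"
      unfolding O'(2) using UT[OF that(1)] e(2)[OF that(2,3)] by simp
    then show ?thesis by simp
  qed
  then show ?thesis using e(1) by blast
qed

text \<open>Boxes of a definite size are used because flowing back stretches them by a known
  factor.\<close>

definition nbhd :: "real^'n \<Rightarrow> real^'n \<Rightarrow> real \<Rightarrow> 'n tproj set set" where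
  "nbhd u w e = {orb c d | c d. bpair c d \<and> norm (c - u) < e \<and> norm (d - w) < e}"

text \<open>A vector over the box is moved into it by some \<open>B\<close>, and whatever is close
  to that vector, relative to the norm of \<open>B\<close>, is moved into it too.\<close>

lemma openin_nbhd: "openin (T1M \<Omega> \<Gamma>) (nbhd u w e)"
  unfolding openin_T1M
proof
  show "nbhd u w e \<subseteq> {orb u w | u w. bpair u w}" by (auto simp: nbhd_def)
  let ?S = "{v \<in> unit_tangent \<Omega>. tangent_orbit \<Gamma> v \<in> nbhd u w e}"
  have "\<exists>T. openin (top_of_set (unit_tangent \<Omega>)) T \<and> v \<in> T \<and> T \<subseteq> ?S" if v: "v \<in> ?S" for v
  proof -
    obtain a b where ab: "bpair a b" "v = bvec a b" using v unfolding unit_tangent_eq by blast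
    obtain c d where cd: "orb a b = orb c d" "bpair c d" "norm (c - u) < e" "norm (d - w) < e"
      using v unfolding ab(2) nbhd_def by blast
    obtain A where A: "A \<in> GG" "a = A *v c" "b = A *v d" by (rule orb_eqD[OF cd(2) ab(1) cd(1)[symmetric]])
    define B where "B = matrix_inv A"
    have B: "B \<in> GG" unfolding B_def by (rule GG_inverse[OF A(1)])
    have Bab: "B *v a = c" "B *v b = d" unfolding B_def A(2,3) by (rule matrix_inv_vector(2)[OF GG_invertible[OF A(1)]])+
    define h where "h = min (e - norm (c - u)) (e - norm (d - w))"
    have h: "h > 0" "h \<le> e - norm (c - u)" "h \<le> e - norm (d - w)" using cd(3,4) by (auto simp: h_def)
    have k: "h / (norm B + 1) > 0" using h by (intro divide_pos_pos) (auto simp: add_nonneg_pos)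
    obtain O' where O': "open O'" "bvec a b \<in> O'" "\<And>c d. bpair c d \<Longrightarrow> bvec c d \<in> O' \<Longrightarrow>
        \<exists>r>0. norm (r *\<^sub>R c - a) < h / (norm B + 1) \<and> norm (r *\<^sub>R d - b) < h / (norm B + 1)"
      by (rule bvec_nbhd[OF ab(1) k]) blast
    have small: "norm (B *v x - B *v y) < h" if "norm (x - y) < h / (norm B + 1)" for x y
    proof -
      have "norm (B *v x - B *v y) \<le> norm B * norm (x - y)"
        using norm_matrix_vector_mult_le[of B "x - y"] by (simp add: matrix_vector_mult_diff_distrib)
      also have "\<dots> \<le> norm B * (h / (norm B + 1))" using that by (intro mult_left_mono) auto
      also have "\<dots> < (norm B + 1) * (h / (norm B + 1))" using k by (intro mult_strict_right_mono) auto
      also have "\<dots> = h" using norm_ge_zero[of B] by (simp add: add_nonneg_eq_0_iff)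
      finally show ?thesis .
    qed
    have "unit_tangent \<Omega> \<inter> O' \<subseteq> ?S"
    proof
      fix y assume y: "y \<in> unit_tangent \<Omega> \<inter> O'"
      then obtain g k where gk: "bpair g k" "y = bvec g k" unfolding unit_tangent_eq by blast
      obtain r where r: "r > 0" "norm (r *\<^sub>R g - a) < h / (norm B + 1)" "norm (r *\<^sub>R k - b) < h / (norm B + 1)"
        using O'(3)[OF gk(1)] y gk(2) by blast
      have rp: "bpair (r *\<^sub>R g) (r *\<^sub>R k)" by (intro bpair_scale gk r)
      have "norm (B *v (r *\<^sub>R g) - u) < e"
        using small[OF r(2)] h(2) norm_triangle_ineq[of "B *v (r *\<^sub>R g) - c" "c - u"] unfolding Bab by simp
      moreover have "norm (B *v (r *\<^sub>R k) - w) < e"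
        using small[OF r(3)] h(3) norm_triangle_ineq[of "B *v (r *\<^sub>R k) - d" "d - w"] unfolding Bab by simp
      ultimately have "orb (B *v (r *\<^sub>R g)) (B *v (r *\<^sub>R k)) \<in> nbhd u w e"
        unfolding nbhd_def using GG_bpair[OF B rp] by blast
      then have "tangent_orbit \<Gamma> y \<in> nbhd u w e" unfolding orb_GG[OF B rp] orb_scale[OF gk(1) r(1)] gk(2) .
      then show "y \<in> ?S" using y by simp
    qed
    moreover have "v \<in> unit_tangent \<Omega> \<inter> O'" using v O'(2) ab(2) by simp
    moreover have "openin (top_of_set (unit_tangent \<Omega>)) (unit_tangent \<Omega> \<inter> O')" using O'(1) by (rule openin_open_Int)
    ultimately show ?thesis by blast
  qed
  then show "openin (top_of_set (unit_tangent \<Omega>)) ?S" by (subst openin_subopen) blast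
qed

lemma T1M_bip_eq: "T1M_bip \<Omega> \<Gamma> = {orb u w | u w. bpair u w \<and> u \<in> LC \<and> w \<in> LC}"
proof -
  have *: "flow_at_plus_infinity \<Omega> (bvec u w) \<in> proximal_limit_set \<Gamma> \<and>
      flow_at_minus_infinity \<Omega> (bvec u w) \<in> proximal_limit_set \<Gamma> \<longleftrightarrow> u \<in> LC \<and> w \<in> LC" if "bpair u w" for u w
    using that bpair_nz[OF that] by (auto simp: flow_at_plus_infinity_bvec flow_at_minus_infinity_bvec LC_def)
  have "{v \<in> unit_tangent \<Omega>. flow_at_plus_infinity \<Omega> v \<in> proximal_limit_set \<Gamma> \<and>
      flow_at_minus_infinity \<Omega> v \<in> proximal_limit_set \<Gamma>} = {bvec u w | u w. bpair u w \<and> u \<in> LC \<and> w \<in> LC}"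
    unfolding unit_tangent_eq using * by blast
  then show ?thesis unfolding T1M_bip_def by (simp only:) blast
qed

text \<open>In \<open>mix_pairs\<close> both \<open>u0\<close> and \<open>y\<close> are in
  \<open>LC\<close>, which is invariant; so the vector and its image under the flow stay in the
  biproximal bundle.\<close>

theorem bip_mixing: "topologically_mixing (subtopology (T1M \<Omega> \<Gamma>) (T1M_bip \<Omega> \<Gamma>)) (quotient_flow \<Omega>)"
  unfolding topologically_mixing_def
proof (intro allI impI, elim conjE)
  fix U U' assume U: "openin (subtopology (T1M \<Omega> \<Gamma>) (T1M_bip \<Omega> \<Gamma>)) U" "U \<noteq> {}"
    and U': "openin (subtopology (T1M \<Omega> \<Gamma>) (T1M_bip \<Omega> \<Gamma>)) U'" "U' \<noteq> {}"
  obtain V where V: "openin (T1M \<Omega> \<Gamma>) V" "U = V \<inter> T1M_bip \<Omega> \<Gamma>" using U(1) unfolding openin_subtopology by blast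
  obtain V' where V': "openin (T1M \<Omega> \<Gamma>) V'" "U' = V' \<inter> T1M_bip \<Omega> \<Gamma>" using U'(1) unfolding openin_subtopology by blast
  obtain u0 w0 where p0: "bpair u0 w0" "u0 \<in> LC" "w0 \<in> LC" "orb u0 w0 \<in> V"
    using U(2) unfolding V(2) T1M_bip_eq by blast
  obtain u1 w1 where p1: "bpair u1 w1" "u1 \<in> LC" "w1 \<in> LC" "orb u1 w1 \<in> V'"
    using U'(2) unfolding V'(2) T1M_bip_eq by blast
  obtain e where e: "e > 0" "\<And>u w. bpair u w \<Longrightarrow> norm (u - u0) < e \<Longrightarrow> norm (w - w0) < e \<Longrightarrow> orb u w \<in> V"
    using T1M_open_contains_nbhd[OF V(1) p0(1,4)] by blast
  obtain e' where e': "e' > 0" "\<And>u w. bpair u w \<Longrightarrow> norm (u - u1) < e' \<Longrightarrow> norm (w - w1) < e' \<Longrightarrow> orb u w \<in> V'"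
    using T1M_open_contains_nbhd[OF V'(1) p1(1,4)] by blast
  have "min e e' > 0" using e e' by simp
  from mix_pairs[OF p0(1-3) p1(1-3) this]
  obtain T where T: "\<And>t. t \<ge> T \<Longrightarrow> \<exists>A r y. A \<in> GG \<and> r > 0 \<and> bpair u0 y \<and> y \<in> LC \<and> norm (y - w0) < min e e' \<and>
    norm ((r * exp (- t)) *\<^sub>R (A *v u0) - u1) < min e e' \<and> (r * exp t) *\<^sub>R (A *v y) = w1" by blast
  have "quotient_flow \<Omega> t ` U \<inter> U' \<noteq> {}" if "t \<ge> T" for t
  proof -
    obtain A r y where A: "A \<in> GG" "r > 0" "bpair u0 y" "y \<in> LC" "norm (y - w0) < min e e'"
      "norm ((r * exp (- t)) *\<^sub>R (A *v u0) - u1) < min e e'" "(r * exp t) *\<^sub>R (A *v y) = w1"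
      using T[OF \<open>t \<ge> T\<close>] by blast
    have in_U: "orb u0 y \<in> U" unfolding V(2) T1M_bip_eq
      using e(2)[OF A(3)] A(3,4,5) e(1) p0(2) by auto
    define u2 where "u2 = (r * exp (- t)) *\<^sub>R (A *v u0)"
    have pt: "bpair (exp (- t) *\<^sub>R u0) (exp t *\<^sub>R y)" by (intro bpair_scale A(3)) auto
    have rA: "r *\<^sub>R A \<in> GG" by (rule GG_scale[OF A(1,2)])
    have eq: "(r *\<^sub>R A) *v (exp (- t) *\<^sub>R u0) = u2" "(r *\<^sub>R A) *v (exp t *\<^sub>R y) = w1"
      unfolding u2_def A(7)[symmetric] by (simp_all add: scaleR_matrix_vector_assoc[symmetric] matrix_vector_mult_scaleR mult.commute)
    have flow: "quotient_flow \<Omega> t (orb u0 y) = orb u2 w1"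
      using flow_orb[OF A(3)] orb_GG[OF rA pt] unfolding eq by simp
    have p2: "bpair u2 w1" using GG_bpair[OF rA pt] unfolding eq .
    have "u2 \<in> LC" unfolding u2_def using A(2) by (intro LC_scale LC_invariant A(1) p0(2)) simp
    moreover have "orb u2 w1 \<in> V'" using e'(2)[OF p2] A(6) e'(1) by (simp add: u2_def)
    ultimately have "orb u2 w1 \<in> U'" unfolding V'(2) T1M_bip_eq using p2 p1(3) by blast
    then show ?thesis using in_U flow by (metis IntI empty_iff imageI)
  qed
  then show "\<forall>\<^sub>F t in at_top. quotient_flow \<Omega> t ` U \<inter> U' \<noteq> {}"
    unfolding eventually_at_top_linorder by blast
qed

text \<open>Transitivity only gives some positive time. The first box is therefore placed around the
  vector already flowed by \<open>S\<close>, which is at least \<open>T\<close>, and is flowed back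
  afterwards; the total time is \<open>S + t\<close>.\<close>

lemma transitive_pairs:
  assumes A: "flow_invariant (quotient_flow \<Omega>) A"
    and tr: "topologically_transitive (subtopology (T1M \<Omega> \<Gamma>) A) (quotient_flow \<Omega>)"
    and p: "bpair a b" "orb a b \<in> A" and p': "bpair a' b'" "orb a' b' \<in> A" and "e > 0"
  shows "\<exists>t\<ge>T. \<exists>G x y x' y'. G \<in> GG \<and> norm (x - a) < e \<and> norm (y - b) < e \<and> norm (x' - a') < e \<and>
    norm (y' - b') < e \<and> x' = exp (- t) *\<^sub>R (G *v x) \<and> y' = exp t *\<^sub>R (G *v y)"
proof -
  define S where "S = max T 0"
  define a1 where "a1 = exp (- S) *\<^sub>R a"
  define b1 where "b1 = exp S *\<^sub>R b"
  have p1: "bpair a1 b1" unfolding a1_def b1_def by (intro bpair_scale p) auto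
  have "quotient_flow \<Omega> S (orb a b) \<in> A" using A p(2) unfolding flow_invariant_def by blast
  then have in_A: "orb a1 b1 \<in> A" unfolding flow_orb[OF p(1)] a1_def b1_def .
  \<comment> \<open>Flowing back by \<open>S\<close> stretches the first component by
    \<open>exp S\<close>.\<close>
  define d where "d = exp (- S) * e"
  have d: "d > 0" using \<open>e > 0\<close> by (simp add: d_def)
  have op: "openin (subtopology (T1M \<Omega> \<Gamma>) A) (nbhd c k h \<inter> A)" for c k h
    using openin_nbhd unfolding openin_subtopology by blast
  have "orb a1 b1 \<in> nbhd a1 b1 d" unfolding nbhd_def using p1 d by force
  then have ne1: "nbhd a1 b1 d \<inter> A \<noteq> {}" using in_A by blast
  have "orb a' b' \<in> nbhd a' b' e" unfolding nbhd_def using p'(1) \<open>e > 0\<close> by force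
  then have ne2: "nbhd a' b' e \<inter> A \<noteq> {}" using p'(2) by blast
  have "\<exists>t>0. quotient_flow \<Omega> t ` (nbhd a1 b1 d \<inter> A) \<inter> (nbhd a' b' e \<inter> A) \<noteq> {}"
    by (rule tr[unfolded topologically_transitive_def, rule_format]) (intro conjI op ne1 ne2)
  then obtain t where t: "t > 0" "quotient_flow \<Omega> t ` (nbhd a1 b1 d \<inter> A) \<inter> (nbhd a' b' e \<inter> A) \<noteq> {}" by auto
  obtain s where s: "s \<in> quotient_flow \<Omega> t ` (nbhd a1 b1 d \<inter> A)" "s \<in> nbhd a' b' e"
    using t(2) by (meson IntE disjoint_iff)
  obtain z where z': "s = quotient_flow \<Omega> t z" "z \<in> nbhd a1 b1 d \<inter> A" using s(1) by (rule imageE)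
  have z: "z \<in> nbhd a1 b1 d" "quotient_flow \<Omega> t z \<in> nbhd a' b' e" using z' s(2) by auto
  obtain x y where xy: "z = orb x y" "bpair x y" "norm (x - a1) < d" "norm (y - b1) < d"
    using z(1) unfolding nbhd_def by blast
  obtain x' y' where xy': "quotient_flow \<Omega> t z = orb x' y'" "bpair x' y'" "norm (x' - a') < e" "norm (y' - b') < e"
    using z(2) unfolding nbhd_def by blast
  have pt: "bpair (exp (- t) *\<^sub>R x) (exp t *\<^sub>R y)" by (intro bpair_scale xy) auto
  have eq: "orb (exp (- t) *\<^sub>R x) (exp t *\<^sub>R y) = orb x' y'" using xy'(1) unfolding xy(1) flow_orb[OF xy(2)] .
  obtain G where G: "G \<in> GG" "x' = G *v (exp (- t) *\<^sub>R x)" "y' = G *v (exp t *\<^sub>R y)"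
    by (rule orb_eqD[OF pt xy'(2) eq])
  define x0 where "x0 = exp S *\<^sub>R x"
  define y0 where "y0 = exp (- S) *\<^sub>R y"
  have ee: "exp S * exp (- S) = 1" "exp (- S) * exp S = 1" by (simp_all add: exp_minus)
  have S: "S \<ge> 0" "exp (- S) \<le> 1" by (simp_all add: S_def)
  have "x0 - a = exp S *\<^sub>R (x - a1)" by (simp add: x0_def a1_def scaleR_diff_right ee)
  then have "norm (x0 - a) = exp S * norm (x - a1)" by simp
  also have "\<dots> < exp S * d" using xy(3) by simp
  also have "\<dots> = e" by (simp add: d_def mult.assoc[symmetric] ee)
  finally have x0: "norm (x0 - a) < e" .
  have "y0 - b = exp (- S) *\<^sub>R (y - b1)" by (simp add: y0_def b1_def scaleR_diff_right ee)
  then have "norm (y0 - b) = exp (- S) * norm (y - b1)" by simp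
  also have "\<dots> \<le> 1 * norm (y - b1)" using S by (intro mult_right_mono) auto
  also have "\<dots> < d" using xy(4) by simp
  also have "d \<le> 1 * e" unfolding d_def using S \<open>e > 0\<close> by (intro mult_right_mono) auto
  finally have y0: "norm (y0 - b) < e" by simp
  have x'0: "x' = exp (- (S + t)) *\<^sub>R (G *v x0)"
  proof -
    have "exp (- (S + t)) * exp S = exp (- t)" by (simp add: exp_add[symmetric])
    then show ?thesis by (simp add: G(2) x0_def matrix_vector_mult_scaleR)
  qed
  have y'0: "y' = exp (S + t) *\<^sub>R (G *v y0)"
  proof -
    have "exp (S + t) * exp (- S) = exp t" by (simp add: exp_add[symmetric])
    then show ?thesis by (simp add: G(3) y0_def matrix_vector_mult_scaleR)
  qed
  have "S + t \<ge> T" using t(1) by (simp add: S_def)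
  then show ?thesis using G(1) x0 y0 xy'(3,4) x'0 y'0 by blast
qed

lemma transitive_sequences:
  assumes A: "flow_invariant (quotient_flow \<Omega>) A"
    and tr: "topologically_transitive (subtopology (T1M \<Omega> \<Gamma>) A) (quotient_flow \<Omega>)"
    and p: "bpair a b" "orb a b \<in> A" and p': "bpair a' b'" "orb a' b' \<in> A"
  obtains t G x y where "\<And>n. t n \<ge> real n" "\<And>n. G n \<in> GG" "x \<longlonglongrightarrow> a" "y \<longlonglongrightarrow> b"
    "(\<lambda>n. exp (- t n) *\<^sub>R (G n *v x n)) \<longlonglongrightarrow> a'" "(\<lambda>n. exp (t n) *\<^sub>R (G n *v y n)) \<longlonglongrightarrow> b'"
proof -
  define P where "P n t G x y \<longleftrightarrow> t \<ge> real n \<and> G \<in> GG \<and> norm (x - a) < inverse (real (Suc n)) \<and>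
    norm (y - b) < inverse (real (Suc n)) \<and> norm (exp (- t) *\<^sub>R (G *v x) - a') < inverse (real (Suc n)) \<and>
    norm (exp t *\<^sub>R (G *v y) - b') < inverse (real (Suc n))" for n t G x y
  have "\<exists>t G x y. P n t G x y" for n
  proof -
    have "inverse (real (Suc n)) > 0" by simp
    from transitive_pairs[OF A tr p p' this, of "real n"] obtain t G x y where
      "t \<ge> real n" "G \<in> GG" "norm (x - a) < inverse (real (Suc n))" "norm (y - b) < inverse (real (Suc n))"
      "norm (exp (- t) *\<^sub>R (G *v x) - a') < inverse (real (Suc n))"
      "norm (exp t *\<^sub>R (G *v y) - b') < inverse (real (Suc n))" by blast
    then have "P n t G x y" unfolding P_def by simp
    then show ?thesis by blast
  qed
  then obtain t G x y where P: "\<And>n. P n (t n) (G n) (x n) (y n)" by metis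
  have lim: "F \<longlonglongrightarrow> l" if "\<And>n. norm (F n - l) < inverse (real (Suc n))" for F :: "nat \<Rightarrow> real^'n" and l
  proof (rule LIM_zero_cancel, rule Lim_null_comparison[OF always_eventually LIMSEQ_inverse_real_of_nat], rule allI)
    show "norm (F n - l) \<le> inverse (real (Suc n))" for n using that[of n] by simp
  qed
  show ?thesis
    by (rule that[of t G x y]; (rule lim)?) (use P[unfolded P_def] in blast)+
qed

text \<open>Let \<open>Z\<close> be a limit of the normalised \<open>K n\<close>. It kills
  \<open>y\<close>, because the images of \<open>Y n\<close> are smaller than those of
  \<open>X n\<close> by \<open>exp (- 2 * t n)\<close>. It does not kill the interior vector
  \<open>x + y\<close>, so \<open>Z x\<close> is a non-zero multiple of \<open>a\<close>, and it is
  a limit of vectors of \<open>LC\<close>.\<close>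

lemma expanding_limit_in_LC:
  assumes K: "\<And>n. K n \<in> GG" and X: "X \<longlonglongrightarrow> x" "x \<in> LC" and Y: "Y \<longlonglongrightarrow> y" "x + y \<in> C"
    and P: "P \<longlonglongrightarrow> a" "f \<bullet> a > 0" and Q: "Q \<longlonglongrightarrow> b" and t: "\<And>n. t n \<ge> real n"
    and KX: "\<And>n. K n *v X n = exp (t n) *\<^sub>R P n" and KY: "\<And>n. K n *v Y n = exp (- t n) *\<^sub>R Q n"
  shows "a \<in> LC"
proof -
  define c where "c n = inverse (norm (K n))" for n
  have Knz: "K n \<noteq> 0" for n
  proof
    assume "K n = 0"
    then have "K n *v (x + y) = 0" by simp
    then show False using matrix_vector_nz[OF GG_invertible[OF K] nz[OF Y(2)]] by simp
  qed
  have c: "c n > 0" for n using Knz[of n] by (simp add: c_def)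
  have n1: "norm (c n *\<^sub>R K n) = 1" for n using Knz[of n] by (simp add: c_def)
  then have "bounded (range (\<lambda>n. c n *\<^sub>R K n))" by (auto simp: bounded_iff)
  then obtain Z r where r: "strict_mono r" "((\<lambda>n. c n *\<^sub>R K n) \<circ> r) \<longlonglongrightarrow> Z"
    using bounded_imp_convergent_subsequence by blast
  have lim: "(\<lambda>n. c (r n) *\<^sub>R K (r n)) \<longlonglongrightarrow> Z" using r(2) by (simp add: o_def)
  have "norm Z = 1" using tendsto_norm[OF lim] n1 by (simp add: LIMSEQ_const_iff)
  have cl: "Z *v z \<in> closure C" if "z \<in> closure C" for z
  proof -
    have "(\<lambda>n. (c (r n) *\<^sub>R K (r n)) *v z) \<longlonglongrightarrow> Z *v z" by (intro tendsto_intros lim)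
    from closed_sequentially[OF closed_closure GG_closure[OF GG_scale[OF K c] that] this] show ?thesis .
  qed
  \<comment> \<open>If \<open>Z\<close> vanished at this interior point, it would map both
    \<open>k\<close> and \<open>- k\<close> into the closed cone for every small \<open>k\<close>,
    and so would be zero.\<close>
  have nz_sum: "Z *v (x + y) \<noteq> 0"
  proof
    assume 0: "Z *v (x + y) = 0"
    have "Z *v v = 0" for v
    proof -
      obtain d where d: "d > 0" "\<And>k. norm (k - 0) < d \<Longrightarrow> (x + y) + k \<in> C"
        using open_add_C[of "x + y" 0 1] Y(2) by auto
      define k where "k = (d / 2) *\<^sub>R sgn v"
      have "norm k < d" using d(1) by (simp add: k_def norm_sgn)
      then have "(x + y) + k \<in> closure C" "(x + y) + - k \<in> closure C"
        using d(2)[of k] d(2)[of "- k"] closure_subset by auto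
      then have "Z *v ((x + y) + k) \<in> closure C" "Z *v ((x + y) + - k) \<in> closure C" by (blast intro: cl)+
      then have "Z *v k \<in> closure C" "- (Z *v k) \<in> closure C"
        using 0 by (simp_all add: matrix_vector_right_distrib matrix_vector_mult_diff_distrib)
      then have "Z *v k = 0" by (rule minus_closure)
      then show ?thesis using d(1) by (auto simp: k_def sgn_div_norm matrix_vector_mult_scaleR)
    qed
    then have "Z = 0" by (intro matrix_eq[THEN iffD2]) simp
    then show False using \<open>norm Z = 1\<close> by simp
  qed
  have sub: "(\<lambda>n. F (r n)) \<longlonglongrightarrow> l" if "F \<longlonglongrightarrow> l" for F :: "nat \<Rightarrow> real^'n" and l
    using LIMSEQ_subseq_LIMSEQ[OF that r(1)] by (simp add: o_def)
  define \<rho> where "\<rho> n = c (r n) * exp (t (r n))" for n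
  have "(\<lambda>n. (c (r n) *\<^sub>R K (r n)) *v X (r n)) \<longlonglongrightarrow> Z *v x" by (intro tendsto_intros lim sub X)
  moreover have "(c (r n) *\<^sub>R K (r n)) *v X (r n) = \<rho> n *\<^sub>R P (r n)" for n
    by (simp add: scaleR_matrix_vector_assoc[symmetric] KX \<rho>_def)
  ultimately have lim1: "(\<lambda>n. \<rho> n *\<^sub>R P (r n)) \<longlonglongrightarrow> Z *v x" by simp
  \<comment> \<open>As \<open>f\<close> is positive at \<open>a\<close>, applying it turns
    convergence of the vectors into convergence of the factors \<open>\<rho>\<close>.\<close>
  have "(\<lambda>n. (f \<bullet> (\<rho> n *\<^sub>R P (r n))) / (f \<bullet> P (r n))) \<longlonglongrightarrow> (f \<bullet> (Z *v x)) / (f \<bullet> a)"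
    using P(2) by (intro tendsto_intros lim1 sub P(1)) auto
  moreover have "\<forall>\<^sub>F n in sequentially. (f \<bullet> (\<rho> n *\<^sub>R P (r n))) / (f \<bullet> P (r n)) = \<rho> n"
  proof -
    have "(\<lambda>n. f \<bullet> P (r n)) \<longlonglongrightarrow> f \<bullet> a" by (intro tendsto_intros sub P(1))
    then have "\<forall>\<^sub>F n in sequentially. f \<bullet> P (r n) > 0" using P(2) by (rule order_tendstoD(1))
    then show ?thesis by eventually_elim simp
  qed
  ultimately have \<rho>: "\<rho> \<longlonglongrightarrow> (f \<bullet> (Z *v x)) / (f \<bullet> a)" by (rule Lim_transform_eventually)
  define k where "k = (f \<bullet> (Z *v x)) / (f \<bullet> a)"
  have "(\<lambda>n. \<rho> n *\<^sub>R P (r n)) \<longlonglongrightarrow> k *\<^sub>R a" unfolding k_def by (intro tendsto_intros \<rho> sub P(1))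
  then have Zx: "Z *v x = k *\<^sub>R a" using lim1 LIMSEQ_unique by blast
  have "(\<lambda>n. exp (- (2 * t (r n)))) \<longlonglongrightarrow> 0"
  proof (rule tendsto_sandwich[OF _ _ tendsto_const])
    have "exp (- (2 * t (r n))) \<le> exp (-1) ^ n" for n
    proof -
      have "real n \<le> t (r n)" using t[of "r n"] seq_suble[OF r(1), of n] by linarith
      then have "- (2 * t (r n)) \<le> real n * (-1)" by linarith
      then have "exp (- (2 * t (r n))) \<le> exp (real n * (-1))" by simp
      then show ?thesis by (simp only: exp_of_nat_mult)
    qed
    then show "\<forall>\<^sub>F n in sequentially. exp (- (2 * t (r n))) \<le> exp (-1) ^ n" by simp
    show "(\<lambda>n. exp (-1) ^ n) \<longlonglongrightarrow> (0::real)" by (rule LIMSEQ_realpow_zero) auto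
  qed simp
  then have "(\<lambda>n. (\<rho> n * exp (- (2 * t (r n)))) *\<^sub>R Q (r n)) \<longlonglongrightarrow> (k * 0) *\<^sub>R b"
    unfolding k_def by (intro tendsto_intros \<rho> sub Q)
  moreover have "(\<rho> n * exp (- (2 * t (r n)))) *\<^sub>R Q (r n) = (c (r n) *\<^sub>R K (r n)) *v Y (r n)" for n
  proof -
    have "exp (t (r n)) * exp (- (2 * t (r n))) = exp (- t (r n))" by (simp add: exp_add[symmetric])
    then show ?thesis by (simp add: scaleR_matrix_vector_assoc[symmetric] KY \<rho>_def mult.assoc)
  qed
  moreover have "(\<lambda>n. (c (r n) *\<^sub>R K (r n)) *v Y (r n)) \<longlonglongrightarrow> Z *v y" by (intro tendsto_intros lim sub Y)
  ultimately have "Z *v y = 0" using LIMSEQ_unique by fastforce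
  then have "Z *v x \<noteq> 0" using nz_sum by (simp add: matrix_vector_right_distrib)
  have lim_x: "(\<lambda>n. (c (r n) *\<^sub>R K (r n)) *v x) \<longlonglongrightarrow> Z *v x" by (intro tendsto_intros lim)
  have "(c (r n) *\<^sub>R K (r n)) *v x \<in> LC" for n
    by (rule LC_invariant[OF GG_scale[OF K c] X(2)])
  from LC_limit[OF this lim_x \<open>Z *v x \<noteq> 0\<close>] have "Z *v x \<in> LC" .
  moreover have "k \<noteq> 0" using \<open>Z *v x \<noteq> 0\<close> Zx by auto
  ultimately have "inverse k *\<^sub>R (Z *v x) \<in> LC" by (intro LC_scale) auto
  then show ?thesis using Zx \<open>k \<noteq> 0\<close> by simp
qed

theorem transitive_subset_eq_bip:
  assumes ne: "T1M_bip \<Omega> \<Gamma> \<noteq> {}" and A: "closedin (T1M \<Omega> \<Gamma>) A" "flow_invariant (quotient_flow \<Omega>) A" "T1M_bip \<Omega> \<Gamma> \<subseteq> A"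
    and tr: "topologically_transitive (subtopology (T1M \<Omega> \<Gamma>) A) (quotient_flow \<Omega>)"
  shows "A = T1M_bip \<Omega> \<Gamma>"
proof
  obtain u0 w0 where p0: "bpair u0 w0" "u0 \<in> LC" "w0 \<in> LC" using ne unfolding T1M_bip_eq by blast
  then have A0: "orb u0 w0 \<in> A" using A(3) unfolding T1M_bip_eq by blast
  have C0: "u0 + w0 \<in> C" "w0 + u0 \<in> C" using p0(1) by (auto simp: bpair_def add.commute)
  show "A \<subseteq> T1M_bip \<Omega> \<Gamma>"
  proof
    fix z assume z: "z \<in> A"
    then have "z \<in> topspace (T1M \<Omega> \<Gamma>)" using A(1) closedin_subset by blast
    then obtain a b where p: "bpair a b" "z = orb a b" unfolding topspace_T1M by blast
    have fab: "f \<bullet> a > 0" "f \<bullet> b > 0" using closure_f_pos bpair_nz[OF p(1)] p(1) by (auto simp: bpair_def bd_def)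
    have zA: "orb a b \<in> A" using z p(2) by simp
    obtain t G x y where 1: "\<And>n. t n \<ge> real n" "\<And>n. G n \<in> GG" "x \<longlonglongrightarrow> a" "y \<longlonglongrightarrow> b"
        "(\<lambda>n. exp (- t n) *\<^sub>R (G n *v x n)) \<longlonglongrightarrow> u0" "(\<lambda>n. exp (t n) *\<^sub>R (G n *v y n)) \<longlonglongrightarrow> w0"
      using transitive_sequences[OF A(2) tr p(1) zA p0(1) A0] by blast
    have Gi: "matrix_inv (G n) *v (G n *v v) = v" for n v by (rule matrix_inv_vector(2)[OF GG_invertible[OF 1(2)]])
    \<comment> \<open>Time is reversed: the inverses of the \<open>G n\<close> expand vectors near
      \<open>w0\<close> to vectors near \<open>b\<close>.\<close>
    have "b \<in> LC"
    proof (rule expanding_limit_in_LC[OF _ 1(6) p0(3) 1(5) C0(2) 1(4) fab(2) 1(3,1)])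
      show "matrix_inv (G n) \<in> GG" for n by (rule GG_inverse[OF 1(2)])
      show "matrix_inv (G n) *v (exp (t n) *\<^sub>R (G n *v y n)) = exp (t n) *\<^sub>R y n"
        "matrix_inv (G n) *v (exp (- t n) *\<^sub>R (G n *v x n)) = exp (- t n) *\<^sub>R x n" for n
        by (simp_all add: matrix_vector_mult_scaleR Gi)
    qed
    obtain t G x y where 2: "\<And>n. t n \<ge> real n" "\<And>n. G n \<in> GG" "x \<longlonglongrightarrow> u0" "y \<longlonglongrightarrow> w0"
        "(\<lambda>n. exp (- t n) *\<^sub>R (G n *v x n)) \<longlonglongrightarrow> a" "(\<lambda>n. exp (t n) *\<^sub>R (G n *v y n)) \<longlonglongrightarrow> b"
      using transitive_sequences[OF A(2) tr p0(1) A0 p(1) zA] by blast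
    \<comment> \<open>Here the \<open>G n\<close> themselves expand: they undo the contraction of
      the first component by the flow and carry vectors near \<open>u0\<close> towards
      \<open>a\<close>.\<close>
    have "a \<in> LC"
    proof (rule expanding_limit_in_LC[OF 2(2,3) p0(2) 2(4) C0(1) 2(5) fab(1) 2(6,1)])
      show "G n *v x n = exp (t n) *\<^sub>R (exp (- t n) *\<^sub>R (G n *v x n))"
        "G n *v y n = exp (- t n) *\<^sub>R (exp (t n) *\<^sub>R (G n *v y n))" for n
        by (simp_all add: exp_minus)
    qed
    then show "z \<in> T1M_bip \<Omega> \<Gamma>" unfolding T1M_bip_eq p(2) using p(1) \<open>b \<in> LC\<close> by blast
  qed
qed (rule A(3))

end

theorem theorem1p2:
  fixes \<Omega> :: "('n::finite) proj set" and \<Gamma> :: "'n pgl set"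
  assumes "open \<Omega>" and "properly_convex \<Omega>"
    and "subgroup \<Gamma> PGL" and "\<Gamma> \<subseteq> Aut \<Omega>" and "discrete \<Gamma>"
    and "strongly_irreducible \<Gamma>"
    and "T1M_bip \<Omega> \<Gamma> \<noteq> {}"
  shows "topologically_mixing (subtopology (T1M \<Omega> \<Gamma>) (T1M_bip \<Omega> \<Gamma>)) (quotient_flow \<Omega>) \<and>
    (\<forall>A. closedin (T1M \<Omega> \<Gamma>) A \<and> flow_invariant (quotient_flow \<Omega>) A \<and> T1M_bip \<Omega> \<Gamma> \<subseteq> A \<and>
         topologically_transitive (subtopology (T1M \<Omega> \<Gamma>) A) (quotient_flow \<Omega>) \<longrightarrow>
         A = T1M_bip \<Omega> \<Gamma>)"
proof -
  obtain C f R where dom: "convex_domain C f R \<Omega>"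
    using properly_convex_imp_convex_domain[OF assms(1,2)] .
  interpret convex_domain C f R \<Omega> by (rule dom)
  obtain v where "v \<in> unit_tangent \<Omega>" using assms(7) unfolding T1M_bip_def by blast
  then obtain u w where "bpair u w" unfolding unit_tangent_eq by blast
  then have "C \<noteq> {}" by (auto simp: bpair_def)
  interpret automorphism_group C f R \<Omega> \<Gamma>
    by (rule automorphism_group.intro[OF dom automorphism_group_axioms.intro]) fact+
  show ?thesis using bip_mixing transitive_subset_eq_bip[OF assms(7)] by blast
qed

end
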